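(* Let $M$ be a closed connected smooth Riemannian manifold and let $H=H(x,p,u):T^*M\times\mathbb{R}\to\mathbb{R}$ be continuous, convex in $p$, superlinear in $p$ ($H(x,p,u)/\|p\|_x\to+\infty$ as $\|p\|_x\to+\infty$), strictly increasing in $u$, and such that $\frac{\partial H}{\partial u}(x,p,0)$ exists and is $>0$ for every $(x,p)\in T^*M$ and, for every compact $S\subset T^*M$, there is a modulus of continuity $\eta_S$ with $\left|H(x,p,u)-H(x,p,0)-u\frac{\partial H}{\partial u}(x,p,0)\right|\le |u|\,\eta_S(|u|)$ for all $(x,p,u)\in S\times\mathbb{R}$. For each $\lambda>0$ let $V(\cdot,\lambda):M\to\mathbb{R}$ be continuous, and suppose $V(\cdot,\lambda)$ converges uniformly to $V(\cdot,0)$ as $\lambda\to0$. Then there exists $\lambda_0>0$ such that for every $\lambda\in(0,\lambda_0]$ the equation $$H(x,d_xu_\lambda,\lambda u_\lambda(x))+\lambda V(x,\lambda)=c(H^0)\quad\text{in } M$$ has a unique continuous viscosity solution $u_\lambda:M\to\mathbb{R}$. Moreover, as $\lambda\to0$, $u_\lambda$ converges uniformly to a function $u_0:M\to\mathbb{R}$ which is a viscosity solution of $$H(x,d_xu,0)=c(H^0)\quad\text{in } M.$$ Specifically, $u_0$ is the largest viscosity subsolution $w$ of $H(x,d_xu,0)=c(H^0)$ such that $$\int_{TM}w(x)\frac{\partial L}{\partial u}(x,v,0)\,d\tilde\mu(x,v)\ \ge\ \int_M V(x,0)\,d\mu(x)$$ for every Mather measure $\tilde\mu$ of the Lagrangian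 $L^0$, where $\mu=\pi_\#\tilde\mu$.
   Context: A modulus of continuity is a non-decreasing function $\eta:[0,+\infty)\to[0,+\infty)$ with $\lim_{r\to0}\eta(r)=0$. $H^0(x,p):=H(x,p,0)$. Its critical value is $c(H^0)=\inf_{f\in C^1(M)}\max_{x\in M}H^0(x,d_xf)$; it is the only constant $c$ for which $H^0(x,d_xu)=c$ admits viscosity solutions on $M$. The Lagrangian is $L(x,v,u)=\sup_{p\in T_x^*M}\big(\langle p,v\rangle_x-H(x,p,u)\big)$ for $(x,v,u)\in TM\times\mathbb{R}$, and $L^0(x,v):=L(x,v,0)$. Standing properties of $L$ in this setting: $L$ is continuous, convex and superlinear in $v$, strictly decreasing in $u$; $\frac{\partial L}{\partial u}(x,v,0)$ exists and is $<0$ for every $(x,v)\in TM$; and for every compact $S\subset TM$ there is a modulus of continuity $\eta_S$ with $\left|L(x,v,u)-L(x,v,0)-u\frac{\partial L}{\partial u}(x,v,0)\right|\le|u|\,\eta_S(|u|)$ for all $(x,v,u)\in S\times\mathbb{R}$. A Borel probability measure $\tilde\mu$ on $TM$ is closed if $\int_{TM}\|v\|_x\,d\tilde\mu<\infty$ and $\int_{TM}d_x\varphi(v)\,d\tilde\mu(x,v)=0$ for all $\varphi\in C^1(M)$. A Mather measure of $L^0$ is a closed probability measure $\tilde\mu$ with $\int_{TM}L^0\,d\tilde\mu=-c(H^0)$. $\pi:TM\to M$ is the canonical projection. *)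

theory Defs
  imports "HOL-Probability.Probability"
begin

section \<open>Smooth manifolds\<close>

text \<open>
  The manifold is a whole type \<open>'m\<close>, modelled on the Euclidean space \<open>'e\<close>.
  A chart is a pair of its domain and its coordinate map (only relevant on the domain).
\<close>

type_synonym ('m, 'e) chart = "'m set \<times> ('m \<Rightarrow> 'e)"

definition chart_inv :: "('m, 'e) chart \<Rightarrow> 'e \<Rightarrow> 'm" where
  "chart_inv c = inv_into (fst c) (snd c)"

definition is_chart :: "('m::topological_space, 'e::euclidean_space) chart \<Rightarrow> bool" where
  "is_chart c \<longleftrightarrow> open (fst c) \<and> open (snd c ` fst c) \<and>
     homeomorphism (fst c) (snd c ` fst c) (snd c) (chart_inv c)"

text \<open>Class \<open>C\<^sup>k\<close> on an open subset of a Euclidean space.\<close>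

primrec Ck_on :: "nat \<Rightarrow> 'e::euclidean_space set \<Rightarrow> ('e \<Rightarrow> 'f::euclidean_space) \<Rightarrow> bool" where
  "Ck_on 0 S f \<longleftrightarrow> continuous_on S f"
| "Ck_on (Suc k) S f \<longleftrightarrow> (\<forall>x\<in>S. f differentiable (at x)) \<and>
     (\<forall>v. Ck_on k S (\<lambda>x. frechet_derivative f (at x) v))"

definition smooth_on :: "'e::euclidean_space set \<Rightarrow> ('e \<Rightarrow> 'f::euclidean_space) \<Rightarrow> bool" where
  "smooth_on S f \<longleftrightarrow> (\<forall>k. Ck_on k S f)"

definition smooth_atlas :: "('m::topological_space, 'e::euclidean_space) chart set \<Rightarrow> bool" where
  "smooth_atlas A \<longleftrightarrow> (\<forall>c\<in>A. is_chart c) \<and> (\<Union>c\<in>A. fst c) = UNIV \<and>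
     (\<forall>c\<in>A. \<forall>d\<in>A. smooth_on (snd c ` (fst c \<inter> fst d)) (snd d \<circ> chart_inv c))"

section \<open>Tangent and cotangent bundles\<close>

text \<open>
  For every point \<open>x\<close> we single out a chart around \<open>x\<close>. A tangent vector at \<open>x\<close> is represented
  by its coordinates \<open>v :: 'e\<close> in that chart, and a covector at \<open>x\<close> by the linear form
  \<open>p :: 'e \<Rightarrow>\<^sub>L real\<close> on these coordinates; the pairing is \<open>blinfun_apply p v\<close>. The points
  of the tangent bundle are thus the pairs of type \<open>'m \<times> 'e\<close> and those of the cotangent
  bundle the pairs of type \<open>'m \<times> ('e \<Rightarrow>\<^sub>L real)\<close>, but the topologies are \<^emph>\<open>not\<close> the product ones
  (the chosen chart may jump with \<open>x\<close>): they are the bundle topologies given by the atlas.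
\<close>

definition chart_at :: "('m, 'e) chart set \<Rightarrow> 'm \<Rightarrow> ('m, 'e) chart" where
  "chart_at A x = (SOME c. c \<in> A \<and> x \<in> fst c)"

text \<open>Derivative at \<open>x\<close> of the transition map from \<open>c\<close> to \<open>d\<close>.\<close>

definition coord_change ::
    "('m, 'e::euclidean_space) chart \<Rightarrow> ('m, 'e) chart \<Rightarrow> 'm \<Rightarrow> 'e \<Rightarrow> 'e" where
  "coord_change c d x = frechet_derivative (snd d \<circ> chart_inv c) (at (snd c x))"

text \<open>The tangent vector (covector) whose coordinates in the chart \<open>c\<close> are \<open>(y, w)\<close>
  (respectively \<open>(y, q)\<close>).\<close>

definition tangent_param ::
    "('m, 'e::euclidean_space) chart set \<Rightarrow> ('m, 'e) chart \<Rightarrow> 'e \<times> 'e \<Rightarrow> 'm \<times> 'e" where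
  "tangent_param A c = (\<lambda>(y, w). let x = chart_inv c y in
     (x, coord_change c (chart_at A x) x w))"

definition cotangent_param ::
    "('m, 'e::euclidean_space) chart set \<Rightarrow> ('m, 'e) chart \<Rightarrow>
     'e \<times> ('e \<Rightarrow>\<^sub>L real) \<Rightarrow> 'm \<times> ('e \<Rightarrow>\<^sub>L real)" where
  "cotangent_param A c = (\<lambda>(y, q). let x = chart_inv c y in
     (x, Blinfun (\<lambda>v. blinfun_apply q (coord_change (chart_at A x) c x v))))"

definition tangent_topology ::
    "('m, 'e::euclidean_space) chart set \<Rightarrow> ('m \<times> 'e) topology" where
  "tangent_topology A = topology (\<lambda>W. \<forall>c\<in>A.
     open {z \<in> (snd c ` fst c) \<times> UNIV. tangent_param A c z \<in> W})"

definition cotangent_topology ::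
    "('m, 'e::euclidean_space) chart set \<Rightarrow> ('m \<times> ('e \<Rightarrow>\<^sub>L real)) topology" where
  "cotangent_topology A = topology (\<lambda>W. \<forall>c\<in>A.
     open {z \<in> (snd c ` fst c) \<times> UNIV. cotangent_param A c z \<in> W})"

lemma istopology_final:
  fixes D :: "'i \<Rightarrow> 'a::topological_space set"
  shows "istopology (\<lambda>W. \<forall>i\<in>I. open {z \<in> D i. f i z \<in> W})"
proof -
  have "{z \<in> D i. f i z \<in> S \<inter> T} = {z \<in> D i. f i z \<in> S} \<inter> {z \<in> D i. f i z \<in> T}" for i S T
    by auto
  moreover have "{z \<in> D i. f i z \<in> \<Union>K} = (\<Union>S\<in>K. {z \<in> D i. f i z \<in> S})" for i K
    by auto
  ultimately show ?thesis
    unfolding istopology_def by (auto simp only: intro!: open_Int open_UN)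
qed

lemma openin_tangent_topology:
  "openin (tangent_topology A) W \<longleftrightarrow>
     (\<forall>c\<in>A. open {z \<in> (snd c ` fst c) \<times> UNIV. tangent_param A c z \<in> W})"
  unfolding tangent_topology_def by (subst topology_inverse'[OF istopology_final]) simp

lemma openin_cotangent_topology:
  "openin (cotangent_topology A) W \<longleftrightarrow>
     (\<forall>c\<in>A. open {z \<in> (snd c ` fst c) \<times> UNIV. cotangent_param A c z \<in> W})"
  unfolding cotangent_topology_def by (subst topology_inverse'[OF istopology_final]) simp

definition tangent_borel :: "('m, 'e::euclidean_space) chart set \<Rightarrow> ('m \<times> 'e) measure" where
  "tangent_borel A = sigma UNIV {W. openin (tangent_topology A) W}"

definition C1_fun :: "('m, 'e::euclidean_space) chart set \<Rightarrow> ('m \<Rightarrow> real) \<Rightarrow> bool" where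
  "C1_fun A f \<longleftrightarrow> (\<forall>c\<in>A. Ck_on 1 (snd c ` fst c) (f \<circ> chart_inv c))"

definition differential ::
    "('m, 'e::euclidean_space) chart set \<Rightarrow> ('m \<Rightarrow> real) \<Rightarrow> 'm \<Rightarrow> ('e \<Rightarrow>\<^sub>L real)" where
  "differential A f x = (let c = chart_at A x in
     Blinfun (frechet_derivative (f \<circ> chart_inv c) (at (snd c x))))"

section \<open>Riemannian metrics\<close>

definition riemannian_metric ::
    "('m, 'e::euclidean_space) chart set \<Rightarrow> ('m \<Rightarrow> 'e \<Rightarrow> 'e \<Rightarrow> real) \<Rightarrow> bool" where
  "riemannian_metric A g \<longleftrightarrow>
     (\<forall>x. bilinear (g x) \<and> (\<forall>v w. g x v w = g x w v) \<and> (\<forall>v. v \<noteq> 0 \<longrightarrow> g x v v > 0)) \<and>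
     (\<forall>c\<in>A. \<forall>a b. smooth_on (snd c ` fst c)
        (\<lambda>y. g (chart_inv c y) (snd (tangent_param A c (y, a))) (snd (tangent_param A c (y, b)))))"

definition tnorm :: "('m \<Rightarrow> 'e \<Rightarrow> 'e \<Rightarrow> real) \<Rightarrow> 'm \<Rightarrow> 'e \<Rightarrow> real" where
  "tnorm g x v = sqrt (g x v v)"

definition conorm ::
    "('m \<Rightarrow> 'e::euclidean_space \<Rightarrow> 'e \<Rightarrow> real) \<Rightarrow> 'm \<Rightarrow> ('e \<Rightarrow>\<^sub>L real) \<Rightarrow> real" where
  "conorm g x p = (SUP v\<in>{v. tnorm g x v \<le> 1}. \<bar>blinfun_apply p v\<bar>)"

text \<open>Second countability is not required: it follows from compactness.\<close>

definition closed_connected_riemannian_manifold ::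
    "('m::t2_space, 'e::euclidean_space) chart set \<Rightarrow> ('m \<Rightarrow> 'e \<Rightarrow> 'e \<Rightarrow> real) \<Rightarrow> bool" where
  "closed_connected_riemannian_manifold A g \<longleftrightarrow>
     compact (UNIV :: 'm set) \<and> connected (UNIV :: 'm set) \<and> smooth_atlas A \<and> riemannian_metric A g"

section \<open>Hamilton-Jacobi equations\<close>

definition modulus_of_continuity :: "(real \<Rightarrow> real) \<Rightarrow> bool" where
  "modulus_of_continuity \<eta> \<longleftrightarrow>
     (\<forall>r\<ge>0. \<eta> r \<ge> 0) \<and> mono_on {0..} \<eta> \<and> (\<eta> \<longlongrightarrow> 0) (at_right 0)"

definition lagrangian ::
    "('m \<Rightarrow> ('e::euclidean_space \<Rightarrow>\<^sub>L real) \<Rightarrow> real \<Rightarrow> real) \<Rightarrow> 'm \<Rightarrow> 'e \<Rightarrow> real \<Rightarrow> real" where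
  "lagrangian H x v u = (SUP p. blinfun_apply p v - H x p u)"

definition critical_value ::
    "('m, 'e::euclidean_space) chart set \<Rightarrow> ('m \<Rightarrow> ('e \<Rightarrow>\<^sub>L real) \<Rightarrow> real) \<Rightarrow> real" where
  "critical_value A H0 = (INF f\<in>{f. C1_fun A f}. SUP x. H0 x (differential A f x))"

text \<open>Continuous viscosity sub-, super- and solutions of \<open>F (x, d\<^sub>x u, u x) = k\<close>.\<close>

definition viscosity_subsolution ::
    "('m::topological_space, 'e::euclidean_space) chart set \<Rightarrow>
     ('m \<Rightarrow> ('e \<Rightarrow>\<^sub>L real) \<Rightarrow> real \<Rightarrow> real) \<Rightarrow> real \<Rightarrow> ('m \<Rightarrow> real) \<Rightarrow> bool" where
  "viscosity_subsolution A F k u \<longleftrightarrow> continuous_on UNIV u \<and>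
     (\<forall>\<phi> x0. C1_fun A \<phi> \<longrightarrow> (\<forall>x. u x - \<phi> x \<le> u x0 - \<phi> x0) \<longrightarrow>
        F x0 (differential A \<phi> x0) (u x0) \<le> k)"

definition viscosity_supersolution ::
    "('m::topological_space, 'e::euclidean_space) chart set \<Rightarrow>
     ('m \<Rightarrow> ('e \<Rightarrow>\<^sub>L real) \<Rightarrow> real \<Rightarrow> real) \<Rightarrow> real \<Rightarrow> ('m \<Rightarrow> real) \<Rightarrow> bool" where
  "viscosity_supersolution A F k u \<longleftrightarrow> continuous_on UNIV u \<and>
     (\<forall>\<phi> x0. C1_fun A \<phi> \<longrightarrow> (\<forall>x. u x - \<phi> x \<ge> u x0 - \<phi> x0) \<longrightarrow>
        F x0 (differential A \<phi> x0) (u x0) \<ge> k)"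

definition viscosity_solution ::
    "('m::topological_space, 'e::euclidean_space) chart set \<Rightarrow>
     ('m \<Rightarrow> ('e \<Rightarrow>\<^sub>L real) \<Rightarrow> real \<Rightarrow> real) \<Rightarrow> real \<Rightarrow> ('m \<Rightarrow> real) \<Rightarrow> bool" where
  "viscosity_solution A F k u \<longleftrightarrow>
     viscosity_subsolution A F k u \<and> viscosity_supersolution A F k u"

section \<open>Mather measures\<close>

definition closed_measure ::
    "('m, 'e::euclidean_space) chart set \<Rightarrow> ('m \<Rightarrow> 'e \<Rightarrow> 'e \<Rightarrow> real) \<Rightarrow>
     ('m \<times> 'e) measure \<Rightarrow> bool" where
  "closed_measure A g m \<longleftrightarrow> prob_space m \<and> sets m = sets (tangent_borel A) \<and>
     integrable m (\<lambda>(x, v). tnorm g x v) \<and>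
     (\<forall>\<phi>. C1_fun A \<phi> \<longrightarrow> (\<integral>(x, v). blinfun_apply (differential A \<phi> x) v \<partial>m) = 0)"

text \<open>The Lagrangian is bounded below, but its integral may be infinite, in which case
  the Bochner integral is 0 by convention; hence integrability is part of the definition.\<close>

definition mather_measure ::
    "('m, 'e::euclidean_space) chart set \<Rightarrow> ('m \<Rightarrow> 'e \<Rightarrow> 'e \<Rightarrow> real) \<Rightarrow>
     ('m \<Rightarrow> ('e \<Rightarrow>\<^sub>L real) \<Rightarrow> real \<Rightarrow> real) \<Rightarrow> ('m \<times> 'e) measure \<Rightarrow> bool" where
  "mather_measure A g H m \<longleftrightarrow> closed_measure A g m \<and>
     has_bochner_integral m (\<lambda>(x, v). lagrangian H x v 0)
       (- critical_value A (\<lambda>x p. H x p 0))"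

text \<open>Viscosity subsolutions of the critical equation satisfying the integral constraint
  against all Mather measures.\<close>

definition constrained_subsolution ::
    "('m::topological_space, 'e::euclidean_space) chart set \<Rightarrow> ('m \<Rightarrow> 'e \<Rightarrow> 'e \<Rightarrow> real) \<Rightarrow>
     ('m \<Rightarrow> ('e \<Rightarrow>\<^sub>L real) \<Rightarrow> real \<Rightarrow> real) \<Rightarrow> ('m \<Rightarrow> real) \<Rightarrow> ('m \<Rightarrow> real) \<Rightarrow> bool" where
  "constrained_subsolution A g H V0 w \<longleftrightarrow>
     viscosity_subsolution A (\<lambda>x p _. H x p 0) (critical_value A (\<lambda>x p. H x p 0)) w \<and>
     (\<forall>m. mather_measure A g H m \<longrightarrow>
        (\<integral>(x, v). w x * deriv (lagrangian H x v) 0 \<partial>m) \<ge> (\<integral>x. V0 x \<partial>(distr m borel fst)))"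

end

theory Submission
  imports Defs "HOL-Complex_Analysis.Great_Picard"
begin

text \<open>
  A subsolution of a convex coercive equation is Lipschitz in charts. Its increments along short
  segments are bounded by the support function of the sublevel sets of the Hamiltonian, so local
  mollification and a partition of unity give uniformly close \<open>C\<^sup>1\<close> functions that are
  subsolutions up to a small error. Testing against these functions replaces the doubling of
  variables: it yields comparison, which together with Perron's method gives \<open>u\<^sub>\<lambda>\<close>,
  and it allows subsolutions to be tested against closed measures.

  The family \<open>u\<^sub>\<lambda>\<close> is equi-Lipschitz and bounded. Integrating the equation of a smoothed
  \<open>u\<^sub>\<lambda>\<close> against a Mather measure and expanding the Lagrangian at \<open>u = 0\<close> shows that every limit
  satisfies the integral constraint. Conversely, let \<open>w\<close> be a subsolution satisfying the constraint.
  Linear programming duality over probability measures on a compact part of \<open>TM\<close>, in which the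
  Mather measures are the minimisers of the limiting problem, produces a \<open>C\<^sup>1\<close> function \<open>f\<close> that is close to \<open>w\<close>
  from below and is a strict subsolution of the discounted equation for small \<open>\<lambda>\<close>; hence
  \<open>w - \<kappa> \<le> u\<^sub>\<lambda>\<close>. So every limit is the largest constrained subsolution, and the whole family converges.
\<close>

section \<open>Continuously differentiable functions on Euclidean space\<close>

text \<open>H is merely continuous, so no Hamiltonian flow and no regularity of minimising curves is
  available; the proof lives on inequalities between C^1 functions and measures. The dependence on
  the unknown is handled by freezing it: for a given continuous u, the map (x,p) \<mapsto>
  H(x,p,\<lambda>u(x)) + e(x) is an ordinary convex coercive Hamiltonian, to which smoothing
  applies. Strict monotonicity in u carries no rate except near u = 0, where the derivative is
  bounded below on compact sets; comparison therefore holds for every \<lambda>, but existence with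
  uniform bounds only for small \<lambda>. The dual object is a pair (\<phi>,t), where t \<ge> 0 is
  the multiplier of the condition that the integral of L + c be at most 0. In the strict subsolution
  f it appears as the weight 1 - \<lambda>t on a smoothed w: the action t(L + c) granted by the dual
  inequality is exactly what this weight gives up. The bundle topologies are not products. All
  uniform constants come from a finite disjoint union of closed chart balls, over which momenta and
  velocities are plain vectors.\<close>

definition grad_on :: "'e::euclidean_space set \<Rightarrow> ('e \<Rightarrow> real) \<Rightarrow> ('e \<Rightarrow> 'e) \<Rightarrow> bool" where
  "grad_on S f G \<longleftrightarrow> continuous_on S G \<and> (\<forall>y\<in>S. (f has_derivative (\<lambda>v. G y \<bullet> v)) (at y))"

definition grad :: "('e::euclidean_space \<Rightarrow> real) \<Rightarrow> 'e \<Rightarrow> 'e" where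
  "grad f y = (\<Sum>i\<in>Basis. frechet_derivative f (at y) i *\<^sub>R i)"

lemma linear_eq_inner_sum:
  fixes f :: "'e::euclidean_space \<Rightarrow> real"
  assumes "linear f"
  shows "f v = (\<Sum>i\<in>Basis. f i *\<^sub>R i) \<bullet> v"
proof -
  have "f v = f (\<Sum>i\<in>Basis. (v \<bullet> i) *\<^sub>R i)" by (simp add: euclidean_representation)
  also have "\<dots> = (\<Sum>i\<in>Basis. (v \<bullet> i) * f i)"
    using assms by (simp add: linear_sum linear_scale)
  finally show ?thesis by (simp add: inner_sum_left inner_sum_right inner_commute mult.commute)
qed

lemma grad_unique:
  assumes "(f has_derivative (\<lambda>v. w \<bullet> v)) (at y)"
  shows "grad f y = w"
proof -
  have "frechet_derivative f (at y) = (\<lambda>v. w \<bullet> v)"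
    using frechet_derivative_at[OF assms] by simp
  then show ?thesis by (simp add: grad_def euclidean_representation)
qed

lemma has_derivative_grad:
  fixes f :: "'e::euclidean_space \<Rightarrow> real"
  assumes "f differentiable (at y)"
  shows "(f has_derivative (\<lambda>v. grad f y \<bullet> v)) (at y)"
proof -
  have *: "(f has_derivative frechet_derivative f (at y)) (at y)"
    using assms frechet_derivative_works by blast
  then have "linear (frechet_derivative f (at y))" by (rule has_derivative_linear)
  from linear_eq_inner_sum[OF this] have "frechet_derivative f (at y) = (\<lambda>v. grad f y \<bullet> v)"
    unfolding grad_def by blast
  with * show ?thesis by simp
qed

lemma Ck_on_1_grad:
  assumes "Ck_on 1 S f" shows "grad_on S f (grad f)"
proof -
  have *: "\<forall>x\<in>S. f differentiable (at x)" "\<And>v. continuous_on S (\<lambda>x. frechet_derivative f (at x) v)"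
    using assms by auto
  have "continuous_on S (grad f)" unfolding grad_def[abs_def]
    by (intro continuous_intros *)
  then show ?thesis using * by (auto simp: grad_on_def has_derivative_grad)
qed

lemma grad_on_Ck_on_1:
  assumes "grad_on S f G" shows "Ck_on 1 S f"
proof -
  have d: "(f has_derivative (\<lambda>v. G y \<bullet> v)) (at y)" if "y \<in> S" for y
    using assms that by (auto simp: grad_on_def)
  have "continuous_on S (\<lambda>x. frechet_derivative f (at x) v)" for v
  proof -
    have "continuous_on S (\<lambda>x. G x \<bullet> v)"
      using assms by (auto simp: grad_on_def intro!: continuous_intros)
    then show ?thesis
      by (rule continuous_on_cong[THEN iffD1, rotated -1]) (auto simp: frechet_derivative_at[OF d, symmetric])
  qed
  then show ?thesis using d by (auto simp: differentiable_def)
qed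

text \<open>C^1 is all that test functions require, and the square of the positive part is the
  simplest one-sided profile of that class. It serves for compactly supported bumps and for
  one-sided penalties.\<close>

lemma has_real_derivative_square_max:
  "((\<lambda>s::real. (max 0 s)\<^sup>2) has_real_derivative 2 * max 0 s) (at s)"
proof -
  consider "s > 0" | "s < 0" | "s = 0" by linarith
  then show ?thesis
  proof cases
    case 1
    have "((\<lambda>s::real. s\<^sup>2) has_real_derivative 2 * max 0 s) (at s)"
      using 1 by (auto intro!: derivative_eq_intros)
    then show ?thesis
      by (rule has_field_derivative_transform_within_open[where S="{0<..}"]) (use 1 in auto)
  next
    case 2
    have "((\<lambda>s::real. 0) has_real_derivative 2 * max 0 s) (at s)"
      using 2 by (auto intro!: derivative_eq_intros)
    then show ?thesis
      by (rule has_field_derivative_transform_within_open[where S="{..<0}"]) (use 2 in auto)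
  next
    case 3
    have "((\<lambda>h::real. (max 0 h)\<^sup>2 / h) \<longlongrightarrow> 0) (at 0)"
    proof (rule Lim_null_comparison)
      show "\<forall>\<^sub>F h in at 0. norm ((max 0 h)\<^sup>2 / h) \<le> \<bar>h::real\<bar>"
        by (intro always_eventually) (auto simp: max_def power2_eq_square)
      show "((\<lambda>h::real. \<bar>h\<bar>) \<longlongrightarrow> 0) (at 0)" by (auto intro!: tendsto_eq_intros)
    qed
    then show ?thesis using 3 by (simp add: DERIV_def)
  qed
qed

lemmas square_max_derivative =
  DERIV_compose_FDERIV[OF has_real_derivative_square_max]

section \<open>Compactly supported C^1 bumps\<close>

definition bump :: "'e::euclidean_space \<Rightarrow> real \<Rightarrow> 'e \<Rightarrow> real" where
  "bump y0 r y = (max 0 (1 - (y - y0) \<bullet> (y - y0) / r\<^sup>2))\<^sup>2"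

definition bump_grad :: "'e::euclidean_space \<Rightarrow> real \<Rightarrow> 'e \<Rightarrow> 'e" where
  "bump_grad y0 r y = (- (4 * max 0 (1 - (y - y0) \<bullet> (y - y0) / r\<^sup>2) / r\<^sup>2)) *\<^sub>R (y - y0)"

lemma has_derivative_bump:
  "(bump y0 r has_derivative (\<lambda>v. bump_grad y0 r y \<bullet> v)) (at y)"
  unfolding bump_def[abs_def] bump_grad_def
proof -
  have "((\<lambda>y. 1 - (y - y0) \<bullet> (y - y0) / r\<^sup>2) has_derivative (\<lambda>v. - (2 * ((y - y0) \<bullet> v) / r\<^sup>2))) (at y)"
    by (rule derivative_eq_intros bounded_linear.has_derivative[OF bounded_linear_divide] refl)+
      (simp add: fun_eq_iff inner_commute)
  from square_max_derivative[OF this]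
  show "((\<lambda>y. (max 0 (1 - (y - y0) \<bullet> (y - y0) / r\<^sup>2))\<^sup>2) has_derivative
    (\<lambda>v. (- (4 * max 0 (1 - (y - y0) \<bullet> (y - y0) / r\<^sup>2) / r\<^sup>2)) *\<^sub>R (y - y0) \<bullet> v)) (at y)"
    by (rule has_derivative_eq_rhs) (auto simp: fun_eq_iff)
qed

lemma continuous_bump_grad: "continuous_on S (bump_grad y0 r)"
  by (cases "r = 0") (auto simp: bump_grad_def intro!: continuous_intros)

lemma continuous_bump: "continuous_on S (bump y0 r)"
  by (meson has_derivative_at_withinI has_derivative_bump has_derivative_continuous_on)

lemma grad_on_bump: "grad_on S (bump y0 r) (bump_grad y0 r)"
  by (simp add: grad_on_def continuous_bump_grad has_derivative_bump)

lemma bump_nonneg: "0 \<le> bump y0 r y" by (simp add: bump_def)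

lemma bump_le_1: "bump y0 r y \<le> 1"
proof -
  have "max 0 (1 - (y - y0) \<bullet> (y - y0) / r\<^sup>2) \<le> 1" by simp
  then show ?thesis unfolding bump_def by (simp add: power_le_one)
qed

lemma bump_center [simp]: "bump y0 r y0 = 1" "bump_grad y0 r y0 = 0"
  by (simp_all add: bump_def bump_grad_def)

lemma bump_less_1: assumes "r > 0" "y \<noteq> y0" shows "bump y0 r y < 1"
proof -
  have "(y - y0) \<bullet> (y - y0) / r\<^sup>2 > 0" using assms by simp
  then have "max 0 (1 - (y - y0) \<bullet> (y - y0) / r\<^sup>2) < 1" by simp
  then show ?thesis unfolding bump_def by (simp add: power_less_one_iff abs_square_less_1)
qed

lemma bump_pos_iff: assumes "r > 0" shows "bump y0 r y > 0 \<longleftrightarrow> y \<in> ball y0 r"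
proof -
  have "bump y0 r y > 0 \<longleftrightarrow> (y - y0) \<bullet> (y - y0) < r\<^sup>2"
    using assms by (auto simp: bump_def max_def divide_simps)
  also have "\<dots> \<longleftrightarrow> (norm (y - y0))\<^sup>2 < r\<^sup>2" by (simp add: power2_norm_eq_inner)
  also have "\<dots> \<longleftrightarrow> norm (y - y0) < r"
    using assms by (smt (verit) norm_ge_zero power2_less_imp_less power_strict_mono zero_less_numeral)
  finally show ?thesis by (simp add: dist_norm norm_minus_commute)
qed

lemma bump_outside: assumes "r > 0" "y \<notin> ball y0 r" shows "bump y0 r y = 0" "bump_grad y0 r y = 0"
proof -
  show "bump y0 r y = 0" using bump_pos_iff[OF assms(1)] bump_nonneg assms(2) by (metis less_eq_real_def)
  then show "bump_grad y0 r y = 0" unfolding bump_def bump_grad_def by simp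
qed

section \<open>Directional increments of subsolutions\<close>

text \<open>If the bound failed, a function of slope a' > a along b, penalised near the far and
  lateral faces of a thin tube around the segment, would touch U from above inside the tube; its
  derivative along b is at least a' there, against \<open>test\<close>. U is only continuous, so
  this is where the regularity of subsolutions begins.\<close>

lemma increment_bound:
  fixes U :: "'e::euclidean_space \<Rightarrow> real"
  assumes cont: "continuous_on (ball y0 r) U"
    and test: "\<And>\<phi> G y1 S. grad_on UNIV \<phi> G \<Longrightarrow> open S \<Longrightarrow> y1 \<in> S \<Longrightarrow> S \<subseteq> ball y0 r \<Longrightarrow>
                 (\<And>y. y \<in> S \<Longrightarrow> U y - \<phi> y \<le> U y1 - \<phi> y1) \<Longrightarrow> G y1 \<bullet> b \<le> a"
    and b: "b \<noteq> 0" and t: "t > 0" and y: "y \<in> ball y0 r" "y + t *\<^sub>R b \<in> ball y0 r"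
  shows "U (y + t *\<^sub>R b) - U y \<le> t * a"
proof (rule ccontr)
  assume neg: "\<not> ?thesis"
  define \<gamma> where "\<gamma> = (U (y + t *\<^sub>R b) - U y - t * a) / 2"
  \<comment> \<open>The excess 2\<gamma> is split: one half steepens the slope, the other remains as
    the margin in \<open>val\<close> that keeps the maximum off the face s = 0.\<close>
  define a' where "a' = a + \<gamma> / t"
  have g: "\<gamma> > 0" and aa: "a' > a" using neg t by (auto simp: \<gamma>_def a'_def)
  have val: "U (y + t *\<^sub>R b) - a' * t = U y + \<gamma>" using t by (simp add: \<gamma>_def a'_def field_simps)
  \<comment> \<open>\<open>s\<close> is the coordinate along b, counted from y in units of b, and
    \<zeta> the component orthogonal to b.\<close>
  define s where "s z = (z - y) \<bullet> b / (b \<bullet> b)" for z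
  define \<zeta> where "\<zeta> z = z - y - s z *\<^sub>R b" for z
  have bb: "b \<bullet> b > 0" using b by simp
  have zb: "\<zeta> z \<bullet> b = 0" for z using bb by (simp add: \<zeta>_def s_def inner_diff_left)
  have zeq: "z = y + s z *\<^sub>R b + \<zeta> z" for z by (simp add: \<zeta>_def)
  have s_line: "s (y + k *\<^sub>R b) = k" for k using bb by (simp add: s_def)
  have contU: "isCont U z" if "z \<in> ball y0 r" for z
    using cont that by (simp add: continuous_on_eq_continuous_at)
  \<comment> \<open>The tube is prolonged beyond t: the point y + t b becomes interior, and the far
    face can be excluded by a penalty that vanishes up to t.\<close>
  obtain t' where t': "t' > t" "y + t' *\<^sub>R b \<in> ball y0 r"
  proof -
    have "((\<lambda>k. y + k *\<^sub>R b) \<longlongrightarrow> y + t *\<^sub>R b) (at_right t)" by (intro tendsto_intros)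
    then have "\<forall>\<^sub>F k in at_right t. y + k *\<^sub>R b \<in> ball y0 r"
      using y(2) open_ball topological_tendstoD by blast
    then obtain k0 where "k0 > t" "\<forall>k. t < k \<and> k < k0 \<longrightarrow> y + k *\<^sub>R b \<in> ball y0 r"
      unfolding eventually_at_right_field by blast
    then show ?thesis by (intro that[of "(t + k0)/2"]) auto
  qed
  have near: "\<exists>\<rho>>0. \<forall>z. norm (z - p) \<le> \<rho> \<longrightarrow> z \<in> ball y0 r \<and> U z < U p + k"
    if "p \<in> ball y0 r" "k > 0" for p k
  proof -
    have "\<forall>\<^sub>F z in nhds p. U z < U p + k"
      using contU[OF that(1)] that(2)
      by (intro order_tendstoD(2)[where y="U p"]) (auto simp: isCont_def tendsto_at_iff_tendsto_nhds)
    moreover have "\<forall>\<^sub>F z in nhds p. z \<in> ball y0 r"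
      using that(1) by (intro eventually_nhds_in_open) auto
    ultimately have "\<forall>\<^sub>F z in nhds p. z \<in> ball y0 r \<and> U z < U p + k" by eventually_elim auto
    then obtain d where "d > 0" "\<forall>z. dist z p < d \<longrightarrow> z \<in> ball y0 r \<and> U z < U p + k"
      unfolding eventually_nhds_metric by blast
    then show ?thesis by (intro exI[of _ "d/2"]) (auto simp: dist_norm)
  qed
  obtain \<rho>1 where r1: "\<rho>1 > 0" "\<And>z. norm (z - y) \<le> \<rho>1 \<Longrightarrow> z \<in> ball y0 r \<and> U z < U y + \<gamma>"
    using near[OF y(1) g] by blast
  obtain \<rho>2 where r2: "\<rho>2 > 0"
    "\<And>z. norm (z - (y + t' *\<^sub>R b)) \<le> \<rho>2 \<Longrightarrow> z \<in> ball y0 r \<and> U z < U (y + t' *\<^sub>R b) + 1"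
    using near[OF t'(2), of 1] by auto
  define \<rho> where "\<rho> = min \<rho>1 \<rho>2"
  have rho: "\<rho> > 0" "\<rho> \<le> \<rho>1" "\<rho> \<le> \<rho>2" using r1 r2 by (auto simp: \<rho>_def)
  define T where "T = {z. 0 \<le> s z \<and> s z \<le> t' \<and> norm (\<zeta> z) \<le> \<rho>}"
  define S where "S = {z. 0 < s z \<and> s z < t' \<and> norm (\<zeta> z) < \<rho>}"
  have cs: "continuous_on A s" for A unfolding s_def using bb by (intro continuous_intros) auto
  have cz: "continuous_on A \<zeta>" for A unfolding \<zeta>_def by (intro continuous_intros cs)
  have "closed T" unfolding T_def
    by (intro closed_Collect_conj closed_Collect_le continuous_intros cs cz)
  moreover have "bounded T"
  proof (rule boundedI[of _ "norm y + t' * norm b + \<rho>"])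
    fix z assume z: "z \<in> T"
    have "norm z \<le> norm y + norm (s z *\<^sub>R b) + norm (\<zeta> z)"
      by (subst zeq[of z]) (meson norm_triangle_le norm_triangle_mono order_refl)
    also have "norm (s z *\<^sub>R b) \<le> t' * norm b" using z by (auto simp: T_def intro!: mult_right_mono)
    finally show "norm z \<le> norm y + t' * norm b + \<rho>" using z by (auto simp: T_def)
  qed
  ultimately have compT: "compact T" by (simp add: compact_eq_bounded_closed)
  have openS: "open S" unfolding S_def
    by (intro open_Collect_conj open_Collect_less continuous_intros cs cz)
  have ST: "S \<subseteq> T" by (auto simp: S_def T_def)
  have Tball: "T \<subseteq> ball y0 r"
  proof
    fix z assume z: "z \<in> T"
    have 1: "y + \<zeta> z \<in> ball y0 r" using r1(2)[of "y + \<zeta> z"] z rho by (auto simp: T_def)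
    have 2: "y + t' *\<^sub>R b + \<zeta> z \<in> ball y0 r"
      using r2(2)[of "y + t' *\<^sub>R b + \<zeta> z"] z rho by (auto simp: T_def)
    have "(1 - s z / t') *\<^sub>R (y + \<zeta> z) + (s z / t') *\<^sub>R (y + t' *\<^sub>R b + \<zeta> z) \<in> ball y0 r"
      using convexD_alt[OF convex_ball 1 2, of "s z / t'"] z t t' by (auto simp: T_def divide_simps)
    also have "(1 - s z / t') *\<^sub>R (y + \<zeta> z) + (s z / t') *\<^sub>R (y + t' *\<^sub>R b + \<zeta> z) = y + s z *\<^sub>R b + \<zeta> z"
      using t t' by (simp add: algebra_simps)
    finally show "z \<in> ball y0 r" using zeq[of z] by simp
  qed
  have contT: "continuous_on T U" using cont Tball continuous_on_subset by blast
  then obtain B where B: "\<And>z. z \<in> T \<Longrightarrow> U z \<le> B"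
    using compact_continuous_image[OF contT compT] bounded_has_Sup(1)[of "U ` T"]
    by (metis bounded_imp_bdd_above bdd_above.unfold compact_imp_bounded imageI)
  \<comment> \<open>C and n are chosen so that on the far face s = t' and on the lateral face of
    radius \<rho> the penalties outweigh every value of U there, measured against the level U y +
    \<gamma>.\<close>
  define C where "C = (\<bar>U (y + t' *\<^sub>R b) + 1 - a' * t' - (U y + \<gamma>)\<bar> + 1) / (t' - t)\<^sup>2"
  have C: "C * (t' - t)\<^sup>2 = \<bar>U (y + t' *\<^sub>R b) + 1 - a' * t' - (U y + \<gamma>)\<bar> + 1" and C0: "C \<ge> 0"
    using t' by (auto simp: C_def)
  define n where "n = (\<bar>B + \<bar>a'\<bar> * t' - (U y + \<gamma>)\<bar> + 1) / \<rho>\<^sup>2"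
  have n: "n * \<rho>\<^sup>2 = \<bar>B + \<bar>a'\<bar> * t' - (U y + \<gamma>)\<bar> + 1" and n0: "n \<ge> 0"
    using rho by (auto simp: n_def)
  \<comment> \<open>The one-sided square has nonnegative slope along b and the lateral term has
    gradient orthogonal to b, so neither penalty lowers the slope a' in that direction.\<close>
  define \<phi> where "\<phi> z = a' * s z + C * (max 0 (s z - t))\<^sup>2 + n * (\<zeta> z \<bullet> \<zeta> z)" for z
  define G where "G z = ((a' + 2 * C * max 0 (s z - t)) / (b \<bullet> b)) *\<^sub>R b + (2 * n) *\<^sub>R \<zeta> z" for z
  have ds: "(s has_derivative (\<lambda>v. v \<bullet> b / (b \<bullet> b))) (at z)" for z
    unfolding s_def[abs_def] using bb by (auto intro!: derivative_eq_intros)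
  have dz: "(\<zeta> has_derivative (\<lambda>v. v - (v \<bullet> b / (b \<bullet> b)) *\<^sub>R b)) (at z)" for z
    unfolding \<zeta>_def[abs_def] by (auto intro!: derivative_eq_intros ds)
  have "(\<phi> has_derivative (\<lambda>v. G z \<bullet> v)) (at z)" for z
  proof -
    have "((\<lambda>z. s z - t) has_derivative (\<lambda>v. v \<bullet> b / (b \<bullet> b))) (at z)"
      by (auto intro!: derivative_eq_intros ds)
    note 2 = has_derivative_mult_right[OF square_max_derivative[OF this], of C]
    note 3 = has_derivative_mult_right[OF has_derivative_inner[OF dz dz], of n]
    note 4 = has_derivative_add[OF has_derivative_add[OF has_derivative_mult_right[OF ds, of a'] 2] 3]
    show ?thesis unfolding \<phi>_def[abs_def]
    proof (rule has_derivative_eq_rhs[OF 4], rule ext)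
      fix v
      define k where "k = v \<bullet> b / (b \<bullet> b)"
      have kb: "b \<bullet> v / (b \<bullet> b) = k" by (simp add: k_def inner_commute)
      have bz: "b \<bullet> \<zeta> z = 0" using zb[of z] by (simp add: inner_commute)
      have "G z \<bullet> v = (a' + 2 * C * max 0 (s z - t)) * k + 2 * n * (\<zeta> z \<bullet> v)"
        unfolding G_def kb[symmetric] by (simp add: inner_add_left)
      then show "a' * (v \<bullet> b / (b \<bullet> b)) + C * (v \<bullet> b / (b \<bullet> b) * (2 * max 0 (s z - t))) +
         n * (\<zeta> z \<bullet> (v - (v \<bullet> b / (b \<bullet> b)) *\<^sub>R b) + (v - (v \<bullet> b / (b \<bullet> b)) *\<^sub>R b) \<bullet> \<zeta> z) = G z \<bullet> v"
        unfolding k_def[symmetric]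
        by (simp add: inner_diff_left inner_diff_right zb bz inner_commute[of v] algebra_simps)
    qed
  qed
  moreover have "continuous_on UNIV G" unfolding G_def using bb by (intro continuous_intros cs cz) auto
  ultimately have gr: "grad_on UNIV \<phi> G" by (simp add: grad_on_def)
  have "continuous_on T (\<lambda>z. U z - \<phi> z)" unfolding \<phi>_def by (intro continuous_intros contT cs cz)
  moreover have yT: "y + t *\<^sub>R b \<in> T" using t t' rho by (simp add: T_def s_line \<zeta>_def)
  ultimately obtain z1 where z1: "z1 \<in> T" "\<And>z. z \<in> T \<Longrightarrow> U z - \<phi> z \<le> U z1 - \<phi> z1"
    using continuous_attains_sup[OF compT] by blast
  have "\<phi> (y + t *\<^sub>R b) = a' * t" using t by (simp add: \<phi>_def s_line \<zeta>_def)
  with z1(2)[OF yT] val have big: "U z1 - \<phi> z1 \<ge> U y + \<gamma>" by simp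
  have s0: "s z1 \<noteq> 0"
  proof
    assume "s z1 = 0"
    then have "norm (z1 - y) \<le> \<rho>1" using z1 rho by (auto simp: T_def \<zeta>_def)
    moreover have "\<phi> z1 \<ge> 0" using \<open>s z1 = 0\<close> t n0 by (simp add: \<phi>_def)
    ultimately show False using r1(2)[of z1] big by force
  qed
  have s1: "s z1 \<noteq> t'"
  proof
    assume st: "s z1 = t'"
    then have "norm (z1 - (y + t' *\<^sub>R b)) \<le> \<rho>2" using z1 rho by (auto simp: T_def \<zeta>_def algebra_simps)
    moreover have "\<phi> z1 \<ge> a' * t' + C * (t' - t)\<^sup>2" using st t' n0 by (simp add: \<phi>_def)
    ultimately show False using r2(2)[of z1] big C by force
  qed
  have s2: "norm (\<zeta> z1) \<noteq> \<rho>"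
  proof
    assume st: "norm (\<zeta> z1) = \<rho>"
    then have "\<zeta> z1 \<bullet> \<zeta> z1 = \<rho>\<^sup>2" by (simp add: power2_norm_eq_inner[symmetric])
    moreover have "a' * s z1 \<ge> - (\<bar>a'\<bar> * t')"
    proof -
      have "\<bar>a' * s z1\<bar> \<le> \<bar>a'\<bar> * t'" using z1 by (auto simp: T_def abs_mult intro!: mult_left_mono)
      then show ?thesis by linarith
    qed
    ultimately have "\<phi> z1 \<ge> - (\<bar>a'\<bar> * t') + n * \<rho>\<^sup>2"
      using C0 unfolding \<phi>_def by (smt (verit) zero_le_mult_iff zero_le_power2)
    then show False using B[OF z1(1)] big n by linarith
  qed
  have z1S: "z1 \<in> S" using z1(1) s0 s1 s2 by (auto simp: S_def T_def)
  have "G z1 \<bullet> b \<le> a"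
    using test[OF gr openS z1S] ST Tball z1(2) by blast
  moreover have "G z1 \<bullet> b = a' + 2 * C * max 0 (s z1 - t)"
    using bb by (simp add: G_def inner_add_left zb)
  moreover have "2 * C * max 0 (s z1 - t) \<ge> 0" using C0 by simp
  ultimately show False using aa by linarith
qed

section \<open>Mollification\<close>

lemma grad_inner_le:
  assumes "(f has_derivative (\<lambda>v. w \<bullet> v)) (at y)"
    and "d > 0" "\<And>t. 0 < t \<Longrightarrow> t < d \<Longrightarrow> f (y + t *\<^sub>R b) - f y \<le> t * \<sigma>"
  shows "w \<bullet> b \<le> \<sigma>"
proof -
  have "((\<lambda>t. f (y + t *\<^sub>R b)) has_derivative (\<lambda>h. w \<bullet> (h *\<^sub>R b))) (at 0)"
    by (rule has_derivative_compose[where f="\<lambda>t. y + t *\<^sub>R b" and g=f])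
      (auto intro!: derivative_eq_intros assms(1))
  then have "((\<lambda>t. f (y + t *\<^sub>R b)) has_real_derivative (w \<bullet> b)) (at 0)"
    unfolding has_field_derivative_def by (rule has_derivative_eq_rhs) (simp add: fun_eq_iff)
  then have "((\<lambda>t. (f (y + t *\<^sub>R b) - f y) / t) \<longlongrightarrow> w \<bullet> b) (at 0)"
    by (simp add: DERIV_def)
  then have "((\<lambda>t. (f (y + t *\<^sub>R b) - f y) / t) \<longlongrightarrow> w \<bullet> b) (at_right 0)"
    by (simp add: filterlim_at_split)
  moreover have "\<forall>\<^sub>F t in at_right 0. (f (y + t *\<^sub>R b) - f y) / t \<le> \<sigma>"
    unfolding eventually_at_right_field using assms(2,3)
    by (intro exI[of _ d]) (auto simp: divide_simps mult.commute)
  ultimately show ?thesis by (rule tendsto_upperbound) simp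
qed

text \<open>An increment bound along b is inherited by averages of translates. One f serves all
  pairs (b, \<sigma>), so that later its gradient lies in all half-spaces at once; and the error
  \<epsilon> is reached by shrinking the kernel alone, with R untouched.\<close>

lemma mollification:
  fixes U :: "'e::euclidean_space \<Rightarrow> real"
  assumes cont: "continuous_on UNIV U" and R: "R > 0" and e: "\<epsilon> > 0"
  shows "\<exists>f G. grad_on (ball y0 (2 * R)) f G \<and> (\<forall>y\<in>ball y0 R. \<bar>f y - U y\<bar> \<le> \<epsilon>) \<and>
    (\<forall>y\<in>ball y0 R. \<forall>b \<sigma>. (\<forall>y\<in>ball y0 (2 * R). \<forall>t>0. y + t *\<^sub>R b \<in> ball y0 (2 * R) \<longrightarrow>
        U (y + t *\<^sub>R b) - U y \<le> t * \<sigma>) \<longrightarrow> G y \<bullet> b \<le> \<sigma>)"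
proof -
  have "uniformly_continuous_on (cball y0 (2 * R)) U"
    using cont by (intro compact_uniformly_continuous continuous_on_subset[OF cont]) auto
  then obtain d where d: "d > 0"
    "\<And>x x'. x \<in> cball y0 (2 * R) \<Longrightarrow> x' \<in> cball y0 (2 * R) \<Longrightarrow> dist x' x < d \<Longrightarrow> dist (U x') (U x) < \<epsilon>"
    using e unfolding uniformly_continuous_on_def by metis
  \<comment> \<open>A kernel radius below d gives the error \<epsilon>; a radius of at most R keeps
    translates of the small ball inside the double ball.\<close>
  define s where "s = min d R"
  have s: "s > 0" "s \<le> d" "s \<le> R" using d R by (auto simp: s_def)
  let ?k = "bump (0::'e) s"
  have k0: "?k z = 0" if "norm z \<ge> s" for z using bump_outside(1)[OF s(1), of z 0] that by auto
  have ksym: "?k (- z) = ?k z" for z by (simp add: bump_def)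
  have int: "integrable lborel (\<lambda>z. ?k z * h z)" if "continuous_on UNIV h" for h :: "'e \<Rightarrow> real"
  proof -
    have "integrable lborel (\<lambda>x. indicator (cball 0 s) x *\<^sub>R (?k x * h x))"
      by (intro borel_integrable_compact continuous_intros continuous_bump continuous_on_subset[OF that]) auto
    also have "(\<lambda>x. indicator (cball 0 s) x *\<^sub>R (?k x * h x)) = (\<lambda>z. ?k z * h z)"
      using k0 by (force simp: fun_eq_iff indicator_def)
    finally show ?thesis .
  qed
  define I where "I = (LINT z|lborel. ?k z)"
  have intk: "integrable lborel ?k" using int[of "\<lambda>_. 1"] by simp
  have "I > 0"
  proof -
    have "I \<ge> 0" unfolding I_def by (simp add: bump_nonneg)
    moreover have "I \<noteq> 0"
    proof
      assume "I = 0"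
      then have "AE z in lborel. ?k z = 0"
        using integral_nonneg_eq_0_iff_AE[OF intk] bump_nonneg unfolding I_def by auto
      then have "AE z in lborel. z \<notin> ball (0::'e) s"
        by eventually_elim (use bump_pos_iff[OF s(1), of 0] in force)
      then have "measure lborel (ball (0::'e) s) = 0" by (subst (asm) AE_iff_measurable[where N="ball 0 s"]) (auto simp: measure_def)
      then show False using content_ball_pos[OF s(1), of "0::'e"]
        by simp
    qed
    ultimately show ?thesis by linarith
  qed
  define F where "F y = (LINT z|lborel. ?k z * U (y + z))" for y
  have intF: "integrable lborel (\<lambda>z. ?k z * U (y + z))" for y
    by (intro int continuous_on_compose2[OF cont] continuous_intros) auto
  obtain p q where pq: "cball y0 (3 * R) \<subseteq> cbox p q"
    using bounded_subset_cbox_symmetric[OF bounded_cball] by metis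
  \<comment> \<open>After the change of variables y occurs only in the kernel and the domain is a
    fixed box, so differentiation under the integral asks no more of U than continuity.\<close>
  have F_alt: "F y = integral (cbox p q) (\<lambda>z. ?k (y - z) * U z)" if y: "y \<in> ball y0 (2 * R)" for y
  proof -
    have "F y = (LINT z|distr lborel borel ((+) (- y)). ?k z * U (y + z))"
      unfolding F_def by (simp add: lborel_distr_plus)
    also have "\<dots> = (LINT z|lborel. ?k (z - y) * U z)"
      by (subst integral_distr) (auto intro!: borel_measurable_continuous_onI continuous_intros continuous_on_compose2[OF cont] continuous_bump)
    finally have 1: "F y = (LINT z|lborel. ?k (z - y) * U z)" .
    have "integrable (distr lborel borel ((+) (- y))) (\<lambda>z. ?k z * U (y + z))"
      using intF by (simp add: lborel_distr_plus)
    then have 2: "integrable lborel (\<lambda>z. ?k (z - y) * U z)"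
      by (subst (asm) integrable_distr_eq) (auto intro!: borel_measurable_continuous_onI continuous_intros continuous_on_compose2[OF cont] continuous_bump)
    have "((\<lambda>z. ?k (z - y) * U z) has_integral F y) UNIV"
      using has_integral_integral_lborel[OF 2] 1 by simp
    also have "(\<lambda>z. ?k (z - y) * U z) = (\<lambda>z. if z \<in> cbox p q then ?k (y - z) * U z else 0)"
    proof (rule ext)
      fix z
      have "z \<in> cbox p q" if "norm (z - y) < s"
      proof -
        have "dist y0 z \<le> dist y0 y + dist y z" by (rule dist_triangle)
        then have "z \<in> cball y0 (3 * R)" using that y s by (auto simp: dist_norm norm_minus_commute)
        then show ?thesis using pq by blast
      qed
      then show "?k (z - y) * U z = (if z \<in> cbox p q then ?k (y - z) * U z else 0)"
        using k0[of "z - y"] ksym[of "z - y"] by force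
    qed
    finally have "((\<lambda>z. ?k (y - z) * U z) has_integral F y) (cbox p q)"
      using has_integral_restrict_UNIV by blast
    then show ?thesis by (simp add: integral_unique)
  qed
  define fx where "fx y z = blinfun_inner_right (U z *\<^sub>R bump_grad 0 s (y - z))" for y z
  have cfx: "continuous_on (ball y0 (2 * R) \<times> cbox p q) (\<lambda>(y, z). fx y z)"
    unfolding fx_def split_beta
    by (intro bounded_linear.continuous_on[OF bounded_linear_blinfun_inner_right] continuous_intros
      continuous_on_compose2[OF cont] continuous_on_compose2[OF continuous_bump_grad[of UNIV]]) auto
  define D where "D y = integral (cbox p q) (fx y)" for y
  have dF: "(F has_derivative blinfun_apply (D y)) (at y)" if y: "y \<in> ball y0 (2 * R)" for y
  proof -
    have "((\<lambda>y. integral (cbox p q) (\<lambda>z. ?k (y - z) * U z)) has_derivative blinfun_apply (D y)) (at y within ball y0 (2 * R))"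
      unfolding D_def
    proof (rule leibniz_rule)
      fix y z assume "y \<in> ball y0 (2 * R)"
      have "((\<lambda>y. ?k (y - z) * U z) has_derivative (\<lambda>v. (bump_grad 0 s (y - z) \<bullet> v) * U z)) (at y)"
        by (rule has_derivative_mult_left) (rule has_derivative_compose[OF _ has_derivative_bump], auto intro!: derivative_eq_intros)
      then have "((\<lambda>y. ?k (y - z) * U z) has_derivative blinfun_apply (fx y z)) (at y)"
        by (rule has_derivative_eq_rhs) (simp add: fx_def fun_eq_iff)
      then show "((\<lambda>y. ?k (y - z) * U z) has_derivative blinfun_apply (fx y z)) (at y within ball y0 (2 * R))"
        by (rule has_derivative_at_withinI)
    next
      fix y
      show "(\<lambda>z. ?k (y - z) * U z) integrable_on cbox p q"
        by (intro integrable_continuous continuous_intros continuous_on_compose2[OF cont] continuous_on_compose2[OF continuous_bump[of UNIV]]) auto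
    qed (use y cfx in auto)
    then have "((\<lambda>y. integral (cbox p q) (\<lambda>z. ?k (y - z) * U z)) has_derivative blinfun_apply (D y)) (at y)"
      using y at_within_open[OF y open_ball] by simp
    then show ?thesis
      by (rule has_derivative_transform_within_open[OF _ open_ball y]) (use F_alt in auto)
  qed
  have cD: "continuous_on (ball y0 (2 * R)) D" unfolding D_def
    by (rule integral_continuous_on_param) (use cfx in auto)
  define f where "f y = F y / I" for y
  define G where "G y = (\<Sum>i\<in>Basis. (blinfun_apply (D y) i / I) *\<^sub>R i)" for y
  have Gv: "G y \<bullet> v = blinfun_apply (D y) v / I" for y v
    using linear_eq_inner_sum[of "\<lambda>v. blinfun_apply (D y) v / I" v]
    by (simp add: G_def linear_iff blinfun.add_right blinfun.scaleR_right add_divide_distrib)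
  have gr: "grad_on (ball y0 (2 * R)) f G" unfolding grad_on_def
  proof (intro conjI ballI)
    show "continuous_on (ball y0 (2 * R)) G" unfolding G_def
      using \<open>I > 0\<close> by (intro continuous_intros cD) auto
    show "(f has_derivative (\<lambda>v. G y \<bullet> v)) (at y)" if "y \<in> ball y0 (2 * R)" for y
      unfolding f_def[abs_def] Gv using \<open>I > 0\<close> by (auto intro!: derivative_eq_intros dF that simp: field_simps)
  qed
  have close: "\<bar>f y - U y\<bar> \<le> \<epsilon>" if y: "y \<in> ball y0 R" for y
  proof -
    have yy: "y \<in> cball y0 (2 * R)" using y R by auto
    have zz: "y + z \<in> cball y0 (2 * R)" "\<bar>U (y + z) - U y\<bar> < \<epsilon>" if "norm z < s" for z
    proof -
      have "dist y0 (y + z) \<le> dist y0 y + dist y (y + z)" by (rule dist_triangle)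
      then show "y + z \<in> cball y0 (2 * R)" using that y s by (auto simp: dist_norm)
      from d(2)[OF yy this] show "\<bar>U (y + z) - U y\<bar> < \<epsilon>" using that s by (auto simp: dist_real_def dist_norm)
    qed
    have "\<bar>F y - I * U y\<bar> = \<bar>LINT z|lborel. ?k z * (U (y + z) - U y)\<bar>"
      unfolding F_def I_def using intF[of y] intk
      by (simp add: right_diff_distrib Bochner_Integration.integral_diff)
    also have "\<dots> \<le> (LINT z|lborel. ?k z * \<epsilon>)"
    proof (rule integral_abs_bound[THEN order_trans], rule integral_mono)
      show "integrable lborel (\<lambda>z. \<bar>?k z * (U (y + z) - U y)\<bar>)"
        using intF[of y] intk by (auto simp: right_diff_distrib)
      show "integrable lborel (\<lambda>z. ?k z * \<epsilon>)" using intk by simp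
      fix z show "\<bar>?k z * (U (y + z) - U y)\<bar> \<le> ?k z * \<epsilon>"
        using zz(2)[of z] k0[of z] bump_nonneg[of 0 s z] by (cases "norm z < s") (auto simp: abs_mult intro!: mult_left_mono)
    qed
    also have "\<dots> = I * \<epsilon>" by (simp add: I_def)
    finally have "\<bar>F y - I * U y\<bar> \<le> I * \<epsilon>" .
    moreover have "F y - I * U y = I * (f y - U y)" using \<open>I > 0\<close> by (simp add: f_def field_simps)
    ultimately show ?thesis using \<open>I > 0\<close> by (simp add: abs_mult)
  qed
  have inc: "G y \<bullet> b \<le> \<sigma>" if y: "y \<in> ball y0 R" and
    h: "\<And>y t. y \<in> ball y0 (2 * R) \<Longrightarrow> t > 0 \<Longrightarrow> y + t *\<^sub>R b \<in> ball y0 (2 * R) \<Longrightarrow> U (y + t *\<^sub>R b) - U y \<le> t * \<sigma>" for y b \<sigma>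
  proof -
    have y2: "y \<in> ball y0 (2 * R)" using y R by auto
    have "((\<lambda>k. y + k *\<^sub>R b) \<longlongrightarrow> y + 0 *\<^sub>R b) (at_right 0)" by (intro tendsto_intros)
    then have "\<forall>\<^sub>F k in at_right 0. y + k *\<^sub>R b \<in> ball y0 R"
      using y open_ball topological_tendstoD by fastforce
    then obtain k0 where k0': "k0 > 0" "\<And>k. 0 < k \<Longrightarrow> k < k0 \<Longrightarrow> y + k *\<^sub>R b \<in> ball y0 R"
      unfolding eventually_at_right_field by blast
    show ?thesis
    proof (rule grad_inner_le[OF _ k0'(1)])
      show "(f has_derivative (\<lambda>v. G y \<bullet> v)) (at y)" using gr y2 by (auto simp: grad_on_def)
      fix t :: real assume t: "0 < t" "t < k0"
      have "F (y + t *\<^sub>R b) - F y = (LINT z|lborel. ?k z * (U (y + t *\<^sub>R b + z) - U (y + z)))"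
        unfolding F_def using intF[of y] intF[of "y + t *\<^sub>R b"]
        by (simp add: right_diff_distrib Bochner_Integration.integral_diff)
      also have "\<dots> \<le> (LINT z|lborel. ?k z * (t * \<sigma>))"
      proof (rule integral_mono)
        show "integrable lborel (\<lambda>z. ?k z * (U (y + t *\<^sub>R b + z) - U (y + z)))"
          using intF[of y] intF[of "y + t *\<^sub>R b"] by (auto simp: right_diff_distrib)
        show "integrable lborel (\<lambda>z. ?k z * (t * \<sigma>))" using intk by simp
        fix z
        have "U (y + t *\<^sub>R b + z) - U (y + z) \<le> t * \<sigma>" if z: "norm z < s"
        proof -
          have *: "x + z \<in> ball y0 (2 * R)" if "x \<in> ball y0 R" for x
          proof -
            have "dist y0 (x + z) \<le> dist y0 x + dist x (x + z)" by (rule dist_triangle)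
            then show ?thesis using that z s by (auto simp: dist_norm)
          qed
          show ?thesis using h[OF *[OF y] t(1)] *[OF k0'(2)[OF t]] by (simp add: add_ac)
        qed
        then show "?k z * (U (y + t *\<^sub>R b + z) - U (y + z)) \<le> ?k z * (t * \<sigma>)"
          using k0[of z] bump_nonneg[of 0 s z] by (cases "norm z < s") (auto intro!: mult_left_mono)
      qed
      also have "\<dots> = I * (t * \<sigma>)" by (simp add: I_def)
      finally show "f (y + t *\<^sub>R b) - f y \<le> t * \<sigma>"
        using \<open>I > 0\<close> by (simp add: f_def diff_divide_distrib[symmetric] divide_simps mult_ac)
    qed
  qed
  show ?thesis using gr close inc by blast
qed

section \<open>Charts and differentials\<close>

lemma Ck_on_1_local:
  fixes f :: "'e::euclidean_space \<Rightarrow> real"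
  assumes "\<And>y. y \<in> S \<Longrightarrow> \<exists>T G h. open T \<and> y \<in> T \<and> grad_on T h G \<and> (\<forall>z\<in>T. f z = h z)"
  shows "Ck_on 1 S f"
proof -
  have "(f has_derivative (\<lambda>v. grad f y \<bullet> v)) (at y) \<and> isCont (grad f) y" if "y \<in> S" for y
  proof -
    obtain T G h where T: "open T" "y \<in> T" "grad_on T h G" "\<And>z. z \<in> T \<Longrightarrow> f z = h z"
      using assms[OF \<open>y \<in> S\<close>] by blast
    have d: "(f has_derivative (\<lambda>v. G z \<bullet> v)) (at z)" if "z \<in> T" for z
    proof -
      have "(h has_derivative (\<lambda>v. G z \<bullet> v)) (at z)" using T(3) that by (auto simp: grad_on_def)
      then show ?thesis
        by (rule has_derivative_transform_within_open[OF _ T(1) that]) (use T in auto)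
    qed
    have "continuous_on T (grad f)"
      using T(3) grad_unique[OF d] by (auto simp: grad_on_def cong: continuous_on_cong)
    then have "isCont (grad f) y" using T by (simp add: continuous_on_eq_continuous_at)
    then show ?thesis using d[OF T(2)] grad_unique[OF d[OF T(2)]] by simp
  qed
  then have "grad_on S f (grad f)"
    by (auto simp: grad_on_def intro!: continuous_at_imp_continuous_on)
  then show ?thesis by (rule grad_on_Ck_on_1)
qed

locale closed_manifold =
  fixes A :: "('m::t2_space, 'e::euclidean_space) chart set"
    and g :: "'m \<Rightarrow> 'e \<Rightarrow> 'e \<Rightarrow> real"
  assumes manifold: "closed_connected_riemannian_manifold A g"
begin

abbreviation img :: "('m, 'e) chart \<Rightarrow> 'e set" where "img c \<equiv> snd c ` fst c"

lemma compact_M: "compact (UNIV :: 'm set)" and connected_M: "connected (UNIV :: 'm set)"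
  and atlas: "smooth_atlas A" and metric: "riemannian_metric A g"
  using manifold by (auto simp: closed_connected_riemannian_manifold_def)

lemma is_chartD: assumes "c \<in> A"
  shows open_dom: "open (fst c)" and open_img: "open (img c)"
    and continuous_chart: "continuous_on (fst c) (snd c)"
    and continuous_chart_inv: "continuous_on (img c) (chart_inv c)"
  using atlas assms by (auto simp: smooth_atlas_def is_chart_def homeomorphism_def)

lemma chart_inv_left [simp]: assumes "c \<in> A" "x \<in> fst c" shows "chart_inv c (snd c x) = x"
  using atlas assms by (auto simp: smooth_atlas_def is_chart_def homeomorphism_def)

lemma chart_inv_right [simp]: assumes "c \<in> A" "y \<in> img c" shows "snd c (chart_inv c y) = y"
  using assms by auto

lemma chart_inv_in: assumes "c \<in> A" "y \<in> img c" shows "chart_inv c y \<in> fst c"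
  using assms by auto

lemma chart_at_in: "chart_at A x \<in> A" "x \<in> fst (chart_at A x)"
proof -
  have "x \<in> (\<Union>c\<in>A. fst c)" using atlas by (simp add: smooth_atlas_def)
  then have "\<exists>c. c \<in> A \<and> x \<in> fst c" by blast
  from someI_ex[OF this] show "chart_at A x \<in> A" "x \<in> fst (chart_at A x)"
    by (auto simp: chart_at_def)
qed

lemma open_chart_preimage: assumes "c \<in> A" "open W" shows "open {y \<in> img c. chart_inv c y \<in> W}"
  using continuous_open_preimage[OF continuous_chart_inv[OF assms(1)] open_img[OF assms(1)] assms(2)]
  by (simp add: Int_def vimage_def)

lemma overlap_eq: assumes "c \<in> A" shows "snd c ` (fst c \<inter> fst d) = {y \<in> img c. chart_inv c y \<in> fst d}"
  using assms by force

lemma open_overlap: assumes "c \<in> A" "d \<in> A" shows "open (snd c ` (fst c \<inter> fst d))"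
  unfolding overlap_eq[OF assms(1)] by (intro open_chart_preimage assms open_dom)

lemma transition_smooth: assumes "c \<in> A" "d \<in> A"
  shows "\<And>y. y \<in> snd c ` (fst c \<inter> fst d) \<Longrightarrow> (snd d \<circ> chart_inv c) differentiable (at y)"
    and "continuous_on (snd c ` (fst c \<inter> fst d)) (\<lambda>y. frechet_derivative (snd d \<circ> chart_inv c) (at y) v)"
proof -
  have "Ck_on (Suc 0) (snd c ` (fst c \<inter> fst d)) (snd d \<circ> chart_inv c)"
    using atlas assms unfolding smooth_atlas_def smooth_on_def by blast
  then show "\<And>y. y \<in> snd c ` (fst c \<inter> fst d) \<Longrightarrow> (snd d \<circ> chart_inv c) differentiable (at y)"
    "continuous_on (snd c ` (fst c \<inter> fst d)) (\<lambda>y. frechet_derivative (snd d \<circ> chart_inv c) (at y) v)"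
    by auto
qed

lemma transition_derivative: assumes "c \<in> A" "d \<in> A" "x \<in> fst c" "x \<in> fst d"
  shows "((snd d \<circ> chart_inv c) has_derivative coord_change c d x) (at (snd c x))"
  using transition_smooth(1)[OF assms(1,2), of "snd c x"] assms
  unfolding coord_change_def frechet_derivative_works[symmetric] by auto

lemma coord_change_linear: assumes "c \<in> A" "d \<in> A" "x \<in> fst c" "x \<in> fst d"
  shows "bounded_linear (coord_change c d x)"
  using transition_derivative[OF assms] by (rule has_derivative_bounded_linear)

text \<open>The chain rule on the triple overlap; it makes the coordinates of vectors and covectors
  consistent between charts.\<close>

lemma coord_change_comp:
  assumes "c \<in> A" "d \<in> A" "e \<in> A" "x \<in> fst c" "x \<in> fst d" "x \<in> fst e"
  shows "coord_change d e x (coord_change c d x v) = coord_change c e x v"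
proof -
  have "((snd e \<circ> chart_inv d) has_derivative coord_change d e x) (at ((snd d \<circ> chart_inv c) (snd c x)))"
    using transition_derivative[of d e x] assms by simp
  from diff_chain_at[OF transition_derivative[OF assms(1,2,4,5)] this]
  have "((snd e \<circ> chart_inv d) \<circ> (snd d \<circ> chart_inv c) has_derivative coord_change d e x \<circ> coord_change c d x) (at (snd c x))" .
  then have "((snd e \<circ> chart_inv c) has_derivative coord_change d e x \<circ> coord_change c d x) (at (snd c x))"
    by (rule has_derivative_transform_within_open[OF _ open_overlap[OF assms(1,2)]]) (use assms in auto)
  from has_derivative_unique[OF this transition_derivative[OF assms(1,3,4,6)]]
  show ?thesis by (auto simp: fun_eq_iff)
qed

lemma coord_change_id [simp]: assumes "c \<in> A" "x \<in> fst c" shows "coord_change c c x v = v"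
proof -
  have "((\<lambda>y. y) has_derivative (\<lambda>v. v)) (at (snd c x))" by (rule has_derivative_ident)
  then have "((snd c \<circ> chart_inv c) has_derivative (\<lambda>v. v)) (at (snd c x))"
    by (rule has_derivative_transform_within_open[OF _ open_img[OF assms(1)]]) (use assms in auto)
  from has_derivative_unique[OF this transition_derivative[OF assms(1,1,2,2)]]
  show ?thesis by (metis)
qed

text \<open>The covector with components \<xi> in the chart c, acting through the inner product, but
  expressed in the chart chosen at x, as points of the cotangent bundle are. Together with
  \<open>tvec\<close> it turns the pairing into \<xi> \<bullet> w and hides
  \<open>chart_at\<close>.\<close>

definition cov :: "('m, 'e) chart \<Rightarrow> 'm \<Rightarrow> 'e \<Rightarrow> ('e \<Rightarrow>\<^sub>L real)" where
  "cov c x \<xi> = Blinfun (\<lambda>v. \<xi> \<bullet> coord_change (chart_at A x) c x v)"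

definition tvec :: "('m, 'e) chart \<Rightarrow> 'm \<Rightarrow> 'e \<Rightarrow> 'e" where
  "tvec c x w = coord_change c (chart_at A x) x w"

lemma cov_apply: assumes "c \<in> A" "x \<in> fst c"
  shows "blinfun_apply (cov c x \<xi>) v = \<xi> \<bullet> coord_change (chart_at A x) c x v"
proof -
  have "bounded_linear (\<lambda>v. \<xi> \<bullet> coord_change (chart_at A x) c x v)"
    by (intro bounded_linear_compose[OF bounded_linear_inner_right] coord_change_linear chart_at_in assms)
  then show ?thesis by (simp add: cov_def bounded_linear_Blinfun_apply)
qed

lemma cov_tvec: assumes "c \<in> A" "x \<in> fst c"
  shows "blinfun_apply (cov c x \<xi>) (tvec c x w) = \<xi> \<bullet> w"
  using assms chart_at_in[of x] by (simp add: cov_apply tvec_def coord_change_comp)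

lemma tvec_surj: assumes "c \<in> A" "x \<in> fst c" obtains w where "v = tvec c x w"
  using assms chart_at_in[of x] by (intro that[of "coord_change (chart_at A x) c x v"]) (simp add: tvec_def coord_change_comp)

lemma cov_surj: assumes "c \<in> A" "x \<in> fst c" obtains \<xi> where "p = cov c x \<xi>"
proof -
  have lin: "linear (\<lambda>w. blinfun_apply p (tvec c x w))"
    using coord_change_linear[OF assms(1) chart_at_in(1) assms(2) chart_at_in(2)]
    by (intro linearI) (auto simp: tvec_def bounded_linear.linear linear_add linear_scale blinfun.add_right blinfun.scaleR_right)
  define \<xi> where "\<xi> = (\<Sum>i\<in>Basis. blinfun_apply p (tvec c x i) *\<^sub>R i)"
  have "blinfun_apply p v = blinfun_apply (cov c x \<xi>) v" for v
  proof -
    obtain w where w: "v = tvec c x w" using tvec_surj[OF assms] by metis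
    show ?thesis unfolding w using linear_eq_inner_sum[OF lin, of w] by (simp add: cov_tvec[OF assms] \<xi>_def)
  qed
  then show ?thesis by (intro that[of \<xi>] blinfun_eqI)
qed

lemma cov_add: assumes "c \<in> A" "x \<in> fst c" shows "cov c x (\<xi> + \<zeta>) = cov c x \<xi> + cov c x \<zeta>"
  using assms by (intro blinfun_eqI) (simp add: cov_apply blinfun.add_left inner_add_left)

lemma cov_scale: assumes "c \<in> A" "x \<in> fst c" shows "cov c x (a *\<^sub>R \<xi>) = a *\<^sub>R cov c x \<xi>"
  using assms by (intro blinfun_eqI) (simp add: cov_apply blinfun.scaleR_left)

lemma cov_0: assumes "c \<in> A" "x \<in> fst c" shows "cov c x 0 = 0"
  using cov_scale[OF assms, of 0] by simp

lemma cov_sum: assumes "c \<in> A" "x \<in> fst c" shows "cov c x (\<Sum>i\<in>I. \<xi> i) = (\<Sum>i\<in>I. cov c x (\<xi> i))"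
  by (induction I rule: infinite_finite_induct) (auto simp: assms cov_add cov_0)

lemma cotangent_param_eq: assumes "c \<in> A" "y \<in> img c"
  shows "cotangent_param A c (y, blinfun_inner_right \<xi>) = (chart_inv c y, cov c (chart_inv c y) \<xi>)"
  by (simp add: cotangent_param_def Let_def cov_def)

lemma tangent_param_eq: "tangent_param A c (y, w) = (chart_inv c y, tvec c (chart_inv c y) w)"
  by (simp add: tangent_param_def Let_def tvec_def)

lemma continuous_map_cotangent_param: assumes "c \<in> A"
  shows "continuous_map (top_of_set (img c \<times> UNIV)) (cotangent_topology A)
           (\<lambda>(y, \<xi>). (chart_inv c y, cov c (chart_inv c y) \<xi>))"
proof -
  have "topspace (cotangent_topology A) = UNIV"
  proof -
    have "{z \<in> img c \<times> (UNIV :: ('e \<Rightarrow>\<^sub>L real) set). cotangent_param A c z \<in> UNIV} = img c \<times> UNIV" for c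
      by auto
    then have "openin (cotangent_topology A) UNIV"
      unfolding openin_cotangent_topology by (auto intro: open_Times open_img)
    then show ?thesis using openin_subset by blast
  qed
  then have 1: "continuous_map (top_of_set (img c \<times> UNIV)) (cotangent_topology A) (cotangent_param A c)"
    using assms unfolding continuous_map by (auto simp: openin_cotangent_topology openin_open_eq open_Times open_img)
  have 2: "continuous_map (top_of_set (img c \<times> UNIV)) (top_of_set (img c \<times> UNIV)) (\<lambda>(y, \<xi>::'e). (y, blinfun_inner_right \<xi>))"
    by (auto simp: continuous_map_in_subtopology split_beta image_subset_iff intro!: continuous_intros
        bounded_linear.continuous_on[OF bounded_linear_blinfun_inner_right])
  show ?thesis using continuous_map_compose[OF 2 1]
    by (rule continuous_map_eq) (auto simp: cotangent_param_eq[OF assms])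
qed

text \<open>Continuity for the bundle topology becomes joint continuity in Euclidean coordinates,
  the form in which continuity of H enters all estimates.\<close>

lemma continuous_on_cotangent_chart:
  assumes "continuous_map (prod_topology (cotangent_topology A) euclideanreal) euclideanreal
             (\<lambda>((x, p), u). F x p u)" and c: "c \<in> A"
  shows "continuous_on (img c \<times> UNIV \<times> UNIV) (\<lambda>(y, \<xi>, u). F (chart_inv c y) (cov c (chart_inv c y) \<xi>) u)"
proof -
  have 1: "continuous_map (top_of_set (img c \<times> UNIV \<times> UNIV)) (top_of_set (img c \<times> UNIV)) (\<lambda>(y, \<xi>::'e, u::real). (y, \<xi>))"
    by (auto simp: continuous_map_in_subtopology split_beta image_subset_iff intro!: continuous_intros)
  have 2: "continuous_map (top_of_set (img c \<times> UNIV \<times> UNIV)) euclideanreal (\<lambda>(y::'e, \<xi>::'e, u::real). u)"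
    by (auto simp: split_beta intro!: continuous_intros)
  have "continuous_map (top_of_set (img c \<times> UNIV \<times> UNIV)) euclideanreal
    ((\<lambda>((x, p), u). F x p u) \<circ> (\<lambda>z. ((((\<lambda>(y, \<xi>). (chart_inv c y, cov c (chart_inv c y) \<xi>)) \<circ> (\<lambda>(y, \<xi>::'e, u::real). (y, \<xi>))) z), (\<lambda>(y::'e, \<xi>::'e, u::real). u) z)))"
    by (intro continuous_map_compose[OF _ assms(1)] continuous_map_pairedI
      continuous_map_compose[OF 1 continuous_map_cotangent_param[OF c]] 2)
  then show ?thesis by (auto simp: o_def split_beta)
qed

section \<open>Calculus of C^1 functions on the manifold\<close>

lemma C1_fun_grad: assumes "C1_fun A f" "c \<in> A"
  shows "grad_on (img c) (f \<circ> chart_inv c) (grad (f \<circ> chart_inv c))"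
  using assms by (intro Ck_on_1_grad) (auto simp: C1_fun_def)

lemma C1_funI: assumes "\<And>c. c \<in> A \<Longrightarrow> grad_on (img c) (f \<circ> chart_inv c) (G c)" shows "C1_fun A f"
  unfolding C1_fun_def using grad_on_Ck_on_1[OF assms] by auto

lemma differential_eq:
  assumes "c \<in> A" "x \<in> fst c" "((f \<circ> chart_inv c) has_derivative (\<lambda>v. w \<bullet> v)) (at (snd c x))"
  shows "differential A f x = cov c x w"
proof -
  let ?k = "chart_at A x"
  have "((f \<circ> chart_inv c) has_derivative (\<lambda>v. w \<bullet> v)) (at ((snd c \<circ> chart_inv ?k) (snd ?k x)))"
    using assms chart_at_in[of x] by simp
  from diff_chain_at[OF transition_derivative[OF chart_at_in(1) assms(1) chart_at_in(2) assms(2)] this]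
  have "((f \<circ> chart_inv c) \<circ> (snd c \<circ> chart_inv ?k) has_derivative (\<lambda>v. w \<bullet> v) \<circ> coord_change ?k c x) (at (snd ?k x))" .
  then have "((f \<circ> chart_inv ?k) has_derivative (\<lambda>v. w \<bullet> v) \<circ> coord_change ?k c x) (at (snd ?k x))"
    by (rule has_derivative_transform_within_open[OF _ open_overlap[OF chart_at_in(1) assms(1)]])
      (use assms chart_at_in[of x] in auto)
  from frechet_derivative_at[OF this]
  show ?thesis by (simp add: differential_def Let_def cov_def o_def)
qed

lemma differential_cov: assumes "C1_fun A f" "c \<in> A" "x \<in> fst c"
  shows "differential A f x = cov c x (grad (f \<circ> chart_inv c) (snd c x))"
  using C1_fun_grad[OF assms(1,2)] assms by (intro differential_eq) (auto simp: grad_on_def)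

lemma continuous_on_M: assumes "\<And>c. c \<in> A \<Longrightarrow> continuous_on (img c) (f \<circ> chart_inv c)"
  shows "continuous_on UNIV f"
proof (rule continuous_at_imp_continuous_on, rule ballI)
  fix x
  let ?c = "chart_at A x"
  have "continuous_on (fst ?c) ((f \<circ> chart_inv ?c) \<circ> snd ?c)"
    by (intro continuous_on_compose continuous_chart assms chart_at_in)
  then have "continuous_on (fst ?c) f"
    by (rule continuous_on_eq) (auto simp: chart_at_in)
  then show "isCont f x" using chart_at_in[of x] open_dom by (simp add: continuous_on_eq_continuous_at)
qed

lemma continuous_on_chart: assumes "continuous_on UNIV f" "c \<in> A"
  shows "continuous_on (img c) (f \<circ> chart_inv c)"
  by (intro continuous_on_compose continuous_chart_inv assms continuous_on_subset[OF assms(1)]) auto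

lemma C1_continuous: assumes "C1_fun A f" shows "continuous_on UNIV f"
proof (rule continuous_on_M)
  fix c assume "c \<in> A"
  from C1_fun_grad[OF assms this] show "continuous_on (img c) (f \<circ> chart_inv c)"
    unfolding grad_on_def by (meson has_derivative_at_withinI has_derivative_continuous_on)
qed

lemma C1_const: "C1_fun A (\<lambda>_. k)"
  by (rule C1_funI[where G="\<lambda>_ _. 0"]) (auto simp: grad_on_def o_def)

lemma C1_add_diff: assumes "C1_fun A f" "C1_fun A h"
  shows C1_add: "C1_fun A (\<lambda>x. f x + h x)"
    and differential_add: "differential A (\<lambda>x. f x + h x) x = differential A f x + differential A h x"
proof -
  have *: "grad_on (img c) ((\<lambda>x. f x + h x) \<circ> chart_inv c) (\<lambda>y. grad (f \<circ> chart_inv c) y + grad (h \<circ> chart_inv c) y)" if "c \<in> A" for c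
    unfolding grad_on_def
  proof (intro conjI ballI)
    note g1 = C1_fun_grad[OF assms(1) that, unfolded grad_on_def]
    note g2 = C1_fun_grad[OF assms(2) that, unfolded grad_on_def]
    show "continuous_on (img c) (\<lambda>y. grad (f \<circ> chart_inv c) y + grad (h \<circ> chart_inv c) y)"
      by (intro continuous_on_add) (use g1 g2 in auto)
    fix y assume y: "y \<in> img c"
    show "((\<lambda>x. f x + h x) \<circ> chart_inv c has_derivative
          (\<lambda>v. (grad (f \<circ> chart_inv c) y + grad (h \<circ> chart_inv c) y) \<bullet> v)) (at y)"
      using has_derivative_add[OF bspec[OF conjunct2[OF g1] y] bspec[OF conjunct2[OF g2] y]]
      by (simp add: o_def inner_add_left)
  qed
  show "C1_fun A (\<lambda>x. f x + h x)" using * by (rule C1_funI)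
  have "differential A (\<lambda>x. f x + h x) x = cov (chart_at A x) x (grad (f \<circ> chart_inv (chart_at A x)) (snd (chart_at A x) x) + grad (h \<circ> chart_inv (chart_at A x)) (snd (chart_at A x) x))"
    using *[OF chart_at_in(1)[of x]] chart_at_in[of x] by (intro differential_eq) (auto simp: grad_on_def)
  then show "differential A (\<lambda>x. f x + h x) x = differential A f x + differential A h x"
    using assms by (simp add: cov_add chart_at_in differential_cov[OF _ chart_at_in])
qed

lemma C1_mult_diff: assumes "C1_fun A f" "C1_fun A h"
  shows C1_mult: "C1_fun A (\<lambda>x. f x * h x)"
    and differential_mult: "differential A (\<lambda>x. f x * h x) x = f x *\<^sub>R differential A h x + h x *\<^sub>R differential A f x"
proof -
  have *: "grad_on (img c) ((\<lambda>x. f x * h x) \<circ> chart_inv c)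
     (\<lambda>y. f (chart_inv c y) *\<^sub>R grad (h \<circ> chart_inv c) y + h (chart_inv c y) *\<^sub>R grad (f \<circ> chart_inv c) y)" if "c \<in> A" for c
  proof -
    have cont: "continuous_on (img c) (\<lambda>y. f (chart_inv c y))" "continuous_on (img c) (\<lambda>y. h (chart_inv c y))"
      using continuous_on_chart[OF C1_continuous that] assms by (auto simp: o_def)
    note g1 = C1_fun_grad[OF assms(1) that, unfolded grad_on_def]
    note g2 = C1_fun_grad[OF assms(2) that, unfolded grad_on_def]
    show ?thesis unfolding grad_on_def
    proof (intro conjI ballI)
      show "continuous_on (img c) (\<lambda>y. f (chart_inv c y) *\<^sub>R grad (h \<circ> chart_inv c) y + h (chart_inv c y) *\<^sub>R grad (f \<circ> chart_inv c) y)"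
        by (intro continuous_on_add continuous_on_scaleR cont) (use g1 g2 in auto)
      fix y assume y: "y \<in> img c"
      show "((\<lambda>x. f x * h x) \<circ> chart_inv c has_derivative
          (\<lambda>v. (f (chart_inv c y) *\<^sub>R grad (h \<circ> chart_inv c) y + h (chart_inv c y) *\<^sub>R grad (f \<circ> chart_inv c) y) \<bullet> v)) (at y)"
        using has_derivative_mult[OF bspec[OF conjunct2[OF g1] y] bspec[OF conjunct2[OF g2] y]]
        by (simp add: o_def inner_add_left mult.commute)
    qed
  qed
  show "C1_fun A (\<lambda>x. f x * h x)" using * by (rule C1_funI)
  let ?c = "chart_at A x"
  have "differential A (\<lambda>x. f x * h x) x = cov ?c x (f x *\<^sub>R grad (h \<circ> chart_inv ?c) (snd ?c x) + h x *\<^sub>R grad (f \<circ> chart_inv ?c) (snd ?c x))"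
    using *[OF chart_at_in(1)[of x]] chart_at_in[of x] by (intro differential_eq) (auto simp: grad_on_def)
  then show "differential A (\<lambda>x. f x * h x) x = f x *\<^sub>R differential A h x + h x *\<^sub>R differential A f x"
    using assms by (simp add: cov_add cov_scale chart_at_in differential_cov[OF _ chart_at_in])
qed

lemma differential_const: "differential A (\<lambda>_. k) x = 0"
proof -
  have "differential A (\<lambda>_. k) x = cov (chart_at A x) x 0"
    by (rule differential_eq) (auto simp: chart_at_in o_def)
  then show ?thesis by (simp add: cov_0 chart_at_in)
qed

lemma C1_cmult: assumes "C1_fun A f" shows "C1_fun A (\<lambda>x. k * f x)"
  by (intro C1_mult C1_const assms)

lemma differential_cmult: assumes "C1_fun A f" shows "differential A (\<lambda>x. k * f x) x = k *\<^sub>R differential A f x"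
  using differential_mult[OF C1_const assms] by (simp add: differential_const)

lemma C1_minus: assumes "C1_fun A f" shows "C1_fun A (\<lambda>x. - f x)"
  using C1_cmult[OF assms, of "-1"] by simp

lemma differential_minus: assumes "C1_fun A f" shows "differential A (\<lambda>x. - f x) x = - differential A f x"
  using differential_cmult[OF assms, of "-1"] by simp

lemma C1_sum: assumes "\<And>i. i \<in> I \<Longrightarrow> C1_fun A (f i)" shows "C1_fun A (\<lambda>x. \<Sum>i\<in>I. f i x)"
  using assms by (induction I rule: infinite_finite_induct) (auto intro: C1_const C1_add)

lemma differential_sum: assumes "\<And>i. i \<in> I \<Longrightarrow> C1_fun A (f i)"
  shows "differential A (\<lambda>x. \<Sum>i\<in>I. f i x) x = (\<Sum>i\<in>I. differential A (f i) x)"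
  using assms by (induction I rule: infinite_finite_induct)
    (auto simp: differential_const differential_add C1_sum)

lemma C1_divide: assumes "C1_fun A f" "C1_fun A h" "\<And>x. h x \<noteq> 0" shows "C1_fun A (\<lambda>x. f x / h x)"
proof -
  have "C1_fun A (\<lambda>x. inverse (h x))"
  proof (rule C1_funI)
    fix c assume c: "c \<in> A"
    have cont: "continuous_on (img c) (\<lambda>y. h (chart_inv c y))"
      using continuous_on_chart[OF C1_continuous c] assms by (auto simp: o_def)
    note g2 = C1_fun_grad[OF assms(2) c, unfolded grad_on_def]
    show "grad_on (img c) ((\<lambda>x. inverse (h x)) \<circ> chart_inv c)
       (\<lambda>y. (- (inverse (h (chart_inv c y)) * inverse (h (chart_inv c y)))) *\<^sub>R grad (h \<circ> chart_inv c) y)"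
      unfolding grad_on_def
    proof (intro conjI ballI)
      show "continuous_on (img c) (\<lambda>y. (- (inverse (h (chart_inv c y)) * inverse (h (chart_inv c y)))) *\<^sub>R grad (h \<circ> chart_inv c) y)"
        by (intro continuous_on_scaleR continuous_on_minus continuous_on_mult continuous_on_inverse cont) (use g2 assms(3) in auto)
      fix y assume y: "y \<in> img c"
      show "((\<lambda>x. inverse (h x)) \<circ> chart_inv c has_derivative
         (\<lambda>v. ((- (inverse (h (chart_inv c y)) * inverse (h (chart_inv c y)))) *\<^sub>R grad (h \<circ> chart_inv c) y) \<bullet> v)) (at y)"
        using Deriv.has_derivative_inverse[OF _ bspec[OF conjunct2[OF g2] y]] assms(3) by (simp add: o_def mult_ac)
    qed
  qed
  from C1_mult[OF assms(1) this] show ?thesis by (simp add: divide_inverse)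
qed

text \<open>In a chart the difference has an interior maximum. This identifies differentials without
  computing them, both for test functions in contact and at zeros of nonnegative functions.\<close>

lemma differential_at_max: assumes "C1_fun A f" "C1_fun A h" "\<And>x. f x - h x \<le> f x0 - h x0"
  shows "differential A f x0 = differential A h x0"
proof -
  let ?c = "chart_at A x0" and ?d = "\<lambda>x. f x + - h x"
  have c: "?c \<in> A" "x0 \<in> fst ?c" by (rule chart_at_in)+
  have d: "C1_fun A ?d" by (intro C1_add C1_minus assms)
  from C1_fun_grad[OF this c(1)] c
  have "((?d \<circ> chart_inv ?c) has_derivative (\<lambda>v. grad (?d \<circ> chart_inv ?c) (snd ?c x0) \<bullet> v)) (at (snd ?c x0))"
    by (auto simp: grad_on_def)
  from differential_zero_maxmin[OF _ open_img[OF c(1)] this]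
  have "(\<lambda>v. grad (?d \<circ> chart_inv ?c) (snd ?c x0) \<bullet> v) = (\<lambda>v. 0)"
    using c assms(3) by fastforce
  then have "grad (?d \<circ> chart_inv ?c) (snd ?c x0) = 0" by (metis inner_eq_zero_iff)
  then have "differential A ?d x0 = 0" using differential_cov[OF d c] cov_0[OF c] by simp
  then show ?thesis using assms differential_add[OF assms(1) C1_minus[OF assms(2)]] differential_minus by simp
qed

section \<open>Extension by zero of functions given in a chart\<close>

definition ext_fun :: "('m, 'e) chart \<Rightarrow> ('e \<Rightarrow> real) \<Rightarrow> 'm \<Rightarrow> real" where
  "ext_fun c \<psi> x = (if x \<in> fst c then \<psi> (snd c x) else 0)"

text \<open>Two open sets cover M: the one where \<psi> is C^1, and the complement of the compact
  set outside which \<psi> vanishes, which is open because M is Hausdorff. On the first, another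
  chart only contributes a transition map.\<close>

lemma C1_ext_fun:
  assumes c: "c \<in> A" and W: "open W" "W \<subseteq> img c" "grad_on W \<psi> G" and K: "compact K" "K \<subseteq> W"
    and zero: "\<And>y. y \<in> img c - K \<Longrightarrow> \<psi> y = 0"
  shows "C1_fun A (ext_fun c \<psi>)"
proof -
  have "compact (chart_inv c ` K)"
    using K W by (intro compact_continuous_image continuous_on_subset[OF continuous_chart_inv[OF c]]) auto
  then have cl: "open (- (chart_inv c ` K))" using compact_imp_closed by blast
  have "Ck_on 1 (img d) (ext_fun c \<psi> \<circ> chart_inv d)" if d: "d \<in> A" for d
  proof (rule Ck_on_1_local)
    fix y assume y: "y \<in> img d"
    show "\<exists>T G h. open T \<and> y \<in> T \<and> grad_on T h G \<and> (\<forall>z\<in>T. (ext_fun c \<psi> \<circ> chart_inv d) z = h z)"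
    proof (cases "chart_inv d y \<in> chart_inv c ` K")
      case False
      let ?T = "{z \<in> img d. chart_inv d z \<in> - (chart_inv c ` K)}"
      have "(ext_fun c \<psi> \<circ> chart_inv d) z = 0" if "z \<in> ?T" for z
      proof (cases "chart_inv d z \<in> fst c")
        case True
        moreover have "snd c (chart_inv d z) \<notin> K"
        proof
          assume "snd c (chart_inv d z) \<in> K"
          then have "chart_inv c (snd c (chart_inv d z)) \<in> chart_inv c ` K" by blast
          then show False using that True c by simp
        qed
        ultimately show ?thesis using zero by (auto simp: ext_fun_def)
      qed (simp add: ext_fun_def)
      moreover have "open ?T" by (intro open_chart_preimage d cl)
      ultimately show ?thesis using y False
        by (intro exI[of _ ?T] exI[of _ "\<lambda>_. 0"] exI[of _ "\<lambda>_. 0"]) (auto simp: grad_on_def)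
    next
      case True
      then obtain k where k: "k \<in> K" "chart_inv d y = chart_inv c k" by blast
      have "open (snd c -` W \<inter> fst c)"
        using continuous_open_preimage[OF continuous_chart[OF c] open_dom[OF c] W(1)] by (simp add: Int_commute)
      then have op: "open {z \<in> img d. chart_inv d z \<in> snd c -` W \<inter> fst c}" by (intro open_chart_preimage d)
      let ?T = "{z \<in> img d. chart_inv d z \<in> snd c -` W \<inter> fst c}"
      let ?t = "snd c \<circ> chart_inv d"
      let ?D = "\<lambda>z. coord_change d c (chart_inv d z)"
      have kin: "k \<in> img c" using k K W by blast
      then have yT: "y \<in> ?T" using y k K W c by (auto simp: chart_inv_in)
      have sub: "?T \<subseteq> snd d ` (fst d \<inter> fst c)" unfolding overlap_eq[OF d] by auto
      \<comment> \<open>The adjoint of the transition derivative applied to G, written by components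
        because continuity of that derivative is known on each fixed vector.\<close>
      let ?G = "\<lambda>z. \<Sum>i\<in>Basis. (G (?t z) \<bullet> ?D z i) *\<^sub>R i"
      have ct: "continuous_on ?T ?t"
        by (intro continuous_on_compose continuous_on_subset[OF continuous_chart_inv[OF d]] continuous_on_subset[OF continuous_chart[OF c]]) auto
      have cD: "continuous_on ?T (\<lambda>z. ?D z i)" for i
      proof -
        have "continuous_on ?T (\<lambda>y. frechet_derivative (snd c \<circ> chart_inv d) (at y) i)"
          by (rule continuous_on_subset[OF transition_smooth(2)[OF d c] sub])
        then show ?thesis
          by (rule continuous_on_eq) (use d in \<open>auto simp: coord_change_def\<close>)
      qed
      have gG: "continuous_on W G" "\<And>y. y \<in> W \<Longrightarrow> (\<psi> has_derivative (\<lambda>v. G y \<bullet> v)) (at y)"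
        using W(3) by (auto simp: grad_on_def)
      have "continuous_on ?T (G \<circ> ?t)"
        by (rule continuous_on_compose[OF ct], rule continuous_on_subset[OF gG(1)]) auto
      then have "continuous_on ?T ?G" by (intro continuous_intros cD) (simp add: o_def)
      moreover have "(\<psi> \<circ> ?t has_derivative (\<lambda>v. ?G z \<bullet> v)) (at z)" if z: "z \<in> ?T" for z
      proof -
        have zx: "z = snd d (chart_inv d z)" "chart_inv d z \<in> fst d" "chart_inv d z \<in> fst c"
          using z d by (auto simp: chart_inv_in)
        have "(?t has_derivative ?D z) (at z)"
          using transition_derivative[OF d c zx(2,3)] zx(1) by simp
        moreover have "(\<psi> has_derivative (\<lambda>v. G (?t z) \<bullet> v)) (at (?t z))" using gG(2) z by auto
        ultimately have *: "(\<psi> \<circ> ?t has_derivative (\<lambda>v. G (?t z) \<bullet> v) \<circ> ?D z) (at z)" by (rule diff_chain_at)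
        have "((\<lambda>v. G (?t z) \<bullet> v) \<circ> ?D z) v = ?G z \<bullet> v" for v
          by (rule trans[OF linear_eq_inner_sum[OF has_derivative_linear[OF *]]]) (simp add: o_def)
        then show ?thesis by (intro has_derivative_eq_rhs[OF *] ext)
      qed
      ultimately have "grad_on ?T (\<psi> \<circ> ?t) ?G" by (simp add: grad_on_def)
      then show ?thesis using op yT
        by (intro exI[of _ ?T] exI[of _ ?G] exI[of _ "\<psi> \<circ> ?t"]) (auto simp: ext_fun_def)
    qed
  qed
  then show ?thesis by (simp add: C1_fun_def)
qed

lemma differential_ext_fun:
  assumes c: "c \<in> A" "x \<in> fst c" and "(\<psi> has_derivative (\<lambda>v. w \<bullet> v)) (at (snd c x))"
  shows "differential A (ext_fun c \<psi>) x = cov c x w"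
proof (rule differential_eq[OF c])
  show "((ext_fun c \<psi> \<circ> chart_inv c) has_derivative (\<lambda>v. w \<bullet> v)) (at (snd c x))"
    by (rule has_derivative_transform_within_open[OF assms(3) open_img[OF c(1)]])
      (use c in \<open>auto simp: ext_fun_def\<close>)
qed

lemma chart_ball: assumes "c \<in> A" "x \<in> fst c" obtains r where "r > 0" "cball (snd c x) r \<subseteq> img c"
  using open_contains_cball[of "img c"] open_img[OF assms(1)] assms by blast

lemma C1_bump: assumes "c \<in> A" "r > 0" "cball y0 r \<subseteq> img c"
  shows "C1_fun A (ext_fun c (bump y0 r))"
  by (rule C1_ext_fun[OF assms(1) open_img[OF assms(1)] subset_refl grad_on_bump, of "cball y0 r"])
    (use assms in \<open>auto intro!: bump_outside(1)\<close>)

text \<open>Added to or subtracted from a test function, \<psi> makes the contact at x0 strict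
  without changing the differential there.\<close>

lemma strict_minimum_exists:
  obtains \<psi> where "C1_fun A \<psi>" "\<psi> x0 = 0" "\<And>x. x \<noteq> x0 \<Longrightarrow> \<psi> x > 0"
proof -
  let ?c = "chart_at A x0"
  note c = chart_at_in[of x0]
  obtain r where r: "r > 0" "cball (snd ?c x0) r \<subseteq> img ?c" using chart_ball[OF c] .
  define \<psi> where "\<psi> x = 1 + - ext_fun ?c (bump (snd ?c x0) r) x" for x
  have "C1_fun A \<psi>" unfolding \<psi>_def by (intro C1_add C1_const C1_minus C1_bump c r)
  moreover have "\<psi> x0 = 0" by (simp add: \<psi>_def ext_fun_def c)
  moreover have "\<psi> x > 0" if "x \<noteq> x0" for x
  proof (cases "x \<in> fst ?c")
    case True
    then have "snd ?c x \<noteq> snd ?c x0" using that c by (metis chart_inv_left)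
    then show ?thesis using True bump_less_1[OF r(1)] by (simp add: \<psi>_def ext_fun_def)
  qed (simp add: \<psi>_def ext_fun_def)
  ultimately show ?thesis using that by blast
qed

end

section \<open>Smoothing of viscosity subsolutions\<close>

context closed_manifold
begin

abbreviation loc :: "('m \<Rightarrow> ('e \<Rightarrow>\<^sub>L real) \<Rightarrow> real) \<Rightarrow> ('m, 'e) chart \<Rightarrow> 'e \<Rightarrow> 'e \<Rightarrow> real" where
  "loc N c y \<xi> \<equiv> N (chart_inv c y) (cov c (chart_inv c y) \<xi>)"

text \<open>The unknown does not occur: its value will be frozen inside N. Coercivity is expressed
  by sublevel sets bounded uniformly over compact parts of a chart, a form that survives freezing
  and directly bounds all gradients that occur.\<close>

definition coercive_hamiltonian :: "('m \<Rightarrow> ('e \<Rightarrow>\<^sub>L real) \<Rightarrow> real) \<Rightarrow> bool" where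
  "coercive_hamiltonian N \<longleftrightarrow>
     (\<forall>c\<in>A. continuous_on (img c \<times> UNIV) (\<lambda>(y, \<xi>). loc N c y \<xi>)) \<and>
     (\<forall>x. convex_on UNIV (N x)) \<and>
     (\<forall>c\<in>A. \<forall>Y C. compact Y \<longrightarrow> Y \<subseteq> img c \<longrightarrow> bounded {\<xi>. \<exists>y\<in>Y. loc N c y \<xi> \<le> C})"

definition subsol :: "('m \<Rightarrow> ('e \<Rightarrow>\<^sub>L real) \<Rightarrow> real) \<Rightarrow> ('m \<Rightarrow> real) \<Rightarrow> bool" where
  "subsol N u \<longleftrightarrow> continuous_on UNIV u \<and>
     (\<forall>\<phi> x0. C1_fun A \<phi> \<longrightarrow> (\<forall>x. u x - \<phi> x \<le> u x0 - \<phi> x0) \<longrightarrow> N x0 (differential A \<phi> x0) \<le> 0)"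

lemma coercive_hamiltonianD: assumes "coercive_hamiltonian N"
  shows "\<And>c. c \<in> A \<Longrightarrow> continuous_on (img c \<times> UNIV) (\<lambda>(y, \<xi>). loc N c y \<xi>)"
    and "\<And>x. convex_on UNIV (N x)"
    and "\<And>c Y C. c \<in> A \<Longrightarrow> compact Y \<Longrightarrow> Y \<subseteq> img c \<Longrightarrow> bounded {\<xi>. \<exists>y\<in>Y. loc N c y \<xi> \<le> C}"
  using assms by (auto simp: coercive_hamiltonian_def)

lemma bounded_on_M: assumes "continuous_on UNIV (u :: 'm \<Rightarrow> real)" shows "\<exists>B. \<forall>x. \<bar>u x\<bar> \<le> B"
proof -
  have "bounded (range u)" by (intro compact_imp_bounded compact_continuous_image assms compact_M)
  then show ?thesis unfolding bounded_iff by auto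
qed

text \<open>Viscosity tests are stated with global C^1 functions and global maxima. A local maximum
  in a chart is made global by interpolating, with a bump, between \<phi> and a suitable
  constant.\<close>

lemma subsol_local_test:
  assumes sub: "subsol N u" and c: "c \<in> A" and S: "open S" "y1 \<in> S" "S \<subseteq> img c" and gr: "grad_on S \<phi> G"
    and max: "\<And>y. y \<in> S \<Longrightarrow> (u \<circ> chart_inv c) y - \<phi> y \<le> (u \<circ> chart_inv c) y1 - \<phi> y1"
  shows "loc N c y1 (G y1) \<le> 0"
proof -
  obtain r where r: "r > 0" "cball y1 r \<subseteq> S" using S open_contains_cball by blast
  obtain B where B: "\<And>x. u x \<le> B"
    using bounded_on_M[of u] sub unfolding subsol_def by (auto simp: abs_le_iff)
  define x1 where "x1 = chart_inv c y1"
  have y1: "y1 \<in> img c" using S by auto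
  have x1: "x1 \<in> fst c" "snd c x1 = y1" using y1 c by (auto simp: x1_def chart_inv_in)
  define m where "m = u x1 - \<phi> y1"
  \<comment> \<open>With this choice u - C \<le> m everywhere. Where the bump has value b, the
    inequalities u - \<phi> \<le> m and u - C \<le> m are combined with weights b and 1 - b.\<close>
  define C where "C = B - m"
  define \<psi> where "\<psi> y = bump y1 r y * (\<phi> y - C)" for y
  define G' where "G' y = bump y1 r y *\<^sub>R G y + (\<phi> y - C) *\<^sub>R bump_grad y1 r y" for y
  have dphi: "(\<phi> has_derivative (\<lambda>v. G y \<bullet> v)) (at y)" if "y \<in> S" for y
    using gr that by (auto simp: grad_on_def)
  have d\<psi>: "(\<psi> has_derivative (\<lambda>v. G' y \<bullet> v)) (at y)" if "y \<in> S" for y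
  proof -
    have "((\<lambda>y. \<phi> y - C) has_derivative (\<lambda>v. G y \<bullet> v)) (at y)"
      using has_derivative_diff[OF dphi[OF that] has_derivative_const[of C]] by simp
    from has_derivative_mult[OF has_derivative_bump this] show ?thesis
      unfolding \<psi>_def[abs_def] by (rule has_derivative_eq_rhs) (auto simp: G'_def inner_add_left fun_eq_iff)
  qed
  have cphi: "continuous_on S \<phi>" using dphi by (meson has_derivative_at_withinI has_derivative_continuous_on)
  have "continuous_on S G'" unfolding G'_def using gr
    by (intro continuous_intros continuous_bump continuous_bump_grad cphi) (auto simp: grad_on_def)
  then have g\<psi>: "grad_on S \<psi> G'" using d\<psi> by (simp add: grad_on_def)
  define \<Phi> where "\<Phi> x = C + ext_fun c \<psi> x" for x
  have C1e: "C1_fun A (ext_fun c \<psi>)"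
    by (rule C1_ext_fun[OF c S(1,3) g\<psi> compact_cball r(2)]) (auto simp: \<psi>_def intro!: bump_outside(1) r)
  have "C1_fun A \<Phi>" unfolding \<Phi>_def by (intro C1_add C1_const C1e)
  moreover have "u x - \<Phi> x \<le> u x1 - \<Phi> x1" for x
  proof -
    have 1: "u x1 - \<Phi> x1 = m" using x1 by (simp add: \<Phi>_def ext_fun_def \<psi>_def m_def)
    show ?thesis
    proof (cases "x \<in> fst c \<and> snd c x \<in> ball y1 r")
      case True
      let ?y = "snd c x" and ?b = "bump y1 r (snd c x)"
      have "?y \<in> S" using True r by auto
      from max[OF this] have "u x - \<phi> ?y \<le> m" using True c by (simp add: m_def x1_def)
      then have "?b * (u x - \<phi> ?y) \<le> ?b * m" by (intro mult_left_mono bump_nonneg)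
      moreover have "(1 - ?b) * (u x - C) \<le> (1 - ?b) * m"
        using B[of x] bump_le_1[of y1 r ?y] by (intro mult_left_mono) (auto simp: C_def)
      ultimately have "?b * (u x - \<phi> ?y) + (1 - ?b) * (u x - C) \<le> m" by (simp add: algebra_simps)
      then show ?thesis unfolding 1 using True by (simp add: \<Phi>_def ext_fun_def \<psi>_def algebra_simps)
    next
      case False
      then have "ext_fun c \<psi> x = 0" using bump_outside(1)[OF r(1)] by (auto simp: ext_fun_def \<psi>_def)
      then show ?thesis unfolding 1 using B[of x] by (simp add: \<Phi>_def C_def)
    qed
  qed
  ultimately have "N x1 (differential A \<Phi> x1) \<le> 0" using sub by (auto simp: subsol_def)
  moreover have "differential A \<Phi> x1 = cov c x1 (G y1)"
    using differential_add[OF C1_const[of C] C1e, of x1] differential_ext_fun[OF c x1(1), of \<psi> "G' y1"] d\<psi>[OF S(2)]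
    by (simp add: \<Phi>_def[abs_def] x1 differential_const G'_def)
  ultimately show ?thesis by (simp add: x1_def)
qed

text \<open>Any half-space containing the nearby zero sublevel sets bounds the increments of u;
  unlike the viscosity inequality, such bounds pass through convolution.\<close>

lemma subsol_increment:
  assumes sub: "subsol N u" and c: "c \<in> A" and r: "ball y0 r \<subseteq> img c"
    and K: "\<And>y \<xi>. y \<in> ball y0 r \<Longrightarrow> loc N c y \<xi> \<le> 0 \<Longrightarrow> \<xi> \<bullet> b \<le> a"
    and b: "b \<noteq> 0" and t: "t > 0" and y: "y \<in> ball y0 r" "y + t *\<^sub>R b \<in> ball y0 r"
  shows "(u \<circ> chart_inv c) (y + t *\<^sub>R b) - (u \<circ> chart_inv c) y \<le> t * a"
proof (rule increment_bound[OF _ _ b t y])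
  show "continuous_on (ball y0 r) (u \<circ> chart_inv c)"
    using sub c r continuous_on_chart continuous_on_subset by (metis subsol_def)
  fix \<phi> G y1 S
  assume h: "grad_on UNIV \<phi> G" "open S" "y1 \<in> S" "S \<subseteq> ball y0 r"
    "\<And>y. y \<in> S \<Longrightarrow> (u \<circ> chart_inv c) y - \<phi> y \<le> (u \<circ> chart_inv c) y1 - \<phi> y1"
  have "grad_on S \<phi> G" using h(1) continuous_on_subset by (auto simp: grad_on_def)
  from subsol_local_test[OF sub c h(2,3) _ this h(5)] r h(4)
  have "loc N c y1 (G y1) \<le> 0" by blast
  then show "G y1 \<bullet> b \<le> a" using K h by blast
qed

text \<open>Near y0 all zero sublevel sets lie in the convex set K of momenta with N(y0,.) \<le>
  \<epsilon>/2, and on K the nearby Hamiltonians are at most \<epsilon>. Increments of u are bounded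
  by the support function of K, so the mollified gradient lies in every closed half-space containing
  K and hence in K. R is chosen before \<delta>: the gluing needs \<delta> small against the
  gradients of cut-offs at scale R.\<close>

lemma subsol_local_smoothing:
  assumes nice: "coercive_hamiltonian N" and sub: "subsol N u" and c: "c \<in> A" and y0: "y0 \<in> img c" and e: "\<epsilon> > 0"
  shows "\<exists>R>0. cball y0 (2 * R) \<subseteq> img c \<and> (\<forall>\<delta>>0. \<exists>f G. grad_on (ball y0 (2 * R)) f G \<and>
     (\<forall>y\<in>ball y0 R. \<bar>f y - u (chart_inv c y)\<bar> \<le> \<delta> \<and> loc N c y (G y) \<le> \<epsilon>))"
proof -
  obtain r where r: "r > 0" "cball y0 r \<subseteq> img c" using y0 open_img[OF c] open_contains_cball by blast
  \<comment> \<open>P bounds every momentum that will occur, so that uniform continuity on a compact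
    set can compare N at y with N at y0.\<close>
  obtain P where P: "\<And>\<xi> y. y \<in> cball y0 r \<Longrightarrow> loc N c y \<xi> \<le> \<epsilon> \<Longrightarrow> norm \<xi> \<le> P"
    using coercive_hamiltonianD(3)[OF nice c compact_cball r(2), of \<epsilon>] unfolding bounded_iff by blast
  have "uniformly_continuous_on (cball y0 r \<times> cball 0 P) (\<lambda>(y, \<xi>). loc N c y \<xi>)"
    using r by (intro compact_uniformly_continuous compact_Times compact_cball continuous_on_subset[OF coercive_hamiltonianD(1)[OF nice c]]) auto
  then obtain d where d: "d > 0" "\<And>y \<xi> y' \<xi>'. y \<in> cball y0 r \<Longrightarrow> norm \<xi> \<le> P \<Longrightarrow> y' \<in> cball y0 r \<Longrightarrow> norm \<xi>' \<le> P \<Longrightarrow>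
      dist (y', \<xi>') (y, \<xi>) < d \<Longrightarrow> \<bar>loc N c y' \<xi>' - loc N c y \<xi>\<bar> < \<epsilon> / 2"
    using e unfolding uniformly_continuous_on_def by (force simp: dist_real_def dest: spec[of _ "\<epsilon> / 2"])
  define R where "R = min r d / 2"
  have R: "R > 0" "2 * R \<le> r" "2 * R \<le> d" using r d by (auto simp: R_def)
  have osc: "\<bar>loc N c y \<xi> - loc N c y0 \<xi>\<bar> < \<epsilon> / 2" if "y \<in> ball y0 (2 * R)" "norm \<xi> \<le> P" for y \<xi>
    using that R r by (intro d(2)) (auto simp: dist_Pair_Pair dist_commute)
  define K where "K = {\<xi>. loc N c y0 \<xi> \<le> \<epsilon> / 2}"
  have KP: "norm \<xi> \<le> P" if "\<xi> \<in> K" for \<xi> using that P[of y0 \<xi>] r e by (auto simp: K_def)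
  have y0c: "chart_inv c y0 \<in> fst c" using c y0 by (simp add: chart_inv_in)
  have contK: "continuous_on UNIV (\<lambda>\<xi>. loc N c y0 \<xi>)"
  proof -
    have "continuous_on UNIV (\<lambda>\<xi>::'e. (y0, \<xi>))" by (intro continuous_intros)
    from continuous_on_compose2[OF coercive_hamiltonianD(1)[OF nice c] this] y0 show ?thesis by auto
  qed
  have closedK: "closed K" unfolding K_def by (intro closed_Collect_le contK continuous_intros)
  have convK: "convex K"
  proof (rule convexI)
    fix \<xi> \<zeta> and s t :: real assume h: "\<xi> \<in> K" "\<zeta> \<in> K" "0 \<le> s" "0 \<le> t" "s + t = 1"
    have "loc N c y0 (s *\<^sub>R \<xi> + t *\<^sub>R \<zeta>) \<le> s * loc N c y0 \<xi> + t * loc N c y0 \<zeta>"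
      using coercive_hamiltonianD(2)[OF nice, of "chart_inv c y0"] h
      by (simp add: cov_add[OF c y0c] cov_scale[OF c y0c] convex_on_def)
    also have "\<dots> \<le> s * (\<epsilon> / 2) + t * (\<epsilon> / 2)" using h by (intro add_mono mult_left_mono) (auto simp: K_def)
    also have "\<dots> = \<epsilon> / 2" using h(5) by (metis distrib_right mult_1)
    finally show "s *\<^sub>R \<xi> + t *\<^sub>R \<zeta> \<in> K" by (simp add: K_def)
  qed
  have inK: "\<xi> \<in> K" if "y \<in> ball y0 (2 * R)" "loc N c y \<xi> \<le> 0" for y \<xi>
  proof -
    have "norm \<xi> \<le> P" using P[of y \<xi>] that R e by auto
    from osc[OF that(1) this] show ?thesis using that(2) unfolding K_def mem_Collect_eq by linarith
  qed
  have outK: "loc N c y \<xi> \<le> \<epsilon>" if "y \<in> ball y0 (2 * R)" "\<xi> \<in> K" for y \<xi>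
    using osc[OF that(1) KP[OF that(2)]] that(2) unfolding K_def mem_Collect_eq by linarith
  \<comment> \<open>Mollification needs a function on the whole space; composing with the projection
    onto the closed ball extends u continuously and leaves it unchanged where it is used.\<close>
  define U where "U = (u \<circ> chart_inv c) \<circ> closest_point (cball y0 r)"
  have contu: "continuous_on UNIV u" using sub by (simp add: subsol_def)
  have contU: "continuous_on UNIV U" unfolding U_def
  proof (rule continuous_on_compose)
    show "continuous_on UNIV (closest_point (cball y0 r))"
      by (rule continuous_on_closest_point) (use r in auto)
    show "continuous_on (range (closest_point (cball y0 r))) (u \<circ> chart_inv c)"
      by (rule continuous_on_subset[OF continuous_on_chart[OF contu c]])
        (use r closest_point_in_set[of "cball y0 r"] in \<open>auto simp: subset_iff\<close>)
  qed
  have Ueq: "U y = (u \<circ> chart_inv c) y" if "y \<in> ball y0 (2 * R)" for y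
    using that R by (auto simp: U_def closest_point_self)
  have "\<exists>f G. grad_on (ball y0 (2 * R)) f G \<and>
     (\<forall>y\<in>ball y0 R. \<bar>f y - u (chart_inv c y)\<bar> \<le> \<delta> \<and> loc N c y (G y) \<le> \<epsilon>)" if \<delta>0: "\<delta> > 0" for \<delta>
  proof -
    obtain f G where fG: "grad_on (ball y0 (2 * R)) f G" "\<And>y. y \<in> ball y0 R \<Longrightarrow> \<bar>f y - U y\<bar> \<le> \<delta>"
      "\<And>y b \<sigma>. y \<in> ball y0 R \<Longrightarrow> (\<And>y t. y\<in>ball y0 (2 * R) \<Longrightarrow> t>0 \<Longrightarrow> y + t *\<^sub>R b \<in> ball y0 (2 * R) \<Longrightarrow>
        U (y + t *\<^sub>R b) - U y \<le> t * \<sigma>) \<Longrightarrow> G y \<bullet> b \<le> \<sigma>"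
      using mollification[OF contU R(1) \<delta>0, of y0] by metis
    have G: "G y \<bullet> b \<le> \<sigma>" if y: "y \<in> ball y0 R" and b: "b \<noteq> 0" and K: "\<And>\<xi>. \<xi> \<in> K \<Longrightarrow> \<xi> \<bullet> b \<le> \<sigma>" for y b \<sigma>
    proof (rule fG(3)[OF y])
      fix y t assume h: "y \<in> ball y0 (2 * R)" "(t::real) > 0" "y + t *\<^sub>R b \<in> ball y0 (2 * R)"
      have sub2: "ball y0 (2 * R) \<subseteq> img c" using r R by (meson ball_subset_cball cball_subset_cball_iff order_trans subset_ball)
      have "(u \<circ> chart_inv c) (y + t *\<^sub>R b) - (u \<circ> chart_inv c) y \<le> t * \<sigma>"
        by (rule subsol_increment[OF sub c sub2 _ b h(2,1,3)]) (use inK K in blast)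
      then show "U (y + t *\<^sub>R b) - U y \<le> t * \<sigma>" using Ueq h by simp
    qed
    have "G y \<in> K" if y: "y \<in> ball y0 R" for y
    proof (rule ccontr)
      assume notin: "G y \<notin> K"
      show False
      proof (cases "K = {}")
        case True
        \<comment> \<open>Without admissible momenta every half-space bound holds vacuously, even
          one that G y violates.\<close>
        obtain b :: 'e where b: "b \<in> Basis" using nonempty_Basis by blast
        from G[OF y nonzero_Basis[OF b], of "G y \<bullet> b - 1"] True show False by simp
      next
        case False
        obtain a k where a: "a \<bullet> G y < k" "\<And>x. x \<in> K \<Longrightarrow> a \<bullet> x > k"
          using separating_hyperplane_closed_point[OF convK closedK notin] by blast
        have "- a \<noteq> 0" using a False by force
        from G[OF y this, of "-k"] a show False by (force simp: inner_commute)
      qed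
    qed
    moreover have "ball y0 R \<subseteq> ball y0 (2 * R)" using R by auto
    ultimately have "\<bar>f y - u (chart_inv c y)\<bar> \<le> \<delta> \<and> loc N c y (G y) \<le> \<epsilon>" if "y \<in> ball y0 R" for y
      using fG(2)[OF that] Ueq[of y] outK[of y "G y"] that by auto
    then show ?thesis using fG(1) by blast
  qed
  moreover have "cball y0 (2 * R) \<subseteq> img c" using r R by (meson subset_cball order_trans)
  ultimately show ?thesis using R by blast
qed

section \<open>Finite covers by chart balls\<close>

lemma finite_chart_cover:
  assumes r: "\<And>x. r x > 0"
  obtains X where "finite X" "\<forall>x'. \<exists>x\<in>X. x' \<in> fst (chart_at A x) \<and> snd (chart_at A x) x' \<in> ball (snd (chart_at A x) x) (r x)"
proof -
  define W where "W x = fst (chart_at A x) \<inter> snd (chart_at A x) -` ball (snd (chart_at A x) x) (r x)" for x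
  have op: "open (W x)" for x unfolding W_def
    by (intro continuous_open_preimage continuous_chart open_dom chart_at_in) simp
  have "x \<in> W x" for x using chart_at_in[of x] r[of x] by (simp add: W_def)
  then have cov: "UNIV \<subseteq> (\<Union>x\<in>UNIV. W x)" by blast
  obtain X where X: "finite X" "UNIV \<subseteq> (\<Union>x\<in>X. W x)"
    by (rule compactE_image[OF compact_M op cov])
  show ?thesis
  proof (rule that[OF X(1)], rule allI)
    fix x'
    obtain x where "x \<in> X" "x' \<in> W x" using X(2) by blast
    then show "\<exists>x\<in>X. x' \<in> fst (chart_at A x) \<and> snd (chart_at A x) x' \<in> ball (snd (chart_at A x) x) (r x)"
      by (auto simp: W_def)
  qed
qed

text \<open>The doubled balls leave room around the closed ones, so that Lipschitz estimates hold up
  to their boundaries.\<close>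

lemma cover_exists:
  "\<exists>n ch ctr rad. (\<forall>i<(n::nat). ch i \<in> A \<and> rad i > 0 \<and> cball (ctr i) (2 * rad i) \<subseteq> img (ch i)) \<and>
     (\<forall>x. \<exists>i<n. x \<in> chart_inv (ch i) ` ball (ctr i) (rad i))"
proof -
  have "\<forall>x. \<exists>r>0. cball (snd (chart_at A x) x) (2 * r) \<subseteq> img (chart_at A x)"
  proof
    fix x
    obtain r where "r > 0" "cball (snd (chart_at A x) x) r \<subseteq> img (chart_at A x)" using chart_ball[OF chart_at_in] .
    then show "\<exists>r>0. cball (snd (chart_at A x) x) (2 * r) \<subseteq> img (chart_at A x)"
      by (intro exI[of _ "r / 2"]) simp
  qed
  from choice[OF this] obtain r where r: "\<And>x. r x > 0" "\<And>x. cball (snd (chart_at A x) x) (2 * r x) \<subseteq> img (chart_at A x)"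
    by blast
  obtain X where X: "finite X" "\<forall>x'. \<exists>x\<in>X. x' \<in> fst (chart_at A x) \<and> snd (chart_at A x) x' \<in> ball (snd (chart_at A x) x) (r x)"
    using finite_chart_cover[where r=r, OF r(1)] .
  obtain h where h: "bij_betw h {0..<card X} X" using ex_bij_betw_nat_finite[OF X(1)] by blast
  have "\<exists>i<card X. x' \<in> chart_inv (chart_at A (h i)) ` ball (snd (chart_at A (h i)) (h i)) (r (h i))" for x'
  proof -
    obtain x where x: "x \<in> X" "x' \<in> fst (chart_at A x)" "snd (chart_at A x) x' \<in> ball (snd (chart_at A x) x) (r x)"
      using X(2) by blast
    obtain i where "i < card X" "h i = x" using x(1) h by (force simp: bij_betw_def)
    moreover have "x' = chart_inv (chart_at A x) (snd (chart_at A x) x')" using x chart_at_in(1) by simp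
    ultimately show ?thesis using x(3) by blast
  qed
  then show ?thesis using r
    by (intro exI[of _ "card X"] exI[of _ "\<lambda>i. chart_at A (h i)"] exI[of _ "\<lambda>i. snd (chart_at A (h i)) (h i)"] exI[of _ "\<lambda>i. r (h i)"])
      (auto simp: chart_at_in)
qed

end

locale covered_manifold = closed_manifold A g
  for A :: "('m::t2_space, 'e::euclidean_space) chart set" and g :: "'m \<Rightarrow> 'e \<Rightarrow> 'e \<Rightarrow> real" +
  fixes n :: nat and ch :: "nat \<Rightarrow> ('m, 'e) chart" and ctr :: "nat \<Rightarrow> 'e" and rad :: "nat \<Rightarrow> real"
  assumes cover: "\<And>i. i < n \<Longrightarrow> ch i \<in> A" "\<And>i. i < n \<Longrightarrow> rad i > 0"
      "\<And>i. i < n \<Longrightarrow> cball (ctr i) (2 * rad i) \<subseteq> img (ch i)"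
    and covers: "\<And>x. \<exists>i<n. x \<in> chart_inv (ch i) ` ball (ctr i) (rad i)"
begin

text \<open>The disjoint union of the chart balls, realised as a compact subset of \<^typ>\<open>real \<times> 'e\<close>:
  over it both bundles become trivial.\<close>

definition base :: "(real \<times> 'e) set" where "base = (\<Union>i<n. {real i} \<times> cball (ctr i) (rad i))"
definition idx :: "real \<times> 'e \<Rightarrow> nat" where "idx z = nat \<lfloor>fst z\<rfloor>"
definition bch :: "real \<times> 'e \<Rightarrow> ('m, 'e) chart" where "bch z = ch (idx z)"
definition pt :: "real \<times> 'e \<Rightarrow> 'm" where "pt z = chart_inv (bch z) (snd z)"
definition bcov :: "real \<times> 'e \<Rightarrow> 'e \<Rightarrow> ('e \<Rightarrow>\<^sub>L real)" where "bcov z = cov (bch z) (pt z)"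
definition btv :: "real \<times> 'e \<Rightarrow> 'e \<Rightarrow> 'e" where "btv z = tvec (bch z) (pt z)"
definition bgrad :: "('m \<Rightarrow> real) \<Rightarrow> real \<times> 'e \<Rightarrow> 'e" where "bgrad f z = grad (f \<circ> chart_inv (bch z)) (snd z)"

lemma baseD: assumes "z \<in> base"
  shows "idx z < n" "snd z \<in> cball (ctr (idx z)) (rad (idx z))" "fst z = real (idx z)"
    "bch z \<in> A" "snd z \<in> img (bch z)" "pt z \<in> fst (bch z)" "snd (bch z) (pt z) = snd z"
proof -
  obtain i where i: "i < n" "z \<in> {real i} \<times> cball (ctr i) (rad i)" using assms by (auto simp: base_def)
  then have id: "idx z = i" by (auto simp: idx_def)
  then show 1: "idx z < n" and 2: "snd z \<in> cball (ctr (idx z)) (rad (idx z))" and "fst z = real (idx z)"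
    using i by auto
  show 3: "bch z \<in> A" using cover(1)[OF 1] by (simp add: bch_def)
  have "snd z \<in> cball (ctr (idx z)) (2 * rad (idx z))" using 2 cover(2)[OF 1] by auto
  then show 4: "snd z \<in> img (bch z)" using cover(3)[OF 1] by (auto simp: bch_def)
  show "pt z \<in> fst (bch z)" "snd (bch z) (pt z) = snd z" using 3 4 by (auto simp: pt_def chart_inv_in)
qed

lemma compact_base: "compact base" unfolding base_def by (intro compact_UN compact_Times) auto

lemma pt_surj: obtains z where "z \<in> base" "pt z = x"
proof -
  obtain i y where "i < n" "y \<in> ball (ctr i) (rad i)" "x = chart_inv (ch i) y" using covers by blast
  then show ?thesis by (intro that[of "(real i, y)"]) (auto simp: base_def pt_def bch_def idx_def)
qed

lemma base_nonempty: "base \<noteq> {}" using pt_surj by blast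

lemma continuous_on_base:
  assumes "\<And>i. i < n \<Longrightarrow> continuous_on (cball (ctr i) (rad i) \<times> B) (\<lambda>(y, b). F i y b)" and "closed B"
  shows "continuous_on (base \<times> B) (\<lambda>(z, b). F (idx z) (snd z) b)"
proof -
  have eq: "base \<times> B = (\<Union>i\<in>{..<n}. ({real i} \<times> cball (ctr i) (rad i)) \<times> B)" by (auto simp: base_def)
  show ?thesis unfolding eq
  proof (rule continuous_on_closed_Union)
    fix i assume "i \<in> {..<n}"
    then have "continuous_on (cball (ctr i) (rad i) \<times> B) (\<lambda>(y, b). F i y b)" using assms by auto
    then have "continuous_on (({real i} \<times> cball (ctr i) (rad i)) \<times> B) ((\<lambda>(y, b). F i y b) \<circ> (\<lambda>(z, b). (snd z, b)))"
      by (intro continuous_on_compose) (auto simp: split_beta intro!: continuous_intros elim!: continuous_on_subset)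
    then show "continuous_on (({real i} \<times> cball (ctr i) (rad i)) \<times> B) (\<lambda>(z, b). F (idx z) (snd z) b)"
      by (rule continuous_on_eq) (auto simp: idx_def)
  qed (auto intro!: closed_Times assms)
qed

lemma continuous_on_base1:
  assumes "\<And>i. i < n \<Longrightarrow> continuous_on (cball (ctr i) (rad i)) (F i)"
  shows "continuous_on base (\<lambda>z. F (idx z) (snd z))"
proof -
  have "continuous_on (base \<times> UNIV) (\<lambda>(z, b::real). F (idx z) (snd z))"
    using assms by (intro continuous_on_base) (auto simp: split_beta intro!: continuous_on_compose2[OF assms] continuous_intros)
  moreover have "continuous_on base (\<lambda>z. (z, 0::real))" by (intro continuous_intros)
  ultimately have "continuous_on base (\<lambda>z. case (z, 0::real) of (z, b) \<Rightarrow> F (idx z) (snd z))"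
    by (rule continuous_on_compose2) auto
  then show ?thesis by simp
qed

lemma cball_img: assumes "i < n" shows "cball (ctr i) (rad i) \<subseteq> img (ch i)"
proof -
  have "cball (ctr i) (rad i) \<subseteq> cball (ctr i) (2 * rad i)" using cover(2)[OF assms] by auto
  then show ?thesis using cover(3)[OF assms] by blast
qed

lemma continuous_pt: assumes "continuous_on UNIV u" shows "continuous_on base (\<lambda>z. u (pt z))"
proof -
  have "continuous_on base (\<lambda>z. (u \<circ> chart_inv (ch (idx z))) (snd z))"
    by (rule continuous_on_base1, rule continuous_on_subset[OF continuous_on_chart[OF assms cover(1)] cball_img])
  then show ?thesis by (simp add: pt_def bch_def)
qed

lemma continuous_bgrad: assumes "C1_fun A f" shows "continuous_on base (bgrad f)"
  unfolding bgrad_def[abs_def] bch_def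
proof (rule continuous_on_base1[of "\<lambda>i. grad (f \<circ> chart_inv (ch i))"])
  fix i assume i: "i < n"
  show "continuous_on (cball (ctr i) (rad i)) (grad (f \<circ> chart_inv (ch i)))"
    using C1_fun_grad[OF assms cover(1)[OF i]] continuous_on_subset[OF _ cball_img[OF i]] by (auto simp: grad_on_def)
qed

lemma differential_pt: assumes "C1_fun A f" "z \<in> base" shows "differential A f (pt z) = bcov z (bgrad f z)"
  using differential_cov[OF assms(1) baseD(4,6)[OF assms(2)]] baseD(7)[OF assms(2)] by (simp add: bcov_def bgrad_def)

lemma bcov_lin: assumes "z \<in> base"
  shows "bcov z (\<xi> + \<zeta>) = bcov z \<xi> + bcov z \<zeta>" "bcov z (a *\<^sub>R \<xi>) = a *\<^sub>R bcov z \<xi>"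
    "bcov z (\<Sum>i\<in>I. \<eta> i) = (\<Sum>i\<in>I. bcov z (\<eta> i))"
  using baseD(4,6)[OF assms] by (simp_all add: bcov_def cov_add cov_scale cov_sum)

lemma bcov_btv: assumes "z \<in> base" shows "blinfun_apply (bcov z \<xi>) (btv z w) = \<xi> \<bullet> w"
  using baseD(4,6)[OF assms] by (simp add: bcov_def btv_def cov_tvec)

lemma bcov_surj: assumes "z \<in> base" obtains \<xi> where "p = bcov z \<xi>"
  using cov_surj[OF baseD(4,6)[OF assms]] by (metis bcov_def)

lemma btv_surj: assumes "z \<in> base" obtains w where "v = btv z w"
  using tvec_surj[OF baseD(4,6)[OF assms]] by (metis btv_def)

lemma continuous_bN: assumes "coercive_hamiltonian N"
  shows "continuous_on (base \<times> UNIV) (\<lambda>(z, \<xi>). N (pt z) (bcov z \<xi>))"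
proof -
  have "continuous_on (base \<times> UNIV) (\<lambda>(z, \<xi>). loc N (ch (idx z)) (snd z) \<xi>)"
    by (rule continuous_on_base, rule continuous_on_subset[OF coercive_hamiltonianD(1)[OF assms cover(1)]])
      (use cball_img in auto)
  then show ?thesis by (simp add: pt_def bch_def bcov_def)
qed

lemma bounded_bN: assumes "coercive_hamiltonian N"
  shows "\<exists>P>0. \<forall>z\<in>base. \<forall>\<xi>. N (pt z) (bcov z \<xi>) \<le> C \<longrightarrow> norm \<xi> \<le> P"
proof -
  have "bounded (\<Union>i<n. {\<xi>. \<exists>y\<in>cball (ctr i) (rad i). loc N (ch i) y \<xi> \<le> C})"
    by (intro bounded_UN ballI coercive_hamiltonianD(3)[OF assms]) (use cover cball_img in auto)
  then obtain P where P: "P > 0" "\<And>\<xi>. \<xi> \<in> (\<Union>i<n. {\<xi>. \<exists>y\<in>cball (ctr i) (rad i). loc N (ch i) y \<xi> \<le> C}) \<Longrightarrow> norm \<xi> \<le> P"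
    unfolding bounded_pos by blast
  have "norm \<xi> \<le> P" if "z \<in> base" "N (pt z) (bcov z \<xi>) \<le> C" for z \<xi>
    using that(2) baseD(1,2)[OF that(1)] by (intro P(2)) (auto simp: pt_def bch_def bcov_def intro!: bexI[of _ "idx z"] bexI[of _ "snd z"])
  with P show ?thesis by blast
qed

text \<open>In the differential of the glued function F the local gradients carry the weights of a
  partition of unity, and the cut-off gradients carry the differences of the local functions with F.
  Convexity of N bounds the first part by \<epsilon>/2; the differences are at most 2\<delta>, so
  the second part is a small shift of the momentum.\<close>

lemma subsol_smoothing:
  assumes nice: "coercive_hamiltonian N" and sub: "subsol N u" and e: "\<epsilon> > 0"
  shows "\<exists>f. C1_fun A f \<and> (\<forall>x. \<bar>f x - u x\<bar> \<le> \<epsilon>) \<and> (\<forall>x. N x (differential A f x) \<le> \<epsilon>)"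
proof -
  let ?k = "chart_at A"
  let ?y = "\<lambda>x. snd (chart_at A x) x"
  have "\<forall>x. \<exists>R>0. cball (?y x) (2 * R) \<subseteq> img (?k x) \<and> (\<forall>\<delta>>0. \<exists>f G. grad_on (ball (?y x) (2 * R)) f G \<and>
     (\<forall>y\<in>ball (?y x) R. \<bar>f y - u (chart_inv (?k x) y)\<bar> \<le> \<delta> \<and> loc N (?k x) y (G y) \<le> \<epsilon> / 2))"
    using chart_at_in e by (intro allI subsol_local_smoothing[OF nice sub]) auto
  from choice[OF this] obtain R where R: "\<And>x. R x > 0" "\<And>x. cball (?y x) (2 * R x) \<subseteq> img (?k x)"
    and loc0: "\<And>x \<delta>. \<delta> > 0 \<Longrightarrow> \<exists>f G. grad_on (ball (?y x) (2 * R x)) f G \<and>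
     (\<forall>y\<in>ball (?y x) (R x). \<bar>f y - u (chart_inv (?k x) y)\<bar> \<le> \<delta> \<and> loc N (?k x) y (G y) \<le> \<epsilon> / 2)"
    by blast
  have Rc: "cball (?y x) (R x) \<subseteq> img (?k x)" for x
    using R(2)[of x] R(1)[of x] subset_cball[of "R x" "2 * R x" "?y x"] by auto
  obtain X where X: "finite X" "\<forall>x'. \<exists>x\<in>X. x' \<in> fst (?k x) \<and> snd (?k x) x' \<in> ball (?y x) (R x)"
    using finite_chart_cover[where r=R, OF R(1)] .
  define \<beta> where "\<beta> x = ext_fun (?k x) (bump (?y x) (R x))" for x
  have \<beta>C1: "C1_fun A (\<beta> x)" for x unfolding \<beta>_def by (intro C1_bump chart_at_in R Rc)
  have \<beta>0: "\<beta> x x' \<ge> 0" for x x' by (simp add: \<beta>_def ext_fun_def bump_nonneg)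
  have \<beta>pos: "\<beta> x x' > 0 \<longleftrightarrow> x' \<in> fst (?k x) \<and> snd (?k x) x' \<in> ball (?y x) (R x)" for x x'
    using bump_pos_iff[OF R(1)] by (auto simp: \<beta>_def ext_fun_def)
  define B where "B x' = (\<Sum>x\<in>X. \<beta> x x')" for x'
  have BC1: "C1_fun A B" unfolding B_def by (intro C1_sum \<beta>C1)
  have Bpos: "B x' > 0" for x'
  proof -
    obtain x where "x \<in> X" "\<beta> x x' > 0" using X(2) \<beta>pos by blast
    then show ?thesis unfolding B_def by (intro sum_pos2[OF X(1)] \<beta>0)
  qed
  obtain Bm where Bm: "Bm > 0" "\<And>x. B x \<ge> Bm"
    using continuous_attains_inf[OF compact_M _ C1_continuous[OF BC1]] Bpos by auto
  obtain P where P: "P > 0" "\<And>z \<xi>. z \<in> base \<Longrightarrow> N (pt z) (bcov z \<xi>) \<le> \<epsilon> / 2 \<Longrightarrow> norm \<xi> \<le> P"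
    using bounded_bN[OF nice] by blast
  \<comment> \<open>The extra unit in the radius leaves room for the shift of the momentum caused by
    the cut-offs.\<close>
  have "uniformly_continuous_on (base \<times> cball 0 (P + 1)) (\<lambda>(z, \<xi>). N (pt z) (bcov z \<xi>))"
    by (intro compact_uniformly_continuous compact_Times compact_cball compact_base continuous_on_subset[OF continuous_bN[OF nice]]) auto
  then obtain d where d: "d > 0" "\<And>z \<xi> z' \<xi>'. z \<in> base \<Longrightarrow> norm \<xi> \<le> P + 1 \<Longrightarrow> z' \<in> base \<Longrightarrow> norm \<xi>' \<le> P + 1 \<Longrightarrow>
      dist (z', \<xi>') (z, \<xi>) < d \<Longrightarrow> \<bar>N (pt z') (bcov z' \<xi>') - N (pt z) (bcov z \<xi>)\<bar> < \<epsilon> / 2"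
    using e unfolding uniformly_continuous_on_def by (force simp: dist_real_def dest: spec[of _ "\<epsilon> / 2"])
  have "\<exists>\<Gamma>. \<forall>z\<in>base. norm (bgrad (\<beta> x) z) \<le> \<Gamma>" for x
    using compact_imp_bounded[OF compact_continuous_image[OF continuous_bgrad[OF \<beta>C1[of x]] compact_base]]
    unfolding bounded_iff by blast
  then obtain \<Gamma> where \<Gamma>: "\<And>x z. z \<in> base \<Longrightarrow> norm (bgrad (\<beta> x) z) \<le> \<Gamma> x" by metis
  have \<Gamma>0: "\<Gamma> x \<ge> 0" for x using \<Gamma>[of _ x] base_nonempty by (meson all_not_in_conv norm_ge_zero order_trans)
  define S where "S = (\<Sum>x\<in>X. \<Gamma> x)"
  have S0: "S \<ge> 0" unfolding S_def by (intro sum_nonneg \<Gamma>0)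
  \<comment> \<open>Chosen so that the total shift 2\<delta>/Bm * S of the momentum stays below both
    d and 1.\<close>
  define \<delta> where "\<delta> = min \<epsilon> (Bm * min d 1 / (4 * (S + 1)))"
  have \<delta>: "\<delta> > 0" "\<delta> \<le> \<epsilon>" using e Bm d S0 by (auto simp: \<delta>_def)
  have \<delta>S: "2 * \<delta> / Bm * S < min d 1"
  proof -
    have "\<delta> \<le> Bm * min d 1 / (4 * (S + 1))" by (simp add: \<delta>_def)
    then have "2 * \<delta> / Bm * S \<le> 2 * (Bm * min d 1 / (4 * (S + 1))) / Bm * S"
      using Bm S0 by (intro mult_right_mono divide_right_mono mult_left_mono) auto
    also have "\<dots> = min d 1 * (S / (2 * (S + 1)))" using Bm(1) S0 by (auto simp: divide_simps)
    also have "\<dots> < min d 1 * 1" using S0 d by (intro mult_strict_left_mono) (auto simp: field_simps)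
    finally show ?thesis by simp
  qed
  have "\<forall>x. \<exists>f G. grad_on (ball (?y x) (2 * R x)) f G \<and>
     (\<forall>y\<in>ball (?y x) (R x). \<bar>f y - u (chart_inv (?k x) y)\<bar> \<le> \<delta> \<and> loc N (?k x) y (G y) \<le> \<epsilon> / 2)"
    using loc0[OF \<delta>(1)] by blast
  from choice[OF this] obtain f where "\<forall>x. \<exists>G. grad_on (ball (?y x) (2 * R x)) (f x) G \<and>
     (\<forall>y\<in>ball (?y x) (R x). \<bar>f x y - u (chart_inv (?k x) y)\<bar> \<le> \<delta> \<and> loc N (?k x) y (G y) \<le> \<epsilon> / 2)"
    by blast
  from choice[OF this] obtain G where fG: "\<And>x. grad_on (ball (?y x) (2 * R x)) (f x) (G x)"
     "\<And>x y. y\<in>ball (?y x) (R x) \<Longrightarrow> \<bar>f x y - u (chart_inv (?k x) y)\<bar> \<le> \<delta>"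
     "\<And>x y. y\<in>ball (?y x) (R x) \<Longrightarrow> loc N (?k x) y (G x y) \<le> \<epsilon> / 2"
    by blast
  define \<psi> where "\<psi> x y = bump (?y x) (R x) y * f x y" for x y
  define G' where "G' x y = bump (?y x) (R x) y *\<^sub>R G x y + f x y *\<^sub>R bump_grad (?y x) (R x) y" for x y
  have df: "(f x has_derivative (\<lambda>v. G x y \<bullet> v)) (at y)" if "y \<in> ball (?y x) (2 * R x)" for x y
    using fG(1)[of x] that by (auto simp: grad_on_def)
  have d\<psi>: "(\<psi> x has_derivative (\<lambda>v. G' x y \<bullet> v)) (at y)" if "y \<in> ball (?y x) (2 * R x)" for x y
    using has_derivative_mult[OF has_derivative_bump df[OF that], of "?y x" "R x"]
    unfolding \<psi>_def[abs_def] by (rule has_derivative_eq_rhs) (auto simp: G'_def inner_add_left fun_eq_iff)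
  have g\<psi>: "grad_on (ball (?y x) (2 * R x)) (\<psi> x) (G' x)" for x
  proof -
    have cf: "continuous_on (ball (?y x) (2 * R x)) (f x)"
      using df by (meson has_derivative_at_withinI has_derivative_continuous_on)
    have "continuous_on (ball (?y x) (2 * R x)) (G' x)" unfolding G'_def
      using fG(1)[of x] by (intro continuous_on_add continuous_on_scaleR continuous_bump continuous_bump_grad cf) (auto simp: grad_on_def)
    then show ?thesis using d\<psi> by (simp add: grad_on_def)
  qed
  define Q where "Q x = ext_fun (?k x) (\<psi> x)" for x
  have QC1: "C1_fun A (Q x)" for x unfolding Q_def
    by (rule C1_ext_fun[OF chart_at_in(1) open_ball _ g\<psi> compact_cball[of "?y x" "R x"]])
      (use R(2)[of x] R(1)[of x] in \<open>auto simp: \<psi>_def intro!: bump_outside(1)\<close>)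
  obtain Mu where Mu: "\<And>x. \<bar>u x\<bar> \<le> Mu" using bounded_on_M[of u] sub by (auto simp: subsol_def)
  have Qval: "Q x x' = \<beta> x x' * f x (snd (?k x) x')" for x x'
    by (simp add: Q_def \<beta>_def ext_fun_def \<psi>_def)
  have fbd: "\<bar>f x (snd (?k x) x') - u x'\<bar> \<le> \<delta>" if "\<beta> x x' > 0" for x x'
    using fG(2)[of "snd (?k x) x'" x] that \<beta>pos[of x x'] chart_at_in(1) by simp
  \<comment> \<open>A zero of \<beta> is a minimum of \<beta>, and there Q touches a multiple of
    \<beta> from below, so both differentials vanish. This disposes of the pieces on whose gradients
    nothing is known at x'.\<close>
  have dz: "differential A (\<beta> x) x' = 0" "differential A (Q x) x' = 0" if "\<not> \<beta> x x' > 0" for x x'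
  proof -
    have b0: "\<beta> x x' = 0" using that \<beta>0[of x x'] by linarith
    have "differential A (\<lambda>_. 0) x' = differential A (\<beta> x) x'"
      by (rule differential_at_max[OF C1_const \<beta>C1]) (simp add: b0 \<beta>0)
    then show 1: "differential A (\<beta> x) x' = 0" by (simp add: differential_const)
    have "differential A (Q x) x' = differential A (\<lambda>x'. (Mu + \<delta>) * \<beta> x x') x'"
    proof (rule differential_at_max[OF QC1 C1_cmult[OF \<beta>C1]])
      fix x''
      have "Q x x'' \<le> (Mu + \<delta>) * \<beta> x x''"
      proof (cases "\<beta> x x'' > 0")
        case True
        have "f x (snd (?k x) x'') \<le> Mu + \<delta>" using fbd[OF True] Mu[of x''] by linarith
        from mult_left_mono[OF this \<beta>0[of x x'']] show ?thesis by (simp add: Qval mult.commute)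
      next
        case False
        then have "\<beta> x x'' = 0" using \<beta>0[of x x''] by linarith
        then show ?thesis by (simp add: Qval)
      qed
      then show "Q x x'' - (Mu + \<delta>) * \<beta> x x'' \<le> Q x x' - (Mu + \<delta>) * \<beta> x x'" by (simp add: Qval b0)
    qed
    then show "differential A (Q x) x' = 0" using 1 by (simp add: differential_cmult \<beta>C1)
  qed
  define F where "F x' = (\<Sum>x\<in>X. Q x x') / B x'" for x'
  have FC1: "C1_fun A F" unfolding F_def by (intro C1_divide C1_sum QC1 BC1) (metis Bpos less_irrefl)
  have Fu: "\<bar>F x' - u x'\<bar> \<le> \<delta>" for x'
  proof -
    have "F x' - u x' = (\<Sum>x\<in>X. \<beta> x x' * (f x (snd (?k x) x') - u x')) / B x'"
      using Bpos[of x'] by (simp add: F_def Qval right_diff_distrib sum_subtractf sum_distrib_right[symmetric] B_def[symmetric] diff_divide_distrib)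
    moreover have "\<bar>\<Sum>x\<in>X. \<beta> x x' * (f x (snd (?k x) x') - u x')\<bar> \<le> (\<Sum>x\<in>X. \<beta> x x' * \<delta>)"
    proof (rule order_trans[OF sum_abs sum_mono])
      fix x show "\<bar>\<beta> x x' * (f x (snd (?k x) x') - u x')\<bar> \<le> \<beta> x x' * \<delta>"
        using fbd[of x x'] \<beta>0[of x x'] by (cases "\<beta> x x' > 0") (auto simp: abs_mult)
    qed
    moreover have "(\<Sum>x\<in>X. \<beta> x x' * \<delta>) = \<delta> * B x'" by (simp add: B_def sum_distrib_left mult.commute)
    ultimately show ?thesis using Bpos[of x'] by (simp add: abs_divide divide_le_eq)
  qed
  have "N x' (differential A F x') \<le> \<epsilon>" for x'
  proof -
    obtain z where z: "z \<in> base" "pt z = x'" using pt_surj by blast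
    define X' where "X' = {x\<in>X. \<beta> x x' > 0}"
    have finX': "finite X'" and X'X: "X' \<subseteq> X" using X by (auto simp: X'_def)
    define yy where "yy x = snd (?k x) x'" for x
    define p where "p x = cov (?k x) x' (G x (yy x))" for x
    have inX: "x' \<in> fst (?k x)" "yy x \<in> ball (?y x) (R x)" if "x \<in> X'" for x
      using that \<beta>pos by (auto simp: X'_def yy_def)
    have Np: "N x' (p x) \<le> \<epsilon> / 2" if "x \<in> X'" for x
      using fG(3)[OF inX(2)[OF that]] inX(1)[OF that] chart_at_in(1) by (simp add: p_def yy_def)
    have dQ: "differential A (Q x) x' = \<beta> x x' *\<^sub>R p x + f x (yy x) *\<^sub>R differential A (\<beta> x) x'" if "x \<in> X'" for x
    proof -
      have k: "?k x \<in> A" "x' \<in> fst (?k x)" using chart_at_in inX(1)[OF that] by auto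
      have y2: "snd (?k x) x' \<in> ball (?y x) (2 * R x)" using inX(2)[OF that] R(1)[of x] by (auto simp: yy_def)
      have "differential A (Q x) x' = cov (?k x) x' (G' x (yy x))"
        unfolding Q_def yy_def by (rule differential_ext_fun[OF k d\<psi>[OF y2]])
      moreover have "differential A (\<beta> x) x' = cov (?k x) x' (bump_grad (?y x) (R x) (yy x))"
        unfolding \<beta>_def yy_def by (rule differential_ext_fun[OF k has_derivative_bump])
      moreover have "\<beta> x x' = bump (?y x) (R x) (yy x)" using k by (simp add: \<beta>_def ext_fun_def yy_def)
      ultimately show ?thesis using k by (simp add: G'_def cov_add cov_scale p_def)
    qed
    \<comment> \<open>F is differentiated through the product of F and B, which is the sum of the
      Q's; this yields the differences with F directly.\<close>
    have "differential A (\<lambda>x'. F x' * B x') x' = differential A (\<lambda>x'. \<Sum>x\<in>X. Q x x') x'"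
      using Bpos by (simp add: F_def less_imp_neq[THEN not_sym])
    then have eq1: "F x' *\<^sub>R differential A B x' + B x' *\<^sub>R differential A F x' = (\<Sum>x\<in>X. differential A (Q x) x')"
      by (simp add: differential_mult[OF FC1 BC1] differential_sum QC1)
    have sX: "(\<Sum>x\<in>X. differential A (Q x) x') = (\<Sum>x\<in>X'. differential A (Q x) x')"
      by (rule sum.mono_neutral_right[OF X(1) X'X]) (use dz(2) in \<open>auto simp: X'_def\<close>)
    have "differential A B x' = (\<Sum>x\<in>X. differential A (\<beta> x) x')" unfolding B_def by (simp add: differential_sum \<beta>C1)
    also have "\<dots> = (\<Sum>x\<in>X'. differential A (\<beta> x) x')"
      by (rule sum.mono_neutral_right[OF X(1) X'X]) (use dz(1) in \<open>auto simp: X'_def\<close>)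
    finally have sB: "differential A B x' = (\<Sum>x\<in>X'. differential A (\<beta> x) x')" .
    have BX': "B x' = (\<Sum>x\<in>X'. \<beta> x x')" unfolding B_def
      by (rule sum.mono_neutral_right[OF X(1) X'X]) (use \<beta>0 in \<open>auto simp: X'_def intro: antisym\<close>)
    define \<theta> where "\<theta> x = \<beta> x x' / B x'" for x
    define q where "q = (\<Sum>x\<in>X'. \<theta> x *\<^sub>R p x)"
    define e' where "e' x = (f x (yy x) - F x') / B x'" for x
    have "B x' *\<^sub>R differential A F x' = (\<Sum>x\<in>X'. \<beta> x x' *\<^sub>R p x + f x (yy x) *\<^sub>R differential A (\<beta> x) x') - F x' *\<^sub>R (\<Sum>x\<in>X'. differential A (\<beta> x) x')"
      using eq1 unfolding sX sB by (simp add: dQ algebra_simps)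
    also have "\<dots> = (\<Sum>x\<in>X'. \<beta> x x' *\<^sub>R p x + (f x (yy x) - F x') *\<^sub>R differential A (\<beta> x) x')"
      by (simp add: scaleR_right.sum scaleR_diff_left sum.distrib sum_subtractf)
    also have "\<dots> = B x' *\<^sub>R (q + (\<Sum>x\<in>X'. e' x *\<^sub>R differential A (\<beta> x) x'))"
      using Bpos[of x'] by (simp add: q_def \<theta>_def e'_def scaleR_right_distrib scaleR_right.sum sum.distrib)
    finally have dF: "differential A F x' = q + (\<Sum>x\<in>X'. e' x *\<^sub>R differential A (\<beta> x) x')"
      using Bpos[of x'] by simp
    have "(\<Sum>x\<in>X'. \<theta> x) = 1" using Bpos[of x'] by (simp add: \<theta>_def sum_divide_distrib[symmetric] BX'[symmetric])
    moreover have "X' \<noteq> {}" using X(2) \<beta>pos[of _ x'] unfolding X'_def by blast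
    moreover have th0: "\<theta> x \<ge> 0" for x using \<beta>0 Bpos by (simp add: \<theta>_def less_imp_le)
    ultimately have "N x' q \<le> (\<Sum>x\<in>X'. \<theta> x * N x' (p x))" unfolding q_def
      by (intro convex_on_sum[OF finX' _ coercive_hamiltonianD(2)[OF nice]]) auto
    also have "\<dots> \<le> (\<Sum>x\<in>X'. \<theta> x * (\<epsilon> / 2))" by (intro sum_mono mult_left_mono Np th0)
    also have "\<dots> = \<epsilon> / 2" using \<open>(\<Sum>x\<in>X'. \<theta> x) = 1\<close> by (simp only: sum_distrib_right[symmetric])
    finally have Nq: "N x' q \<le> \<epsilon> / 2" .
    obtain \<xi> where \<xi>: "q = bcov z \<xi>" using bcov_surj[OF z(1)] by blast
    define \<zeta> where "\<zeta> = (\<Sum>x\<in>X'. e' x *\<^sub>R bgrad (\<beta> x) z)"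
    have dF2: "differential A F x' = bcov z (\<xi> + \<zeta>)"
      unfolding dF \<xi> \<zeta>_def by (simp add: bcov_lin[OF z(1)] differential_pt[OF \<beta>C1 z(1), unfolded z(2)])
    have "norm \<zeta> \<le> (\<Sum>x\<in>X'. norm (e' x *\<^sub>R bgrad (\<beta> x) z))" unfolding \<zeta>_def by (rule norm_sum)
    also have "\<dots> \<le> (\<Sum>x\<in>X'. 2 * \<delta> / Bm * \<Gamma> x)"
    proof (rule sum_mono)
      fix x assume x: "x \<in> X'"
      have "\<bar>f x (yy x) - F x'\<bar> \<le> 2 * \<delta>" using fbd[of x x'] x Fu[of x'] unfolding X'_def yy_def by auto
      then have "\<bar>e' x\<bar> \<le> 2 * \<delta> / Bm" unfolding e'_def abs_divide using Bpos[of x'] Bm \<delta> by (intro frac_le) auto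
      then show "norm (e' x *\<^sub>R bgrad (\<beta> x) z) \<le> 2 * \<delta> / Bm * \<Gamma> x"
        unfolding norm_scaleR using \<Gamma>[OF z(1), of x] by (intro mult_mono) auto
    qed
    also have "\<dots> \<le> (\<Sum>x\<in>X. 2 * \<delta> / Bm * \<Gamma> x)"
      using \<delta> Bm \<Gamma>0 by (intro sum_mono2[OF X(1) X'X]) auto
    also have "\<dots> = 2 * \<delta> / Bm * S" by (simp add: S_def sum_distrib_left)
    finally have \<zeta>n: "norm \<zeta> < d" "norm \<zeta> \<le> 1" using \<delta>S by auto
    have xP: "norm \<xi> \<le> P" using P(2)[OF z(1)] Nq \<xi> z(2) by simp
    have "norm (\<xi> + \<zeta>) \<le> P + 1" using norm_triangle_ineq[of \<xi> \<zeta>] xP \<zeta>n by linarith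
    moreover have "dist (z, \<xi> + \<zeta>) (z, \<xi>) < d" using \<zeta>n by (simp add: dist_Pair_Pair dist_norm)
    ultimately have "\<bar>N (pt z) (bcov z (\<xi> + \<zeta>)) - N (pt z) (bcov z \<xi>)\<bar> < \<epsilon> / 2"
      using xP z(1) by (intro d(2)) auto
    then show ?thesis using Nq unfolding dF2 z(2) \<xi> by linarith
  qed
  then show ?thesis using FC1 Fu \<delta>(2) order_trans by blast
qed

end

section \<open>Compactness of families of subsolutions\<close>

context covered_manifold
begin

definition chart_lipschitz :: "real \<Rightarrow> ('m \<Rightarrow> real) \<Rightarrow> bool" where
  "chart_lipschitz P u \<longleftrightarrow> (\<forall>i<n. \<forall>y\<in>cball (ctr i) (rad i). \<forall>y'\<in>cball (ctr i) (rad i).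
     \<bar>u (chart_inv (ch i) y) - u (chart_inv (ch i) y')\<bar> \<le> P * norm (y - y'))"

text \<open>P is read off the zero sublevel sets of N over the doubled balls, so one constant serves
  all subsolutions of N.\<close>

lemma subsol_lipschitz:
  assumes nice: "coercive_hamiltonian N"
  shows "\<exists>P>0. \<forall>u. subsol N u \<longrightarrow> chart_lipschitz P u"
proof -
  have "bounded (\<Union>i<n. {\<xi>. \<exists>y\<in>cball (ctr i) (2 * rad i). loc N (ch i) y \<xi> \<le> 0})"
    by (intro bounded_UN ballI coercive_hamiltonianD(3)[OF assms]) (use cover in auto)
  then obtain P where P: "P > 0" "\<And>\<xi>. \<xi> \<in> (\<Union>i<n. {\<xi>. \<exists>y\<in>cball (ctr i) (2 * rad i). loc N (ch i) y \<xi> \<le> 0}) \<Longrightarrow> norm \<xi> \<le> P"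
    unfolding bounded_pos by blast
  have one: "u (chart_inv (ch i) y') - u (chart_inv (ch i) y) \<le> P * norm (y' - y)"
    if sub: "subsol N u" and i: "i < n" and y: "y \<in> cball (ctr i) (rad i)" "y' \<in> cball (ctr i) (rad i)" for u i y y'
  proof (cases "y = y'")
    case False
    have K: "\<xi> \<bullet> (y' - y) \<le> P * norm (y' - y)" if "x \<in> ball (ctr i) (2 * rad i)" "loc N (ch i) x \<xi> \<le> 0" for x \<xi>
    proof -
      have "x \<in> cball (ctr i) (2 * rad i)" using that(1) by auto
      then have "norm \<xi> \<le> P" using that(2) i by (intro P(2)) blast
      then show ?thesis using norm_cauchy_schwarz[of \<xi> "y' - y"] mult_right_mono[of "norm \<xi>" P "norm (y' - y)"] by simp
    qed
    have sub2: "ball (ctr i) (2 * rad i) \<subseteq> img (ch i)" using cover(3)[OF i] ball_subset_cball by blast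
    have y2: "y \<in> ball (ctr i) (2 * rad i)" "y + 1 *\<^sub>R (y' - y) \<in> ball (ctr i) (2 * rad i)"
      using y cover(2)[OF i] by auto
    show ?thesis
      using subsol_increment[OF sub cover(1)[OF i] sub2 K _ _ y2] False by simp
  qed simp
  have "chart_lipschitz P u" if "subsol N u" for u
    unfolding chart_lipschitz_def abs_le_iff
  proof (intro allI impI ballI conjI)
    fix i y y' assume h: "i < n" "y \<in> cball (ctr i) (rad i)" "y' \<in> cball (ctr i) (rad i)"
    show "u (chart_inv (ch i) y) - u (chart_inv (ch i) y') \<le> P * norm (y - y')"
      using one[OF that h(1,3,2)] by simp
    show "- (u (chart_inv (ch i) y) - u (chart_inv (ch i) y')) \<le> P * norm (y - y')"
      using one[OF that h] by (simp add: norm_minus_commute)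
  qed
  then show ?thesis using P by blast
qed

definition patch :: "nat \<Rightarrow> 'm set" where "patch i = chart_inv (ch i) ` ball (ctr i) (rad i)"

lemma ball_img: assumes "i < n" shows "ball (ctr i) (rad i) \<subseteq> img (ch i)"
  using cball_img[OF assms] ball_subset_cball by blast

lemma patch_eq: assumes "i < n" shows "patch i = fst (ch i) \<inter> snd (ch i) -` ball (ctr i) (rad i)"
proof -
  have *: "chart_inv (ch i) y \<in> fst (ch i)" "snd (ch i) (chart_inv (ch i) y) = y" if "y \<in> ball (ctr i) (rad i)" for y
    using ball_img[OF assms] that cover(1)[OF assms] by (auto simp: chart_inv_in subset_iff)
  show ?thesis unfolding patch_def using * cover(1)[OF assms]
    by (auto intro!: image_eqI[where x="snd (ch i) x" for x])
qed

lemma open_patch: assumes "i < n" shows "open (patch i)"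
  unfolding patch_eq[OF assms] by (intro continuous_open_preimage continuous_chart open_dom cover(1) assms open_ball)

lemma chart_lipschitz_patch: assumes "chart_lipschitz P u" "i < n" "x \<in> patch i" "x' \<in> patch i" "P \<ge> 0"
  shows "\<bar>u x - u x'\<bar> \<le> P * (2 * rad i)"
proof -
  obtain y y' where y: "x = chart_inv (ch i) y" "x' = chart_inv (ch i) y'" "y \<in> ball (ctr i) (rad i)" "y' \<in> ball (ctr i) (rad i)"
    using assms(3,4) by (auto simp: patch_def)
  have "\<bar>u x - u x'\<bar> \<le> P * norm (y - y')"
    using assms(1,2) y unfolding chart_lipschitz_def by auto
  also have "norm (y - y') \<le> 2 * rad i"
    using dist_triangle[of y y' "ctr i"] y(3,4) by (simp add: dist_norm norm_minus_commute)
  finally show ?thesis using assms(5) by (simp add: mult_left_mono)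
qed

lemma chart_lipschitz_continuous: assumes "chart_lipschitz P u" shows "continuous_on UNIV u"
proof (rule continuous_at_imp_continuous_on, rule ballI)
  fix x :: 'm
  obtain i where i: "i < n" "x \<in> patch i" using covers[of x] by (auto simp: patch_def)
  let ?B = "ball (ctr i) (rad i)"
  have "\<bar>P\<bar>-lipschitz_on ?B (u \<circ> chart_inv (ch i))"
  proof (rule lipschitz_onI)
    fix y y' assume h: "y \<in> ?B" "y' \<in> ?B"
    have "\<bar>u (chart_inv (ch i) y) - u (chart_inv (ch i) y')\<bar> \<le> P * norm (y - y')"
      using assms i(1) h unfolding chart_lipschitz_def by auto
    also have "\<dots> \<le> \<bar>P\<bar> * norm (y - y')" by (intro mult_right_mono) auto
    finally show "dist ((u \<circ> chart_inv (ch i)) y) ((u \<circ> chart_inv (ch i)) y') \<le> \<bar>P\<bar> * dist y y'"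
      by (simp add: dist_norm)
  qed simp
  then have "continuous_on ?B (u \<circ> chart_inv (ch i))" by (rule lipschitz_on_continuous_on)
  moreover have "snd (ch i) ` patch i \<subseteq> ?B" unfolding patch_eq[OF i(1)] by auto
  ultimately have "continuous_on (patch i) ((u \<circ> chart_inv (ch i)) \<circ> snd (ch i))"
    by (metis (no_types) continuous_on_compose continuous_on_subset continuous_chart[OF cover(1)[OF i(1)]] patch_eq[OF i(1)] Int_lower1)
  then have "continuous_on (patch i) u"
    by (rule continuous_on_eq) (use i cover(1) in \<open>auto simp: patch_eq\<close>)
  then show "isCont u x" using open_patch[OF i(1)] i(2) by (simp add: continuous_on_eq_continuous_at)
qed

text \<open>M carries no distance, so the bound is propagated through overlapping patches: the
  points where u - u(x0) is bounded uniformly in u form a set that is open with open complement, and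
  M is connected. Finitely many patches then make the bound uniform in x.\<close>

lemma chart_lipschitz_oscillation: assumes "P \<ge> 0"
  shows "\<exists>D>0. \<forall>u. chart_lipschitz P u \<longrightarrow> (\<forall>x y. \<bar>u x - u y\<bar> \<le> D)"
proof -
  fix x0 :: 'm
  define S where "S = {x. \<exists>D. \<forall>u. chart_lipschitz P u \<longrightarrow> \<bar>u x - u x0\<bar> \<le> D}"
  have step: "x' \<in> S" if "x \<in> S" "i < n" "x \<in> patch i" "x' \<in> patch i" for x x' i
  proof -
    obtain D where D: "\<And>u. chart_lipschitz P u \<Longrightarrow> \<bar>u x - u x0\<bar> \<le> D" using \<open>x \<in> S\<close> by (auto simp: S_def)
    have "\<bar>u x' - u x0\<bar> \<le> D + P * (2 * rad i)" if "chart_lipschitz P u" for u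
      using D[OF that] chart_lipschitz_patch[OF that \<open>i < n\<close> \<open>x \<in> patch i\<close> \<open>x' \<in> patch i\<close> assms] by linarith
    then show ?thesis by (auto simp: S_def)
  qed
  have pin: "\<exists>i<n. x \<in> patch i" for x using covers[of x] by (auto simp: patch_def)
  have "open S"
  proof (subst open_subopen, intro ballI)
    fix x assume x: "x \<in> S"
    obtain i where i: "i < n" "x \<in> patch i" using pin by blast
    show "\<exists>T. open T \<and> x \<in> T \<and> T \<subseteq> S" using open_patch[OF i(1)] i step[OF x i] by blast
  qed
  moreover have "open (- S)"
  proof (subst open_subopen, intro ballI)
    fix x assume x: "x \<in> - S"
    obtain i where i: "i < n" "x \<in> patch i" using pin by blast
    have "patch i \<subseteq> - S" using step[OF _ i(1) _ i(2)] x by blast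
    then show "\<exists>T. open T \<and> x \<in> T \<and> T \<subseteq> - S" using open_patch[OF i(1)] i by blast
  qed
  moreover have "x0 \<in> S" by (auto simp: S_def)
  ultimately have "S = UNIV"
    using connected_M[unfolded connected_clopen] by (auto simp: open_Compl closed_def)
  then have "\<forall>x. \<exists>D. \<forall>u. chart_lipschitz P u \<longrightarrow> \<bar>u x - u x0\<bar> \<le> D" by (auto simp: S_def)
  from choice[OF this] obtain D where D: "\<And>x u. chart_lipschitz P u \<Longrightarrow> \<bar>u x - u x0\<bar> \<le> D x" by blast
  define e where "e i = chart_inv (ch i) (ctr i)" for i
  define K where "K = (\<Sum>i<n. \<bar>D (e i)\<bar> + P * (2 * rad i))"
  have bd: "\<bar>u x - u x0\<bar> \<le> K" if u: "chart_lipschitz P u" for u x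
  proof -
    obtain i where i: "i < n" "x \<in> patch i" using pin by blast
    have "e i \<in> patch i" using cover(2)[OF i(1)] by (auto simp: e_def patch_def)
    from chart_lipschitz_patch[OF u i this assms] D[OF u, of "e i"]
    have "\<bar>u x - u x0\<bar> \<le> \<bar>D (e i)\<bar> + P * (2 * rad i)" by linarith
    also have "\<dots> \<le> K" unfolding K_def
      using i(1) assms cover(2) by (intro member_le_sum) (auto intro!: add_nonneg_nonneg mult_nonneg_nonneg simp: order.strict_implies_order)
    finally show ?thesis .
  qed
  show ?thesis
  proof (intro exI[of _ "2 * \<bar>K\<bar> + 1"] conjI allI impI)
    fix u x y assume "chart_lipschitz P u"
    from bd[OF this, of x] bd[OF this, of y] show "\<bar>u x - u y\<bar> \<le> 2 * \<bar>K\<bar> + 1" by linarith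
  qed simp
qed

text \<open>Arzela-Ascoli is applied on the compact metric space \<open>base\<close>, and the limit
  is carried back along a section of \<open>pt\<close>. The section may be discontinuous; continuity
  of the limit on M comes from uniform convergence.\<close>

lemma chart_lipschitz_compactness:
  fixes u :: "nat \<Rightarrow> 'm \<Rightarrow> real"
  assumes lip: "\<And>k. chart_lipschitz P (u k)" and bd: "\<And>k x. \<bar>u k x\<bar> \<le> B"
  shows "\<exists>r v. strict_mono (r :: nat \<Rightarrow> nat) \<and> continuous_on UNIV v \<and> uniform_limit UNIV (\<lambda>k. u (r k)) v sequentially"
proof -
  have equi: "\<exists>d. 0 < d \<and> (\<forall>k z'. z' \<in> base \<and> norm (z - z') < d \<longrightarrow> norm (u k (pt z) - u k (pt z')) < e)"
    if z: "z \<in> base" and e: "0 < e" for z e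
  proof (intro exI[of _ "min 1 (e / (\<bar>P\<bar> + 1))"] conjI allI impI)
    show "0 < min 1 (e / (\<bar>P\<bar> + 1))" using e by simp
    fix k z' assume h: "z' \<in> base \<and> norm (z - z') < min 1 (e / (\<bar>P\<bar> + 1))"
    then have z': "z' \<in> base" by simp
    have "norm (fst z - fst z') \<le> norm (z - z')" "norm (snd z - snd z') \<le> norm (z - z')"
      by (metis fst_diff norm_fst_le prod.collapse, metis snd_diff norm_snd_le prod.collapse)
    then have a: "\<bar>fst z - fst z'\<bar> < 1" and b: "norm (snd z - snd z') < e / (\<bar>P\<bar> + 1)" using h by auto
    \<comment> \<open>First coordinates are integers, so points less than 1 apart belong to the same
      ball.\<close>
    have id: "idx z = idx z'" using a baseD(3)[OF z] baseD(3)[OF z'] by auto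
    have "\<bar>u k (chart_inv (ch (idx z)) (snd z)) - u k (chart_inv (ch (idx z)) (snd z'))\<bar> \<le> P * norm (snd z - snd z')"
      using lip[of k] baseD(1,2)[OF z] baseD(2)[OF z'] id unfolding chart_lipschitz_def by auto
    also have "\<dots> \<le> (\<bar>P\<bar> + 1) * norm (snd z - snd z')" by (intro mult_right_mono) auto
    also have "\<dots> < e" using b by (simp add: pos_less_divide_eq mult.commute)
    finally show "norm (u k (pt z) - u k (pt z')) < e" by (simp add: pt_def bch_def id)
  qed
  obtain w r where wr: "continuous_on base w" "strict_mono (r :: nat \<Rightarrow> nat)"
    "\<And>e. 0 < e \<Longrightarrow> \<exists>N. \<forall>k z. k \<ge> N \<and> z \<in> base \<longrightarrow> norm (u (r k) (pt z) - w z) < e"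
    using Arzela_Ascoli[OF compact_base, of "\<lambda>k z. u k (pt z)" B] bd equi by (auto simp: real_norm_def)
  have "\<forall>x. \<exists>z. z \<in> base \<and> pt z = x" using pt_surj by blast
  from choice[OF this] obtain s where s: "\<And>x. s x \<in> base" "\<And>x. pt (s x) = x" by blast
  have ul: "uniform_limit UNIV (\<lambda>k. u (r k)) (\<lambda>x. w (s x)) sequentially"
    unfolding uniform_limit_iff eventually_sequentially
  proof (intro allI impI)
    fix e :: real assume "e > 0"
    from wr(3)[OF this] obtain N where N: "\<And>k z. k \<ge> N \<Longrightarrow> z \<in> base \<Longrightarrow> norm (u (r k) (pt z) - w z) < e" by blast
    show "\<exists>N. \<forall>k\<ge>N. \<forall>x\<in>UNIV. dist (u (r k) x) (w (s x)) < e"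
      using N[OF _ s(1)] s(2) by (auto simp: dist_norm intro!: exI[of _ N])
  qed
  have "continuous_on UNIV (\<lambda>x. w (s x))"
    by (rule uniform_limit_theorem[OF _ ul]) (auto intro!: always_eventually chart_lipschitz_continuous[OF lip])
  then show ?thesis using ul wr(2) by blast
qed

end

section \<open>Comparison and existence for viscosity solutions\<close>

text \<open>At one point y0 the growth on a large sphere is known; uniform continuity carries it to
  nearby y, and convexity along rays extends it beyond the sphere. Compactness of Y then removes the
  dependence on y0.\<close>

lemma uniform_superlinear:
  fixes F :: "'e::euclidean_space \<Rightarrow> 'e \<Rightarrow> real"
  assumes O: "open O'" and cont: "continuous_on (O' \<times> UNIV) (\<lambda>(y, \<xi>). F y \<xi>)"
    and conv: "\<And>y. y \<in> O' \<Longrightarrow> convex_on UNIV (F y)"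
    and sup: "\<And>y K. y \<in> O' \<Longrightarrow> \<exists>a. \<forall>\<xi>. norm \<xi> \<ge> a \<longrightarrow> F y \<xi> \<ge> K * norm \<xi>"
    and Y: "compact Y" "Y \<subseteq> O'" and R: "R \<ge> 0"
  shows "\<exists>C. \<forall>y\<in>Y. \<forall>\<xi>. F y \<xi> \<ge> R * norm \<xi> - C"
proof -
  have "\<forall>y0\<in>Y. \<exists>d>0. \<exists>C. \<forall>y\<in>ball y0 d. \<forall>\<xi>. F y \<xi> \<ge> R * norm \<xi> - C"
  proof
    fix y0 assume "y0 \<in> Y"
    then have y0: "y0 \<in> O'" using Y by auto
    obtain r where r: "r > 0" "cball y0 r \<subseteq> O'" using O y0 open_contains_cball by blast
    obtain a where a: "\<And>\<xi>. norm \<xi> \<ge> a \<Longrightarrow> F y0 \<xi> \<ge> (R + 2) * norm \<xi>" using sup[OF y0, of "R + 2"] by blast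
    \<comment> \<open>With these lower bounds on \<rho> the growth (R + 2)\<rho> on the sphere still
      leaves R\<rho> after subtracting F y0 0 and two continuity errors of 1/2.\<close>
    define \<rho> where "\<rho> = max (max a \<bar>F y0 0\<bar>) 1"
    have \<rho>: "\<rho> \<ge> a" "\<rho> \<ge> \<bar>F y0 0\<bar>" "\<rho> \<ge> 1" by (auto simp: \<rho>_def)
    have comp: "compact (cball y0 r \<times> cball (0::'e) \<rho>)" by (intro compact_Times) auto
    have cc: "continuous_on (cball y0 r \<times> cball 0 \<rho>) (\<lambda>(y, \<xi>). F y \<xi>)"
      by (rule continuous_on_subset[OF cont]) (use r in auto)
    have "uniformly_continuous_on (cball y0 r \<times> cball 0 \<rho>) (\<lambda>(y, \<xi>). F y \<xi>)"
      by (rule compact_uniformly_continuous[OF cc comp])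
    then obtain d where d: "d > 0" "\<And>y \<xi> y' \<xi>'. y \<in> cball y0 r \<Longrightarrow> norm \<xi> \<le> \<rho> \<Longrightarrow> y' \<in> cball y0 r \<Longrightarrow> norm \<xi>' \<le> \<rho> \<Longrightarrow>
        dist (y', \<xi>') (y, \<xi>) < d \<Longrightarrow> \<bar>F y' \<xi>' - F y \<xi>\<bar> < 1 / 2"
      unfolding uniformly_continuous_on_def by (force simp: dist_real_def dest: spec[of _ "1 / 2"])
    have "bounded ((\<lambda>(y, \<xi>). F y \<xi>) ` (cball y0 r \<times> cball 0 \<rho>))"
      by (intro compact_imp_bounded compact_continuous_image cc comp)
    then obtain B where B: "\<And>y \<xi>. y \<in> cball y0 r \<Longrightarrow> norm \<xi> \<le> \<rho> \<Longrightarrow> \<bar>F y \<xi>\<bar> \<le> B"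
      unfolding bounded_iff by (fastforce simp: image_iff)
    have "F y \<xi> \<ge> R * norm \<xi> - (B + R * \<rho>)" if y: "y \<in> ball y0 (min d r)" for y \<xi>
    proof (cases "norm \<xi> \<le> \<rho>")
      case True
      have "F y \<xi> \<ge> - B" using B[of y \<xi>] y True by (auto simp: abs_le_iff)
      moreover have "R * norm \<xi> \<le> R * \<rho>" using True R by (rule mult_left_mono)
      ultimately show ?thesis by linarith
    next
      case False
      have n0: "norm \<xi> > 0" "norm \<xi> > \<rho>" using False \<rho> by linarith+
      define t where "t = \<rho> / norm \<xi>"
      have t: "0 < t" "t \<le> 1" using n0 \<rho> by (auto simp: t_def divide_simps)
      have nt: "norm (t *\<^sub>R \<xi>) = \<rho>" using n0 \<rho> t by (simp add: t_def)
      have yr: "y \<in> cball y0 r" "y0 \<in> cball y0 r" using y r by auto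
      have 1: "\<bar>F y (t *\<^sub>R \<xi>) - F y0 (t *\<^sub>R \<xi>)\<bar> < 1 / 2"
        using y nt by (intro d(2)[OF yr(2) _ yr(1)]) (auto simp: dist_Pair_Pair dist_commute)
      have 2: "\<bar>F y 0 - F y0 0\<bar> < 1 / 2"
        using y \<rho> by (intro d(2)[OF yr(2) _ yr(1)]) (auto simp: dist_Pair_Pair dist_commute)
      have 3: "F y0 (t *\<^sub>R \<xi>) \<ge> (R + 2) * \<rho>" using a[of "t *\<^sub>R \<xi>"] nt \<rho>(1) by simp
      have 4: "F y (t *\<^sub>R \<xi>) - F y 0 \<ge> R * \<rho>" using 1 2 3 \<rho> unfolding distrib_right by linarith
      have "y \<in> O'" using r yr by blast
      from convex_onD[OF conv[OF this], of t 0 \<xi>] t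
      have 5: "F y (t *\<^sub>R \<xi>) \<le> (1 - t) * F y 0 + t * F y \<xi>" by simp
      have "R * \<rho> \<le> t * (F y \<xi> - F y 0)" using 4 5 by (simp add: algebra_simps)
      then have "R * \<rho> / t \<le> F y \<xi> - F y 0" using t by (simp add: divide_le_eq mult.commute)
      moreover have "R * \<rho> / t = R * norm \<xi>" using n0 \<rho> by (simp add: t_def)
      moreover have "F y 0 \<ge> - B" using B[OF yr(1), of 0] \<rho> by (auto simp: abs_le_iff)
      moreover have "R * \<rho> \<ge> 0" using R \<rho> by simp
      ultimately show ?thesis by linarith
    qed
    then show "\<exists>d>0. \<exists>C. \<forall>y\<in>ball y0 d. \<forall>\<xi>. F y \<xi> \<ge> R * norm \<xi> - C"
      using d(1) r(1) by (intro exI[of _ "min d r"] conjI exI[of _ "B + R * \<rho>"]) auto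
  qed
  from bchoice[OF this] obtain d where d: "\<forall>y0\<in>Y. d y0 > 0 \<and> (\<exists>C. \<forall>y\<in>ball y0 (d y0). \<forall>\<xi>. F y \<xi> \<ge> R * norm \<xi> - C)" by blast
  then have "\<forall>y0\<in>Y. \<exists>C. \<forall>y\<in>ball y0 (d y0). \<forall>\<xi>. F y \<xi> \<ge> R * norm \<xi> - C" by blast
  from bchoice[OF this] obtain C where C: "\<forall>y0\<in>Y. \<forall>y\<in>ball y0 (d y0). \<forall>\<xi>. F y \<xi> \<ge> R * norm \<xi> - C y0" by blast
  have cov: "Y \<subseteq> (\<Union>y0\<in>Y. ball y0 (d y0))" using d by force
  obtain X where X: "X \<subseteq> Y" "finite X" "Y \<subseteq> (\<Union>y0\<in>X. ball y0 (d y0))"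
    by (rule compactE_image[OF Y(1) _ cov]) auto
  show ?thesis
  proof (intro exI[of _ "\<Sum>x\<in>X. \<bar>C x\<bar>"] ballI allI)
    fix y \<xi> assume "y \<in> Y"
    then obtain y0 where y0: "y0 \<in> X" "y \<in> ball y0 (d y0)" using X by blast
    have "F y \<xi> \<ge> R * norm \<xi> - C y0" using C y0 X by blast
    moreover have "\<bar>C y0\<bar> \<le> (\<Sum>x\<in>X. \<bar>C x\<bar>)" using X y0 by (intro member_le_sum) auto
    ultimately show "F y \<xi> \<ge> R * norm \<xi> - (\<Sum>x\<in>X. \<bar>C x\<bar>)" by linarith
  qed
qed

lemma continuous_on_open_nbhd:
  fixes G :: "'a::topological_space \<Rightarrow> real \<Rightarrow> real"
  assumes "continuous_on UNIV (\<lambda>(x, z). G x z)" "open B" "G x0 z0 \<in> B"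
  shows "\<exists>W \<epsilon>. open W \<and> x0 \<in> W \<and> \<epsilon> > 0 \<and> (\<forall>x\<in>W. \<forall>z. \<bar>z - z0\<bar> < \<epsilon> \<longrightarrow> G x z \<in> B)"
proof -
  have "open ((\<lambda>(x, z). G x z) -` B)" using assms(1,2) by (simp add: continuous_on_open_vimage)
  then obtain W T where WT: "open W" "open T" "(x0, z0) \<in> W \<times> T" "W \<times> T \<subseteq> (\<lambda>(x, z). G x z) -` B"
    using assms(3) by (elim open_prod_elim[of _ "(x0, z0)"]) auto
  then obtain \<epsilon> where "\<epsilon> > 0" "ball z0 \<epsilon> \<subseteq> T" using open_contains_ball by blast
  then show ?thesis using WT by (intro exI[of _ W] exI[of _ \<epsilon>]) (auto simp: dist_real_def abs_minus_commute subset_iff)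
qed

context closed_manifold
begin

text \<open>The strict gap away from x0 absorbs an error \<eta>. Off x0 only an upper bound on w is
  required, which is what the members of a family with supremum u satisfy.\<close>

lemma strict_touching:
  assumes u: "continuous_on UNIV u" and \<Phi>: "continuous_on UNIV \<Phi>"
    and strict: "\<And>x. x \<noteq> x0 \<Longrightarrow> u x - \<Phi> x < u x0 - \<Phi> (x0 :: 'm)"
    and W: "open W" "x0 \<in> W" and e: "\<epsilon> > (0::real)"
  shows "\<exists>\<eta>>0. \<forall>w. continuous_on UNIV w \<longrightarrow> (\<forall>x. w x \<le> u x + \<eta>) \<longrightarrow> w x0 \<ge> u x0 - \<eta> \<longrightarrow>
     (\<exists>x1\<in>W. \<bar>w x1 - u x0\<bar> < \<epsilon> \<and> (\<forall>x. w x - \<Phi> x \<le> w x1 - \<Phi> x1))"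
proof -
  define W' where "W' = W \<inter> {x. \<bar>u x - u x0\<bar> < \<epsilon> / 4} \<inter> {x. \<bar>\<Phi> x - \<Phi> x0\<bar> < \<epsilon> / 4}"
  have opW: "open W'" unfolding W'_def
    by (intro open_Int W open_Collect_less continuous_intros u \<Phi>)
  have x0W: "x0 \<in> W'" using W e by (simp add: W'_def)
  have compW: "compact (- W')" using opW compact_M by (metis Compl_eq_Diff_UNIV compact_diff)
  obtain \<gamma> where \<gamma>: "\<gamma> > 0" "\<And>x. x \<notin> W' \<Longrightarrow> u x - \<Phi> x \<le> u x0 - \<Phi> x0 - \<gamma>"
  proof (cases "- W' = {}")
    case True then show ?thesis using that[of 1] by auto
  next
    case False
    have "continuous_on (- W') (\<lambda>x. u x - \<Phi> x)"
      by (intro continuous_intros continuous_on_subset[OF u] continuous_on_subset[OF \<Phi>]) auto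
    from continuous_attains_sup[OF compW False this]
    obtain xm where xm: "xm \<in> - W'" "\<forall>x\<in>- W'. u x - \<Phi> x \<le> u xm - \<Phi> xm" by blast
    have "xm \<noteq> x0" using xm x0W by auto
    then show ?thesis using strict[of xm] xm by (intro that[of "u x0 - \<Phi> x0 - (u xm - \<Phi> xm)"]) auto
  qed
  define \<eta> where "\<eta> = min (\<gamma> / 3) (\<epsilon> / 4)"
  have \<eta>: "\<eta> > 0" "2 * \<eta> < \<gamma>" "\<eta> \<le> \<epsilon> / 4" using \<gamma> e by (auto simp: \<eta>_def)
  have "\<exists>x1\<in>W. \<bar>w x1 - u x0\<bar> < \<epsilon> \<and> (\<forall>x. w x - \<Phi> x \<le> w x1 - \<Phi> x1)"
    if w: "continuous_on UNIV w" "\<And>x. w x \<le> u x + \<eta>" "w x0 \<ge> u x0 - \<eta>" for w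
  proof -
    obtain x1 where x1: "\<And>x. w x - \<Phi> x \<le> w x1 - \<Phi> x1"
      using continuous_attains_sup[OF compact_M _ continuous_on_diff[OF w(1) \<Phi>]] by auto
    have big: "w x1 - \<Phi> x1 \<ge> u x0 - \<Phi> x0 - \<eta>" using x1[of x0] w(3) by linarith
    have "x1 \<in> W'"
    proof (rule ccontr)
      assume "x1 \<notin> W'"
      from \<gamma>(2)[OF this] w(2)[of x1] big \<eta> show False by linarith
    qed
    then have h: "x1 \<in> W" "\<bar>u x1 - u x0\<bar> < \<epsilon> / 4" "\<bar>\<Phi> x1 - \<Phi> x0\<bar> < \<epsilon> / 4" by (auto simp: W'_def)
    have "\<bar>w x1 - u x0\<bar> < \<epsilon>" using h(2,3) w(2)[of x1] big \<eta> unfolding abs_less_iff by linarith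
    then show ?thesis using h(1) x1 by blast
  qed
  then show ?thesis using \<eta>(1) by blast
qed

definition supersol :: "('m \<Rightarrow> ('e \<Rightarrow>\<^sub>L real) \<Rightarrow> real) \<Rightarrow> ('m \<Rightarrow> real) \<Rightarrow> bool" where
  "supersol N u \<longleftrightarrow> continuous_on UNIV u \<and>
     (\<forall>\<phi> x0. C1_fun A \<phi> \<longrightarrow> (\<forall>x. u x - \<phi> x \<ge> u x0 - \<phi> x0) \<longrightarrow> N x0 (differential A \<phi> x0) \<ge> 0)"

lemma viscosity_subsolution_iff: "viscosity_subsolution A F k u \<longleftrightarrow> subsol (\<lambda>x p. F x p (u x) - k) u"
  by (simp add: viscosity_subsolution_def subsol_def)

lemma viscosity_supersolution_iff: "viscosity_supersolution A F k u \<longleftrightarrow> supersol (\<lambda>x p. F x p (u x) - k) u"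
  by (simp add: viscosity_supersolution_def supersol_def)

lemma subsol_mono: assumes "subsol N u" "\<And>x p. N' x p \<le> N x p" shows "subsol N' u"
  using assms unfolding subsol_def by (meson order_trans)

lemma C1_subsol: assumes "C1_fun A f" "\<And>x. N x (differential A f x) \<le> 0" shows "subsol N f"
  unfolding subsol_def
proof (intro conjI allI impI)
  show "continuous_on UNIV f" using assms by (simp add: C1_continuous)
  fix \<phi> x0 assume "C1_fun A \<phi>" "\<forall>x. f x - \<phi> x \<le> f x0 - \<phi> x0"
  then have "differential A f x0 = differential A \<phi> x0" by (intro differential_at_max[OF assms(1)]) auto
  then show "N x0 (differential A \<phi> x0) \<le> 0" using assms(2)[of x0] by simp
qed

end

section \<open>H in coordinates: growth, coercivity and stability of viscosity inequalities\<close>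

locale hamiltonian = covered_manifold A g n ch ctr rad
  for A :: "('m::t2_space, 'e::euclidean_space) chart set" and g n ch ctr rad +
  fixes H :: "'m \<Rightarrow> ('e \<Rightarrow>\<^sub>L real) \<Rightarrow> real \<Rightarrow> real"
  assumes H_cont: "continuous_map (prod_topology (cotangent_topology A) euclideanreal) euclideanreal
                   (\<lambda>((x, p), u). H x p u)"
    and H_convex: "\<And>x u. convex_on UNIV (\<lambda>p. H x p u)"
    and H_superlinear: "\<And>x u. filterlim (\<lambda>p. H x p u / conorm g x p) at_top
                                 (filtercomap (conorm g x) at_top)"
    and H_incr: "\<And>x p. strict_mono (H x p)"
begin

lemma H_mono: "u \<le> u' \<Longrightarrow> H x p u \<le> H x p u'" and H_less: "u < u' \<Longrightarrow> H x p u < H x p u'"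
  using H_incr[of x p] by (auto simp: strict_mono_less_eq strict_mono_less)

text \<open>Superlinearity is stated in the Riemannian norm of covectors, whereas the estimates use
  the norm of chart components. The comparison is made point by point;
  \<open>uniform_superlinear\<close> restores uniformity in x.\<close>

lemma conorm_lower: assumes c: "c \<in> A" "x \<in> fst c"
  shows "\<exists>m>0. \<forall>\<xi>. conorm g x (cov c x \<xi>) \<ge> m * norm \<xi>"
proof -
  have g: "bilinear (g x)" "\<And>v. v \<noteq> 0 \<Longrightarrow> g x v v > 0"
    using metric by (auto simp: riemannian_metric_def)
  have bb: "bounded_bilinear (g x)" using g(1) by (simp add: bilinear_conv_bounded_bilinear)
  have g0: "g x v v \<ge> 0" for v using g(2)[of v] bounded_bilinear.zero_left[OF bb] by (cases "v = 0") (auto intro: less_imp_le)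
  have cg: "continuous_on S (\<lambda>v. g x v v)" for S
    by (intro bounded_bilinear.continuous_on[OF bb] continuous_intros)
  have ne: "sphere (0::'e) 1 \<noteq> {}" by simp
  obtain v1 where v1: "v1 \<in> sphere (0::'e) 1" "\<forall>v\<in>sphere 0 1. g x v1 v1 \<le> g x v v"
    using continuous_attains_inf[OF compact_sphere ne cg] by blast
  define b where "b = g x v1 v1"
  have b: "b > 0" using g(2)[of v1] v1(1) unfolding b_def by force
  have low: "g x v v \<ge> b * (norm v)\<^sup>2" for v
  proof (cases "v = 0")
    case False
    have "g x (v /\<^sub>R norm v) (v /\<^sub>R norm v) \<ge> b" using v1 False by (auto simp: b_def)
    also have "g x (v /\<^sub>R norm v) (v /\<^sub>R norm v) = g x v v / (norm v)\<^sup>2"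
      by (simp add: bounded_bilinear.scaleR_left[OF bb] bounded_bilinear.scaleR_right[OF bb] power2_eq_square divide_simps)
    finally show ?thesis using False by (simp add: le_divide_eq)
  qed (simp add: bounded_bilinear.zero_left[OF bb])
  obtain K where K: "K > 0" "\<And>v w. norm (g x v w) \<le> norm v * norm w * K"
    using bounded_bilinear.pos_bounded[OF bb] by blast
  have bl: "bounded_linear (tvec c x)" unfolding tvec_def[abs_def]
    by (rule coord_change_linear[OF c(1) chart_at_in(1) c(2) chart_at_in(2)])
  obtain T where T: "T > 0" "\<And>w. norm (tvec c x w) \<le> norm w * T" using bounded_linear.pos_bounded[OF bl] by blast
  define m where "m = 1 / (T * sqrt K)"
  have m: "m > 0" using T K by (simp add: m_def)
  have small: "tnorm g x (tvec c x w) \<le> 1" if "norm w \<le> m" for w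
  proof -
    have "norm (tvec c x w) \<le> m * T" using T(2)[of w] mult_right_mono[OF that, of T] T(1) by linarith
    also have "m * T = 1 / sqrt K" using T by (simp add: m_def)
    finally have "norm (tvec c x w) * norm (tvec c x w) \<le> (1 / sqrt K) * (1 / sqrt K)" by (intro mult_mono) (use K in auto)
    also have "\<dots> = 1 / K" using K(1) by (simp add: times_divide_times_eq)
    finally have "norm (tvec c x w) * norm (tvec c x w) * K \<le> 1" using K by (simp add: le_divide_eq)
    then have "g x (tvec c x w) (tvec c x w) \<le> 1" using K(2)[of "tvec c x w" "tvec c x w"] by (auto simp: abs_le_iff)
    then show ?thesis by (simp add: tnorm_def)
  qed
  have "m * norm \<xi> \<le> conorm g x (cov c x \<xi>)" for \<xi>
  proof (cases "\<xi> = 0")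
    case True
    have "bdd_above ((\<lambda>v. \<bar>blinfun_apply (cov c x \<xi>) v\<bar>) ` {v. tnorm g x v \<le> 1})"
      using True by (auto intro!: bdd_aboveI[of _ 0] simp: cov_0[OF c])
    then have "\<bar>blinfun_apply (cov c x \<xi>) 0\<bar> \<le> conorm g x (cov c x \<xi>)" unfolding conorm_def
      by (intro cSUP_upper) (auto simp: tnorm_def bounded_bilinear.zero_left[OF bb])
    then show ?thesis using True by (simp add: cov_0[OF c])
  next
    case False
    let ?p = "cov c x \<xi>"
    have bdd: "bdd_above ((\<lambda>v. \<bar>blinfun_apply ?p v\<bar>) ` {v. tnorm g x v \<le> 1})"
    proof (rule bdd_aboveI2)
      fix v assume "v \<in> {v. tnorm g x v \<le> 1}"
      then have "g x v v \<le> 1" by (simp add: tnorm_def)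
      then have "(norm v)\<^sup>2 \<le> 1 / b" using low[of v] b by (simp add: le_divide_eq mult.commute)
      then have "norm v \<le> sqrt (1 / b)" by (rule real_le_rsqrt)
      then show "\<bar>blinfun_apply ?p v\<bar> \<le> norm ?p * sqrt (1 / b)"
        using norm_blinfun[of ?p v] mult_left_mono[of "norm v" "sqrt (1 / b)" "norm ?p"] by simp
    qed
    define w where "w = (m / norm \<xi>) *\<^sub>R \<xi>"
    have "norm w \<le> m" using m False by (simp add: w_def)
    then have "\<bar>blinfun_apply ?p (tvec c x w)\<bar> \<le> conorm g x ?p" unfolding conorm_def
      by (intro cSUP_upper bdd) (use small in auto)
    moreover have "blinfun_apply ?p (tvec c x w) = m * norm \<xi>"
      using False by (simp add: cov_tvec[OF c] w_def power2_norm_eq_inner[symmetric] power2_eq_square)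
    ultimately show ?thesis by simp
  qed
  then show ?thesis using m by blast
qed

lemma H_chart_superlinear:
  assumes c: "c \<in> A" and Y: "compact Y" "Y \<subseteq> img c" and R: "R \<ge> 0"
  shows "\<exists>C. \<forall>y\<in>Y. \<forall>\<xi>. loc (\<lambda>x p. H x p u) c y \<xi> \<ge> R * norm \<xi> - C"
proof (rule uniform_superlinear[OF open_img[OF c] _ _ _ Y R])
  have "continuous_on (img c \<times> UNIV) (\<lambda>(y, \<xi>). (y, \<xi>::'e, u))" unfolding split_beta by (intro continuous_intros)
  from continuous_on_compose2[OF continuous_on_cotangent_chart[OF H_cont c] this]
  show "continuous_on (img c \<times> UNIV) (\<lambda>(y, \<xi>). loc (\<lambda>x p. H x p u) c y \<xi>)" by (simp add: split_beta mem_Times_iff image_subset_iff)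
next
  fix y assume y: "y \<in> img c"
  let ?x = "chart_inv c y"
  have x: "?x \<in> fst c" using c y by (simp add: chart_inv_in)
  show "convex_on UNIV (loc (\<lambda>x p. H x p u) c y)"
  proof (rule convex_onI)
    fix t \<xi> \<zeta> assume "0 < (t::real)" "t < 1"
    then show "loc (\<lambda>x p. H x p u) c y ((1 - t) *\<^sub>R \<xi> + t *\<^sub>R \<zeta>) \<le> (1 - t) * loc (\<lambda>x p. H x p u) c y \<xi> + t * loc (\<lambda>x p. H x p u) c y \<zeta>"
      using convex_onD[OF H_convex[of ?x u], of t] by (simp add: cov_add[OF c x] cov_scale[OF c x])
  qed simp
  fix K :: real
  obtain m where m: "m > 0" "\<And>\<xi>. conorm g ?x (cov c ?x \<xi>) \<ge> m * norm \<xi>" using conorm_lower[OF c x] by blast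
  \<comment> \<open>Division by m converts growth in the Riemannian norm into growth in the
    coordinates; truncation at 0 keeps the factor nonnegative for the product estimates.\<close>
  define K' where "K' = max 0 K / m"
  have "eventually (\<lambda>p. K' \<le> H ?x p u / conorm g ?x p) (filtercomap (conorm g ?x) at_top)"
    using H_superlinear[of ?x u] unfolding filterlim_at_top by blast
  then obtain a where a: "\<And>p. conorm g ?x p \<ge> a \<Longrightarrow> K' \<le> H ?x p u / conorm g ?x p"
    unfolding eventually_filtercomap eventually_at_top_linorder by blast
  show "\<exists>a. \<forall>\<xi>. norm \<xi> \<ge> a \<longrightarrow> loc (\<lambda>x p. H x p u) c y \<xi> \<ge> K * norm \<xi>"
  proof (intro exI[of _ "max 1 (a / m)"] allI impI)
    fix \<xi> :: 'e assume h: "norm \<xi> \<ge> max 1 (a / m)"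
    let ?k = "conorm g ?x (cov c ?x \<xi>)"
    have "norm \<xi> \<ge> a / m" "norm \<xi> \<ge> 1" using h by auto
    then have "m * norm \<xi> \<ge> a" using m(1) by (simp add: divide_le_eq mult.commute)
    then have ka: "?k \<ge> a" using m(2)[of \<xi>] by linarith
    have "m * norm \<xi> > 0" using m(1) \<open>norm \<xi> \<ge> 1\<close> by (intro mult_pos_pos) auto
    then have k0: "?k > 0" using m(2)[of \<xi>] by linarith
    have "K' * (m * norm \<xi>) \<le> K' * ?k" using m(2)[of \<xi>] by (intro mult_left_mono) (auto simp: K'_def m(1) less_imp_le)
    also have "\<dots> \<le> H ?x (cov c ?x \<xi>) u" using a[OF ka] k0 by (simp add: le_divide_eq)
    finally have "max 0 K * norm \<xi> \<le> H ?x (cov c ?x \<xi>) u" using m(1) by (simp add: K'_def)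
    moreover have "K * norm \<xi> \<le> max 0 K * norm \<xi>" by (intro mult_right_mono) auto
    ultimately show "loc (\<lambda>x p. H x p u) c y \<xi> \<ge> K * norm \<xi>" by linarith
  qed
qed

text \<open>Boundedness of s and monotonicity in u reduce coercivity to the single level u = -S.
  With s = \<lambda>u this presents the discounted equation as one without unknown in the
  Hamiltonian.\<close>

lemma coercive_frozen:
  assumes s: "continuous_on UNIV s" and e: "continuous_on UNIV e"
  shows "coercive_hamiltonian (\<lambda>x p. H x p (s x) + e x)"
  unfolding coercive_hamiltonian_def
proof (intro conjI ballI allI impI)
  fix c assume c: "c \<in> A"
  have cs: "continuous_on (img c) (\<lambda>y. s (chart_inv c y))" "continuous_on (img c) (\<lambda>y. e (chart_inv c y))"
    using continuous_on_chart[OF s c] continuous_on_chart[OF e c] by (auto simp: o_def)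
  have 1: "continuous_on (img c \<times> UNIV) (\<lambda>(y, \<xi>::'e). (y, \<xi>, s (chart_inv c y)))"
    unfolding split_beta by (intro continuous_intros continuous_on_compose2[OF cs(1)]) auto
  have 2: "continuous_on (img c \<times> UNIV) (\<lambda>(y, \<xi>). H (chart_inv c y) (cov c (chart_inv c y) \<xi>) (s (chart_inv c y)))"
    using continuous_on_compose2[OF continuous_on_cotangent_chart[OF H_cont c] 1] by (simp add: split_beta mem_Times_iff image_subset_iff)
  have 3: "continuous_on (img c \<times> UNIV) (\<lambda>(y, \<xi>::'e). e (chart_inv c y))"
    unfolding split_beta by (intro continuous_intros continuous_on_compose2[OF cs(2)]) auto
  show "continuous_on (img c \<times> UNIV) (\<lambda>(y, \<xi>). loc (\<lambda>x p. H x p (s x) + e x) c y \<xi>)"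
    using continuous_on_add[OF 2 3] by (simp add: split_beta)
next
  fix x show "convex_on UNIV (\<lambda>p. H x p (s x) + e x)" by (intro convex_on_add H_convex) (simp add: convex_on_def distrib_right[symmetric])
next
  fix c Y C assume c: "c \<in> A" and Y: "compact Y" "Y \<subseteq> img c"
  obtain S where S: "\<And>x. \<bar>s x\<bar> \<le> S" using bounded_on_M[OF s] by blast
  obtain E where E: "\<And>x. \<bar>e x\<bar> \<le> E" using bounded_on_M[OF e] by blast
  obtain K where K: "\<And>y \<xi>. y \<in> Y \<Longrightarrow> loc (\<lambda>x p. H x p (- S)) c y \<xi> \<ge> 1 * norm \<xi> - K"
    using H_chart_superlinear[OF c Y, of 1 "- S"] by auto
  have "norm \<xi> \<le> C + E + K" if "y \<in> Y" "loc (\<lambda>x p. H x p (s x) + e x) c y \<xi> \<le> C" for y \<xi>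
  proof -
    let ?x = "chart_inv c y"
    have "H ?x (cov c ?x \<xi>) (- S) \<le> H ?x (cov c ?x \<xi>) (s ?x)" using S[of ?x] by (intro H_mono) (auto simp: abs_le_iff)
    then show ?thesis using that(2) K[OF that(1), of \<xi>] E[of ?x] by (auto simp: abs_le_iff)
  qed
  then show "bounded {\<xi>. \<exists>y\<in>Y. loc (\<lambda>x p. H x p (s x) + e x) c y \<xi> \<le> C}"
    unfolding bounded_iff by blast
qed

text \<open>The third argument of H is kept as a free variable, because in stability arguments the
  value at the contact point moves together with the point.\<close>

lemma continuous_H_differential: assumes \<Phi>: "C1_fun A \<Phi>" and e: "continuous_on UNIV e"
  shows "continuous_on UNIV (\<lambda>(x, z::real). H x (differential A \<Phi> x) z + e x)"
proof (rule continuous_at_imp_continuous_on, rule ballI)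
  fix p :: "'m \<times> real"
  let ?c = "chart_at A (fst p)"
  note c = chart_at_in[of "fst p"]
  let ?S = "fst ?c \<times> (UNIV :: real set)"
  have op: "open ?S" by (intro open_Times open_dom c) simp
  have cg: "continuous_on (img ?c) (grad (\<Phi> \<circ> chart_inv ?c))" using C1_fun_grad[OF \<Phi> c(1)] by (simp add: grad_on_def)
  have 1: "continuous_on ?S (\<lambda>(x, z). (snd ?c x, grad (\<Phi> \<circ> chart_inv ?c) (snd ?c x), z))"
    unfolding split_beta
    by (intro continuous_intros continuous_on_compose2[OF continuous_chart[OF c(1)]] continuous_on_compose2[OF cg]) auto
  have 2: "continuous_on ?S (\<lambda>(x, z). H (chart_inv ?c (snd ?c x)) (cov ?c (chart_inv ?c (snd ?c x)) (grad (\<Phi> \<circ> chart_inv ?c) (snd ?c x))) z)"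
    using continuous_on_compose2[OF continuous_on_cotangent_chart[OF H_cont c(1)] 1] by (simp add: split_beta mem_Times_iff image_subset_iff)
  have 3: "continuous_on ?S (\<lambda>(x, z). H x (differential A \<Phi> x) z)"
    by (rule continuous_on_eq[OF 2]) (auto simp: differential_cov[OF \<Phi> c(1)] c(1))
  have 4: "continuous_on ?S (\<lambda>(x, z). H x (differential A \<Phi> x) z + e x)"
    using 3 unfolding split_beta by (intro continuous_on_add continuous_on_compose2[OF e] continuous_intros) auto
  show "isCont (\<lambda>(x, z). H x (differential A \<Phi> x) z + e x) p"
    by (rule bspec[OF 4[unfolded continuous_on_eq_continuous_at[OF op]]]) (simp add: c mem_Times_iff)
qed

definition bH :: "real \<times> 'e \<Rightarrow> 'e \<Rightarrow> real \<Rightarrow> real" where "bH z \<xi> u = H (pt z) (bcov z \<xi>) u"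

lemma continuous_bH: "continuous_on (base \<times> UNIV \<times> UNIV) (\<lambda>(z, \<xi>, u). bH z \<xi> u)"
proof -
  have "continuous_on (base \<times> UNIV) (\<lambda>(z, b). case b of (\<xi>, u) \<Rightarrow> H (chart_inv (ch (idx z)) (snd z)) (cov (ch (idx z)) (chart_inv (ch (idx z)) (snd z)) \<xi>) u)"
  proof (rule continuous_on_base)
    fix i assume i: "i < n"
    have "continuous_on (cball (ctr i) (rad i) \<times> UNIV \<times> UNIV) (\<lambda>(y, \<xi>, u). H (chart_inv (ch i) y) (cov (ch i) (chart_inv (ch i) y) \<xi>) u)"
      by (rule continuous_on_subset[OF continuous_on_cotangent_chart[OF H_cont cover(1)[OF i]]]) (use cball_img[OF i] in auto)
    then show "continuous_on (cball (ctr i) (rad i) \<times> UNIV) (\<lambda>(y, b). case b of (\<xi>, u) \<Rightarrow> H (chart_inv (ch i) y) (cov (ch i) (chart_inv (ch i) y) \<xi>) u)"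
      by simp
  qed simp
  then show ?thesis by (simp add: bH_def pt_def bch_def bcov_def)
qed

lemma continuous_bH_compose:
  assumes "continuous_on S a" "continuous_on S b" "continuous_on S c" "\<And>x. x \<in> S \<Longrightarrow> a x \<in> base"
  shows "continuous_on S (\<lambda>x. bH (a x) (b x) (c x))"
proof -
  have "continuous_on S (\<lambda>x. (a x, b x, c x))" by (intro continuous_intros assms)
  from continuous_on_compose2[OF continuous_bH this] assms(4) show ?thesis by auto
qed

lemma strict_test:
  assumes "C1_fun A \<phi>"
  obtains \<psi> where "C1_fun A \<psi>" "\<psi> x0 = (0::real)" "\<And>x. x \<noteq> x0 \<Longrightarrow> \<psi> x > 0"
    "differential A (\<lambda>x. \<phi> x + \<psi> x) x0 = differential A \<phi> x0"
    "differential A (\<lambda>x. \<phi> x + - \<psi> x) x0 = differential A \<phi> x0"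
proof -
  obtain \<psi> where \<psi>: "C1_fun A \<psi>" "\<psi> x0 = 0" "\<And>x. x \<noteq> x0 \<Longrightarrow> \<psi> x > 0" using strict_minimum_exists[of x0] by blast
  have "differential A (\<lambda>_. 0) x0 = differential A \<psi> x0"
  proof (rule differential_at_max[OF C1_const \<psi>(1)])
    show "0 - \<psi> x \<le> 0 - \<psi> x0" for x using \<psi>(2) \<psi>(3)[of x] by (cases "x = x0") auto
  qed
  then have d0: "differential A \<psi> x0 = 0" by (simp add: differential_const)
  have "differential A (\<lambda>x. \<phi> x + - \<psi> x) x0 = differential A \<phi> x0"
    by (subst differential_add[OF assms C1_minus[OF \<psi>(1)]]) (simp add: differential_minus[OF \<psi>(1)] d0)
  moreover have "differential A (\<lambda>x. \<phi> x + \<psi> x) x0 = differential A \<phi> x0"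
    by (subst differential_add[OF assms \<psi>(1)]) (simp add: d0)
  ultimately show ?thesis using \<psi> by (intro that[of \<psi>])
qed

text \<open>A test function in strict contact with u touches w nearby, where the inequality would
  fail by a margin. Since s' and e' need only be close to l*w and e, the lemma covers the supremum
  in Perron's method, with the same l, as well as the vanishing discount, where l = 0 and s', e' are
  the small terms \<lambda>u and \<lambda>V.\<close>

lemma subsol_stable:
  assumes u: "continuous_on UNIV u" and e: "continuous_on UNIV e"
    and approx: "\<And>x0 \<eta>. \<eta> > 0 \<Longrightarrow> \<exists>w s' e'. (\<forall>x. w x \<le> u x + \<eta>) \<and> w x0 \<ge> u x0 - \<eta> \<and>
      subsol (\<lambda>x p. H x p (s' x) + e' x - k) w \<and> (\<forall>x. \<bar>s' x - l * w x\<bar> \<le> \<eta>) \<and> (\<forall>x. \<bar>e' x - e x\<bar> \<le> \<eta>)"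
  shows "subsol (\<lambda>x p. H x p (l * u x) + e x - k) u"
  unfolding subsol_def
proof (intro conjI allI impI u, rule ccontr)
  fix \<phi> x0 assume \<phi>: "C1_fun A \<phi>" "\<forall>x. u x - \<phi> x \<le> u x0 - \<phi> x0"
    and neg: "\<not> H x0 (differential A \<phi> x0) (l * u x0) + e x0 - k \<le> 0"
  obtain \<psi> where \<psi>: "C1_fun A \<psi>" "\<psi> x0 = 0" "\<And>x. x \<noteq> x0 \<Longrightarrow> \<psi> x > 0"
    "differential A (\<lambda>x. \<phi> x + \<psi> x) x0 = differential A \<phi> x0" using strict_test[OF \<phi>(1), of x0] by blast
  define \<Phi> where "\<Phi> x = \<phi> x + \<psi> x" for x
  have \<Phi>1: "C1_fun A \<Phi>" unfolding \<Phi>_def by (intro C1_add \<phi> \<psi>)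
  have d: "differential A \<Phi> x0 = differential A \<phi> x0" unfolding \<Phi>_def[abs_def] by (rule \<psi>(4))
  have strict: "u x - \<Phi> x < u x0 - \<Phi> x0" if "x \<noteq> x0" for x
    using \<phi>(2)[rule_format, of x] \<psi>(2) \<psi>(3)[OF that] by (simp add: \<Phi>_def)
  define \<kappa> where "\<kappa> = (H x0 (differential A \<Phi> x0) (l * u x0) + e x0 - k) / 2"
  have \<kappa>: "\<kappa> > 0" "H x0 (differential A \<Phi> x0) (l * u x0) + e x0 \<in> {k + \<kappa><..}" using neg d by (auto simp: \<kappa>_def field_simps)
  obtain W \<epsilon> where W: "open W" "x0 \<in> W" "\<epsilon> > 0"
    "\<And>x z. x \<in> W \<Longrightarrow> \<bar>z - l * u x0\<bar> < \<epsilon> \<Longrightarrow> H x (differential A \<Phi> x) z + e x > k + \<kappa>"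
    using continuous_on_open_nbhd[OF continuous_H_differential[OF \<Phi>1 e] open_greaterThan \<kappa>(2)] by auto
  \<comment> \<open>Half of \<epsilon> is reserved for the variation of l*w at the contact point,
    the other half for the distance of s' from l*w.\<close>
  define \<epsilon>' where "\<epsilon>' = \<epsilon> / (2 * (\<bar>l\<bar> + 1))"
  have \<epsilon>': "\<epsilon>' > 0" using W by (simp add: \<epsilon>'_def)
  have l\<epsilon>: "\<bar>l\<bar> * \<epsilon>' \<le> \<epsilon> / 2" using W(3) by (simp add: \<epsilon>'_def divide_simps)
  obtain \<eta>0 where \<eta>0: "\<eta>0 > 0" "\<And>w. continuous_on UNIV w \<Longrightarrow> (\<forall>x. w x \<le> u x + \<eta>0) \<Longrightarrow> w x0 \<ge> u x0 - \<eta>0 \<Longrightarrow>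
     (\<exists>x1\<in>W. \<bar>w x1 - u x0\<bar> < \<epsilon>' \<and> (\<forall>x. w x - \<Phi> x \<le> w x1 - \<Phi> x1))"
    using strict_touching[OF u C1_continuous[OF \<Phi>1] strict W(1,2) \<epsilon>'] by blast
  define \<eta> where "\<eta> = min \<eta>0 (min \<kappa> (\<epsilon> / 3))"
  have \<eta>: "\<eta> > 0" "\<eta> \<le> \<eta>0" "\<eta> \<le> \<kappa>" "\<eta> < \<epsilon> / 2" using \<eta>0 \<kappa> W(3) by (auto simp: \<eta>_def)
  obtain w s' e' where w: "\<forall>x. w x \<le> u x + \<eta>" "w x0 \<ge> u x0 - \<eta>"
    and ws: "subsol (\<lambda>x p. H x p (s' x) + e' x - k) w" and w2: "\<And>x. \<bar>s' x - l * w x\<bar> \<le> \<eta>" "\<And>x. \<bar>e' x - e x\<bar> \<le> \<eta>"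
    using approx[OF \<eta>(1), of x0] by blast
  have "\<forall>x. w x \<le> u x + \<eta>0" "w x0 \<ge> u x0 - \<eta>0" using w \<eta>(2) by (auto intro: order_trans)
  moreover have "continuous_on UNIV w" using ws by (simp add: subsol_def)
  ultimately obtain x1 where x1: "x1 \<in> W" "\<bar>w x1 - u x0\<bar> < \<epsilon>'" "\<forall>x. w x - \<Phi> x \<le> w x1 - \<Phi> x1"
    using \<eta>0(2)[of w] by blast
  have "H x1 (differential A \<Phi> x1) (s' x1) + e' x1 - k \<le> 0" using ws \<Phi>1 x1(3) unfolding subsol_def by blast
  moreover have "\<bar>s' x1 - l * u x0\<bar> < \<epsilon>"
  proof -
    have "\<bar>l * w x1 - l * u x0\<bar> = \<bar>l\<bar> * \<bar>w x1 - u x0\<bar>" by (simp add: right_diff_distrib[symmetric] abs_mult)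
    also have "\<dots> \<le> \<bar>l\<bar> * \<epsilon>'" using x1(2) by (intro mult_left_mono) auto
    finally show ?thesis using l\<epsilon> w2(1)[of x1] \<eta>(4) unfolding abs_le_iff abs_less_iff by linarith
  qed
  from W(4)[OF x1(1) this] w2(2)[of x1] \<eta>(3)
  have "H x1 (differential A \<Phi> x1) (s' x1) + e' x1 - k > 0" by linarith
  ultimately show False by linarith
qed

text \<open>Contact from below for u is contact from above for -u, so \<open>strict_touching\<close>
  applies again.\<close>

lemma supersol_stable:
  assumes u: "continuous_on UNIV u" and e: "continuous_on UNIV e"
    and approx: "\<And>x0 \<eta>. \<eta> > 0 \<Longrightarrow> \<exists>w s' e'. (\<forall>x. w x \<ge> u x - \<eta>) \<and> w x0 \<le> u x0 + \<eta> \<and>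
      supersol (\<lambda>x p. H x p (s' x) + e' x - k) w \<and> (\<forall>x. \<bar>s' x - l * w x\<bar> \<le> \<eta>) \<and> (\<forall>x. \<bar>e' x - e x\<bar> \<le> \<eta>)"
  shows "supersol (\<lambda>x p. H x p (l * u x) + e x - k) u"
  unfolding supersol_def
proof (intro conjI allI impI u, rule ccontr)
  fix \<phi> x0 assume \<phi>: "C1_fun A \<phi>" "\<forall>x. u x - \<phi> x \<ge> u x0 - \<phi> x0"
    and neg: "\<not> H x0 (differential A \<phi> x0) (l * u x0) + e x0 - k \<ge> 0"
  obtain \<psi> where \<psi>: "C1_fun A \<psi>" "\<psi> x0 = 0" "\<And>x. x \<noteq> x0 \<Longrightarrow> \<psi> x > 0"
    "differential A (\<lambda>x. \<phi> x + - \<psi> x) x0 = differential A \<phi> x0" using strict_test[OF \<phi>(1), of x0] by blast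
  define \<Phi> where "\<Phi> x = \<phi> x + - \<psi> x" for x
  have \<Phi>1: "C1_fun A \<Phi>" unfolding \<Phi>_def by (intro C1_add C1_minus \<phi> \<psi>)
  have d: "differential A \<Phi> x0 = differential A \<phi> x0" unfolding \<Phi>_def[abs_def] by (rule \<psi>(4))
  have strict: "- u x - - \<Phi> x < - u x0 - - \<Phi> x0" if "x \<noteq> x0" for x
    using \<phi>(2)[rule_format, of x] \<psi>(2) \<psi>(3)[OF that] by (simp add: \<Phi>_def)
  define \<kappa> where "\<kappa> = (k - (H x0 (differential A \<Phi> x0) (l * u x0) + e x0)) / 2"
  have \<kappa>: "\<kappa> > 0" "H x0 (differential A \<Phi> x0) (l * u x0) + e x0 \<in> {..<k - \<kappa>}" using neg d by (auto simp: \<kappa>_def field_simps)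
  obtain W \<epsilon> where W: "open W" "x0 \<in> W" "\<epsilon> > 0"
    "\<And>x z. x \<in> W \<Longrightarrow> \<bar>z - l * u x0\<bar> < \<epsilon> \<Longrightarrow> H x (differential A \<Phi> x) z + e x < k - \<kappa>"
    using continuous_on_open_nbhd[OF continuous_H_differential[OF \<Phi>1 e] open_lessThan \<kappa>(2)] by auto
  define \<epsilon>' where "\<epsilon>' = \<epsilon> / (2 * (\<bar>l\<bar> + 1))"
  have \<epsilon>': "\<epsilon>' > 0" using W by (simp add: \<epsilon>'_def)
  have l\<epsilon>: "\<bar>l\<bar> * \<epsilon>' \<le> \<epsilon> / 2" using W(3) by (simp add: \<epsilon>'_def divide_simps)
  obtain \<eta>0 where \<eta>0: "\<eta>0 > 0" "\<And>w. continuous_on UNIV w \<Longrightarrow> (\<forall>x. w x \<le> - u x + \<eta>0) \<Longrightarrow> w x0 \<ge> - u x0 - \<eta>0 \<Longrightarrow>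
     (\<exists>x1\<in>W. \<bar>w x1 - - u x0\<bar> < \<epsilon>' \<and> (\<forall>x. w x - - \<Phi> x \<le> w x1 - - \<Phi> x1))"
    using strict_touching[OF continuous_on_minus[OF u] continuous_on_minus[OF C1_continuous[OF \<Phi>1]] strict W(1,2) \<epsilon>'] by blast
  define \<eta> where "\<eta> = min \<eta>0 (min \<kappa> (\<epsilon> / 3))"
  have \<eta>: "\<eta> > 0" "\<eta> \<le> \<eta>0" "\<eta> \<le> \<kappa>" "\<eta> < \<epsilon> / 2" using \<eta>0 \<kappa> W(3) by (auto simp: \<eta>_def)
  obtain w s' e' where w: "\<forall>x. w x \<ge> u x - \<eta>" "w x0 \<le> u x0 + \<eta>"
    and ws: "supersol (\<lambda>x p. H x p (s' x) + e' x - k) w" and w2: "\<And>x. \<bar>s' x - l * w x\<bar> \<le> \<eta>" "\<And>x. \<bar>e' x - e x\<bar> \<le> \<eta>"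
    using approx[OF \<eta>(1), of x0] by blast
  have wb: "- w x \<le> - u x + \<eta>0" for x using w(1)[rule_format, of x] \<eta>(2) by linarith
  have wx: "- w x0 \<ge> - u x0 - \<eta>0" using w(2) \<eta>(2) by linarith
  have cw: "continuous_on UNIV (\<lambda>x. - w x)" using ws by (simp add: supersol_def continuous_on_minus)
  obtain x1 where x1: "x1 \<in> W" "\<bar>- w x1 - - u x0\<bar> < \<epsilon>'" "\<forall>x. - w x - - \<Phi> x \<le> - w x1 - - \<Phi> x1"
    using \<eta>0(2)[OF cw _ wx] wb by blast
  have "\<forall>x. w x - \<Phi> x \<ge> w x1 - \<Phi> x1"
  proof
    fix x show "w x - \<Phi> x \<ge> w x1 - \<Phi> x1" using x1(3)[rule_format, of x] by linarith
  qed
  then have "H x1 (differential A \<Phi> x1) (s' x1) + e' x1 - k \<ge> 0" using ws \<Phi>1 unfolding supersol_def by blast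
  moreover have "\<bar>s' x1 - l * u x0\<bar> < \<epsilon>"
  proof -
    have "\<bar>l * w x1 - l * u x0\<bar> = \<bar>l\<bar> * \<bar>w x1 - u x0\<bar>" by (simp add: right_diff_distrib[symmetric] abs_mult)
    also have "\<dots> \<le> \<bar>l\<bar> * \<epsilon>'" using x1(2) by (intro mult_left_mono) auto
    finally show ?thesis using l\<epsilon> w2(1)[of x1] \<eta>(4) unfolding abs_le_iff abs_less_iff by linarith
  qed
  from W(4)[OF x1(1) this] w2(2)[of x1] \<eta>(3)
  have "H x1 (differential A \<Phi> x1) (s' x1) + e' x1 - k < 0" by linarith
  ultimately show False by linarith
qed

text \<open>A C^1 function f is itself a test function for u at a minimum of u - f, so strict
  monotonicity of H in u decides at once.\<close>

lemma strict_C1_subsol_le: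
  assumes f: "C1_fun A f" "\<And>x. H x (differential A f x) (l * f x) + e x < k" and l: "l > 0"
    and sup: "supersol (\<lambda>x p. H x p (l * u x) + e x - k) u"
  shows "f x \<le> u x"
proof -
  have u: "continuous_on UNIV u" using sup by (simp add: supersol_def)
  obtain x0 where x0: "\<And>x. u x0 - f x0 \<le> u x - f x"
    using continuous_attains_inf[OF compact_M _ continuous_on_diff[OF u C1_continuous[OF f(1)]]] by auto
  have "H x0 (differential A f x0) (l * u x0) + e x0 - k \<ge> 0" using sup f(1) x0 unfolding supersol_def by blast
  then have "H x0 (differential A f x0) (l * f x0) < H x0 (differential A f x0) (l * u x0)" using f(2)[of x0] by linarith
  then have "l * f x0 < l * u x0" by (metis H_mono linorder_not_less)
  then show ?thesis using x0[of x] l by simp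
qed

text \<open>With u1 frozen inside H, u1 is smoothed to f, and f tests u2 at the minimum of u2 - f.
  There u2 lies below u1 by at least M/2, so the two inequalities at the same momentum contradict
  monotonicity in u.\<close>

lemma comparison:
  assumes l: "l > 0" and e: "continuous_on UNIV e"
    and sub: "subsol (\<lambda>x p. H x p (l * u1 x) + e x - k) u1"
    and sup: "supersol (\<lambda>x p. H x p (l * u2 x) + e x - k) u2"
  shows "u1 x \<le> u2 x"
proof (rule ccontr)
  assume neg: "\<not> u1 x \<le> u2 x"
  have c1: "continuous_on UNIV u1" and c2: "continuous_on UNIV u2" using sub sup by (auto simp: subsol_def supersol_def)
  obtain xm where xm: "\<And>x. u1 x - u2 x \<le> u1 xm - u2 xm"
    using continuous_attains_sup[OF compact_M _ continuous_on_diff[OF c1 c2]] by auto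
  define M where "M = u1 xm - u2 xm"
  have M: "M > 0" using neg xm[of x] by (simp add: M_def)
  define N where "N = (\<lambda>x p. H x p (l * u1 x) + (e x - k))"
  have nice: "coercive_hamiltonian N" unfolding N_def by (intro coercive_frozen continuous_intros c1 e)
  have sub': "subsol N u1" using sub by (simp add: N_def add_diff_eq)
  obtain P where P: "P > 0" "\<forall>z\<in>base. \<forall>\<xi>. N (pt z) (bcov z \<xi>) \<le> 1 \<longrightarrow> norm \<xi> \<le> P" using bounded_bN[OF nice, of 1] by blast
  \<comment> \<open>Strict monotonicity gives no rate; its minimum over the compact set of possible
    points and momenta provides one.\<close>
  define gap where "gap q = bH (fst q) (snd q) (l * u1 (pt (fst q))) - bH (fst q) (snd q) (l * u1 (pt (fst q)) - l * M / 2)" for q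
  have cgap: "continuous_on (base \<times> cball 0 P) gap" unfolding gap_def
  proof -
    have "continuous_on (base \<times> cball (0::'e) P) (\<lambda>q. u1 (pt (fst q)))"
      by (intro continuous_on_compose2[OF continuous_pt[OF c1]] continuous_intros) auto
    then show "continuous_on (base \<times> cball 0 P) (\<lambda>q. bH (fst q) (snd q) (l * u1 (pt (fst q))) - bH (fst q) (snd q) (l * u1 (pt (fst q)) - l * M / 2))"
      by (intro continuous_intros continuous_bH_compose) auto
  qed
  have ne: "base \<times> cball (0::'e) P \<noteq> {}" using base_nonempty P(1) by auto
  obtain q where q: "\<forall>q'\<in>base \<times> cball 0 P. gap q \<le> gap q'"
    using continuous_attains_inf[OF compact_Times[OF compact_base compact_cball] ne cgap] by blast
  have "gap q > 0" unfolding gap_def bH_def using l M by (simp add: H_less)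
  \<comment> \<open>At most 1 for the momentum bound P, below the gap for the contradiction, and at
    most M/4 because the two smoothing errors may cost no more than M/2.\<close>
  define \<epsilon> where "\<epsilon> = min (min 1 (gap q / 2)) (M / 4)"
  have \<epsilon>: "\<epsilon> > 0" "\<epsilon> \<le> 1" "\<epsilon> < gap q" "\<epsilon> \<le> M / 4" using \<open>gap q > 0\<close> M by (auto simp: \<epsilon>_def)
  obtain f where f: "C1_fun A f" "\<And>x. \<bar>f x - u1 x\<bar> \<le> \<epsilon>" "\<And>x. N x (differential A f x) \<le> \<epsilon>"
    using subsol_smoothing[OF nice sub' \<epsilon>(1)] by blast
  obtain x0 where x0: "\<And>x. u2 x0 - f x0 \<le> u2 x - f x"
    using continuous_attains_inf[OF compact_M _ continuous_on_diff[OF c2 C1_continuous[OF f(1)]]] by auto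
  have t: "H x0 (differential A f x0) (l * u2 x0) + e x0 - k \<ge> 0" using sup f(1) x0 unfolding supersol_def by blast
  have "u2 x0 \<le> u1 x0 - M / 2"
    using x0[of xm] f(2)[of xm] f(2)[of x0] \<epsilon>(4) unfolding M_def abs_le_iff by argo
  then have "l * u2 x0 \<le> l * (u1 x0 - M / 2)" using l by (intro mult_left_mono) auto
  then have 1: "H x0 (differential A f x0) (l * u2 x0) \<le> H x0 (differential A f x0) (l * u1 x0 - l * M / 2)"
    by (intro H_mono) (simp add: algebra_simps)
  obtain z where z: "z \<in> base" "pt z = x0" using pt_surj by blast
  have dz: "differential A f x0 = bcov z (bgrad f z)" using differential_pt[OF f(1) z(1)] z(2) by simp
  have Nx: "N x0 (differential A f x0) \<le> \<epsilon>" by (rule f(3))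
  then have "norm (bgrad f z) \<le> P" using P(2) z dz \<epsilon>(2) by force
  then have "gap q \<le> gap (z, bgrad f z)" using q z by auto
  also have "\<dots> = H x0 (differential A f x0) (l * u1 x0) - H x0 (differential A f x0) (l * u1 x0 - l * M / 2)"
    by (simp add: gap_def bH_def z dz)
  also have "\<dots> \<le> \<epsilon>" using t 1 Nx unfolding N_def by linarith
  finally show False using \<epsilon>(3) by linarith
qed

text \<open>All subsolutions above f0 share one Lipschitz constant, so their supremum is continuous
  and is itself a subsolution by stability, without semicontinuous envelopes. If it were not a
  supersolution, it could be raised near a point.\<close>

lemma perron:
  assumes e: "continuous_on UNIV e" and f0: "subsol (\<lambda>x p. H x p (l * f0 x) + e x - k) f0"
    and fam: "\<And>w. subsol (\<lambda>x p. H x p (l * w x) + e x - k) w \<Longrightarrow> (\<And>x. f0 x \<le> w x) \<Longrightarrow>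
      chart_lipschitz P w \<and> (\<forall>x. w x \<le> B)"
  shows "\<exists>u. subsol (\<lambda>x p. H x p (l * u x) + e x - k) u \<and> supersol (\<lambda>x p. H x p (l * u x) + e x - k) u \<and> (\<forall>x. f0 x \<le> u x)"
proof -
  define S where "S = {w. subsol (\<lambda>x p. H x p (l * w x) + e x - k) w \<and> (\<forall>x. f0 x \<le> w x)}"
  have fS: "f0 \<in> S" using f0 by (simp add: S_def)
  define u where "u x = (SUP w\<in>S. w x)" for x
  have bdd: "bdd_above ((\<lambda>w. w x) ` S)" for x by (rule bdd_aboveI[of _ B]) (use fam in \<open>auto simp: S_def\<close>)
  have up: "w x \<le> u x" if "w \<in> S" for w x unfolding u_def by (rule cSUP_upper[OF that bdd])
  have least: "u x \<le> b" if "\<And>w. w \<in> S \<Longrightarrow> w x \<le> b" for x b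
    unfolding u_def using fS that by (intro cSUP_least) auto
  have "chart_lipschitz P u" unfolding chart_lipschitz_def
  proof (intro allI impI ballI)
    fix i y y' assume i: "i < n" and y: "y \<in> cball (ctr i) (rad i)" "y' \<in> cball (ctr i) (rad i)"
    have one: "u (chart_inv (ch i) a) \<le> u (chart_inv (ch i) b) + P * norm (a - b)"
      if ab: "a \<in> cball (ctr i) (rad i)" "b \<in> cball (ctr i) (rad i)" for a b
    proof (rule least)
      fix w assume w: "w \<in> S"
      then have "chart_lipschitz P w" using fam by (auto simp: S_def)
      then have "\<bar>w (chart_inv (ch i) a) - w (chart_inv (ch i) b)\<bar> \<le> P * norm (a - b)"
        using i ab unfolding chart_lipschitz_def by blast
      then show "w (chart_inv (ch i) a) \<le> u (chart_inv (ch i) b) + P * norm (a - b)"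
        using up[OF w, of "chart_inv (ch i) b"] by linarith
    qed
    show "\<bar>u (chart_inv (ch i) y) - u (chart_inv (ch i) y')\<bar> \<le> P * norm (y - y')"
      using one[OF y] one[OF y(2,1)] by (simp add: abs_le_iff norm_minus_commute)
  qed
  then have cu: "continuous_on UNIV u" by (rule chart_lipschitz_continuous)
  have usub: "subsol (\<lambda>x p. H x p (l * u x) + e x - k) u"
  proof (rule subsol_stable[OF cu e])
    fix x0 and \<eta> :: real assume \<eta>: "\<eta> > 0"
    have "\<exists>w\<in>S. u x0 - \<eta> < w x0"
    proof (rule ccontr)
      assume "\<not> (\<exists>w\<in>S. u x0 - \<eta> < w x0)"
      then have "u x0 \<le> u x0 - \<eta>" by (intro least) auto
      then show False using \<eta> by simp
    qed
    then obtain w where w: "w \<in> S" "u x0 - \<eta> < w x0" by blast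
    have "\<forall>x. w x \<le> u x + \<eta>"
    proof
      fix x show "w x \<le> u x + \<eta>" using up[OF w(1), of x] \<eta> by linarith
    qed
    moreover have "subsol (\<lambda>x p. H x p (l * w x) + e x - k) w" using w by (simp add: S_def)
    ultimately show "\<exists>w s' e'. (\<forall>x. w x \<le> u x + \<eta>) \<and> w x0 \<ge> u x0 - \<eta> \<and>
      subsol (\<lambda>x p. H x p (s' x) + e' x - k) w \<and> (\<forall>x. \<bar>s' x - l * w x\<bar> \<le> \<eta>) \<and> (\<forall>x. \<bar>e' x - e x\<bar> \<le> \<eta>)"
      using w(2) \<eta> by (intro exI[of _ w] exI[of _ "\<lambda>x. l * w x"] exI[of _ e]) auto
  qed
  have "supersol (\<lambda>x p. H x p (l * u x) + e x - k) u"
    unfolding supersol_def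
  proof (intro conjI allI impI cu, rule ccontr)
    fix \<phi> x0 assume \<phi>: "C1_fun A \<phi>" "\<forall>x. u x - \<phi> x \<ge> u x0 - \<phi> x0"
      and neg: "\<not> H x0 (differential A \<phi> x0) (l * u x0) + e x0 - k \<ge> 0"
    obtain \<psi> where \<psi>: "C1_fun A \<psi>" "\<psi> x0 = 0" "\<And>x. x \<noteq> x0 \<Longrightarrow> \<psi> x > 0"
      "differential A (\<lambda>x. \<phi> x + - \<psi> x) x0 = differential A \<phi> x0" using strict_test[OF \<phi>(1), of x0] by blast
    define h where "h = u x0 - \<phi> x0"
    define \<Phi> where "\<Phi> x = (\<phi> x + - \<psi> x) + h" for x
    have \<Phi>1: "C1_fun A \<Phi>" unfolding \<Phi>_def by (intro C1_add C1_minus C1_const \<phi> \<psi>)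
    have d: "differential A \<Phi> x0 = differential A \<phi> x0"
      unfolding \<Phi>_def[abs_def] differential_add[OF C1_add[OF \<phi>(1) C1_minus[OF \<psi>(1)]] C1_const] \<psi>(4)
      by (simp add: differential_const)
    have \<Phi>0: "\<Phi> x0 = u x0" by (simp add: \<Phi>_def h_def \<psi>(2))
    have below: "\<Phi> x < u x" if "x \<noteq> x0" for x
      using \<phi>(2)[rule_format, of x] \<psi>(3)[OF that] by (simp add: \<Phi>_def h_def)
    have "H x0 (differential A \<Phi> x0) (l * u x0) + e x0 \<in> {..<k}" using neg d by simp
    from continuous_on_open_nbhd[OF continuous_H_differential[OF \<Phi>1 e] open_lessThan this]
    obtain W \<epsilon> where W: "open W" "x0 \<in> W" "\<epsilon> > 0"
      "\<And>x z. x \<in> W \<Longrightarrow> \<bar>z - l * u x0\<bar> < \<epsilon> \<Longrightarrow> H x (differential A \<Phi> x) z + e x < k" by auto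
    \<comment> \<open>Twice \<epsilon>' occurs because w differs from u x0 by the variation of
      \<Phi> on W' and by the lift \<delta>.\<close>
    define \<epsilon>' where "\<epsilon>' = \<epsilon> / (2 * (\<bar>l\<bar> + 1))"
    have \<epsilon>': "\<epsilon>' > 0" using W by (simp add: \<epsilon>'_def)
    have l\<epsilon>: "\<bar>l\<bar> * (2 * \<epsilon>') < \<epsilon>" using W(3) by (simp add: \<epsilon>'_def divide_simps)
    define W' where "W' = W \<inter> {x. \<bar>\<Phi> x - u x0\<bar> < \<epsilon>'}"
    have opW: "open W'" unfolding W'_def
      by (intro open_Int W open_Collect_less continuous_intros C1_continuous[OF \<Phi>1])
    have x0W: "x0 \<in> W'" using W \<epsilon>' \<Phi>0 by (simp add: W'_def)
    have compW: "compact (- W')" using opW compact_M by (metis Compl_eq_Diff_UNIV compact_diff)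
    obtain \<gamma> where \<gamma>: "\<gamma> > 0" "\<And>x. x \<notin> W' \<Longrightarrow> \<Phi> x + \<gamma> \<le> u x"
    proof (cases "- W' = {}")
      case True then show ?thesis using that[of 1] by auto
    next
      case False
      have "continuous_on (- W') (\<lambda>x. u x - \<Phi> x)"
        by (intro continuous_intros continuous_on_subset[OF cu] continuous_on_subset[OF C1_continuous[OF \<Phi>1]]) auto
      from continuous_attains_inf[OF compW False this]
      obtain xm where xm: "xm \<in> - W'" "\<forall>x\<in>- W'. u xm - \<Phi> xm \<le> u x - \<Phi> x" by blast
      have "xm \<noteq> x0" using xm x0W by auto
      then show ?thesis using below[of xm] xm by (intro that[of "u xm - \<Phi> xm"]) force+
    qed
    define \<delta> where "\<delta> = min \<gamma> \<epsilon>'"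
    have \<delta>: "\<delta> > 0" "\<delta> \<le> \<gamma>" "\<delta> \<le> \<epsilon>'" using \<gamma> \<epsilon>' by (auto simp: \<delta>_def)
    \<comment> \<open>Outside W' the lifted \<Phi> stays below u; inside, \<Phi> satisfies the
      strict inequality with room for the lift. But w exceeds u at x0, against maximality.\<close>
    define w where "w x = max (u x) (\<Phi> x + \<delta>)" for x
    have cw: "continuous_on UNIV w" unfolding w_def by (intro continuous_intros cu C1_continuous[OF \<Phi>1])
    have uw: "u x \<le> w x" for x by (simp add: w_def)
    have "subsol (\<lambda>x p. H x p (l * w x) + e x - k) w" unfolding subsol_def
    proof (intro conjI allI impI cw)
      fix \<theta> y assume \<theta>: "C1_fun A \<theta>" "\<forall>x. w x - \<theta> x \<le> w y - \<theta> y"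
      show "H y (differential A \<theta> y) (l * w y) + e y - k \<le> 0"
      proof (cases "\<Phi> y + \<delta> \<le> u y")
        case True
        then have wy: "w y = u y" by (simp add: w_def)
        have "u x - \<theta> x \<le> u y - \<theta> y" for x using \<theta>(2)[rule_format, of x] uw[of x] wy by linarith
        then show ?thesis using usub \<theta>(1) wy unfolding subsol_def by simp
      next
        case False
        then have wy: "w y = \<Phi> y + \<delta>" by (simp add: w_def)
        have yW: "y \<in> W'" using False \<gamma>(2)[of y] \<delta>(2) by (meson add_left_mono order_trans)
        have "differential A \<Phi> y = differential A \<theta> y"
        proof (rule differential_at_max[OF \<Phi>1 \<theta>(1)])
          fix x show "\<Phi> x - \<theta> x \<le> \<Phi> y - \<theta> y"
            using \<theta>(2)[rule_format, of x] wy unfolding w_def by linarith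
        qed
        moreover have "\<bar>l * w y - l * u x0\<bar> < \<epsilon>"
        proof -
          have "\<bar>w y - u x0\<bar> \<le> 2 * \<epsilon>'" using yW \<delta> unfolding wy W'_def by (auto simp: abs_le_iff abs_less_iff)
          then have "\<bar>l\<bar> * \<bar>w y - u x0\<bar> \<le> \<bar>l\<bar> * (2 * \<epsilon>')" by (intro mult_left_mono) auto
          then show ?thesis using l\<epsilon> by (simp add: right_diff_distrib[symmetric] abs_mult)
        qed
        then have "H y (differential A \<Phi> y) (l * w y) + e y < k" using yW by (intro W(4)) (auto simp: W'_def)
        ultimately show ?thesis by simp
      qed
    qed
    moreover have "\<forall>x. f0 x \<le> w x" using up[OF fS] uw order_trans by blast
    ultimately have "w \<in> S" by (simp add: S_def)
    from up[OF this, of x0] show False using \<Phi>0 \<delta>(1) by (simp add: w_def)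
  qed
  then show ?thesis using usub up[OF fS] by blast
qed

end

context closed_manifold
begin

section \<open>Expansion of H at u = 0\<close>

lemma compactin_cotangent_chart:
  assumes c: "c \<in> A" and K: "compact K" "K \<subseteq> img c \<times> UNIV"
  shows "compactin (cotangent_topology A) ((\<lambda>(y, \<xi>). (chart_inv c y, cov c (chart_inv c y) \<xi>)) ` K)"
  by (rule image_compactin[OF _ continuous_map_cotangent_param[OF c]]) (use K in \<open>simp add: compactin_subtopology\<close>)

end

locale discounted_hamiltonian = hamiltonian A g n ch ctr rad H
  for A :: "('m::t2_space, 'e::euclidean_space) chart set" and g n ch ctr rad H +
  assumes H_diff: "\<And>x p. H x p field_differentiable (at 0)"
    and H_deriv_pos: "\<And>x p. deriv (H x p) 0 > 0"
    and H_modulus: "\<And>S. compactin (cotangent_topology A) S \<Longrightarrow>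
           \<exists>\<eta>. modulus_of_continuity \<eta> \<and>
             (\<forall>(x, p)\<in>S. \<forall>u. \<bar>H x p u - H x p 0 - u * deriv (H x p) 0\<bar> \<le> \<bar>u\<bar> * \<eta> \<bar>u\<bar>)"
    and L_diff: "\<And>x v. lagrangian H x v field_differentiable (at 0)"
begin

definition bh :: "real \<times> 'e \<Rightarrow> 'e \<Rightarrow> real" where "bh z \<xi> = deriv (H (pt z) (bcov z \<xi>)) 0"

text \<open>The momenta of norm at most P over all balls form one compact subset of the cotangent
  bundle, so a single modulus serves; it is traded for an error \<epsilon>|u| on a fixed
  interval.\<close>

lemma bH_expansion: assumes "\<epsilon> > 0"
  shows "\<exists>s>0. s \<le> 1 \<and> (\<forall>z\<in>base. \<forall>\<xi>. norm \<xi> \<le> P \<longrightarrow> (\<forall>u. \<bar>u\<bar> \<le> s \<longrightarrow> \<bar>bH z \<xi> u - bH z \<xi> 0 - u * bh z \<xi>\<bar> \<le> \<epsilon> * \<bar>u\<bar>))"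
proof -
  define S where "S i = (\<lambda>(y, \<xi>). (chart_inv (ch i) y, cov (ch i) (chart_inv (ch i) y) \<xi>)) ` (cball (ctr i) (rad i) \<times> cball 0 P)" for i
  have "compactin (cotangent_topology A) (\<Union>i<n. S i)"
  proof (rule compactin_Union)
    fix T assume "T \<in> S ` {..<n}"
    then obtain i where i: "i < n" "T = S i" by auto
    show "compactin (cotangent_topology A) T" unfolding i(2) S_def
      by (rule compactin_cotangent_chart[OF cover(1)[OF i(1)]]) (use cball_img[OF i(1)] in \<open>auto intro!: compact_Times\<close>)
  qed simp
  from H_modulus[OF this] obtain \<eta> where \<eta>: "modulus_of_continuity \<eta>"
    "\<forall>(x, p)\<in>(\<Union>i<n. S i). \<forall>u. \<bar>H x p u - H x p 0 - u * deriv (H x p) 0\<bar> \<le> \<bar>u\<bar> * \<eta> \<bar>u\<bar>" by blast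
  have "(\<eta> \<longlongrightarrow> 0) (at_right 0)" using \<eta>(1) by (simp add: modulus_of_continuity_def)
  then have "\<forall>\<^sub>F r in at_right 0. \<eta> r < \<epsilon>" using assms by (rule order_tendstoD(2))
  then obtain b where b: "b > 0" "\<And>r. 0 < r \<Longrightarrow> r < b \<Longrightarrow> \<eta> r < \<epsilon>"
    unfolding eventually_at_right_field by blast
  have "\<bar>bH z \<xi> u - bH z \<xi> 0 - u * bh z \<xi>\<bar> \<le> \<epsilon> * \<bar>u\<bar>"
    if z: "z \<in> base" and \<xi>: "norm \<xi> \<le> P" and u: "\<bar>u\<bar> \<le> min 1 (b / 2)" for z \<xi> u
  proof -
    have "(snd z, \<xi>) \<in> cball (ctr (idx z)) (rad (idx z)) \<times> cball 0 P" using baseD(2)[OF z] \<xi> by auto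
    then have "(pt z, bcov z \<xi>) \<in> S (idx z)" unfolding S_def pt_def bcov_def bch_def by force
    then have "(pt z, bcov z \<xi>) \<in> (\<Union>i<n. S i)" using baseD(1)[OF z] by blast
    from bspec[OF \<eta>(2) this] have 1: "\<bar>bH z \<xi> u - bH z \<xi> 0 - u * bh z \<xi>\<bar> \<le> \<bar>u\<bar> * \<eta> \<bar>u\<bar>" by (simp add: bH_def bh_def)
    show ?thesis
    proof (cases "u = 0")
      case False
      then have "\<eta> \<bar>u\<bar> < \<epsilon>" using u b(1) by (intro b(2)) auto
      then have "\<bar>u\<bar> * \<eta> \<bar>u\<bar> \<le> \<bar>u\<bar> * \<epsilon>" by (intro mult_left_mono) auto
      then show ?thesis using 1 by (simp add: mult.commute)
    qed simp
  qed
  then show ?thesis using b(1) by (intro exI[of _ "min 1 (b / 2)"]) auto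
qed

text \<open>The derivative in u is given only pointwise; its continuity follows because the
  expansion makes difference quotients converge uniformly on compact sets.\<close>

lemma continuous_bh: "continuous_on (base \<times> cball 0 P) (\<lambda>(z, \<xi>). bh z \<xi>)"
proof -
  define D where "D k q = real (Suc k) * (bH (fst q) (snd q) (1 / real (Suc k)) - bH (fst q) (snd q) 0)" for k and q :: "(real \<times> 'e) \<times> 'e"
  have cD: "continuous_on (base \<times> cball 0 P) (D k)" for k unfolding D_def
    by (intro continuous_intros continuous_bH_compose) auto
  have "uniform_limit (base \<times> cball 0 P) D (\<lambda>q. bh (fst q) (snd q)) sequentially"
    unfolding uniform_limit_iff
  proof (intro allI impI)
    fix e :: real assume e: "e > 0"
    obtain s where s: "s > 0" "\<And>z \<xi> u. z \<in> base \<Longrightarrow> norm \<xi> \<le> P \<Longrightarrow> \<bar>u\<bar> \<le> s \<Longrightarrow> \<bar>bH z \<xi> u - bH z \<xi> 0 - u * bh z \<xi>\<bar> \<le> e / 2 * \<bar>u\<bar>"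
      using bH_expansion[of "e / 2" P] e by auto
    obtain K where K: "1 / real (Suc K) < s" using s(1) nat_approx_posE by blast
    have "dist (D k q) (bh (fst q) (snd q)) < e" if "k \<ge> K" "q \<in> base \<times> cball 0 P" for k q
    proof -
      let ?u = "1 / real (Suc k)"
      have "?u \<le> 1 / real (Suc K)" using that(1) by (simp add: frac_le)
      then have "\<bar>?u\<bar> \<le> s" using K by simp
      from s(2)[OF _ _ this, of "fst q" "snd q"] that(2)
      have "\<bar>bH (fst q) (snd q) ?u - bH (fst q) (snd q) 0 - ?u * bh (fst q) (snd q)\<bar> \<le> e / 2 * ?u" by (auto simp: mem_Times_iff)
      then have "real (Suc k) * \<bar>bH (fst q) (snd q) ?u - bH (fst q) (snd q) 0 - ?u * bh (fst q) (snd q)\<bar> \<le> real (Suc k) * (e / 2 * ?u)"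
        by (intro mult_left_mono) auto
      moreover have "real (Suc k) * \<bar>bH (fst q) (snd q) ?u - bH (fst q) (snd q) 0 - ?u * bh (fst q) (snd q)\<bar> = \<bar>D k q - bh (fst q) (snd q)\<bar>"
      proof -
        have "D k q - bh (fst q) (snd q) = real (Suc k) * (bH (fst q) (snd q) ?u - bH (fst q) (snd q) 0 - ?u * bh (fst q) (snd q))"
          by (simp add: D_def right_diff_distrib)
        then show ?thesis by (simp only: abs_mult abs_of_nat)
      qed
      moreover have "real (Suc k) * (e / 2 * ?u) = e / 2" by (simp del: of_nat_Suc)
      ultimately have "\<bar>D k q - bh (fst q) (snd q)\<bar> \<le> e / 2" by linarith
      then show ?thesis using e unfolding dist_real_def by linarith
    qed
    then show "\<forall>\<^sub>F k in sequentially. \<forall>q\<in>base \<times> cball 0 P. dist (D k q) (bh (fst q) (snd q)) < e"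
      unfolding eventually_sequentially by blast
  qed
  from uniform_limit_theorem[OF _ this] cD show ?thesis by (simp add: split_beta)
qed

lemma bh_pos: "bh z \<xi> > 0" using H_deriv_pos by (simp add: bh_def)

lemma bh_lower: assumes "P \<ge> 0" shows "\<exists>h>0. \<forall>z\<in>base. \<forall>\<xi>. norm \<xi> \<le> P \<longrightarrow> bh z \<xi> \<ge> h"
proof -
  have "base \<times> cball (0::'e) P \<noteq> {}" using base_nonempty assms by auto
  from continuous_attains_inf[OF compact_Times[OF compact_base compact_cball] this continuous_bh]
  obtain q where "\<forall>y\<in>base \<times> cball 0 P. (case q of (z, \<xi>) \<Rightarrow> bh z \<xi>) \<le> (case y of (z, \<xi>) \<Rightarrow> bh z \<xi>)" by blast
  then show ?thesis using bh_pos by (intro exI[of _ "case q of (z, \<xi>) \<Rightarrow> bh z \<xi>"]) (auto simp: split_beta)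
qed

section \<open>The critical value and uniform bounds\<close>

abbreviation crit :: real where "crit \<equiv> critical_value A (\<lambda>x p. H x p 0)"

lemma bdd_above_H_differential: assumes "C1_fun A f" shows "bdd_above (range (\<lambda>x. H x (differential A f x) 0))"
proof -
  have "continuous_on UNIV (\<lambda>x. (x, 0::real))" by (intro continuous_intros)
  from continuous_on_compose2[OF continuous_H_differential[OF assms continuous_on_const[of _ 0]] this]
  have "continuous_on UNIV (\<lambda>x. H x (differential A f x) 0)" by simp
  from bounded_on_M[OF this] obtain B where "\<And>x. \<bar>H x (differential A f x) 0\<bar> \<le> B" by blast
  then show ?thesis by (intro bdd_aboveI[of _ B]) (auto simp: abs_le_iff)
qed

text \<open>At a maximum of f its differential vanishes, so every supremum in the family dominates
  some value H(x,0,0).\<close>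

lemma bdd_below_critical: "bdd_below ((\<lambda>f. SUP x. H x (differential A f x) 0) ` {f. C1_fun A f})"
proof -
  have "continuous_on UNIV (\<lambda>x. (x, 0::real))" by (intro continuous_intros)
  from continuous_on_compose2[OF continuous_H_differential[OF C1_const[of 0] continuous_on_const[of _ 0]] this]
  have "continuous_on UNIV (\<lambda>x. H x 0 0)" by (simp add: differential_const)
  from bounded_on_M[OF this] obtain B where B: "\<And>x. \<bar>H x 0 0\<bar> \<le> B" by blast
  show ?thesis
  proof (rule bdd_belowI2[of _ "- B"])
    fix f assume "f \<in> {f. C1_fun A f}"
    then have f: "C1_fun A f" by simp
    obtain x0 where "\<And>x. f x \<le> f x0" using continuous_attains_sup[OF compact_M _ C1_continuous[OF f]] by auto
    then have "differential A f x0 = differential A (\<lambda>_. 0) x0" by (intro differential_at_max[OF f C1_const]) simp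
    then have "- B \<le> H x0 (differential A f x0) 0" using B[of x0] by (simp add: differential_const abs_le_iff)
    also have "\<dots> \<le> (SUP x. H x (differential A f x) 0)" by (rule cSUP_upper[OF UNIV_I bdd_above_H_differential[OF f]])
    finally show "- B \<le> (SUP x. H x (differential A f x) 0)" .
  qed
qed

lemma crit_le: assumes "C1_fun A f" "\<And>x. H x (differential A f x) 0 \<le> b" shows "crit \<le> b"
proof -
  have "crit \<le> (SUP x. H x (differential A f x) 0)" unfolding critical_value_def
    by (rule cINF_lower[OF bdd_below_critical]) (use assms in auto)
  also have "\<dots> \<le> b" by (rule cSUP_least) (use assms in auto)
  finally show ?thesis .
qed

lemma crit_approx: assumes "\<epsilon> > 0" shows "\<exists>f. C1_fun A f \<and> (\<forall>x. H x (differential A f x) 0 \<le> crit + \<epsilon>)"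
proof -
  have "{f. C1_fun A f} \<noteq> {}" using C1_const[of 0] by blast
  from cINF_less_iff[OF this bdd_below_critical, of "crit + \<epsilon>"]
  obtain f where f: "C1_fun A f" "(SUP x. H x (differential A f x) 0) < crit + \<epsilon>"
    using assms unfolding critical_value_def by auto
  have "H x (differential A f x) 0 \<le> crit + \<epsilon>" for x
    using cSUP_upper[OF UNIV_I bdd_above_H_differential[OF f(1)], of x] f(2) by linarith
  then show ?thesis using f(1) by blast
qed

text \<open>Near u = 0 monotonicity acquires a linear rate, uniform over a sublevel set. The level u
  = -1 is used because, by monotonicity, its sublevel set contains those of all levels u \<ge> -1.
  Half of the derivative bound pays for the expansion error.\<close>

lemma sublevel_expansion:
  "\<exists>h>0. \<exists>s0>0. s0 \<le> 1 \<and> (\<forall>x p s. H x p (-1) \<le> C \<longrightarrow> 0 \<le> s \<longrightarrow> s \<le> s0 \<longrightarrow>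
      H x p s \<ge> H x p 0 + s * h \<and> H x p (- s) \<le> H x p 0 - s * h)"
proof -
  have nice: "coercive_hamiltonian (\<lambda>x p. H x p (-1) + 0)" by (rule coercive_frozen) auto
  obtain P where P: "P > 0" "\<forall>z\<in>base. \<forall>\<xi>. H (pt z) (bcov z \<xi>) (-1) + 0 \<le> C \<longrightarrow> norm \<xi> \<le> P"
    using bounded_bN[OF nice, of C] by blast
  obtain h where h: "h > 0" "\<forall>z\<in>base. \<forall>\<xi>. norm \<xi> \<le> P \<longrightarrow> bh z \<xi> \<ge> h" using bh_lower[of P] P(1) by auto
  obtain s0 where s0: "s0 > 0" "s0 \<le> 1" "\<And>z \<xi> u. z \<in> base \<Longrightarrow> norm \<xi> \<le> P \<Longrightarrow> \<bar>u\<bar> \<le> s0 \<Longrightarrow> \<bar>bH z \<xi> u - bH z \<xi> 0 - u * bh z \<xi>\<bar> \<le> h / 2 * \<bar>u\<bar>"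
    using bH_expansion[of "h / 2" P] h(1) by auto
  have "H x p s \<ge> H x p 0 + s * (h / 2) \<and> H x p (- s) \<le> H x p 0 - s * (h / 2)"
    if a: "H x p (-1) \<le> C" "0 \<le> s" "s \<le> s0" for x p s
  proof -
    obtain z where z: "z \<in> base" "pt z = x" using pt_surj by blast
    obtain \<xi> where \<xi>: "p = bcov z \<xi>" using bcov_surj[OF z(1)] by blast
    have nP: "norm \<xi> \<le> P" using P(2) z \<xi> a(1) by auto
    have hb: "s * h \<le> s * bh z \<xi>" using h(2) z(1) nP a(2) by (intro mult_left_mono) auto
    have 1: "\<bar>H x p s - H x p 0 - s * bh z \<xi>\<bar> \<le> h / 2 * s" using s0(3)[OF z(1) nP, of s] a by (simp add: bH_def z \<xi>)
    have 2: "\<bar>H x p (- s) - H x p 0 + s * bh z \<xi>\<bar> \<le> h / 2 * s" using s0(3)[OF z(1) nP, of "- s"] a by (simp add: bH_def z \<xi>)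
    show ?thesis using 1 2 hb unfolding abs_le_iff by (auto simp: field_simps)
  qed
  then show ?thesis using h(1) s0(1,2) by (intro exI[of _ "h / 2"] conjI exI[of _ s0]) auto
qed

text \<open>By the rate of H in u near 0, a near-critical C^1 subsolution lowered by a constant is a
  subsolution of the discounted equation. Conversely no subsolution above it can exceed K'
  everywhere: smoothing it would give a C^1 function with H(x,df,0) below the critical value. The
  common oscillation bound D turns both facts into bounds independent of \<lambda>.\<close>

lemma existence_small:
  assumes l1: "l1 > 0" and Vc: "\<And>l. 0 < l \<Longrightarrow> l \<le> l1 \<Longrightarrow> continuous_on UNIV (\<lambda>x. V x l)"
    and Vb: "\<And>l x. 0 < l \<Longrightarrow> l \<le> l1 \<Longrightarrow> \<bar>V x l\<bar> \<le> Vm"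
  shows "\<exists>l0>0. l0 \<le> l1 \<and> (\<exists>P>0. \<exists>B. \<forall>l. 0 < l \<longrightarrow> l \<le> l0 \<longrightarrow>
     (\<exists>u. subsol (\<lambda>x p. H x p (l * u x) + l * V x l - crit) u \<and> supersol (\<lambda>x p. H x p (l * u x) + l * V x l - crit) u \<and>
        chart_lipschitz P u \<and> (\<forall>x. \<bar>u x\<bar> \<le> B)))"
proof -
  \<comment> \<open>One Hamiltonian for all small \<lambda>: if \<lambda>w \<ge> -1 and \<lambda>(Vm
    + 1) \<le> 1, every discounted subsolution w is a subsolution of N0. Hence P and D are
    independent of \<lambda>.\<close>
  define N0 where "N0 = (\<lambda>x p. H x p (-1) + - (crit + 1))"
  have nice0: "coercive_hamiltonian N0" unfolding N0_def by (intro coercive_frozen) auto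
  obtain P where P: "P > 0" "\<And>u. subsol N0 u \<Longrightarrow> chart_lipschitz P u" using subsol_lipschitz[OF nice0] by blast
  obtain D where D: "D > 0" "\<And>u x y. chart_lipschitz P u \<Longrightarrow> \<bar>u x - u y\<bar> \<le> D"
    using chart_lipschitz_oscillation[of P] P(1) by auto
  obtain h s0 where hs: "h > 0" "s0 > 0" "s0 \<le> 1"
    and ex: "\<And>x p s. H x p (-1) \<le> crit + 2 \<Longrightarrow> 0 \<le> s \<Longrightarrow> s \<le> s0 \<Longrightarrow> H x p s \<ge> H x p 0 + s * h"
      "\<And>x p s. H x p (-1) \<le> crit + 2 \<Longrightarrow> 0 \<le> s \<Longrightarrow> s \<le> s0 \<Longrightarrow> H x p (- s) \<le> H x p 0 - s * h"
    using sublevel_expansion[of "crit + 2"] by blast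
  have Vm0: "Vm \<ge> 0" using Vb[of l1] l1 by (meson abs_ge_zero order_refl order_trans)
  \<comment> \<open>Lowering by K makes -\<lambda>f0 at least \<lambda>(K - D), a gain of
    \<lambda>(1 + Vm) in H: \<lambda> for the near-critical error of f' and \<lambda>Vm for the
    potential.\<close>
  define K where "K = D + (1 + Vm) / h"
  \<comment> \<open>K'h covers Vm for the potential, 1 for smoothing with error \<lambda>, and 1
    more to end strictly below the critical value.\<close>
  define K' where "K' = (Vm + 2) / h"
  have K: "(K - D) * h = 1 + Vm" "K > D" using hs Vm0 by (auto simp: K_def)
  have K': "K' * h = Vm + 2" "K' > 0" using hs Vm0 by (auto simp: K'_def)
  \<comment> \<open>These bounds keep \<lambda>f0 and \<lambda>K' within [-s0, s0], where the linear
    rate is valid, and ensure \<lambda>(Vm + 1) \<le> 1.\<close>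
  define l0 where "l0 = min (min l1 (s0 / (K + D))) (min (s0 / K') (1 / (Vm + 1)))"
  have KD: "K + D > 0" using K D by linarith
  have l0: "l0 > 0" "l0 \<le> l1" using l1 hs KD K' Vm0 by (auto simp: l0_def)
  have "\<exists>u. subsol (\<lambda>x p. H x p (l * u x) + l * V x l - crit) u \<and> supersol (\<lambda>x p. H x p (l * u x) + l * V x l - crit) u \<and>
        chart_lipschitz P u \<and> (\<forall>x. \<bar>u x\<bar> \<le> K + K' + D)" if l: "0 < l" "l \<le> l0" for l
  proof -
    have "l \<le> s0 / (K + D)" "l \<le> s0 / K'" "l \<le> 1 / (Vm + 1)" and ll1: "l \<le> l1" using l(2) by (auto simp: l0_def)
    then have lK: "l * (K + D) \<le> s0" and lK': "l * K' \<le> s0" and "l * (Vm + 1) \<le> 1"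
      using KD K'(2) Vm0 by (auto simp: le_divide_eq)
    then have lV: "l * Vm + l \<le> 1" by (simp add: algebra_simps)
    have lVm0: "l * Vm \<ge> 0" using l Vm0 by simp
    have V1: "\<bar>l * V x l\<bar> \<le> l * Vm" for x using Vb[OF l(1) ll1, of x] l(1) by (simp add: abs_mult)
    have e: "continuous_on UNIV (\<lambda>x. l * V x l)" using Vc[OF l(1) ll1] by (intro continuous_intros)
    obtain f' where f': "C1_fun A f'" "\<And>x. H x (differential A f' x) 0 \<le> crit + l" using crit_approx[OF l(1)] by blast
    have f'1: "H x (differential A f' x) (-1) \<le> crit + 1" for x
      using f'(2)[of x] H_mono[of "-1" 0 x "differential A f' x"] lV lVm0 by linarith
    have "chart_lipschitz P f'" by (intro P(2) C1_subsol f') (unfold N0_def, use f'1 in \<open>simp add: algebra_simps\<close>)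
    note osc = D(2)[OF this]
    \<comment> \<open>\<open>undefined\<close> is an arbitrary point at which f' is normalised; the
      oscillation bound makes its choice immaterial.\<close>
    define f0 where "f0 x = f' x + - (f' undefined + K)" for x
    have f0C: "C1_fun A f0" unfolding f0_def by (intro C1_add C1_const f')
    have df0: "differential A f0 x = differential A f' x" for x
      unfolding f0_def[abs_def] differential_add[OF f'(1) C1_const] by (simp add: differential_const)
    have f0b: "f0 x \<ge> - D - K" "f0 x \<le> D - K" for x using osc[of x undefined] by (auto simp: f0_def abs_le_iff)
    have f0sub: "subsol (\<lambda>x p. H x p (l * f0 x) + l * V x l - crit) f0"
    proof (rule C1_subsol[OF f0C])
      fix x
      let ?p = "differential A f' x"
      define s where "s = - (l * f0 x)"
      have s1: "s \<ge> l * (K - D)" "s \<le> l * (K + D)"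
        using mult_left_mono[OF f0b(1)[of x], of l] mult_left_mono[OF f0b(2)[of x], of l] l(1) by (auto simp: s_def algebra_simps)
      have s2: "0 \<le> s" "s \<le> s0"
      proof -
        have "l * (K - D) \<ge> 0" using l(1) K(2) by simp
        then show "0 \<le> s" "s \<le> s0" using s1 lK by linarith+
      qed
      have "H x ?p (- s) \<le> H x ?p 0 - s * h" using f'1[of x] by (intro ex(2) s2) auto
      moreover have "s * h \<ge> l * (1 + Vm)"
        using mult_right_mono[OF s1(1), of h] hs(1) K(1) by (simp add: mult.assoc)
      ultimately have "H x ?p (l * f0 x) \<le> crit + l - l * (1 + Vm)" using f'(2)[of x] by (simp add: s_def)
      then show "H x (differential A f0 x) (l * f0 x) + l * V x l - crit \<le> 0"
        using V1[of x] unfolding df0 by (simp add: abs_le_iff algebra_simps)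
    qed
    have fam: "chart_lipschitz P w \<and> (\<forall>x. w x \<le> K' + D)"
      if w: "subsol (\<lambda>x p. H x p (l * w x) + l * V x l - crit) w" "\<And>x. f0 x \<le> w x" for w
    proof -
      have "l * w x \<ge> -1" for x
      proof -
        have "l * w x \<ge> l * (- D - K)" using w(2)[of x] f0b(1)[of x] l(1) by (intro mult_left_mono) auto
        then show ?thesis using lK hs(3) by (simp add: algebra_simps)
      qed
      then have "subsol N0 w"
      proof (intro subsol_mono[OF w(1)])
        fix x p assume h: "\<And>x. l * w x \<ge> -1"
        show "N0 x p \<le> H x p (l * w x) + l * V x l - crit"
          using H_mono[OF h[of x], of x p] V1[of x] lV l(1) unfolding N0_def abs_le_iff by linarith
      qed
      then have lip: "chart_lipschitz P w" by (rule P(2))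
      have "\<exists>x. w x \<le> K'"
      proof (rule ccontr)
        assume "\<not> (\<exists>x. w x \<le> K')"
        then have big: "K' \<le> w x" for x by (meson linear)
        define N1 where "N1 = (\<lambda>x p. H x p (l * K') + - (crit + l * Vm))"
        have nice1: "coercive_hamiltonian N1" unfolding N1_def by (intro coercive_frozen) auto
        have "subsol N1 w"
        proof (rule subsol_mono[OF w(1)])
          fix x p
          have "H x p (l * K') \<le> H x p (l * w x)" using big[of x] l(1) by (intro H_mono mult_left_mono) auto
          then show "N1 x p \<le> H x p (l * w x) + l * V x l - crit" using V1[of x] unfolding N1_def abs_le_iff by linarith
        qed
        from subsol_smoothing[OF nice1 this l(1)] obtain f where f: "C1_fun A f" "\<And>x. N1 x (differential A f x) \<le> l" by blast
        have "H x (differential A f x) 0 \<le> crit - l" for x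
        proof -
          let ?p = "differential A f x"
          have 1: "H x ?p (l * K') \<le> crit + l * Vm + l" using f(2)[of x] by (simp add: N1_def)
          have lk0: "l * K' \<ge> 0" using l(1) K'(2) by simp
          have "H x ?p (-1) \<le> H x ?p (l * K')" using lk0 by (intro H_mono) linarith
          then have "H x ?p (-1) \<le> crit + 2" using 1 lV by linarith
          from ex(1)[OF this lk0 lK'] have "H x ?p 0 \<le> H x ?p (l * K') - l * (K' * h)" by (simp add: mult.assoc)
          then show ?thesis using 1 unfolding K'(1) by (simp add: algebra_simps)
        qed
        from crit_le[OF f(1) this] show False using l(1) by simp
      qed
      then obtain x1 where "w x1 \<le> K'" by blast
      then have "w x \<le> K' + D" for x using D(2)[OF lip, of x x1] by (simp add: abs_le_iff)
      then show ?thesis using lip by blast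
    qed
    obtain u where u: "subsol (\<lambda>x p. H x p (l * u x) + l * V x l - crit) u" "supersol (\<lambda>x p. H x p (l * u x) + l * V x l - crit) u" "\<And>x. f0 x \<le> u x"
      using perron[OF e f0sub fam] by blast
    from fam[OF u(1,3)] have "chart_lipschitz P u" "\<And>x. u x \<le> K' + D" by auto
    moreover have "\<bar>u x\<bar> \<le> K + K' + D" for x
      using u(3)[of x] f0b(1)[of x] \<open>\<And>x. u x \<le> K' + D\<close>[of x] K(2) K'(2) D(1) unfolding abs_le_iff by linarith
    ultimately show ?thesis using u(1,2) by blast
  qed
  then show ?thesis using l0 P(1) by blast
qed

end

section \<open>The Lagrangian\<close>

text \<open>The graph point is separated from the strict epigraph. The normal cannot be horizontal
  because f is finite on the whole space; dividing by its vertical component gives the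
  slope.\<close>

lemma convex_subgradient:
  fixes f :: "'e::euclidean_space \<Rightarrow> real"
  assumes conv: "convex_on UNIV f"
  shows "\<exists>w. \<forall>\<eta>. f \<eta> \<ge> f \<xi> + (\<eta> - \<xi>) \<bullet> w"
proof -
  define T where "T = {q :: 'e \<times> real. f (fst q) < snd q}"
  have "convex T"
  proof (rule convexI)
    fix q r and s t :: real assume h: "q \<in> T" "r \<in> T" "0 \<le> s" "0 \<le> t" "s + t = 1"
    have "f (s *\<^sub>R fst q + t *\<^sub>R fst r) \<le> s * f (fst q) + t * f (fst r)"
      using conv h unfolding convex_on_def by auto
    also have "\<dots> < s * snd q + t * snd r"
    proof (cases "s = 0")
      case True then show ?thesis using h by (simp add: T_def)
    next
      case False
      then have "s * f (fst q) < s * snd q" using h by (simp add: T_def)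
      moreover have "t * f (fst r) \<le> t * snd r" using h by (intro mult_left_mono) (auto simp: T_def)
      ultimately show ?thesis by linarith
    qed
    finally show "s *\<^sub>R q + t *\<^sub>R r \<in> T" by (simp add: T_def)
  qed
  moreover have "(\<xi>, f \<xi> + 1) \<in> T" by (simp add: T_def)
  then have "T \<noteq> {}" by blast
  moreover have "{(\<xi>, f \<xi>)} \<inter> T = {}" by (simp add: T_def)
  ultimately have "\<exists>a b. a \<noteq> 0 \<and> (\<forall>q\<in>{(\<xi>, f \<xi>)}. a \<bullet> q \<le> b) \<and> (\<forall>q\<in>T. b \<le> a \<bullet> q)"
    by (intro separating_hyperplane_sets) simp_all
  then obtain a b where ab: "a \<noteq> 0" "a \<bullet> (\<xi>, f \<xi>) \<le> b" "\<And>q. q \<in> T \<Longrightarrow> a \<bullet> q \<ge> b"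
    by blast
  obtain \<alpha> \<beta> where a: "a = (\<alpha>, \<beta>)" by fastforce
  have key: "\<alpha> \<bullet> \<xi> + \<beta> * f \<xi> \<le> \<alpha> \<bullet> \<eta> + \<beta> * t" if "f \<eta> < t" for \<eta> t
    using ab(2) ab(3)[of "(\<eta>, t)"] that by (simp add: a T_def)
  have \<beta>0: "\<beta> \<ge> 0" using key[of \<xi> "f \<xi> + 1"] by (simp add: algebra_simps)
  have \<beta>: "\<beta> > 0"
  proof (rule ccontr)
    assume "\<not> \<beta> > 0"
    then have b0: "\<beta> = 0" using \<beta>0 by linarith
    have "\<alpha> \<bullet> \<xi> \<le> \<alpha> \<bullet> (\<xi> - \<alpha>)" using key[of "\<xi> - \<alpha>" "f (\<xi> - \<alpha>) + 1"] b0 by simp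
    then have "\<alpha> \<bullet> \<alpha> \<le> 0" by (simp add: inner_diff_right)
    then have "\<alpha> = 0" using inner_gt_zero_iff[of \<alpha>] by linarith
    then show False using ab(1) a b0 by (simp add: zero_prod_def)
  qed
  have "f \<eta> \<ge> f \<xi> + (\<eta> - \<xi>) \<bullet> (- (1 / \<beta>) *\<^sub>R \<alpha>)" for \<eta>
  proof (rule field_le_epsilon)
    fix e :: real assume "e > 0"
    then have "\<alpha> \<bullet> \<xi> + \<beta> * f \<xi> \<le> \<alpha> \<bullet> \<eta> + \<beta> * (f \<eta> + e)" by (intro key) simp
    then have "\<beta> * (f \<xi> + (\<eta> - \<xi>) \<bullet> (- (1 / \<beta>) *\<^sub>R \<alpha>)) \<le> \<beta> * (f \<eta> + e)"
      using \<beta> by (simp add: inner_diff_left algebra_simps inner_commute)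
    then show "f \<xi> + (\<eta> - \<xi>) \<bullet> (- (1 / \<beta>) *\<^sub>R \<alpha>) \<le> f \<eta> + e" using \<beta> by simp
  qed
  then show ?thesis by blast
qed

context discounted_hamiltonian
begin

definition bL :: "real \<times> 'e \<Rightarrow> 'e \<Rightarrow> real \<Rightarrow> real" where "bL z w u = lagrangian H (pt z) (btv z w) u"
text \<open>The sign makes it positive: it equals the derivative of H in u at any momentum dual to
  w.\<close>

definition ba :: "real \<times> 'e \<Rightarrow> 'e \<Rightarrow> real" where "ba z w = - deriv (lagrangian H (pt z) (btv z w)) 0"

lemma bH_superlinear: assumes "R \<ge> 0" shows "\<exists>C. \<forall>z\<in>base. \<forall>\<xi>. bH z \<xi> u \<ge> R * norm \<xi> - C"
proof -
  have "\<forall>i\<in>{..<n}. \<exists>C. \<forall>y\<in>cball (ctr i) (rad i). \<forall>\<xi>. loc (\<lambda>x p. H x p u) (ch i) y \<xi> \<ge> R * norm \<xi> - C"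
    using H_chart_superlinear[OF cover(1) compact_cball cball_img assms] by blast
  from bchoice[OF this] obtain C where C: "\<And>i y \<xi>. i < n \<Longrightarrow> y \<in> cball (ctr i) (rad i) \<Longrightarrow> loc (\<lambda>x p. H x p u) (ch i) y \<xi> \<ge> R * norm \<xi> - C i" by blast
  show ?thesis
  proof (intro exI[of _ "\<Sum>i<n. \<bar>C i\<bar>"] ballI allI)
    fix z \<xi> assume z: "z \<in> base"
    have "bH z \<xi> u \<ge> R * norm \<xi> - C (idx z)"
      using C[OF baseD(1,2)[OF z], of \<xi>] by (simp add: bH_def pt_def bch_def bcov_def)
    moreover have "\<bar>C (idx z)\<bar> \<le> (\<Sum>i<n. \<bar>C i\<bar>)" using baseD(1)[OF z] by (intro member_le_sum) auto
    ultimately show "bH z \<xi> u \<ge> R * norm \<xi> - (\<Sum>i<n. \<bar>C i\<bar>)" by linarith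
  qed
qed

lemma bH_mono: "u \<le> u' \<Longrightarrow> bH z \<xi> u \<le> bH z \<xi> u'" by (simp add: bH_def H_mono)

lemma bL_eq: assumes "z \<in> base" shows "bL z w u = (SUP \<xi>. \<xi> \<bullet> w - bH z \<xi> u)"
proof -
  have "range (\<lambda>p. blinfun_apply p (btv z w) - H (pt z) p u) = range (\<lambda>\<xi>. \<xi> \<bullet> w - bH z \<xi> u)"
  proof (intro equalityI subsetI)
    fix t assume "t \<in> range (\<lambda>p. blinfun_apply p (btv z w) - H (pt z) p u)"
    then obtain p where p: "t = blinfun_apply p (btv z w) - H (pt z) p u" by blast
    obtain \<xi> where "p = bcov z \<xi>" using bcov_surj[OF assms] by blast
    then show "t \<in> range (\<lambda>\<xi>. \<xi> \<bullet> w - bH z \<xi> u)" using p assms by (auto simp: bcov_btv bH_def)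
  next
    fix t assume "t \<in> range (\<lambda>\<xi>. \<xi> \<bullet> w - bH z \<xi> u)"
    then obtain \<xi> where "t = blinfun_apply (bcov z \<xi>) (btv z w) - H (pt z) (bcov z \<xi>) u"
      using assms by (auto simp: bcov_btv bH_def)
    then show "t \<in> range (\<lambda>p. blinfun_apply p (btv z w) - H (pt z) p u)" by blast
  qed
  then show ?thesis by (simp add: bL_def lagrangian_def)
qed

lemma bL_bdd: assumes "z \<in> base" shows "bdd_above (range (\<lambda>\<xi>. \<xi> \<bullet> w - bH z \<xi> u))"
proof -
  obtain C where C: "\<forall>z\<in>base. \<forall>\<xi>. bH z \<xi> u \<ge> norm w * norm \<xi> - C" using bH_superlinear[of "norm w" u] by auto
  have "\<xi> \<bullet> w - bH z \<xi> u \<le> C" for \<xi>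
    using bspec[OF C assms, THEN spec, of \<xi>] norm_cauchy_schwarz[of \<xi> w] by (simp add: mult.commute)
  then show ?thesis by (intro bdd_aboveI[of _ C]) auto
qed

lemma bL_fenchel: assumes "z \<in> base" shows "\<xi> \<bullet> w - bH z \<xi> u \<le> bL z w u"
  unfolding bL_eq[OF assms] by (rule cSUP_upper[OF UNIV_I bL_bdd[OF assms]])

lemma fenchel: "blinfun_apply p v - H x p u \<le> lagrangian H x v u"
proof -
  obtain z where z: "z \<in> base" "pt z = x" using pt_surj by blast
  obtain \<xi> where \<xi>: "p = bcov z \<xi>" using bcov_surj[OF z(1)] by blast
  obtain w where w: "v = btv z w" using btv_surj[OF z(1)] by blast
  show ?thesis using bL_fenchel[OF z(1), of \<xi> w u] unfolding bL_def bH_def \<xi> w z(2)[symmetric] bcov_btv[OF z(1)] .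
qed

text \<open>Superlinearity at u = -1 bounds H from below at all levels |u| \<le> 1, so one ball
  contains maximisers for all such u and all w of bounded norm.\<close>

lemma bL_attained: "\<exists>Q>0. \<forall>z\<in>base. \<forall>w u. norm w \<le> R \<longrightarrow> \<bar>u\<bar> \<le> 1 \<longrightarrow> (\<exists>\<xi>. norm \<xi> \<le> Q \<and> bL z w u = \<xi> \<bullet> w - bH z \<xi> u)"
proof -
  obtain C where C: "\<forall>z\<in>base. \<forall>\<xi>. bH z \<xi> (-1) \<ge> (\<bar>R\<bar> + 1) * norm \<xi> - C" using bH_superlinear[of "\<bar>R\<bar> + 1" "-1"] by auto
  have "continuous_on base (\<lambda>z. bH z 0 1)" by (intro continuous_bH_compose continuous_intros) auto
  from compact_imp_bounded[OF compact_continuous_image[OF this compact_base]]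
  obtain C0 where C0: "\<And>z. z \<in> base \<Longrightarrow> bH z 0 1 \<le> C0" unfolding bounded_iff by (auto simp: abs_le_iff)
  \<comment> \<open>Beyond this radius the objective is below -C0, hence below its value at the
    momentum 0.\<close>
  define Q where "Q = \<bar>C\<bar> + \<bar>C0\<bar> + 1"
  have "\<exists>\<xi>. norm \<xi> \<le> Q \<and> bL z w u = \<xi> \<bullet> w - bH z \<xi> u" if z: "z \<in> base" and w: "norm w \<le> R" and u: "\<bar>u\<bar> \<le> 1" for z w u
  proof -
    have "continuous_on (cball 0 Q) (\<lambda>\<xi>. \<xi> \<bullet> w - bH z \<xi> u)"
      by (intro continuous_intros continuous_bH_compose) (use z in auto)
    moreover have "cball (0::'e) Q \<noteq> {}" by (simp add: Q_def)
    ultimately obtain \<xi> where \<xi>: "norm \<xi> \<le> Q" "\<And>\<xi>'. norm \<xi>' \<le> Q \<Longrightarrow> \<xi>' \<bullet> w - bH z \<xi>' u \<le> \<xi> \<bullet> w - bH z \<xi> u"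
      using continuous_attains_sup[of "cball (0::'e) Q" "\<lambda>\<xi>. \<xi> \<bullet> w - bH z \<xi> u"] by auto
    have "\<xi>' \<bullet> w - bH z \<xi>' u \<le> \<xi> \<bullet> w - bH z \<xi> u" for \<xi>'
    proof (cases "norm \<xi>' \<le> Q")
      case False
      have "\<xi>' \<bullet> w \<le> norm \<xi>' * \<bar>R\<bar>"
        using norm_cauchy_schwarz[of \<xi>' w] mult_left_mono[of "norm w" "\<bar>R\<bar>" "norm \<xi>'"] w by fastforce
      moreover have "bH z \<xi>' (-1) \<ge> (\<bar>R\<bar> + 1) * norm \<xi>' - C" using C z by blast
      moreover have "bH z \<xi>' u \<ge> bH z \<xi>' (-1)" using u by (intro bH_mono) auto
      ultimately have "\<xi>' \<bullet> w - bH z \<xi>' u \<le> C - norm \<xi>'" by (simp add: algebra_simps)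
      also have "\<dots> \<le> - C0" using False by (simp add: Q_def)
      also have "\<dots> \<le> - bH z 0 1" using C0[OF z] by simp
      also have "\<dots> \<le> - bH z 0 u" using bH_mono[of u 1 z 0] u by auto
      also have "\<dots> \<le> \<xi> \<bullet> w - bH z \<xi> u" using \<xi>(2)[of 0] by (simp add: Q_def)
      finally show ?thesis .
    qed (rule \<xi>(2))
    then have "bL z w u \<le> \<xi> \<bullet> w - bH z \<xi> u" unfolding bL_eq[OF z] by (intro cSUP_least) auto
    with bL_fenchel[OF z, of \<xi> w u] \<xi>(1) show ?thesis by (intro exI[of _ \<xi>]) auto
  qed
  moreover have "Q > 0" by (simp add: Q_def)
  ultimately show ?thesis by blast
qed

text \<open>The converse passage, from momenta to velocities: a subgradient of H at \<xi> is a
  velocity at which Fenchel's inequality is an equality. Its uniform bound allows the duality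
  argument to be confined to a compact set of velocities.\<close>

lemma bL_subgradient: "\<exists>R>0. \<forall>z\<in>base. \<forall>\<xi> u. norm \<xi> \<le> P \<longrightarrow> \<bar>u\<bar> \<le> 1 \<longrightarrow> (\<exists>w. norm w \<le> R \<and> bL z w u = \<xi> \<bullet> w - bH z \<xi> u)"
proof -
  let ?K = "(base \<times> cball (0::'e) (P + 1)) \<times> {-1..1::real}"
  have "continuous_on ?K (\<lambda>q. bH (fst (fst q)) (snd (fst q)) (snd q))"
    by (intro continuous_bH_compose continuous_intros) auto
  from compact_imp_bounded[OF compact_continuous_image[OF this]] obtain B where
    B: "\<And>z \<xi> u. z \<in> base \<Longrightarrow> norm \<xi> \<le> P + 1 \<Longrightarrow> \<bar>u\<bar> \<le> 1 \<Longrightarrow> \<bar>bH z \<xi> u\<bar> \<le> B"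
    unfolding bounded_iff by (force simp: compact_Times compact_base abs_le_iff)
  have "\<exists>w. norm w \<le> 2 * \<bar>B\<bar> + 1 \<and> bL z w u = \<xi> \<bullet> w - bH z \<xi> u" if z: "z \<in> base" and \<xi>: "norm \<xi> \<le> P" and u: "\<bar>u\<bar> \<le> 1" for z \<xi> u
  proof -
    have "convex_on UNIV (\<lambda>\<xi>. bH z \<xi> u)"
    proof (rule convex_onI)
      fix t \<xi> \<zeta> assume "0 < (t::real)" "t < 1"
      then show "bH z ((1 - t) *\<^sub>R \<xi> + t *\<^sub>R \<zeta>) u \<le> (1 - t) * bH z \<xi> u + t * bH z \<zeta> u"
        using convex_onD[OF H_convex[of "pt z" u], of t] by (simp add: bH_def bcov_lin[OF z])
    qed simp
    from convex_subgradient[OF this, of \<xi>] obtain w where w: "\<And>\<eta>. bH z \<eta> u \<ge> bH z \<xi> u + (\<eta> - \<xi>) \<bullet> w" by blast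
    have "bL z w u \<le> \<xi> \<bullet> w - bH z \<xi> u" unfolding bL_eq[OF z]
    proof (rule cSUP_least)
      fix \<eta> show "\<eta> \<bullet> w - bH z \<eta> u \<le> \<xi> \<bullet> w - bH z \<xi> u" using w[of \<eta>] by (simp add: inner_diff_left)
    qed simp
    then have eq: "bL z w u = \<xi> \<bullet> w - bH z \<xi> u" using bL_fenchel[OF z, of \<xi> w u] by linarith
    have "norm w \<le> 2 * \<bar>B\<bar> + 1"
    proof (cases "w = 0")
      case False
      \<comment> \<open>A unit step from \<xi> in the direction of w raises H by at least the norm
        of w, while H is bounded on the enlarged ball.\<close>
      define \<eta> where "\<eta> = \<xi> + (1 / norm w) *\<^sub>R w"
      have "norm \<eta> \<le> P + 1" unfolding \<eta>_def using norm_triangle_ineq[of \<xi> "(1 / norm w) *\<^sub>R w"] \<xi> False by simp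
      then have "\<bar>bH z \<eta> u\<bar> \<le> B" using B[OF z _ u] by blast
      moreover have "\<bar>bH z \<xi> u\<bar> \<le> B" using B[OF z _ u, of \<xi>] \<xi> by simp
      moreover have "(\<eta> - \<xi>) \<bullet> w = norm w" using False by (simp add: \<eta>_def power2_norm_eq_inner[symmetric] power2_eq_square)
      ultimately show ?thesis using w[of \<eta>] unfolding abs_le_iff by linarith
    qed simp
    then show ?thesis using eq by blast
  qed
  then show ?thesis by (intro exI[of _ "2 * \<bar>B\<bar> + 1"]) auto
qed

text \<open>Fenchel's inequality at the unit momentum in the direction of w.\<close>

lemma bL_coercive: "\<exists>R>0. \<forall>z\<in>base. \<forall>w. bL z w 0 \<le> C \<longrightarrow> norm w \<le> R"
proof -
  have "continuous_on (base \<times> cball (0::'e) 1) (\<lambda>q. bH (fst q) (snd q) 0)"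
    by (intro continuous_bH_compose continuous_intros) auto
  from compact_imp_bounded[OF compact_continuous_image[OF this]] obtain B where
    B: "\<And>z \<xi>. z \<in> base \<Longrightarrow> norm \<xi> \<le> 1 \<Longrightarrow> \<bar>bH z \<xi> 0\<bar> \<le> B"
    unfolding bounded_iff by (force simp: compact_Times compact_base)
  have "norm w \<le> \<bar>C\<bar> + \<bar>B\<bar> + 1" if z: "z \<in> base" "bL z w 0 \<le> C" for z w
  proof (cases "w = 0")
    case False
    define \<xi> where "\<xi> = (1 / norm w) *\<^sub>R w"
    have "norm \<xi> \<le> 1" using False by (simp add: \<xi>_def)
    then have "\<bar>bH z \<xi> 0\<bar> \<le> B" using B z by blast
    moreover have "\<xi> \<bullet> w = norm w" using False by (simp add: \<xi>_def power2_norm_eq_inner[symmetric] power2_eq_square)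
    ultimately show ?thesis using bL_fenchel[OF z(1), of \<xi> w 0] z(2) unfolding abs_le_iff by linarith
  qed simp
  then show ?thesis by (intro exI[of _ "\<bar>C\<bar> + \<bar>B\<bar> + 1"]) auto
qed

text \<open>At a maximiser \<open>\<xi>\<close> the function \<open>u \<mapsto> L(u) - (\<xi> \<bullet> w - H(\<xi>, u))\<close> has a minimum at \<open>0\<close>.\<close>

lemma ba_eq: assumes z: "z \<in> base" and \<xi>: "bL z w 0 = \<xi> \<bullet> w - bH z \<xi> 0" shows "ba z w = bh z \<xi>"
proof -
  have dL: "((\<lambda>u. bL z w u) has_real_derivative - ba z w) (at 0)"
    unfolding bL_def[abs_def] ba_def using L_diff[of "pt z" "btv z w"] by (simp add: field_differentiable_derivI)
  have dH: "((\<lambda>u. bH z \<xi> u) has_real_derivative bh z \<xi>) (at 0)"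
    unfolding bH_def[abs_def] bh_def using H_diff[of "pt z" "bcov z \<xi>"] by (simp add: field_differentiable_derivI)
  have "((\<lambda>u. bL z w u + bH z \<xi> u) has_real_derivative - ba z w + bh z \<xi>) (at 0)" by (rule DERIV_add[OF dL dH])
  moreover have "\<forall>u. \<bar>0 - u\<bar> < 1 \<longrightarrow> bL z w 0 + bH z \<xi> 0 \<le> bL z w u + bH z \<xi> u"
    using bL_fenchel[OF z, of \<xi> w] \<xi> by (auto simp: algebra_simps)
  ultimately have "- ba z w + bh z \<xi> = 0" by (rule DERIV_local_min[OF _ zero_less_one])
  then show ?thesis by simp
qed

text \<open>Being a maximiser is a family of closed conditions, one for each competing momentum, so
  closedness follows before any continuity of L is known.\<close>

lemma compact_maximizers:
  "compact {q \<in> ((base \<times> cball 0 R) \<times> {-1..1}) \<times> cball 0 Q.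
     case q of (((z, w), u), \<xi>) \<Rightarrow> bL z w u = \<xi> \<bullet> w - bH z \<xi> u}" (is "compact ?G")
proof -
  let ?B = "((base \<times> cball (0::'e) R) \<times> {-1..1::real}) \<times> cball (0::'e) Q"
  have compB: "compact ?B" by (intro compact_Times compact_base) auto
  let ?f = "\<lambda>\<xi>'. \<lambda>q. \<xi>' \<bullet> snd (fst (fst q)) - bH (fst (fst (fst q))) \<xi>' (snd (fst q))"
  let ?g = "\<lambda>q. snd q \<bullet> snd (fst (fst q)) - bH (fst (fst (fst q))) (snd q) (snd (fst q))"
  have eq: "?G = (\<Inter>\<xi>'. {q \<in> ?B. ?f \<xi>' q \<le> ?g q})"
  proof (intro equalityI subsetI)
    fix q assume q: "q \<in> ?G"
    then have "?f \<xi>' q \<le> ?g q" for \<xi>'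
      using bL_fenchel[of "fst (fst (fst q))" \<xi>' "snd (fst (fst q))" "snd (fst q)"] by (auto simp: split_beta)
    then show "q \<in> (\<Inter>\<xi>'. {q \<in> ?B. ?f \<xi>' q \<le> ?g q})" using q by auto
  next
    fix q assume q: "q \<in> (\<Inter>\<xi>'. {q \<in> ?B. ?f \<xi>' q \<le> ?g q})"
    then have qB: "q \<in> ?B" and le: "\<And>\<xi>'. ?f \<xi>' q \<le> ?g q" by auto
    have z: "fst (fst (fst q)) \<in> base" using qB by auto
    have "bL (fst (fst (fst q))) (snd (fst (fst q))) (snd (fst q)) \<le> ?g q"
      unfolding bL_eq[OF z] by (rule cSUP_least) (use le in auto)
    with bL_fenchel[OF z, of "snd q" "snd (fst (fst q))" "snd (fst q)"]
    show "q \<in> ?G" using qB by (auto simp: split_beta)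
  qed
  have "closed {q \<in> ?B. ?f \<xi>' q \<le> ?g q}" for \<xi>'
    by (intro continuous_on_closed_Collect_le continuous_intros continuous_bH_compose compact_imp_closed[OF compB]) auto
  then have "closed ?G" unfolding eq by (intro closed_INT) auto
  moreover have "?G = ?G \<inter> ?B" by auto
  ultimately show ?thesis using compB by (metis (no_types, lifting) closed_Int_compact)
qed

text \<open>Maximisers need not be unique, so there is no continuous selection to rely on. But if F
  takes the same value at all maximisers, the graph of G is a continuous image of a compact set, and
  a closed graph with values in a compact set gives continuity.\<close>

lemma continuous_from_maximizers:
  assumes F: "continuous_on ((base \<times> cball 0 R) \<times> cball 0 Q) F"
    and Q: "\<And>z w. z \<in> base \<Longrightarrow> norm w \<le> R \<Longrightarrow> \<exists>\<xi>. norm \<xi> \<le> Q \<and> bL z w 0 = \<xi> \<bullet> w - bH z \<xi> 0"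
    and G: "\<And>z w \<xi>. z \<in> base \<Longrightarrow> norm w \<le> R \<Longrightarrow> norm \<xi> \<le> Q \<Longrightarrow> bL z w 0 = \<xi> \<bullet> w - bH z \<xi> 0 \<Longrightarrow> G (z, w) = (F ((z, w), \<xi>) :: real)"
  shows "continuous_on (base \<times> cball 0 R) G"
proof -
  let ?B = "((base \<times> cball (0::'e) R) \<times> {-1..1::real}) \<times> cball (0::'e) Q"
  let ?M = "{q \<in> ?B. case q of (((z, w), u), \<xi>) \<Rightarrow> bL z w u = \<xi> \<bullet> w - bH z \<xi> u} \<inter> {q. snd (fst q) = 0}"
  have "closed {q :: (((real \<times> 'e) \<times> 'e) \<times> real) \<times> 'e. snd (fst q) = 0}" by (intro closed_Collect_eq continuous_intros)
  then have compM: "compact ?M" using compact_maximizers by (rule compact_Int_closed[rotated])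
  let ?\<pi> = "\<lambda>q :: (((real \<times> 'e) \<times> 'e) \<times> real) \<times> 'e. (fst (fst q), F (fst (fst q), snd q))"
  have cpi: "continuous_on ?M ?\<pi>"
    by (intro continuous_intros continuous_on_compose2[OF F]) auto
  have graph: "(\<lambda>x. (x, G x)) ` (base \<times> cball 0 R) = ?\<pi> ` ?M"
  proof (intro equalityI subsetI)
    fix y assume "y \<in> (\<lambda>x. (x, G x)) ` (base \<times> cball 0 R)"
    then obtain z w where zw: "z \<in> base" "norm w \<le> R" "y = ((z, w), G (z, w))" by auto
    obtain \<xi> where \<xi>: "norm \<xi> \<le> Q" "bL z w 0 = \<xi> \<bullet> w - bH z \<xi> 0" using Q[OF zw(1,2)] by blast
    have "(((z, w), 0), \<xi>) \<in> ?M" using zw \<xi> by auto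
    moreover have "y = ?\<pi> (((z, w), 0), \<xi>)" using G[OF zw(1,2) \<xi>] zw by simp
    ultimately show "y \<in> ?\<pi> ` ?M" by blast
  next
    fix y assume "y \<in> ?\<pi> ` ?M"
    then obtain z w \<xi> where q: "z \<in> base" "norm w \<le> R" "norm \<xi> \<le> Q" "bL z w 0 = \<xi> \<bullet> w - bH z \<xi> 0" "y = ((z, w), F ((z, w), \<xi>))"
      by auto
    then show "y \<in> (\<lambda>x. (x, G x)) ` (base \<times> cball 0 R)" using G[OF q(1-4)] by auto
  qed
  have cl: "closed ((\<lambda>x. (x, G x)) ` (base \<times> cball 0 R))" unfolding graph
    by (intro compact_imp_closed compact_continuous_image cpi compM)
  have "compact (F ` ((base \<times> cball 0 R) \<times> cball 0 Q))"
    by (intro compact_continuous_image F compact_Times compact_base) auto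
  moreover have "G \<in> base \<times> cball 0 R \<rightarrow> F ` ((base \<times> cball 0 R) \<times> cball 0 Q)"
  proof
    fix x assume "x \<in> base \<times> cball (0::'e) R"
    then obtain z w where zw: "x = (z, w)" "z \<in> base" "norm w \<le> R" by auto
    obtain \<xi> where \<xi>: "norm \<xi> \<le> Q" "bL z w 0 = \<xi> \<bullet> w - bH z \<xi> 0" using Q[OF zw(2,3)] by blast
    then show "G x \<in> F ` ((base \<times> cball 0 R) \<times> cball 0 Q)" using G[OF zw(2,3) \<xi>] zw by auto
  qed
  ultimately show ?thesis using cl by (rule continuous_from_closed_graph)
qed

lemma bL_continuous: "continuous_on (base \<times> cball 0 R) (\<lambda>(z, w). bL z w 0)"
proof -
  obtain Q where Q: "Q > 0" "\<forall>z\<in>base. \<forall>w u. norm w \<le> R \<longrightarrow> \<bar>u\<bar> \<le> 1 \<longrightarrow> (\<exists>\<xi>. norm \<xi> \<le> Q \<and> bL z w u = \<xi> \<bullet> w - bH z \<xi> u)"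
    using bL_attained by blast
  show ?thesis
  proof (rule continuous_from_maximizers[where Q=Q and F="\<lambda>q. snd q \<bullet> snd (fst q) - bH (fst (fst q)) (snd q) 0"])
    show "continuous_on ((base \<times> cball 0 R) \<times> cball 0 Q) (\<lambda>q. snd q \<bullet> snd (fst q) - bH (fst (fst q)) (snd q) 0)"
      by (intro continuous_intros continuous_bH_compose) auto
    fix z and w :: 'e assume "z \<in> base" "norm w \<le> R"
    then show "\<exists>\<xi>. norm \<xi> \<le> Q \<and> bL z w 0 = \<xi> \<bullet> w - bH z \<xi> 0" using Q(2) by simp
  qed simp
qed

lemma ba_continuous: "continuous_on (base \<times> cball 0 R) (\<lambda>(z, w). ba z w)"
proof -
  obtain Q where Q: "Q > 0" "\<forall>z\<in>base. \<forall>w u. norm w \<le> R \<longrightarrow> \<bar>u\<bar> \<le> 1 \<longrightarrow> (\<exists>\<xi>. norm \<xi> \<le> Q \<and> bL z w u = \<xi> \<bullet> w - bH z \<xi> u)"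
    using bL_attained by blast
  have c: "continuous_on (base \<times> cball 0 Q) (\<lambda>q. bh (fst q) (snd q))" using continuous_bh[of Q] by (simp add: split_beta)
  show ?thesis
  proof (rule continuous_from_maximizers[where Q=Q and F="\<lambda>q. bh (fst (fst q)) (snd q)"])
    have "continuous_on ((base \<times> cball 0 R) \<times> cball (0::'e) Q) (\<lambda>q. (fst (fst q), snd q))" by (intro continuous_intros)
    from continuous_on_compose2[OF c this]
    show "continuous_on ((base \<times> cball 0 R) \<times> cball 0 Q) (\<lambda>q. bh (fst (fst q)) (snd q))" by (simp add: image_subset_iff)
    fix z and w :: 'e assume "z \<in> base" "norm w \<le> R"
    then show "\<exists>\<xi>. norm \<xi> \<le> Q \<and> bL z w 0 = \<xi> \<bullet> w - bH z \<xi> 0" using Q(2) by simp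
  qed (simp add: ba_eq)
qed

lemma ba_pos: assumes "z \<in> base" shows "ba z w > 0"
proof -
  obtain \<xi> where "bL z w 0 = \<xi> \<bullet> w - bH z \<xi> 0" using bL_attained[of "norm w"] assms by (metis abs_zero order_refl zero_le_one)
  from ba_eq[OF assms this] bh_pos show ?thesis by simp
qed

lemma ba_bounds: assumes "R \<ge> 0" shows "\<exists>a>0. \<exists>a'. \<forall>z\<in>base. \<forall>w. norm w \<le> R \<longrightarrow> a \<le> ba z w \<and> ba z w \<le> a'"
proof -
  have comp: "compact (base \<times> cball (0::'e) R)" by (intro compact_Times compact_base) auto
  have ne: "base \<times> cball (0::'e) R \<noteq> {}" using base_nonempty assms by auto
  note ca = ba_continuous[of R, unfolded split_beta]
  obtain q where q: "q \<in> base \<times> cball (0::'e) R" "\<And>y. y \<in> base \<times> cball (0::'e) R \<Longrightarrow> ba (fst q) (snd q) \<le> ba (fst y) (snd y)"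
    using continuous_attains_inf[OF comp ne ca] by blast
  obtain q' where q': "\<And>y. y \<in> base \<times> cball (0::'e) R \<Longrightarrow> ba (fst y) (snd y) \<le> ba (fst q') (snd q')"
    using continuous_attains_sup[OF comp ne ca] by blast
  show ?thesis using q(2)[of "(_, _)"] q'[of "(_, _)"] ba_pos[of "fst q"] q(1)
    by (intro exI[of _ "ba (fst q) (snd q)"] conjI exI[of _ "ba (fst q') (snd q')"]) auto
qed

text \<open>An envelope argument: using a maximiser for 0 at u, and one for u at 0, squeezes the
  increment of L between increments of H at the two momenta. It remains to see that the derivative
  of H at the second momentum tends to \<open>ba\<close> uniformly, which is a compactness
  statement.\<close>

lemma bL_expansion: assumes e: "\<epsilon> > 0" and R: "R \<ge> 0"
  shows "\<exists>s>0. s \<le> 1 \<and> (\<forall>z\<in>base. \<forall>w u. norm w \<le> R \<longrightarrow> \<bar>u\<bar> \<le> s \<longrightarrow> \<bar>bL z w u - bL z w 0 + u * ba z w\<bar> \<le> \<epsilon> * \<bar>u\<bar>)"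
proof -
  obtain Q where Q: "Q > 0" "\<forall>z\<in>base. \<forall>w u. norm w \<le> R \<longrightarrow> \<bar>u\<bar> \<le> 1 \<longrightarrow> (\<exists>\<xi>. norm \<xi> \<le> Q \<and> bL z w u = \<xi> \<bullet> w - bH z \<xi> u)"
    using bL_attained by blast
  obtain s1 where s1: "s1 > 0" "s1 \<le> 1" "\<And>z \<xi> u. z \<in> base \<Longrightarrow> norm \<xi> \<le> Q \<Longrightarrow> \<bar>u\<bar> \<le> s1 \<Longrightarrow> \<bar>bH z \<xi> u - bH z \<xi> 0 - u * bh z \<xi>\<bar> \<le> \<epsilon> / 2 * \<bar>u\<bar>"
    using bH_expansion[of "\<epsilon> / 2" Q] e by auto
  let ?B = "((base \<times> cball (0::'e) R) \<times> {-1..1::real}) \<times> cball (0::'e) Q"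
  let ?M = "{q \<in> ?B. case q of (((z, w), u), \<xi>) \<Rightarrow> bL z w u = \<xi> \<bullet> w - bH z \<xi> u}"
  let ?F = "\<lambda>q :: (((real \<times> 'e) \<times> 'e) \<times> real) \<times> 'e. \<bar>bh (fst (fst (fst q))) (snd q) - ba (fst (fst (fst q))) (snd (fst (fst q)))\<bar>"
  have ch: "continuous_on (base \<times> cball 0 Q) (\<lambda>q. bh (fst q) (snd q))" using continuous_bh[of Q] by (simp add: split_beta)
  have ca: "continuous_on (base \<times> cball 0 R) (\<lambda>q. ba (fst q) (snd q))" using ba_continuous[of R] by (simp add: split_beta)
  have "continuous_on ?B (\<lambda>q. (fst (fst (fst q)), snd q))" by (intro continuous_intros)
  from continuous_on_compose2[OF ch this] have 1: "continuous_on ?B (\<lambda>q. bh (fst (fst (fst q))) (snd q))" by (simp add: image_subset_iff)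
  have "continuous_on ?B (\<lambda>q. fst (fst q))" by (intro continuous_intros)
  from continuous_on_compose2[OF ca this] have 2: "continuous_on ?B (\<lambda>q. ba (fst (fst (fst q))) (snd (fst (fst q))))" by (simp add: image_subset_iff mem_Times_iff)
  have cF: "continuous_on ?B ?F" by (intro continuous_intros 1 2)
  \<comment> \<open>Maximisers at which the derivative of H is off by \<epsilon>/2 or more. This set
    is compact, and by \<open>ba_eq\<close> it contains no point with u = 0, so |u| has a positive
    minimum on it.\<close>
  let ?K = "{q \<in> ?M. ?F q \<ge> \<epsilon> / 2}"
  have "closed {q \<in> ?B. \<epsilon> / 2 \<le> ?F q}"
    by (intro continuous_on_closed_Collect_le cF continuous_on_const compact_imp_closed compact_Times compact_base) auto
  moreover have "?K = ?M \<inter> {q \<in> ?B. \<epsilon> / 2 \<le> ?F q}" by auto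
  ultimately have compK: "compact ?K" using compact_maximizers[of R Q] by (metis (no_types, lifting) compact_Int_closed)
  obtain s2 where s2: "s2 > 0" "\<And>q. q \<in> ?K \<Longrightarrow> \<bar>snd (fst q)\<bar> \<ge> s2"
  proof (cases "?K = {}")
    case True show ?thesis by (rule that[of 1], simp) (use True in blast)
  next
    case False
    have "continuous_on ?K (\<lambda>q. \<bar>snd (fst q)\<bar>)" by (intro continuous_intros)
    from continuous_attains_inf[OF compK False this]
    obtain q0 where q0: "q0 \<in> ?K" "\<forall>q\<in>?K. \<bar>snd (fst q0)\<bar> \<le> \<bar>snd (fst q)\<bar>" by blast
    have "snd (fst q0) \<noteq> 0"
    proof
      assume u0: "snd (fst q0) = 0"
      then have "bL (fst (fst (fst q0))) (snd (fst (fst q0))) 0 = snd q0 \<bullet> snd (fst (fst q0)) - bH (fst (fst (fst q0))) (snd q0) 0"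
        using q0(1) by (auto simp: split_beta)
      from ba_eq[OF _ this] q0(1) have "?F q0 = 0" by auto
      then show False using q0(1) e by auto
    qed
    then show ?thesis by (intro that[of "\<bar>snd (fst q0)\<bar>"] bspec[OF q0(2)]) simp_all
  qed
  define s where "s = min s1 (s2 / 2)"
  have s: "s > 0" "s \<le> 1" "s \<le> s1" "s < s2" using s1 s2(1) by (auto simp: s_def)
  have "\<bar>bL z w u - bL z w 0 + u * ba z w\<bar> \<le> \<epsilon> * \<bar>u\<bar>" if z: "z \<in> base" and w: "norm w \<le> R" and u: "\<bar>u\<bar> \<le> s" for z w u
  proof -
    have u1: "\<bar>u\<bar> \<le> 1" "\<bar>u\<bar> \<le> s1" using u s by auto
    obtain \<xi>0 where \<xi>0: "norm \<xi>0 \<le> Q" "bL z w 0 = \<xi>0 \<bullet> w - bH z \<xi>0 0" using Q(2) z w by (metis abs_zero zero_le_one)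
    obtain \<xi> where \<xi>: "norm \<xi> \<le> Q" "bL z w u = \<xi> \<bullet> w - bH z \<xi> u" using Q(2) z w u1(1) by blast
    have a0: "ba z w = bh z \<xi>0" by (rule ba_eq[OF z \<xi>0(2)])
    have low: "bL z w u \<ge> bL z w 0 + bH z \<xi>0 0 - bH z \<xi>0 u" using bL_fenchel[OF z, of \<xi>0 w u] \<xi>0(2) by linarith
    have up: "bL z w u \<le> bL z w 0 + bH z \<xi> 0 - bH z \<xi> u" using bL_fenchel[OF z, of \<xi> w 0] \<xi>(2) by linarith
    have 3: "\<bar>bH z \<xi>0 u - bH z \<xi>0 0 - u * ba z w\<bar> \<le> \<epsilon> / 2 * \<bar>u\<bar>" using s1(3)[OF z \<xi>0(1) u1(2)] a0 by simp
    have 4: "\<bar>bH z \<xi> u - bH z \<xi> 0 - u * bh z \<xi>\<bar> \<le> \<epsilon> / 2 * \<bar>u\<bar>" using s1(3)[OF z \<xi>(1) u1(2)] .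
    have "(((z, w), u), \<xi>) \<in> ?M" using z w u1 \<xi> by (auto simp: abs_le_iff)
    moreover have "(((z, w), u), \<xi>) \<notin> ?K" using s2(2)[of "(((z, w), u), \<xi>)"] u s by fastforce
    ultimately have "\<bar>bh z \<xi> - ba z w\<bar> \<le> \<epsilon> / 2" by auto
    then have "\<bar>u\<bar> * \<bar>bh z \<xi> - ba z w\<bar> \<le> \<bar>u\<bar> * (\<epsilon> / 2)" by (intro mult_left_mono) auto
    then have 5: "\<bar>u * bh z \<xi> - u * ba z w\<bar> \<le> \<epsilon> / 2 * \<bar>u\<bar>" by (simp add: right_diff_distrib[symmetric] abs_mult mult.commute)
    have "\<epsilon> / 2 * \<bar>u\<bar> \<ge> 0" using e by simp
    then show ?thesis using low up 3 4 5 unfolding abs_le_iff by (auto simp: field_simps)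
  qed
  then show ?thesis using s by blast
qed

end

section \<open>Linear programming duality over probability measures\<close>

lemma finite_net:
  assumes Z: "compact Z" and d: "d > 0"
  shows "\<exists>xs. set xs \<subseteq> Z \<and> (\<forall>z\<in>Z. \<exists>x\<in>set xs. dist x z < d)"
proof -
  have cov: "Z \<subseteq> (\<Union>x\<in>Z. ball x d)" using d by force
  obtain F where F: "F \<subseteq> Z" "finite F" "Z \<subseteq> (\<Union>x\<in>F. ball x d)"
    by (rule compactE_image[OF Z _ cov]) auto
  obtain xs where "set xs = F" using finite_list[OF F(2)] by blast
  show ?thesis
  proof (intro exI[of _ xs] conjI ballI)
    show "set xs \<subseteq> Z" using F(1) \<open>set xs = F\<close> by simp
    fix z assume "z \<in> Z"
    then obtain x where "x \<in> F" "z \<in> ball x d" using F(3) by blast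
    then show "\<exists>x\<in>set xs. dist x z < d" using \<open>set xs = F\<close> by auto
  qed
qed

text \<open>Any injection of a compact metric space into the reals with uniformly continuous inverse
  allows the Helly selection theorem on the line to be used on the space itself.\<close>

lemma compact_real_code:
  fixes Z :: "'a::metric_space set"
  assumes Z: "compact Z"
  shows "\<exists>(t :: 'a \<Rightarrow> real) B. (\<forall>z\<in>Z. \<bar>t z\<bar> \<le> B) \<and>
    (\<forall>\<epsilon>>0. \<exists>\<delta>>0. \<forall>z\<in>Z. \<forall>z'\<in>Z. \<bar>t z - t z'\<bar> < \<delta> \<longrightarrow> dist z z' < (\<epsilon>::real))"
proof -
  have "\<forall>k::nat. \<exists>xs. set xs \<subseteq> Z \<and> (\<forall>z\<in>Z. \<exists>x\<in>set xs. dist x z < (1/2)^k)"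
    using finite_net[OF Z] by simp
  from choice[OF this] obtain xs where xs: "\<And>k z. z \<in> Z \<Longrightarrow> \<exists>x\<in>set (xs k). dist x z < (1/2)^k" by blast
  define N where "N k = length (xs k)" for k
  \<comment> \<open>The digit of z at scale k: the number of a point of the k-th net near z.\<close>
  define code where "code k z = (SOME i. i < N k \<and> dist (xs k ! i) z < (1/2)^k)" for k z
  have code: "code k z < N k" "dist (xs k ! code k z) z < (1/2)^k" if "z \<in> Z" for k z
  proof -
    have "\<exists>i. i < N k \<and> dist (xs k ! i) z < (1/2)^k" using xs[OF that, of k] by (metis N_def in_set_conv_nth)
    from someI_ex[OF this] show "code k z < N k" "dist (xs k ! code k z) z < (1/2)^k" by (auto simp: code_def)
  qed
  \<comment> \<open>Weights of a mixed-radix expansion, decreasing so fast that all digits after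
    position j together contribute at most w j / 3. Digits can therefore be recovered from the
    sum.\<close>
  define w where "w = rec_nat (1::real) (\<lambda>k v. v / (4 * real (N (Suc k) + 1)))"
  have wS: "w (Suc k) = w k / (4 * real (N (Suc k) + 1))" for k by (simp add: w_def)
  have wpos: "w k > 0" for k by (induction k) (simp add: w_def, simp add: wS)
  have Nw: "real (N (Suc k)) * w (Suc k) \<le> w k / 4" for k
  proof -
    have "real (N (Suc k)) * w (Suc k) = w k / 4 * (real (N (Suc k)) / real (N (Suc k) + 1))" by (simp add: wS field_simps)
    also have "\<dots> \<le> w k / 4 * 1" using wpos[of k] by (intro mult_left_mono) auto
    finally show ?thesis by simp
  qed
  have w4: "w (Suc k) \<le> w k / 4" for k
  proof -
    have "w (Suc k) = w k / 4 / real (N (Suc k) + 1)" by (simp add: wS)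
    also have "\<dots> \<le> w k / 4 / 1" using wpos[of k] by (intro divide_left_mono) auto
    finally show ?thesis by simp
  qed
  have wgeo: "w (m + j) \<le> w j * (1/4)^m" for m j
  proof (induction m)
    case (Suc m) then show ?case using w4[of "m + j"] by simp
  qed simp
  have wmono: "w j \<ge> w k" if "j \<le> k" for j k
  proof -
    have "w (Suc i) \<le> w i" for i using w4[of i] wpos[of i] by linarith
    then show ?thesis using that lift_Suc_antimono_le[of w] by blast
  qed
  have Nwgeo: "real (N (Suc (m + j))) * w (Suc (m + j)) \<le> w j / 4 * (1/4)^m" for m j
    using Nw[of "m + j"] wgeo[of m j] by simp
  define t where "t z = (\<Sum>k. real (code k z) * w k)" for z
  have geo: "summable (\<lambda>m. w j / 4 * (1/4::real)^m)" "(\<Sum>m. w j / 4 * (1/4::real)^m) = w j / 3" for j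
  proof -
    show "summable (\<lambda>m. w j / 4 * (1/4::real)^m)" by (intro summable_mult summable_geometric) simp
    show "(\<Sum>m. w j / 4 * (1/4::real)^m) = w j / 3" by (subst suminf_mult) (auto intro!: summable_geometric simp: suminf_geometric)
  qed
  have codew: "real (code (Suc (m + j)) z) * w (Suc (m + j)) \<le> w j / 4 * (1/4)^m" if "z \<in> Z" for m j z
  proof -
    have "real (code (Suc (m + j)) z) * w (Suc (m + j)) \<le> real (N (Suc (m + j))) * w (Suc (m + j))"
      using code(1)[OF that, of "Suc (m + j)"] wpos[of "Suc (m + j)"] by (intro mult_right_mono) auto
    then show ?thesis using Nwgeo[of m j] by linarith
  qed
  have sm: "summable (\<lambda>k. real (code k z) * w k)" if "z \<in> Z" for z
  proof -
    have "summable (\<lambda>m. real (code (m + 1) z) * w (m + 1))"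
      by (rule summable_comparison_test'[OF geo(1)[of 0], of 0])
        (use codew[OF that, of _ 0] wpos in \<open>auto simp: abs_mult less_imp_le\<close>)
    then show ?thesis by (subst (asm) summable_iff_shift)
  qed
  have bd: "\<bar>t z\<bar> \<le> real (N 0) * w 0 + w 0 / 3" if z: "z \<in> Z" for z
  proof -
    have nn: "t z \<ge> 0" unfolding t_def using wpos by (intro suminf_nonneg sm z) (simp add: less_imp_le)
    have "t z = (\<Sum>m. real (code (m + 1) z) * w (m + 1)) + (\<Sum>k<1. real (code k z) * w k)"
      unfolding t_def by (rule suminf_split_initial_segment[OF sm[OF z]])
    also have "(\<Sum>m. real (code (m + 1) z) * w (m + 1)) \<le> (\<Sum>m. w 0 / 4 * (1/4::real)^m)"
      by (intro suminf_le geo(1) summable_ignore_initial_segment[OF sm[OF z], of 1]) (use codew[OF z, of _ 0] in simp)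
    also have "(\<Sum>k<1. real (code k z) * w k) \<le> real (N 0) * w 0"
      using code(1)[OF z, of 0] wpos[of 0] by (simp add: mult_right_mono)
    finally show ?thesis using nn geo(2)[of 0] by linarith
  qed
  have inj: "\<forall>k\<le>n. code k z = code k z'" if z: "z \<in> Z" "z' \<in> Z" and small: "\<bar>t z - t z'\<bar> < w n / 2" for z z' n
  proof (rule ccontr)
    assume "\<not> ?thesis"
    then have ex: "\<exists>k. k \<le> n \<and> code k z \<noteq> code k z'" by blast
    \<comment> \<open>The first differing digit changes the sum by at least w j, more than the later
      digits can undo.\<close>
    define j where "j = (LEAST k. k \<le> n \<and> code k z \<noteq> code k z')"
    have j: "j \<le> n" "code j z \<noteq> code j z'" using LeastI_ex[OF ex] by (auto simp: j_def)
    have eq: "code k z = code k z'" if "k < j" for k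
      using not_less_Least[of k "\<lambda>k. k \<le> n \<and> code k z \<noteq> code k z'"] that j(1) by (auto simp: j_def[symmetric])
    define d where "d k = (real (code k z) - real (code k z')) * w k" for k
    have sd: "summable d" unfolding d_def left_diff_distrib by (intro summable_diff sm z)
    have "t z - t z' = (\<Sum>k. d k)" unfolding t_def d_def left_diff_distrib by (rule suminf_diff[OF sm[OF z(1)] sm[OF z(2)]])
    also have "\<dots> = (\<Sum>m. d (m + Suc j)) + (\<Sum>k<Suc j. d k)" by (rule suminf_split_initial_segment[OF sd])
    also have "(\<Sum>k<Suc j. d k) = d j" using eq by (simp add: d_def)
    finally have td: "t z - t z' = (\<Sum>m. d (m + Suc j)) + d j" .
    have db: "\<bar>d (m + Suc j)\<bar> \<le> w j / 4 * (1/4)^m" for m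
    proof -
      have "\<bar>real (code (Suc (m + j)) z) - real (code (Suc (m + j)) z')\<bar> \<le> real (N (Suc (m + j)))"
        using code(1)[OF z(1), of "Suc (m + j)"] code(1)[OF z(2), of "Suc (m + j)"] by linarith
      then have "\<bar>d (m + Suc j)\<bar> \<le> real (N (Suc (m + j))) * w (Suc (m + j))"
        using wpos[of "Suc (m + j)"] by (auto simp: d_def abs_mult intro!: mult_right_mono)
      then show ?thesis using Nwgeo[of m j] by linarith
    qed
    have sda: "summable (\<lambda>m. \<bar>d (m + Suc j)\<bar>)" by (rule summable_comparison_test'[OF geo(1)[of j], of 0]) (use db in auto)
    have "\<bar>\<Sum>m. d (m + Suc j)\<bar> \<le> (\<Sum>m. \<bar>d (m + Suc j)\<bar>)" by (rule summable_rabs[OF sda])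
    also have "\<dots> \<le> (\<Sum>m. w j / 4 * (1/4::real)^m)" by (rule suminf_le[OF db sda geo(1)])
    finally have tail: "\<bar>\<Sum>m. d (m + Suc j)\<bar> \<le> w j / 3" using geo(2)[of j] by simp
    have "\<bar>real (code j z) - real (code j z')\<bar> \<ge> 1" using j(2) by linarith
    then have "\<bar>d j\<bar> \<ge> w j" using wpos[of j] by (simp add: d_def abs_mult)
    then have "\<bar>t z - t z'\<bar> \<ge> w j - w j / 3" using tail td by linarith
    then show False using small wmono[OF j(1)] wpos[of j] by linarith
  qed
  have "\<exists>\<delta>>0. \<forall>z\<in>Z. \<forall>z'\<in>Z. \<bar>t z - t z'\<bar> < \<delta> \<longrightarrow> dist z z' < \<epsilon>" if \<epsilon>: "\<epsilon> > 0" for \<epsilon> :: real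
  proof -
    obtain n where n: "(1/2::real)^n < \<epsilon> / 2" using real_arch_pow_inv[of "\<epsilon> / 2" "1/2"] \<epsilon> by auto
    have "dist z z' < \<epsilon>" if z: "z \<in> Z" "z' \<in> Z" "\<bar>t z - t z'\<bar> < w n / 2" for z z'
    proof -
      have "code n z = code n z'" using inj[OF z] by blast
      then show ?thesis using code(2)[OF z(1), of n] code(2)[OF z(2), of n] dist_triangle2[of z z' "xs n ! code n z"] n
        by (simp add: dist_commute)
    qed
    then show ?thesis using wpos[of n] by (intro exI[of _ "w n / 2"]) auto
  qed
  then show ?thesis using bd by blast
qed

text \<open>Coded on the line the laws are supported in one bounded interval, hence tight, and
  Helly's theorem gives a weak limit; decoding by the uniformly continuous inverse of the code
  returns it to Z. Test functions need be continuous on Z only.\<close>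

lemma pmf_weak_compactness:
  fixes Z :: "'a::euclidean_space set" and p :: "nat \<Rightarrow> 'a pmf"
  assumes Z: "compact Z" and p: "\<And>k. set_pmf (p k) \<subseteq> Z"
  shows "\<exists>r \<nu>. strict_mono (r :: nat \<Rightarrow> nat) \<and> prob_space \<nu> \<and> sets \<nu> = sets borel \<and> (AE z in \<nu>. z \<in> Z) \<and>
    (\<forall>f :: 'a \<Rightarrow> real. continuous_on Z f \<longrightarrow>
       (\<lambda>k. measure_pmf.expectation (p (r k)) f) \<longlonglongrightarrow> (LINT z:Z|\<nu>. f z))"
proof -
  obtain z0 where z0: "z0 \<in> Z" using p[of 0] set_pmf_not_empty[of "p 0"] by blast
  obtain t :: "'a \<Rightarrow> real" and B where t: "\<And>z. z \<in> Z \<Longrightarrow> \<bar>t z\<bar> \<le> B"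
    "\<And>\<epsilon>. \<epsilon> > 0 \<Longrightarrow> \<exists>\<delta>>0. \<forall>z\<in>Z. \<forall>z'\<in>Z. \<bar>t z - t z'\<bar> < \<delta> \<longrightarrow> dist z z' < \<epsilon>"
    using compact_real_code[OF Z] by blast
  \<comment> \<open>The code t is in general neither continuous nor Borel; the image law exists
    because every map is measurable for a \<open>pmf\<close>.\<close>
  define \<mu> where "\<mu> k = distr (measure_pmf (p k)) borel t" for k
  have rd: "real_distribution (\<mu> k)" for k
    unfolding \<mu>_def real_distribution_def real_distribution_axioms_def
    by (auto intro!: measure_pmf.prob_space_distr)
  have int\<mu>: "(LINT x|\<mu> k. F x) = measure_pmf.expectation (p k) (\<lambda>z. F (t z))" if "F \<in> borel_measurable borel" for k and F :: "real \<Rightarrow> real"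
    unfolding \<mu>_def by (subst integral_distr) (use that in auto)
  have "tight \<mu>" unfolding tight_def
  proof (intro conjI allI impI rd)
    fix \<epsilon> :: real assume e: "\<epsilon> > 0"
    have "measure (\<mu> k) {- \<bar>B\<bar> - 1<..\<bar>B\<bar> + 1} = 1" for k
    proof -
      have "measure (\<mu> k) {- \<bar>B\<bar> - 1<..\<bar>B\<bar> + 1} = measure (measure_pmf (p k)) (t -` {- \<bar>B\<bar> - 1<..\<bar>B\<bar> + 1})"
        unfolding \<mu>_def by (subst measure_distr) auto
      also have "\<dots> = 1"
      proof (subst measure_pmf.prob_eq_1)
        show "AE x in measure_pmf (p k). x \<in> t -` {- \<bar>B\<bar> - 1<..\<bar>B\<bar> + 1}"
          unfolding AE_measure_pmf_iff
        proof
          fix y assume "y \<in> set_pmf (p k)"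
          then have "\<bar>t y\<bar> \<le> B" using p t(1) by blast
          then show "y \<in> t -` {- \<bar>B\<bar> - 1<..\<bar>B\<bar> + 1}" by auto
        qed
      qed simp
      finally show ?thesis .
    qed
    then show "\<exists>a b. a < b \<and> (\<forall>n. 1 - \<epsilon> < measure (\<mu> n) {a<..b})"
      using e by (intro exI[of _ "- \<bar>B\<bar> - 1"] exI[of _ "\<bar>B\<bar> + 1"]) auto
  qed
  from tight_imp_convergent_subsubsequence[OF this strict_mono_id]
  obtain r M where r: "strict_mono (r :: nat \<Rightarrow> nat)" and M: "real_distribution M" and conv: "weak_conv_m (\<mu> \<circ> r) M" by auto
  interpret M: real_distribution M by fact
  have lim: "(\<lambda>k. measure_pmf.expectation (p (r k)) (\<lambda>z. F (t z))) \<longlonglongrightarrow> (LINT x|M. F x)"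
    if F: "continuous_on UNIV F" "\<And>x. \<bar>F x\<bar> \<le> K" for F :: "real \<Rightarrow> real" and K
  proof -
    have "(\<lambda>k. LINT x|(\<mu> \<circ> r) k. F x) \<longlonglongrightarrow> (LINT x|M. F x)"
      by (rule weak_conv_imp_integral_bdd_continuous_conv[OF _ M conv, of F K])
        (use rd F in \<open>auto simp: continuous_on_eq_continuous_at\<close>)
    then show ?thesis using int\<mu>[OF borel_measurable_continuous_onI[OF F(1)]] by (simp add: o_def)
  qed
  have injt: "inj_on t Z"
  proof (rule inj_onI, rule ccontr)
    fix z z' assume h: "z \<in> Z" "z' \<in> Z" "t z = t z'" "z \<noteq> z'"
    then have "dist z z' > 0" by simp
    from t(2)[OF this] obtain \<delta> where "\<delta> > 0" "\<forall>a\<in>Z. \<forall>a'\<in>Z. \<bar>t a - t a'\<bar> < \<delta> \<longrightarrow> dist a a' < dist z z'" by blast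
    then show False using h by force
  qed
  define s0 where "s0 = inv_into Z t"
  have s0: "s0 (t z) = z" if "z \<in> Z" for z using injt that by (simp add: s0_def)
  have "uniformly_continuous_on (t ` Z) s0"
    unfolding uniformly_continuous_on_def
  proof (intro allI impI)
    fix e :: real assume "e > 0"
    from t(2)[OF this] obtain \<delta> where "\<delta> > 0" "\<forall>z\<in>Z. \<forall>z'\<in>Z. \<bar>t z - t z'\<bar> < \<delta> \<longrightarrow> dist z z' < e" by blast
    then show "\<exists>d>0. \<forall>x\<in>t ` Z. \<forall>x'\<in>t ` Z. dist x' x < d \<longrightarrow> dist (s0 x') (s0 x) < e"
      by (intro exI[of _ \<delta>]) (auto simp: s0 dist_real_def)
  qed
  \<comment> \<open>The limit law may charge points of the closure outside the image of Z, so the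
    decoding is extended there; its values remain in the closed set Z.\<close>
  from uniformly_continuous_on_extension_on_closure[OF this]
  obtain G where G: "uniformly_continuous_on (closure (t ` Z)) G" "\<And>x. x \<in> t ` Z \<Longrightarrow> s0 x = G x" by metis
  define C where "C = closure (t ` Z)"
  have Gt: "G (t z) = z" "t z \<in> C" if "z \<in> Z" for z
    using G(2)[of "t z"] s0[OF that] that closure_subset[of "t ` Z"] by (auto simp: C_def)
  have contG: "continuous_on C G" unfolding C_def by (rule uniformly_continuous_imp_continuous[OF G(1)])
  have GZ: "G x \<in> Z" if "x \<in> C" for x
  proof -
    have "G ` closure (t ` Z) \<subseteq> closure (G ` t ` Z)"
      by (rule continuous_image_closure_subset[OF contG[unfolded C_def]]) simp
    also have "G ` t ` Z \<subseteq> Z" using Gt by auto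
    then have "closure (G ` t ` Z) \<subseteq> Z" using compact_imp_closed[OF Z] by (simp add: closure_minimal)
    finally show ?thesis using that by (auto simp: C_def)
  qed
  have clC: "closed C" and neC: "C \<noteq> {}" using z0 Gt by (auto simp: C_def)
  have "AE x in M. x \<in> C"
  proof -
    \<comment> \<open>The truncated distance to C is a bounded continuous function with zero
      expectation under every approximating law, so the limit law lives on C.\<close>
    define F where "F x = min 1 (infdist x C)" for x :: real
    have F0: "F x \<ge> 0" "\<bar>F x\<bar> \<le> 1" for x using infdist_nonneg[of x C] by (auto simp: F_def)
    have cF: "continuous_on UNIV F" unfolding F_def by (intro continuous_intros)
    have "measure_pmf.expectation (p (r k)) (\<lambda>z. F (t z)) = 0" for k
    proof -
      have "measure_pmf.expectation (p (r k)) (\<lambda>z. F (t z)) = measure_pmf.expectation (p (r k)) (\<lambda>z. 0)"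
        by (intro integral_cong_AE) (use p Gt(2) in \<open>auto simp: AE_measure_pmf_iff F_def subset_iff\<close>)
      then show ?thesis by simp
    qed
    then have "(\<lambda>_. 0) \<longlonglongrightarrow> (LINT x|M. F x)" using lim[OF cF F0(2)] by simp
    then have "(LINT x|M. F x) = 0" by (simp add: LIMSEQ_const_iff)
    moreover have "integrable M F"
      by (rule M.integrable_const_bound[of _ 1]) (use F0 borel_measurable_continuous_onI[OF cF] in auto)
    ultimately have "AE x in M. F x = 0" using integral_nonneg_eq_0_iff_AE[of M F] F0(1) by auto
    then show ?thesis
      by eventually_elim (use in_closed_iff_infdist_zero[OF clC neC] in \<open>auto simp: F_def min_def split: if_splits\<close>)
  qed
  note AEC = this
  define G' where "G' x = (if x \<in> C then G x else z0)" for x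
  have mG: "G' \<in> borel_measurable borel" unfolding G'_def
    by (rule borel_measurable_continuous_on_if) (use clC contG in auto)
  then have mGM: "G' \<in> measurable M borel" by simp
  define \<nu> where "\<nu> = distr M borel G'"
  have "prob_space \<nu>" unfolding \<nu>_def by (rule M.prob_space_distr[OF mGM])
  moreover have "sets \<nu> = sets borel" by (simp add: \<nu>_def)
  moreover have "AE z in \<nu>. z \<in> Z" unfolding \<nu>_def
    by (subst AE_distr_iff[OF mGM]) (use GZ z0 compact_imp_closed[OF Z] in \<open>auto simp: G'_def\<close>)
  moreover have "(\<lambda>k. measure_pmf.expectation (p (r k)) f) \<longlonglongrightarrow> (LINT z:Z|\<nu>. f z)"
    if f: "continuous_on Z f" for f :: "'a \<Rightarrow> real"
  proof -
    obtain K where K: "K \<ge> 0" "\<And>z. z \<in> Z \<Longrightarrow> \<bar>f z\<bar> \<le> K"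
      using compact_imp_bounded[OF compact_continuous_image[OF f Z]] unfolding bounded_iff
      by (metis abs_ge_zero imageI order_trans real_norm_def z0)
    have "continuous_on C (\<lambda>x. f (G x))" by (rule continuous_on_compose2[OF f contG]) (use GZ in auto)
    moreover have "closedin (top_of_set UNIV) C" using clC by simp
    \<comment> \<open>Weak convergence is tested with functions on the whole line; Tietze extends
      the decoded f with the same bound.\<close>
    ultimately obtain F where F: "continuous_on UNIV F" "\<And>x. x \<in> C \<Longrightarrow> F x = f (G x)" "\<And>x. \<bar>F x\<bar> \<le> K"
      using Tietze[of C "\<lambda>x. f (G x)" UNIV K] K GZ by (auto simp: real_norm_def)
    have "measure_pmf.expectation (p (r k)) (\<lambda>z. F (t z)) = measure_pmf.expectation (p (r k)) f" for k
      by (intro integral_cong_AE) (use p Gt F(2) in \<open>auto simp: AE_measure_pmf_iff subset_iff\<close>)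
    then have "(\<lambda>k. measure_pmf.expectation (p (r k)) f) \<longlonglongrightarrow> (LINT x|M. F x)" using lim[OF F(1,3)] by simp
    moreover have "(LINT z:Z|\<nu>. f z) = (LINT x|M. F x)"
    proof -
      have mf: "(\<lambda>z. indicator Z z *\<^sub>R f z) \<in> borel_measurable borel"
        by (rule borel_measurable_continuous_on_indicator[OF _ f]) (use compact_imp_closed[OF Z] in auto)
      have "(LINT z:Z|\<nu>. f z) = (LINT x|M. indicator Z (G' x) *\<^sub>R f (G' x))"
        unfolding \<nu>_def set_lebesgue_integral_def by (rule integral_distr[OF mGM mf])
      also have "\<dots> = (LINT x|M. F x)"
      proof (rule integral_cong_AE)
        show "(\<lambda>x. indicator Z (G' x) *\<^sub>R f (G' x)) \<in> borel_measurable M"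
          using measurable_compose[OF mGM mf] by simp
        show "F \<in> borel_measurable M" using borel_measurable_continuous_onI[OF F(1)] by simp
        show "AE x in M. indicator Z (G' x) *\<^sub>R f (G' x) = F x"
          using AEC by eventually_elim (use GZ F(2) in \<open>auto simp: G'_def\<close>)
      qed
      finally show ?thesis .
    qed
    ultimately show ?thesis by simp
  qed
  ultimately show ?thesis using r by blast
qed

text \<open>A function with a given modulus at one scale is determined, up to a small error, by its
  rounded values on a finite net. There are countably many such codes; one member of E is kept for
  each code that occurs, and f0 stands in for the others.\<close>

lemma uniform_separability:
  fixes Z :: "'a::metric_space set" and E :: "('a \<Rightarrow> real) set"
  assumes Z: "compact Z" and E: "\<And>f. f \<in> E \<Longrightarrow> continuous_on Z f" and ne: "f0 \<in> E"
  shows "\<exists>e :: nat \<Rightarrow> 'a \<Rightarrow> real. (\<forall>j. e j \<in> E) \<and> (\<forall>f\<in>E. \<forall>\<epsilon>>0. \<exists>j. \<forall>z\<in>Z. \<bar>f z - e j z\<bar> < \<epsilon>)"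
proof -
  have "\<forall>k::nat. \<exists>xs. set xs \<subseteq> Z \<and> (\<forall>z\<in>Z. \<exists>x\<in>set xs. dist x z < 1 / real (Suc k))"
    using finite_net[OF Z] by simp
  from choice[OF this] obtain xs where xs: "\<And>k. set (xs k) \<subseteq> Z" "\<And>k z. z \<in> Z \<Longrightarrow> \<exists>x\<in>set (xs k). dist x z < 1 / real (Suc k)" by blast
  define good where "good f m k \<longleftrightarrow> (\<forall>z\<in>Z. \<forall>z'\<in>Z. dist z z' < 1 / real (Suc k) \<longrightarrow> \<bar>f z - f z'\<bar> < 1 / real (Suc m))" for f :: "'a \<Rightarrow> real" and m k
  define cd where "cd f m k = map (\<lambda>x. \<lfloor>real (Suc m) * f x\<rfloor>) (xs k)" for f :: "'a \<Rightarrow> real" and m k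
  define pick where "pick = (\<lambda>(m, k, is). if \<exists>f\<in>E. good f m k \<and> cd f m k = is then SOME f. f \<in> E \<and> good f m k \<and> cd f m k = is else f0)"
  have pick: "pick (m, k, is) \<in> E" for m k "is"
    unfolding pick_def using ne someI_ex[of "\<lambda>f. f \<in> E \<and> good f m k \<and> cd f m k = is"] by auto
  have pick2: "good (pick (m, k, cd f m k)) m k \<and> cd (pick (m, k, cd f m k)) m k = cd f m k" if "f \<in> E" "good f m k" for f m k
    unfolding pick_def using that someI_ex[of "\<lambda>h. h \<in> E \<and> good h m k \<and> cd h m k = cd f m k"] by auto
  have "\<exists>j. \<forall>z\<in>Z. \<bar>f z - pick (from_nat j) z\<bar> < \<epsilon>" if f: "f \<in> E" and e: "\<epsilon> > 0" for f \<epsilon>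
  proof -
    obtain m where m: "1 / real (Suc m) < \<epsilon> / 3" using nat_approx_posE[of "\<epsilon> / 3"] e by auto
    have "uniformly_continuous_on Z f" by (rule compact_uniformly_continuous[OF E[OF f] Z])
    then obtain d where d: "d > 0" "\<And>z z'. z \<in> Z \<Longrightarrow> z' \<in> Z \<Longrightarrow> dist z' z < d \<Longrightarrow> dist (f z') (f z) < 1 / real (Suc m)"
      unfolding uniformly_continuous_on_def by (metis of_nat_0_less_iff zero_less_Suc zero_less_divide_1_iff)
    obtain k where k: "1 / real (Suc k) < d" using nat_approx_posE[OF d(1)] by blast
    have g: "good f m k" unfolding good_def using d(2) k by (force simp: dist_real_def)
    define h where "h = pick (m, k, cd f m k)"
    have h: "good h m k" "cd h m k = cd f m k" using pick2[OF f g] by (auto simp: h_def)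
    have "\<bar>f z - h z\<bar> < \<epsilon>" if z: "z \<in> Z" for z
    proof -
      obtain x where x: "x \<in> set (xs k)" "dist x z < 1 / real (Suc k)" using xs(2)[OF z] by blast
      then have xZ: "x \<in> Z" using xs(1) by blast
      have "\<lfloor>real (Suc m) * h x\<rfloor> = \<lfloor>real (Suc m) * f x\<rfloor>" using h(2) x(1) by (auto simp: cd_def)
      then have "\<bar>real (Suc m) * h x - real (Suc m) * f x\<bar> < 1" by linarith
      then have "real (Suc m) * \<bar>h x - f x\<bar> < 1" by (simp add: right_diff_distrib[symmetric] abs_mult del: of_nat_Suc)
      then have 1: "\<bar>h x - f x\<bar> < 1 / real (Suc m)" by (simp add: less_divide_eq mult.commute del: of_nat_Suc)
      have 2: "\<bar>f x - f z\<bar> < 1 / real (Suc m)" using g xZ z x(2) unfolding good_def by blast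
      have 3: "\<bar>h x - h z\<bar> < 1 / real (Suc m)" using h(1) xZ z x(2) unfolding good_def by blast
      show ?thesis using 1 2 3 m by linarith
    qed
    then show ?thesis by (intro exI[of _ "to_nat (m, k, cd f m k)"]) (simp add: h_def)
  qed
  moreover have "pick (from_nat j) \<in> E" for j using pick by (metis prod.collapse)
  ultimately show ?thesis by (intro exI[of _ "\<lambda>j. pick (from_nat j)"]) auto
qed

lemma square_max_add_le: "(max 0 (x + h))\<^sup>2 \<le> (max 0 x)\<^sup>2 + 2 * h * max 0 x + (h::real)\<^sup>2"
proof (cases "x \<ge> 0")
  case True
  have "(max 0 (x + h))\<^sup>2 \<le> (x + h)\<^sup>2" by (auto simp: max_def)
  then show ?thesis using True by (simp add: power2_sum algebra_simps)
next
  case False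
  have "\<bar>max 0 (x + h)\<bar> \<le> \<bar>h\<bar>" using False by auto
  then have "(max 0 (x + h))\<^sup>2 \<le> h\<^sup>2" by (rule abs_le_square_iff[THEN iffD1])
  then show ?thesis using False by simp
qed

text \<open>The first variation of a sum of squares at an almost minimiser separates the moment set.\<close>

lemma lp_duality_finite:
  fixes e :: "nat \<Rightarrow> 'a \<Rightarrow> real"
  assumes ne: "z0 \<in> Z" and bd: "\<And>j z. j < n \<Longrightarrow> z \<in> Z \<Longrightarrow> \<bar>e j z\<bar> \<le> K" "\<And>z. z \<in> Z \<Longrightarrow> \<bar>l z\<bar> \<le> K" "\<And>z. z \<in> Z \<Longrightarrow> \<bar>b z\<bar> \<le> K"
    and alt: "\<And>c t. t \<ge> 0 \<Longrightarrow> \<exists>z\<in>Z. b z > (\<Sum>j<n. c j * e j z) + t * l z" and eps: "\<epsilon> > 0"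
  shows "\<exists>p. finite (set_pmf p) \<and> set_pmf p \<subseteq> Z \<and>
    (\<Sum>j<n. (measure_pmf.expectation p (e j))\<^sup>2) + (max 0 (measure_pmf.expectation p l))\<^sup>2 + (max 0 (- measure_pmf.expectation p b))\<^sup>2 < \<epsilon>"
proof (rule ccontr)
  assume neg: "\<not> ?thesis"
  let ?E = "\<lambda>p f. measure_pmf.expectation p f :: real"
  define S where "S = {p. finite (set_pmf p) \<and> set_pmf p \<subseteq> Z}"
  define J where "J p = (\<Sum>j<n. (?E p (e j))\<^sup>2) + (max 0 (?E p l))\<^sup>2 + (max 0 (- ?E p b))\<^sup>2" for p
  have Jge: "J p \<ge> \<epsilon>" if "p \<in> S" for p using neg that by (auto simp: S_def J_def not_less)
  have retS: "return_pmf z0 \<in> S" using ne by (simp add: S_def)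
  define J0 where "J0 = (INF p\<in>S. J p)"
  have bddJ: "bdd_below (J ` S)" by (rule bdd_belowI[of _ \<epsilon>]) (use Jge in auto)
  have J0e: "J0 \<ge> \<epsilon>" unfolding J0_def by (rule cINF_greatest) (use retS Jge in auto)
  then have J0pos: "J0 > 0" using eps by linarith
  have J0le: "J0 \<le> J p" if "p \<in> S" for p unfolding J0_def by (rule cINF_lower[OF bddJ that])
  have Eb: "\<bar>?E p f\<bar> \<le> K" if p: "p \<in> S" and f: "\<And>z. z \<in> Z \<Longrightarrow> \<bar>f z\<bar> \<le> K" for p and f :: "'a \<Rightarrow> real"
  proof -
    have fin: "finite (set_pmf p)" and sub: "set_pmf p \<subseteq> Z" using p by (auto simp: S_def)
    have "\<bar>?E p f\<bar> \<le> ?E p (\<lambda>z. \<bar>f z\<bar>)" by (rule integral_abs_bound)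
    also have "\<dots> \<le> ?E p (\<lambda>_. K)"
      by (intro integral_mono_AE integrable_measure_pmf_finite fin) (use f sub in \<open>auto simp: AE_measure_pmf_iff\<close>)
    finally show ?thesis by simp
  qed
  have K0: "K \<ge> 0" using bd(2)[OF ne] by linarith
  \<comment> \<open>C bounds the second-order part of J on the segment from p to a Dirac mass. With
    s = J0 / C that part is at most s * J0, and the summand J0 ensures s \<le> 1.\<close>
  define C where "C = (real n + 2) * (2 * K)\<^sup>2 + J0"
  have Cpos: "C > 0" using J0pos by (simp add: C_def add_nonneg_pos)
  define s where "s = J0 / C"
  have s: "0 < s" "s \<le> 1" "s * C = J0" using J0pos Cpos by (auto simp: s_def C_def)
  obtain p where p: "p \<in> S" "J p < J0 + s * J0 / 2"
  proof -
    have "J0 < J0 + s * J0 / 2" using s J0pos by simp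
    then show ?thesis using that cINF_less_iff[OF _ bddJ, of "J0 + s * J0 / 2"] retS unfolding J0_def by blast
  qed
  have fin: "finite (set_pmf p)" and sub: "set_pmf p \<subseteq> Z" using p(1) by (auto simp: S_def)
  define x where "x j = ?E p (e j)" for j
  define X where "X = max 0 (?E p l)"
  define Y where "Y = max 0 (- ?E p b)"
  \<comment> \<open>G z - J p is half the derivative of J at p towards the Dirac mass at z. As J
    cannot fall below J0 and p is within s * J0 / 2 of it, G is at least J0 / 4 on all of Z.\<close>
  define G where "G z = (\<Sum>j<n. x j * e j z) + X * l z - Y * b z" for z
  have Jp: "J p = (\<Sum>j<n. (x j)\<^sup>2) + X\<^sup>2 + Y\<^sup>2" by (simp add: J_def x_def X_def Y_def)
  have Gz: "G z \<ge> J0 / 4" if z: "z \<in> Z" for z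
  proof -
    \<comment> \<open>The mixture of p, with weight 1 - s, and the Dirac mass at z.\<close>
    define q where "q = bind_pmf (bernoulli_pmf s) (\<lambda>a. if a then return_pmf z else p)"
    have Eq: "?E q f = ?E p f + s * (f z - ?E p f)" for f
    proof -
      have "?E q f = (\<Sum>a\<in>UNIV. pmf (bernoulli_pmf s) a *\<^sub>R measure_pmf.expectation (if a then return_pmf z else p) f)"
        unfolding q_def by (rule pmf_expectation_bind) (use fin in auto)
      also have "\<dots> = s * f z + (1 - s) * ?E p f" using s by (simp add: UNIV_bool)
      finally show ?thesis by (simp add: algebra_simps)
    qed
    have "q \<in> S" using fin sub z by (auto simp: S_def q_def split: if_splits)
    have d: "(s * (f z - ?E p f))\<^sup>2 \<le> s\<^sup>2 * (2 * K)\<^sup>2" if f: "\<And>z. z \<in> Z \<Longrightarrow> \<bar>f z\<bar> \<le> K" for f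
    proof -
      have "\<bar>?E p f\<bar> \<le> K" by (rule Eb[OF p(1)]) (rule f)
      then have "\<bar>f z - ?E p f\<bar> \<le> 2 * K" using f[OF z] by linarith
      then have "(f z - ?E p f)\<^sup>2 \<le> (2 * K)\<^sup>2" using K0 by (intro abs_le_square_iff[THEN iffD1]) simp
      then show ?thesis by (simp add: power_mult_distrib mult_left_mono)
    qed
    have 1: "(?E q (e j))\<^sup>2 \<le> (x j)\<^sup>2 + 2 * s * (x j * e j z - (x j)\<^sup>2) + s\<^sup>2 * (2 * K)\<^sup>2" if "j < n" for j
      using d[of "e j"] bd(1)[OF that] unfolding Eq x_def[symmetric] by (simp add: power2_sum power2_eq_square algebra_simps)
    have 2: "(max 0 (?E q l))\<^sup>2 \<le> X\<^sup>2 + 2 * s * (X * l z - X\<^sup>2) + s\<^sup>2 * (2 * K)\<^sup>2"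
    proof -
      have "X * ?E p l = X\<^sup>2" by (auto simp: X_def max_def power2_eq_square)
      then have e1: "2 * (s * (l z - ?E p l)) * X = 2 * s * (X * l z - X\<^sup>2)" by (simp add: algebra_simps)
      show ?thesis using square_max_add_le[of "?E p l" "s * (l z - ?E p l)"] d[of l, OF bd(2)] unfolding Eq X_def[symmetric] e1 by linarith
    qed
    have 3: "(max 0 (- ?E q b))\<^sup>2 \<le> Y\<^sup>2 + 2 * s * (- Y * b z - Y\<^sup>2) + s\<^sup>2 * (2 * K)\<^sup>2"
    proof -
      have "Y * (- ?E p b) = Y\<^sup>2" by (auto simp: Y_def max_def power2_eq_square)
      then have e0: "Y * ?E p b = - Y\<^sup>2" by simp
      have "2 * (- (s * (b z - ?E p b))) * Y = 2 * s * (- Y * b z + Y * ?E p b)" by algebra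
      also have "\<dots> = 2 * s * (- Y * b z - Y\<^sup>2)" by (simp only: e0 diff_conv_add_uminus)
      finally have e1: "2 * (- (s * (b z - ?E p b))) * Y = 2 * s * (- Y * b z - Y\<^sup>2)" .
      have "- ?E q b = - ?E p b + - (s * (b z - ?E p b))" by (simp add: Eq)
      then have "(max 0 (- ?E q b))\<^sup>2 \<le> Y\<^sup>2 + 2 * (- (s * (b z - ?E p b))) * Y + (- (s * (b z - ?E p b)))\<^sup>2"
        using square_max_add_le[of "- ?E p b" "- (s * (b z - ?E p b))"] unfolding Y_def by simp
      moreover have "(- (s * (b z - ?E p b)))\<^sup>2 \<le> s\<^sup>2 * (2 * K)\<^sup>2" using d[of b, OF bd(3)] by simp
      ultimately show ?thesis unfolding e1 by linarith
    qed
    have "(\<Sum>j<n. (?E q (e j))\<^sup>2) \<le> (\<Sum>j<n. (x j)\<^sup>2 + 2 * s * (x j * e j z - (x j)\<^sup>2) + s\<^sup>2 * (2 * K)\<^sup>2)"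
      by (intro sum_mono 1) simp
    also have "\<dots> = (\<Sum>j<n. (x j)\<^sup>2) + 2 * s * ((\<Sum>j<n. x j * e j z) - (\<Sum>j<n. (x j)\<^sup>2)) + real n * (s\<^sup>2 * (2 * K)\<^sup>2)"
      by (simp only: sum.distrib sum_distrib_left[symmetric] sum_subtractf sum_constant card_lessThan, simp only: mult.left_commute)
    finally have 5: "(\<Sum>j<n. (?E q (e j))\<^sup>2) \<le> (\<Sum>j<n. (x j)\<^sup>2) + 2 * s * ((\<Sum>j<n. x j * e j z) - (\<Sum>j<n. (x j)\<^sup>2)) + real n * (s\<^sup>2 * (2 * K)\<^sup>2)" .
    have 6: "2 * s * (G z - J p) = 2 * s * ((\<Sum>j<n. x j * e j z) - (\<Sum>j<n. (x j)\<^sup>2)) + 2 * s * (X * l z - X\<^sup>2) + 2 * s * (- Y * b z - Y\<^sup>2)"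
      unfolding G_def Jp by algebra
    have 7: "(real n + 2) * (s\<^sup>2 * (2 * K)\<^sup>2) = real n * (s\<^sup>2 * (2 * K)\<^sup>2) + s\<^sup>2 * (2 * K)\<^sup>2 + s\<^sup>2 * (2 * K)\<^sup>2" by algebra
    have "J q \<le> J p + 2 * s * (G z - J p) + (real n + 2) * (s\<^sup>2 * (2 * K)\<^sup>2)"
      using 2 3 5 6 7 Jp J_def[of q] by linarith
    moreover have "(real n + 2) * (s\<^sup>2 * (2 * K)\<^sup>2) \<le> s * J0"
    proof -
      have "(real n + 2) * (s\<^sup>2 * (2 * K)\<^sup>2) = s * (s * ((real n + 2) * (2 * K)\<^sup>2))" by (simp add: power2_eq_square)
      also have "\<dots> \<le> s * (s * C)" using s J0pos by (intro mult_left_mono) (auto simp: C_def)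
      finally show ?thesis using s(3) by simp
    qed
    ultimately have 4: "J0 \<le> J p + 2 * s * (G z - J p) + s * J0" using J0le[OF \<open>q \<in> S\<close>] by linarith
    have "s * J0 \<le> s * J p" using J0le[OF p(1)] s(1) by simp
    moreover have "2 * s * (G z - J p) = 2 * (s * G z) - 2 * (s * J p)" by (simp add: algebra_simps)
    ultimately have "s * J0 / 4 \<le> s * G z" using 4 p(2) by linarith
    then show ?thesis using s(1) by simp
  qed
  \<comment> \<open>The residuals act as multipliers. If Y is positive, dividing by it gives
    coefficients for which \<open>alt\<close> yields a point with G < 0.\<close>
  show False
  proof (cases "Y > 0")
    case True
    have "X / Y \<ge> 0" using True by (simp add: X_def)
    from alt[OF this, of "\<lambda>j. x j / Y"] obtain z where z: "z \<in> Z" "b z > (\<Sum>j<n. x j / Y * e j z) + X / Y * l z" by blast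
    have "Y * b z > Y * ((\<Sum>j<n. x j / Y * e j z) + X / Y * l z)" using z(2) True by simp
    also have "Y * ((\<Sum>j<n. x j / Y * e j z) + X / Y * l z) = (\<Sum>j<n. x j * e j z) + X * l z"
      using True by (simp add: distrib_left sum_distrib_left)
    finally show False using Gz[OF z(1)] J0pos by (simp add: G_def)
  next
    case False
    then have Y0: "Y = 0" by (simp add: Y_def)
    \<comment> \<open>With Y = 0 the lower bound on G involves only the constraints, and scaling by
      D lifts it above K, an upper bound for b.\<close>
    define D where "D = 4 * (K + 1) / J0"
    have D0: "D \<ge> 0" using K0 J0pos by (simp add: D_def)
    have "D * X \<ge> 0" using D0 by (simp add: X_def)
    from alt[OF this, of "\<lambda>j. D * x j"] obtain z where z: "z \<in> Z" "b z > (\<Sum>j<n. D * x j * e j z) + D * X * l z" by blast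
    have "(\<Sum>j<n. D * x j * e j z) + D * X * l z = D * G z" by (simp add: G_def Y0 distrib_left sum_distrib_left mult.assoc)
    moreover have "D * G z \<ge> D * (J0 / 4)" using Gz[OF z(1)] D0 by (rule mult_left_mono)
    moreover have "D * (J0 / 4) = K + 1" using J0pos by (simp add: D_def)
    ultimately show False using z(2) bd(3)[OF z(1)] by linarith
  qed
qed

text \<open>\<open>alt\<close> says that the dual problem is infeasible: no f + t l dominates b on
  Z. Countably many members of E determine the constraints by uniform approximation; finitely
  supported laws that meet the first n of them up to a vanishing error have a weak limit meeting
  all. Since almost feasible laws suffice at each stage, closedness of a cone of moments never
  arises.\<close>

theorem lp_duality:
  fixes Z :: "'a::euclidean_space set" and E :: "('a \<Rightarrow> real) set"
  assumes Z: "compact Z" "Z \<noteq> {}" and E: "\<And>f. f \<in> E \<Longrightarrow> continuous_on Z f"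
    and E0: "(\<lambda>_. 0) \<in> E" and Eadd: "\<And>f h. f \<in> E \<Longrightarrow> h \<in> E \<Longrightarrow> (\<lambda>z. f z + h z) \<in> E"
    and Escale: "\<And>c f. f \<in> E \<Longrightarrow> (\<lambda>z. c * f z) \<in> E"
    and l: "continuous_on Z l" and b: "continuous_on Z b"
    and alt: "\<And>f t. f \<in> E \<Longrightarrow> t \<ge> 0 \<Longrightarrow> \<exists>z\<in>Z. b z > f z + t * l z"
  shows "\<exists>\<nu>. prob_space \<nu> \<and> sets \<nu> = sets borel \<and> (AE z in \<nu>. z \<in> Z) \<and>
    (\<forall>f\<in>E. (LINT z:Z|\<nu>. f z) = 0) \<and> (LINT z:Z|\<nu>. l z) \<le> 0 \<and> (LINT z:Z|\<nu>. b z) \<ge> 0"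
proof -
  obtain z0 where z0: "z0 \<in> Z" using Z by blast
  have "\<exists>e :: nat \<Rightarrow> 'a \<Rightarrow> real. (\<forall>j. e j \<in> E) \<and> (\<forall>f\<in>E. \<forall>\<epsilon>>0. \<exists>j. \<forall>z\<in>Z. \<bar>f z - e j z\<bar> < \<epsilon>)"
    by (rule uniform_separability[OF Z(1) _ E0]) (rule E)
  then obtain e :: "nat \<Rightarrow> 'a \<Rightarrow> real" where
    ee: "(\<forall>j. e j \<in> E) \<and> (\<forall>f\<in>E. \<forall>\<epsilon>>0. \<exists>j. \<forall>z\<in>Z. \<bar>f z - e j z\<bar> < \<epsilon>)" by (elim exE)
  have e: "e j \<in> E" "f \<in> E \<Longrightarrow> \<epsilon> > 0 \<Longrightarrow> \<exists>j. \<forall>z\<in>Z. \<bar>f z - e j z\<bar> < \<epsilon>" for j f \<epsilon>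
    using ee by auto
  have bdd: "\<exists>K. \<forall>z\<in>Z. \<bar>f z\<bar> \<le> K" if "continuous_on Z f" for f :: "'a \<Rightarrow> real"
    using compact_imp_bounded[OF compact_continuous_image[OF that Z(1)]] unfolding bounded_iff by auto
  have "\<forall>j. \<exists>K. \<forall>z\<in>Z. \<bar>e j z\<bar> \<le> K" by (intro allI bdd E e(1))
  from choice[OF this] obtain Ke where Ke: "\<And>j z. z \<in> Z \<Longrightarrow> \<bar>e j z\<bar> \<le> Ke j" by blast
  obtain Kl where Kl: "\<And>z. z \<in> Z \<Longrightarrow> \<bar>l z\<bar> \<le> Kl" using bdd[OF l] by blast
  obtain Kb where Kb: "\<And>z. z \<in> Z \<Longrightarrow> \<bar>b z\<bar> \<le> Kb" using bdd[OF b] by blast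
  let ?X = "\<lambda>p f. measure_pmf.expectation p f :: real"
  have "\<forall>n::nat. \<exists>p. finite (set_pmf p) \<and> set_pmf p \<subseteq> Z \<and>
      (\<Sum>j<n. (?X p (e j))\<^sup>2) + (max 0 (?X p l))\<^sup>2 + (max 0 (- ?X p b))\<^sup>2 < 1 / real (Suc n)"
  proof
    fix n :: nat
    define K where "K = (\<Sum>j<n. \<bar>Ke j\<bar>) + \<bar>Kl\<bar> + \<bar>Kb\<bar>"
    have S0: "(\<Sum>j<n. \<bar>Ke j\<bar>) \<ge> 0" by (intro sum_nonneg) auto
    have 1: "\<bar>e j z\<bar> \<le> K" if "j < n" "z \<in> Z" for j z
    proof -
      have "\<bar>Ke j\<bar> \<le> (\<Sum>j<n. \<bar>Ke j\<bar>)" using that by (intro member_le_sum) auto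
      then show ?thesis using Ke[OF that(2), of j] unfolding K_def by linarith
    qed
    have 2: "\<bar>l z\<bar> \<le> K" "\<bar>b z\<bar> \<le> K" if "z \<in> Z" for z using Kl[OF that] Kb[OF that] S0 unfolding K_def by linarith+
    have sumE: "(\<lambda>z. \<Sum>j<m. c j * e j z) \<in> E" for m :: nat and c
    proof (induction m)
      case 0 show ?case using E0 by simp
    next
      case (Suc m) from Eadd[OF Suc.IH Escale[OF e(1), of "c m" m]] show ?case by simp
    qed
    show "\<exists>p. finite (set_pmf p) \<and> set_pmf p \<subseteq> Z \<and>
      (\<Sum>j<n. (?X p (e j))\<^sup>2) + (max 0 (?X p l))\<^sup>2 + (max 0 (- ?X p b))\<^sup>2 < 1 / real (Suc n)"
      by (rule lp_duality_finite[OF z0 1 2]) (use alt[OF sumE] in auto)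
  qed
  from choice[OF this] obtain p where pp: "\<forall>n. finite (set_pmf (p n)) \<and> set_pmf (p n) \<subseteq> Z \<and>
    (\<Sum>j<n. (?X (p n) (e j))\<^sup>2) + (max 0 (?X (p n) l))\<^sup>2 + (max 0 (- ?X (p n) b))\<^sup>2 < 1 / real (Suc n)" by (elim exE)
  have p: "set_pmf (p n) \<subseteq> Z"
    "(\<Sum>j<n. (?X (p n) (e j))\<^sup>2) + (max 0 (?X (p n) l))\<^sup>2 + (max 0 (- ?X (p n) b))\<^sup>2 < 1 / real (Suc n)" for n
    using pp by blast+
  from pmf_weak_compactness[OF Z(1), of p, OF p(1)] obtain r \<nu> where
    r: "strict_mono (r :: nat \<Rightarrow> nat)" and \<nu>: "prob_space \<nu>" "sets \<nu> = sets borel" "AE z in \<nu>. z \<in> Z"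
    and lim0: "\<forall>f :: 'a \<Rightarrow> real. continuous_on Z f \<longrightarrow> (\<lambda>k. ?X (p (r k)) f) \<longlonglongrightarrow> (LINT z:Z|\<nu>. f z)"
    by (elim exE conjE)
  have lim: "(\<lambda>k. ?X (p (r k)) f) \<longlonglongrightarrow> (LINT z:Z|\<nu>. f z)" if "continuous_on Z f" for f
    using lim0 that by simp
  interpret \<nu>: prob_space \<nu> by fact
  have inv: "(\<lambda>k. 1 / real (Suc (r k))) \<longlonglongrightarrow> 0"
    using LIMSEQ_subseq_LIMSEQ[OF LIMSEQ_inverse_real_of_nat r] by (simp add: o_def inverse_eq_divide)
  have sq: "\<bar>y\<bar> \<le> sqrt c" if "y\<^sup>2 \<le> c" for y c :: real using that by (metis real_sqrt_abs real_sqrt_le_mono)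
  have sqinv: "(\<lambda>k. sqrt (1 / real (Suc (r k)))) \<longlonglongrightarrow> 0" using tendsto_real_sqrt[OF inv] by simp
  have ej: "(LINT z:Z|\<nu>. e j z) = 0" for j
  proof -
    have "\<forall>\<^sub>F k in sequentially. norm (?X (p (r k)) (e j)) \<le> sqrt (1 / real (Suc (r k)))"
    proof (rule eventually_sequentiallyI[of "Suc j"])
      fix k assume "Suc j \<le> k"
      then have jr: "j < r k" using seq_suble[OF r, of k] by linarith
      have "(?X (p (r k)) (e j))\<^sup>2 \<le> (\<Sum>j<r k. (?X (p (r k)) (e j))\<^sup>2)" using jr by (intro member_le_sum) auto
      also have "\<dots> \<le> 1 / real (Suc (r k))" using p(2)[of "r k"]
        zero_le_power2[of "max 0 (?X (p (r k)) l)"] zero_le_power2[of "max 0 (- ?X (p (r k)) b)"] by linarith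
      finally show "norm (?X (p (r k)) (e j)) \<le> sqrt (1 / real (Suc (r k)))" using sq by simp
    qed
    from Lim_null_comparison[OF this sqinv] have "(\<lambda>k. ?X (p (r k)) (e j)) \<longlonglongrightarrow> 0" .
    then show ?thesis using lim[OF E[OF e(1)]] LIMSEQ_unique by blast
  qed
  have nn: "(\<Sum>j<m. (?X (p m) (e j))\<^sup>2) \<ge> 0" for m by (intro sum_nonneg) simp
  have lle: "(LINT z:Z|\<nu>. l z) \<le> 0"
  proof (rule tendsto_le[OF _ sqinv lim[OF l]])
    show "\<forall>\<^sub>F k in sequentially. ?X (p (r k)) l \<le> sqrt (1 / real (Suc (r k)))"
    proof (rule always_eventually, rule allI)
      fix k
      have "(max 0 (?X (p (r k)) l))\<^sup>2 \<le> 1 / real (Suc (r k))" using p(2)[of "r k"] nn[of "r k"]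
        zero_le_power2[of "max 0 (- ?X (p (r k)) b)"] by linarith
      from sq[OF this] show "?X (p (r k)) l \<le> sqrt (1 / real (Suc (r k)))" by linarith
    qed
  qed simp
  have ble: "0 \<le> (LINT z:Z|\<nu>. b z)"
  proof -
    have "- (LINT z:Z|\<nu>. b z) \<le> 0"
    proof (rule tendsto_le[OF _ sqinv tendsto_minus[OF lim[OF b]]])
      show "\<forall>\<^sub>F k in sequentially. - ?X (p (r k)) b \<le> sqrt (1 / real (Suc (r k)))"
      proof (rule always_eventually, rule allI)
        fix k
        have "(max 0 (- ?X (p (r k)) b))\<^sup>2 \<le> 1 / real (Suc (r k))" using p(2)[of "r k"] nn[of "r k"]
          zero_le_power2[of "max 0 (?X (p (r k)) l)"] by linarith
        from sq[OF this] show "- ?X (p (r k)) b \<le> sqrt (1 / real (Suc (r k)))" by linarith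
      qed
    qed simp
    then show ?thesis by simp
  qed
  \<comment> \<open>A general f is within \<epsilon> of some e j uniformly on Z, so its expectations
    are within \<epsilon> of those of e j, which tend to 0.\<close>
  have "(LINT z:Z|\<nu>. f z) = 0" if f: "f \<in> E" for f
  proof (rule ccontr)
    assume n0: "(LINT z:Z|\<nu>. f z) \<noteq> 0"
    define \<epsilon> where "\<epsilon> = \<bar>LINT z:Z|\<nu>. f z\<bar> / 2"
    have \<epsilon>: "\<epsilon> > 0" using n0 by (simp add: \<epsilon>_def)
    obtain j where j: "\<And>z. z \<in> Z \<Longrightarrow> \<bar>f z - e j z\<bar> < \<epsilon>" using e(2)[OF f \<epsilon>] by blast
    have "(\<lambda>k. ?X (p (r k)) f - ?X (p (r k)) (e j)) \<longlonglongrightarrow> (LINT z:Z|\<nu>. f z) - (LINT z:Z|\<nu>. e j z)"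
      by (intro tendsto_diff lim E f e(1))
    then have "(\<lambda>k. \<bar>?X (p (r k)) f - ?X (p (r k)) (e j)\<bar>) \<longlonglongrightarrow> \<bar>LINT z:Z|\<nu>. f z\<bar>"
      unfolding ej by (intro tendsto_rabs) simp
    moreover have "\<bar>?X (p m) f - ?X (p m) (e j)\<bar> \<le> \<epsilon>" for m
    proof -
      have int: "integrable (measure_pmf (p m)) h" if h: "continuous_on Z h" for h :: "'a \<Rightarrow> real"
      proof -
        obtain K where "\<forall>z\<in>Z. \<bar>h z\<bar> \<le> K" using bdd[OF h] by blast
        then show ?thesis using p(1)[of m]
          by (intro measure_pmf.integrable_const_bound[of _ K]) (auto simp: AE_measure_pmf_iff subset_iff)
      qed
      have "?X (p m) f - ?X (p m) (e j) = ?X (p m) (\<lambda>z. f z - e j z)"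
        by (rule Bochner_Integration.integral_diff[symmetric]) (intro int E f e(1))+
      also have "\<bar>\<dots>\<bar> \<le> ?X (p m) (\<lambda>z. \<bar>f z - e j z\<bar>)" by (rule integral_abs_bound)
      also have "\<dots> \<le> ?X (p m) (\<lambda>_. \<epsilon>)"
        by (intro integral_mono_AE int continuous_intros E f e(1)) (use p(1)[of m] j in \<open>auto simp: AE_measure_pmf_iff subset_iff less_imp_le\<close>)
      finally show ?thesis by simp
    qed
    ultimately have "\<bar>LINT z:Z|\<nu>. f z\<bar> \<le> \<epsilon>" by (intro tendsto_upperbound) auto
    then show False using \<epsilon> by (simp add: \<epsilon>_def)
  qed
  then show ?thesis using \<nu> lle ble by blast
qed

section \<open>Mather measures\<close>

context closed_manifold
begin

section \<open>Borel functions on the tangent bundle\<close>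

lemma space_tangent_borel [simp]: "space (tangent_borel A) = UNIV"
  by (simp add: tangent_borel_def space_measure_of_conv)

lemma openin_tangent_measurable: assumes "openin (tangent_topology A) W" shows "W \<in> sets (tangent_borel A)"
  unfolding tangent_borel_def using assms by (subst sets_measure_of) auto

lemma openin_tangentI:
  assumes "\<And>c. c \<in> A \<Longrightarrow> open {q \<in> img c \<times> UNIV. (chart_inv c (fst q), tvec c (chart_inv c (fst q)) (snd q)) \<in> W}"
  shows "openin (tangent_topology A) W"
  unfolding openin_tangent_topology
proof
  fix c assume "c \<in> A"
  moreover have "{q \<in> img c \<times> UNIV. tangent_param A c q \<in> W} = {q \<in> img c \<times> UNIV. (chart_inv c (fst q), tvec c (chart_inv c (fst q)) (snd q)) \<in> W}"
    by (auto simp: tangent_param_eq)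
  ultimately show "open {q \<in> img c \<times> UNIV. tangent_param A c q \<in> W}" using assms by simp
qed

lemma measurable_tangent_continuous:
  fixes F :: "'m \<times> 'e \<Rightarrow> real"
  assumes "\<And>c. c \<in> A \<Longrightarrow> continuous_on (img c \<times> UNIV) (\<lambda>q. F (chart_inv c (fst q), tvec c (chart_inv c (fst q)) (snd q)))"
  shows "F \<in> borel_measurable (tangent_borel A)"
proof (rule borel_measurableI)
  fix S :: "real set" assume S: "open S"
  have "openin (tangent_topology A) (F -` S)"
  proof (rule openin_tangentI)
    fix c assume c: "c \<in> A"
    have "open (img c \<times> (UNIV :: 'e set))" by (intro open_Times open_img c open_UNIV)
    from continuous_open_preimage[OF assms[OF c] this S]
    show "open {q \<in> img c \<times> UNIV. (chart_inv c (fst q), tvec c (chart_inv c (fst q)) (snd q)) \<in> F -` S}"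
      by (simp add: Int_def vimage_def)
  qed
  then show "F -` S \<inter> space (tangent_borel A) \<in> sets (tangent_borel A)" by (simp add: openin_tangent_measurable)
qed

lemma measurable_fst_tangent: "fst \<in> measurable (tangent_borel A) borel"
proof (rule borel_measurableI)
  fix S :: "'m set" assume S: "open S"
  have "openin (tangent_topology A) (fst -` S)"
  proof (rule openin_tangentI)
    fix c assume c: "c \<in> A"
    have "open ({y \<in> img c. chart_inv c y \<in> S} \<times> (UNIV :: 'e set))" by (intro open_Times open_chart_preimage c S open_UNIV)
    also have "{y \<in> img c. chart_inv c y \<in> S} \<times> UNIV = {q \<in> img c \<times> UNIV. (chart_inv c (fst q), tvec c (chart_inv c (fst q)) (snd q)) \<in> fst -` S}"
      by auto
    finally show "open {q \<in> img c \<times> UNIV. (chart_inv c (fst q), tvec c (chart_inv c (fst q)) (snd q)) \<in> fst -` S}" .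
  qed
  then show "fst -` S \<inter> space (tangent_borel A) \<in> sets (tangent_borel A)" by (simp add: openin_tangent_measurable)
qed

lemma measurable_base_fun: assumes "continuous_on UNIV u"
  shows "(\<lambda>q. u (fst q) :: real) \<in> borel_measurable (tangent_borel A)"
  using measurable_compose[OF measurable_fst_tangent borel_measurable_continuous_onI[OF assms]] .

lemma measurable_differential: assumes "C1_fun A \<phi>"
  shows "(\<lambda>q. blinfun_apply (differential A \<phi> (fst q)) (snd q)) \<in> borel_measurable (tangent_borel A)"
proof (rule measurable_tangent_continuous)
  fix c assume c: "c \<in> A"
  have cg: "continuous_on (img c) (grad (\<phi> \<circ> chart_inv c))" using C1_fun_grad[OF assms c] by (simp add: grad_on_def)
  have 1: "continuous_on (img c \<times> UNIV) (\<lambda>q. grad (\<phi> \<circ> chart_inv c) (fst q) \<bullet> snd q)"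
    by (intro continuous_intros continuous_on_compose2[OF cg]) auto
  show "continuous_on (img c \<times> UNIV) (\<lambda>q. blinfun_apply (differential A \<phi> (fst (chart_inv c (fst q), tvec c (chart_inv c (fst q)) (snd q)))) (snd (chart_inv c (fst q), tvec c (chart_inv c (fst q)) (snd q))))"
  proof (rule continuous_on_eq[OF 1])
    fix q assume "q \<in> img c \<times> (UNIV :: 'e set)"
    then have y: "fst q \<in> img c" by auto
    have x: "chart_inv c (fst q) \<in> fst c" using c y by (rule chart_inv_in)
    show "grad (\<phi> \<circ> chart_inv c) (fst q) \<bullet> snd q = blinfun_apply (differential A \<phi> (fst (chart_inv c (fst q), tvec c (chart_inv c (fst q)) (snd q)))) (snd (chart_inv c (fst q), tvec c (chart_inv c (fst q)) (snd q)))"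
      by (simp add: differential_cov[OF assms c x] cov_tvec[OF c x] chart_inv_right[OF c y])
  qed
qed

text \<open>Regularity of the metric is given for each fixed pair of coordinate vectors; expansion
  in the basis turns it into joint continuity.\<close>

lemma tnorm_chart_continuous: assumes c: "c \<in> A"
  shows "continuous_on (img c \<times> UNIV) (\<lambda>q. tnorm g (chart_inv c (fst q)) (tvec c (chart_inv c (fst q)) (snd q)))"
proof -
  let ?G = "\<lambda>i j y. g (chart_inv c y) (tvec c (chart_inv c y) i) (tvec c (chart_inv c y) j)"
  have cg: "continuous_on (img c) (?G i j)" for i j
  proof -
    have "\<forall>k. Ck_on k (img c) (\<lambda>y. g (chart_inv c y) (snd (tangent_param A c (y, i))) (snd (tangent_param A c (y, j))))"
      using metric c by (simp add: riemannian_metric_def smooth_on_def)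
    from this[rule_format, of 0] show ?thesis by (simp add: tangent_param_eq)
  qed
  have 1: "continuous_on (img c \<times> UNIV) (\<lambda>q. sqrt (\<Sum>i\<in>Basis. \<Sum>j\<in>Basis. (snd q \<bullet> i) * ((snd q \<bullet> j) * ?G i j (fst q))))"
    by (intro continuous_intros continuous_on_compose2[OF cg]) auto
  show ?thesis
  proof (rule continuous_on_eq[OF 1])
    fix q assume "q \<in> img c \<times> (UNIV :: 'e set)"
    then have y: "fst q \<in> img c" by auto
    let ?x = "chart_inv c (fst q)"
    have x: "?x \<in> fst c" using c y by (rule chart_inv_in)
    have bb: "bounded_bilinear (g ?x)" using metric by (simp add: riemannian_metric_def bilinear_conv_bounded_bilinear)
    have sym: "g ?x v w = g ?x w v" for v w using metric by (auto simp: riemannian_metric_def)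
    have lin: "linear (tvec c ?x)" unfolding tvec_def[abs_def]
      by (rule bounded_linear.linear[OF coord_change_linear[OF c chart_at_in(1) x chart_at_in(2)]])
    have e: "tvec c ?x (snd q) = (\<Sum>i\<in>Basis. (snd q \<bullet> i) *\<^sub>R tvec c ?x i)"
    proof -
      have "tvec c ?x (snd q) = tvec c ?x (\<Sum>i\<in>Basis. (snd q \<bullet> i) *\<^sub>R i)" by (simp add: euclidean_representation)
      then show ?thesis by (simp add: linear_sum[OF lin] linear_scale[OF lin])
    qed
    have "g ?x (tvec c ?x (snd q)) (tvec c ?x (snd q)) = (\<Sum>i\<in>Basis. \<Sum>j\<in>Basis. (snd q \<bullet> i) * ((snd q \<bullet> j) * ?G i j (fst q)))"
      by (subst (1 2) e) (simp add: bounded_bilinear.sum_left[OF bb] bounded_bilinear.sum_right[OF bb]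
          bounded_bilinear.scaleR_left[OF bb] bounded_bilinear.scaleR_right[OF bb] sum_distrib_left sym, simp only: mult.left_commute)
    then show "sqrt (\<Sum>i\<in>Basis. \<Sum>j\<in>Basis. (snd q \<bullet> i) * ((snd q \<bullet> j) * ?G i j (fst q))) = tnorm g ?x (tvec c ?x (snd q))"
      by (simp add: tnorm_def)
  qed
qed

end

context discounted_hamiltonian
begin

abbreviation Lag :: "'m \<times> 'e \<Rightarrow> real \<Rightarrow> real" where "Lag q u \<equiv> lagrangian H (fst q) (snd q) u"
abbreviation dLag :: "'m \<times> 'e \<Rightarrow> real" where "dLag q \<equiv> deriv (lagrangian H (fst q) (snd q)) 0"

text \<open>L is a supremum of functions continuous in charts, so its strict superlevel sets are
  open in the bundle topology.\<close>

lemma measurable_Lag: "(\<lambda>q. Lag q u) \<in> borel_measurable (tangent_borel A)"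
  unfolding borel_measurable_iff_greater
proof
  fix a
  have iff: "a < lagrangian H x v u \<longleftrightarrow> (\<exists>p. a < blinfun_apply p v - H x p u)" for x v
  proof -
    have "bdd_above (range (\<lambda>p. blinfun_apply p v - H x p u))" using fenchel by (intro bdd_aboveI2) auto
    from less_cSUP_iff[OF _ this] show ?thesis by (simp add: lagrangian_def)
  qed
  have "openin (tangent_topology A) {q. a < Lag q u}"
  proof (rule openin_tangentI)
    fix c assume c: "c \<in> A"
    have "{q \<in> img c \<times> UNIV. (chart_inv c (fst q), tvec c (chart_inv c (fst q)) (snd q)) \<in> {q. a < Lag q u}} =
      (\<Union>\<xi>. {q \<in> img c \<times> UNIV. a < \<xi> \<bullet> snd q - loc (\<lambda>x p. H x p u) c (fst q) \<xi>})" (is "?L = ?R")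
    proof (intro equalityI subsetI)
      fix q assume q: "q \<in> ?L"
      let ?x = "chart_inv c (fst q)"
      have x: "?x \<in> fst c" using c q by (intro chart_inv_in) auto
      obtain p where p: "a < blinfun_apply p (tvec c ?x (snd q)) - H ?x p u" using q by (auto simp: iff)
      obtain \<xi> where "p = cov c ?x \<xi>" using cov_surj[OF c x] by blast
      then have "a < \<xi> \<bullet> snd q - loc (\<lambda>x p. H x p u) c (fst q) \<xi>" using p by (simp add: cov_tvec[OF c x])
      then show "q \<in> ?R" using q by auto
    next
      fix q assume "q \<in> ?R"
      then obtain \<xi> where q: "q \<in> img c \<times> UNIV" "a < \<xi> \<bullet> snd q - loc (\<lambda>x p. H x p u) c (fst q) \<xi>" by blast
      let ?x = "chart_inv c (fst q)"
      have x: "?x \<in> fst c" using c q by (intro chart_inv_in) auto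
      have "a < blinfun_apply (cov c ?x \<xi>) (tvec c ?x (snd q)) - H ?x (cov c ?x \<xi>) u" using q(2) by (simp add: cov_tvec[OF c x])
      then show "q \<in> ?L" using q(1) by (auto simp: iff)
    qed
    moreover have "open {q \<in> img c \<times> UNIV. a < \<xi> \<bullet> snd q - loc (\<lambda>x p. H x p u) c (fst q) \<xi>}" for \<xi>
    proof -
      have 1: "continuous_on (img c \<times> (UNIV :: 'e set)) (\<lambda>q. (fst q, \<xi>, u))" by (intro continuous_intros)
      have 2: "continuous_on (img c \<times> (UNIV :: 'e set)) (\<lambda>q. loc (\<lambda>x p. H x p u) c (fst q) \<xi>)"
        using continuous_on_compose2[OF continuous_on_cotangent_chart[OF H_cont c] 1] by (auto simp: split_beta image_subset_iff)
      have 3: "continuous_on (img c \<times> (UNIV :: 'e set)) (\<lambda>q. \<xi> \<bullet> snd q - loc (\<lambda>x p. H x p u) c (fst q) \<xi>)"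
        by (intro continuous_intros 2)
      have "open (img c \<times> (UNIV :: 'e set))" by (intro open_Times open_img c open_UNIV)
      from continuous_open_preimage[OF 3 this open_greaterThan[of a]] show ?thesis by (simp add: Int_def vimage_def)
    qed
    ultimately show "open {q \<in> img c \<times> UNIV. (chart_inv c (fst q), tvec c (chart_inv c (fst q)) (snd q)) \<in> {q. a < Lag q u}}"
      by (metis (no_types, lifting) open_UN)
  qed
  then show "{q \<in> space (tangent_borel A). a < Lag q u} \<in> sets (tangent_borel A)" by (simp add: openin_tangent_measurable)
qed

text \<open>A pointwise limit of difference quotients along a sequence, each measurable by the
  previous lemma.\<close>

lemma measurable_dLag: "dLag \<in> borel_measurable (tangent_borel A)"
proof (rule borel_measurable_LIMSEQ_real)
  fix k :: nat
  show "(\<lambda>q. (Lag q (inverse (real (Suc k))) - Lag q 0) / inverse (real (Suc k))) \<in> borel_measurable (tangent_borel A)"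
    by (intro borel_measurable_divide borel_measurable_diff measurable_Lag borel_measurable_const)
next
  fix q :: "'m \<times> 'e"
  have "(lagrangian H (fst q) (snd q) has_real_derivative dLag q) (at 0)"
    using L_diff by (simp add: field_differentiable_derivI)
  then have *: "((\<lambda>h. (Lag q h - Lag q 0) / h) \<longlongrightarrow> dLag q) (at 0)" by (simp add: DERIV_def)
  have "filterlim (\<lambda>k. inverse (real (Suc k))) (at 0) sequentially"
    unfolding filterlim_at using LIMSEQ_inverse_real_of_nat by auto
  from filterlim_compose[OF * this]
  show "(\<lambda>k. (Lag q (inverse (real (Suc k))) - Lag q 0) / inverse (real (Suc k))) \<longlonglongrightarrow> dLag q" .
qed

text \<open>Fenchel's inequality for df and for -df; it makes the pairing with df integrable
  wherever L is.\<close>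

lemma C1_differential_bound: assumes "C1_fun A f"
  shows "\<exists>B. \<forall>q. \<bar>blinfun_apply (differential A f (fst q)) (snd q)\<bar> \<le> \<bar>Lag q 0\<bar> + B"
proof -
  obtain B1 where B1: "\<And>x. H x (differential A f x) 0 \<le> B1" using bdd_above_H_differential[OF assms] by (auto simp: bdd_above_def)
  obtain B2 where B2: "\<And>x. H x (differential A (\<lambda>x. - f x) x) 0 \<le> B2" using bdd_above_H_differential[OF C1_minus[OF assms]] by (auto simp: bdd_above_def)
  have "\<bar>blinfun_apply (differential A f (fst q)) (snd q)\<bar> \<le> \<bar>Lag q 0\<bar> + (\<bar>B1\<bar> + \<bar>B2\<bar>)" for q
    using fenchel[of "differential A f (fst q)" "snd q" "fst q" 0] B1[of "fst q"]
      fenchel[of "differential A (\<lambda>x. - f x) (fst q)" "snd q" "fst q" 0] B2[of "fst q"]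
    unfolding differential_minus[OF assms] blinfun.minus_left by linarith
  then show ?thesis by blast
qed

section \<open>Compact support and integrability for Mather measures\<close>

lemma matherD: assumes "mather_measure A g H m"
  shows "prob_space m" "sets m = sets (tangent_borel A)" "integrable m (\<lambda>q. Lag q 0)" "(\<integral>q. Lag q 0 \<partial>m) = - crit"
    "\<And>\<phi>. C1_fun A \<phi> \<Longrightarrow> (\<integral>q. blinfun_apply (differential A \<phi> (fst q)) (snd q) \<partial>m) = 0"
    "\<And>\<phi>. C1_fun A \<phi> \<Longrightarrow> integrable m (\<lambda>q. blinfun_apply (differential A \<phi> (fst q)) (snd q))"
proof -
  have cm: "closed_measure A g m" and hb: "has_bochner_integral m (\<lambda>q. Lag q 0) (- crit)"
    using assms unfolding mather_measure_def split_beta by blast+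
  show "prob_space m" and s: "sets m = sets (tangent_borel A)" using cm by (auto simp: closed_measure_def)
  show int: "integrable m (\<lambda>q. Lag q 0)" and "(\<integral>q. Lag q 0 \<partial>m) = - crit"
    using hb by (auto simp: has_bochner_integral_iff)
  fix \<phi> assume \<phi>: "C1_fun A \<phi>"
  then show "(\<integral>q. blinfun_apply (differential A \<phi> (fst q)) (snd q) \<partial>m) = 0"
    using cm unfolding closed_measure_def split_beta by blast
  obtain B where B: "\<And>q. \<bar>blinfun_apply (differential A \<phi> (fst q)) (snd q)\<bar> \<le> \<bar>Lag q 0\<bar> + B" using C1_differential_bound[OF \<phi>] by blast
  interpret prob_space m by fact
  show "integrable m (\<lambda>q. blinfun_apply (differential A \<phi> (fst q)) (snd q))"
  proof (rule Bochner_Integration.integrable_bound)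
    show "integrable m (\<lambda>q. \<bar>Lag q 0\<bar> + B)" using int by simp
    show "(\<lambda>q. blinfun_apply (differential A \<phi> (fst q)) (snd q)) \<in> borel_measurable m"
      using measurable_differential[OF \<phi>] by (simp add: measurable_cong_sets[OF s refl])
    show "AE q in m. norm (blinfun_apply (differential A \<phi> (fst q)) (snd q)) \<le> norm (\<bar>Lag q 0\<bar> + B)"
    proof (rule AE_I2)
      fix q show "norm (blinfun_apply (differential A \<phi> (fst q)) (snd q)) \<le> norm (\<bar>Lag q 0\<bar> + B)"
        using B[of q] by (simp add: real_norm_def)
    qed
  qed
qed

text \<open>For a C^1 function f with H(x,df,0) \<le> c + e, the function L + c + e - df(v) is
  nonnegative with integral e, because the measure is closed and minimising. Superlinearity makes it
  at least 1 where L is large, so that region has measure at most e for every e > 0.\<close>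

lemma mather_support: "\<exists>C. \<forall>m. mather_measure A g H m \<longrightarrow> (AE q in m. Lag q 0 \<le> C)"
proof -
  have nice: "coercive_hamiltonian (\<lambda>x p. H x p 0 + 0)" by (rule coercive_frozen) auto
  obtain P where P: "P > 0" "\<forall>z\<in>base. \<forall>\<xi>. H (pt z) (bcov z \<xi>) 0 + 0 \<le> crit + 1 \<longrightarrow> norm \<xi> \<le> P"
    using bounded_bN[OF nice, of "crit + 1"] by blast
  have "continuous_on (base \<times> cball (0::'e) P) (\<lambda>q. bH (fst q) (2 *\<^sub>R snd q) 0)"
    by (intro continuous_bH_compose continuous_intros) auto
  from compact_imp_bounded[OF compact_continuous_image[OF this]]
  obtain B where B: "\<And>z \<xi>. z \<in> base \<Longrightarrow> norm \<xi> \<le> P \<Longrightarrow> \<bar>bH z (2 *\<^sub>R \<xi>) 0\<bar> \<le> B"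
    unfolding bounded_iff by (force simp: compact_Times compact_base)
  \<comment> \<open>Fenchel's inequality with twice the momentum: the factor 1/2 in front of L is
    what leaves a surplus where L is large.\<close>
  have half: "blinfun_apply p v \<le> (lagrangian H x v 0 + B) / 2" if "H x p 0 \<le> crit + 1" for x p v
  proof -
    obtain z where z: "z \<in> base" "pt z = x" using pt_surj by blast
    obtain \<xi> where \<xi>: "p = bcov z \<xi>" using bcov_surj[OF z(1)] by blast
    have "norm \<xi> \<le> P" using P(2) z \<xi> that by auto
    from B[OF z(1) this] have "H x (2 *\<^sub>R p) 0 \<le> B" by (auto simp: bH_def bcov_lin[OF z(1)] z \<xi> abs_le_iff)
    then show ?thesis using fenchel[of "2 *\<^sub>R p" v x 0] by (simp add: blinfun.scaleR_left)
  qed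
  \<comment> \<open>Above this value of L, the bound (L + B)/2 on the pairing is below L + c by at
    least 1.\<close>
  define C where "C = B + 2 - 2 * crit"
  have "AE q in m. Lag q 0 \<le> C" if m: "mather_measure A g H m" for m
  proof -
    note mm = matherD[OF m]
    interpret prob_space m by (rule mm(1))
    have sp: "space m = UNIV" using sets_eq_imp_space_eq[OF mm(2)] by simp
    have S: "{q. C < Lag q 0} \<in> sets m"
      using borel_measurable_iff_greater[THEN iffD1, OF measurable_Lag[of 0], rule_format, of C] mm(2) by simp
    have "measure m {q. C < Lag q 0} \<le> inverse (real (Suc k))" for k
    proof -
      let ?e = "inverse (real (Suc k))"
      obtain f where f: "C1_fun A f" "\<And>x. H x (differential A f x) 0 \<le> crit + ?e" using crit_approx[of ?e] by auto
      have e1: "?e \<le> 1" "?e > 0" by (auto simp: inverse_le_1_iff)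
      let ?F = "\<lambda>q. Lag q 0 + (crit + ?e) - blinfun_apply (differential A f (fst q)) (snd q)"
      have intF: "integrable m ?F" by (intro Bochner_Integration.integrable_diff Bochner_Integration.integrable_add mm(3) mm(6) f(1) integrable_const)
      have "(\<integral>q. ?F q \<partial>m) = (\<integral>q. Lag q 0 + (crit + ?e) \<partial>m) - (\<integral>q. blinfun_apply (differential A f (fst q)) (snd q) \<partial>m)"
        by (intro Bochner_Integration.integral_diff Bochner_Integration.integrable_add mm(3) mm(6) f(1) integrable_const)
      also have "(\<integral>q. Lag q 0 + (crit + ?e) \<partial>m) = - crit + (crit + ?e)"
        by (subst Bochner_Integration.integral_add) (auto simp: mm(3,4) prob_space)
      finally have val: "(\<integral>q. ?F q \<partial>m) = ?e" using mm(5)[OF f(1)] by simp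
      have "(\<integral>q. indicator {q. C < Lag q 0} q \<partial>m) \<le> (\<integral>q. ?F q \<partial>m)"
      proof (rule integral_mono[OF _ intF])
        show "integrable m (indicator {q. C < Lag q 0} :: 'm \<times> 'e \<Rightarrow> real)" by (rule integrable_real_indicator[OF S]) (simp add: emeasure_finite less_top[symmetric])
        fix q
        have "?F q \<ge> 0" using fenchel[of "differential A f (fst q)" "snd q" "fst q" 0] f(2)[of "fst q"] by linarith
        moreover have "?F q \<ge> 1" if "C < Lag q 0"
        proof -
          have "H (fst q) (differential A f (fst q)) 0 \<le> crit + 1" using f(2)[of "fst q"] e1(1) by linarith
          from half[OF this, of "snd q"] have "blinfun_apply (differential A f (fst q)) (snd q) + 1 \<le> Lag q 0 + crit"
            using that unfolding C_def by argo
          then show ?thesis using e1(2) by linarith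
        qed
        ultimately show "indicator {q. C < Lag q 0} q \<le> ?F q" by (simp add: indicator_def)
      qed
      then show ?thesis unfolding val by (simp add: sp)
    qed
    then have "measure m {q. C < Lag q 0} \<le> 0"
      by (intro tendsto_lowerbound[OF LIMSEQ_inverse_real_of_nat]) auto
    then have "measure m {q. C < Lag q 0} = 0" using measure_nonneg[of m] by (simp add: antisym)
    then have "{q. C < Lag q 0} \<in> null_sets m" using S by (simp add: null_sets_def emeasure_eq_measure)
    from AE_not_in[OF this] show ?thesis by eventually_elim auto
  qed
  then show ?thesis by blast
qed

lemma support_coordinates:
  "\<exists>R>0. \<forall>q. Lag q 0 \<le> C \<longrightarrow> (\<exists>z\<in>base. \<exists>w. norm w \<le> R \<and> fst q = pt z \<and> snd q = btv z w)"
proof -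
  obtain R where R: "R > 0" "\<forall>z\<in>base. \<forall>w. bL z w 0 \<le> C \<longrightarrow> norm w \<le> R" using bL_coercive by blast
  have "\<exists>z\<in>base. \<exists>w. norm w \<le> R \<and> fst q = pt z \<and> snd q = btv z w" if "Lag q 0 \<le> C" for q
  proof -
    obtain z where z: "z \<in> base" "pt z = fst q" using pt_surj by blast
    obtain w where w: "snd q = btv z w" using btv_surj[OF z(1)] by blast
    then have "norm w \<le> R" using R(2) z that by (auto simp: bL_def)
    then show ?thesis using z w by (intro bexI[of _ z] exI[of _ w]) auto
  qed
  then show ?thesis using R(1) by blast
qed

lemma mather_dLag_bound: "\<exists>a'. \<forall>m. mather_measure A g H m \<longrightarrow> (AE q in m. \<bar>dLag q\<bar> \<le> a')"
proof -
  obtain C where C: "\<And>m. mather_measure A g H m \<Longrightarrow> AE q in m. Lag q 0 \<le> C" using mather_support by blast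
  obtain R where R: "R > 0" "\<And>q. Lag q 0 \<le> C \<Longrightarrow> \<exists>z\<in>base. \<exists>w. norm w \<le> R \<and> fst q = pt z \<and> snd q = btv z w"
    using support_coordinates[of C] by blast
  obtain a a' where a: "\<forall>z\<in>base. \<forall>w. norm w \<le> R \<longrightarrow> a \<le> ba z w \<and> ba z w \<le> a'" using ba_bounds[of R] R(1) by auto
  have *: "\<bar>dLag q\<bar> \<le> a'" if qC: "Lag q 0 \<le> C" for q
  proof -
    obtain z w where z: "z \<in> base" "norm w \<le> R" "fst q = pt z" "snd q = btv z w" using R(2)[OF qC] by blast
    have "dLag q = - ba z w" by (simp add: ba_def z)
    then show ?thesis using a z ba_pos[OF z(1), of w] by auto
  qed
  have "AE q in m. \<bar>dLag q\<bar> \<le> a'" if "mather_measure A g H m" for m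
    using C[OF that] by eventually_elim (rule *)
  then show ?thesis by blast
qed

lemma mather_integrable: assumes m: "mather_measure A g H m" and u: "continuous_on UNIV u"
  shows "integrable m (\<lambda>q. u (fst q))" "integrable m (\<lambda>q. u (fst q) * dLag q)"
proof -
  note mm = matherD[OF m]
  interpret prob_space m by (rule mm(1))
  obtain B where B: "\<And>x. \<bar>u x\<bar> \<le> B" using bounded_on_M[OF u] by blast
  obtain a' where a': "AE q in m. \<bar>dLag q\<bar> \<le> a'" using mather_dLag_bound m by blast
  have mu: "(\<lambda>q. u (fst q)) \<in> borel_measurable m"
    using measurable_base_fun[OF u] by (simp add: measurable_cong_sets[OF mm(2) refl])
  have ma: "dLag \<in> borel_measurable m" using measurable_dLag by (simp add: measurable_cong_sets[OF mm(2) refl])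
  show "integrable m (\<lambda>q. u (fst q))" by (rule integrable_const_bound[of _ B]) (use B mu in auto)
  show "integrable m (\<lambda>q. u (fst q) * dLag q)"
  proof (rule integrable_const_bound[of _ "B * a'"])
    show "AE q in m. norm (u (fst q) * dLag q) \<le> B * a'"
      using a' by eventually_elim (use B in \<open>auto simp: abs_mult intro!: mult_mono order_trans[OF abs_ge_zero B]\<close>)
  qed (use mu ma in simp)
qed

text \<open>After integration the critical value cancels against the action and everything left is
  of order \<lambda>: the smoothing error is taken proportional to \<lambda>, and the expansion of L
  at 0 is uniform on the common compact support. Hence the threshold depends on neither the measure
  nor u and e.\<close>

lemma mather_constraint:
  assumes eps: "\<epsilon> > 0"
  shows "\<exists>l1>0. \<forall>l u e m. 0 < l \<longrightarrow> l \<le> l1 \<longrightarrow> continuous_on UNIV e \<longrightarrow> (\<forall>x. \<bar>u x\<bar> \<le> B) \<longrightarrow>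
     subsol (\<lambda>x p. H x p (l * u x) + l * e x - crit) u \<longrightarrow> mather_measure A g H m \<longrightarrow>
     (\<integral>q. e (fst q) \<partial>m) \<le> (\<integral>q. u (fst q) * dLag q \<partial>m) + \<epsilon>"
proof -
  obtain C where C: "\<And>m. mather_measure A g H m \<Longrightarrow> AE q in m. Lag q 0 \<le> C" using mather_support by blast
  obtain R where R: "R > 0" "\<And>q. Lag q 0 \<le> C \<Longrightarrow> \<exists>z\<in>base. \<exists>w. norm w \<le> R \<and> fst q = pt z \<and> snd q = btv z w"
    using support_coordinates[of C] by blast
  \<comment> \<open>The relative expansion error, small enough that multiplied by |u| \<le> B it
    costs at most \<epsilon>/2.\<close>
  define \<epsilon>1 where "\<epsilon>1 = \<epsilon> / (2 * (\<bar>B\<bar> + 1))"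
  have e1: "\<epsilon>1 > 0" using eps by (simp add: \<epsilon>1_def)
  have e1B: "\<epsilon>1 * \<bar>B\<bar> \<le> \<epsilon> / 2"
  proof -
    have "\<epsilon>1 * \<bar>B\<bar> \<le> \<epsilon>1 * (\<bar>B\<bar> + 1)" using e1 by (intro mult_left_mono) auto
    also have "\<dots> = \<epsilon> / 2" by (simp add: \<epsilon>1_def field_simps)
    finally show ?thesis .
  qed
  obtain s where s: "s > 0" "\<And>z w u. z \<in> base \<Longrightarrow> norm w \<le> R \<Longrightarrow> \<bar>u\<bar> \<le> s \<Longrightarrow> \<bar>bL z w u - bL z w 0 + u * ba z w\<bar> \<le> \<epsilon>1 * \<bar>u\<bar>"
    using bL_expansion[OF e1, of R] R(1) by auto
  have "(\<integral>q. e (fst q) \<partial>m) \<le> (\<integral>q. u (fst q) * dLag q \<partial>m) + \<epsilon>"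
    if l: "0 < l" "l \<le> s / (\<bar>B\<bar> + 1)" and e: "continuous_on UNIV e" and uB: "\<And>x. \<bar>u x\<bar> \<le> B"
      and sub: "subsol (\<lambda>x p. H x p (l * u x) + l * e x - crit) u" and m: "mather_measure A g H m" for l u e m
  proof -
    note mm = matherD[OF m]
    interpret prob_space m by (rule mm(1))
    have u: "continuous_on UNIV u" using sub by (simp add: subsol_def)
    have nice: "coercive_hamiltonian (\<lambda>x p. H x p (l * u x) + (l * e x - crit))" by (intro coercive_frozen continuous_intros u e)
    have sub': "subsol (\<lambda>x p. H x p (l * u x) + (l * e x - crit)) u" using sub by (simp add: add_diff_eq)
    have "l * (\<epsilon> / 2) > 0" using l eps by simp
    from subsol_smoothing[OF nice sub' this]
    obtain f where f: "C1_fun A f" "\<And>x. H x (differential A f x) (l * u x) + (l * e x - crit) \<le> l * (\<epsilon> / 2)" by blast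
    let ?d = "\<lambda>q. blinfun_apply (differential A f (fst q)) (snd q)"
    have key: "?d q - crit - l * (\<epsilon> / 2) + l * e (fst q) \<le> Lag q 0 + l * (u (fst q) * dLag q) + l * (\<epsilon> / 2)" if q: "Lag q 0 \<le> C" for q
    proof -
      obtain z w where z: "z \<in> base" "norm w \<le> R" "fst q = pt z" "snd q = btv z w" using R(2)[OF q] by blast
      let ?u = "u (fst q)"
      have lu: "\<bar>l * ?u\<bar> \<le> l * \<bar>B\<bar>" using uB[of "fst q"] l(1) by (simp add: abs_mult)
      have "l * (\<bar>B\<bar> + 1) \<le> s" using l(2) by (simp add: le_divide_eq)
      then have "l * \<bar>B\<bar> \<le> s" using l(1) by (simp add: distrib_left)
      then have "\<bar>l * ?u\<bar> \<le> s" using lu by linarith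
      from s(2)[OF z(1,2) this] have "Lag q (l * ?u) \<le> Lag q 0 + l * ?u * dLag q + \<epsilon>1 * \<bar>l * ?u\<bar>"
        by (simp add: bL_def ba_def z(3,4)[symmetric] abs_le_iff)
      moreover have "\<epsilon>1 * \<bar>l * ?u\<bar> \<le> l * (\<epsilon> / 2)"
      proof -
        have "\<epsilon>1 * \<bar>l * ?u\<bar> \<le> \<epsilon>1 * (l * \<bar>B\<bar>)" using lu e1 by (intro mult_left_mono) auto
        also have "\<dots> = l * (\<epsilon>1 * \<bar>B\<bar>)" by simp
        also have "\<dots> \<le> l * (\<epsilon> / 2)" using e1B l(1) by (intro mult_left_mono) auto
        finally show ?thesis .
      qed
      moreover have "?d q - H (fst q) (differential A f (fst q)) (l * ?u) \<le> Lag q (l * ?u)" by (rule fenchel)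
      ultimately show ?thesis using f(2)[of "fst q"] by (simp add: mult.assoc)
    qed
    have i1: "integrable m (\<lambda>q. ?d q - crit - l * (\<epsilon> / 2) + l * e (fst q))"
      using mm(6)[OF f(1)] mather_integrable(1)[OF m e] by simp
    have i2: "integrable m (\<lambda>q. Lag q 0 + l * (u (fst q) * dLag q) + l * (\<epsilon> / 2))"
      using mm(3) mather_integrable(2)[OF m u] by simp
    have "AE q in m. ?d q - crit - l * (\<epsilon> / 2) + l * e (fst q) \<le> Lag q 0 + l * (u (fst q) * dLag q) + l * (\<epsilon> / 2)"
      using C[OF m] by eventually_elim (rule key)
    from integral_mono_AE[OF i1 i2 this]
    have "- crit - l * (\<epsilon> / 2) + l * (\<integral>q. e (fst q) \<partial>m) \<le> - crit + l * (\<integral>q. u (fst q) * dLag q \<partial>m) + l * (\<epsilon> / 2)"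
      using mm(3) mm(6)[OF f(1)] mather_integrable(1)[OF m e] mather_integrable(2)[OF m u] mm(4) mm(5)[OF f(1)] by (simp add: prob_space)
    then have "l * (\<integral>q. e (fst q) \<partial>m) \<le> l * ((\<integral>q. u (fst q) * dLag q \<partial>m) + \<epsilon>)" by (simp add: algebra_simps)
    then show ?thesis using l(1) by simp
  qed
  moreover have "s / (\<bar>B\<bar> + 1) > 0" using s(1) by simp
  ultimately show ?thesis by blast
qed

section \<open>Duality and the vanishing discount limit\<close>

definition lift :: "(real \<times> 'e) \<times> 'e \<Rightarrow> 'm \<times> 'e" where "lift q = (pt (fst q), btv (fst q) (snd q))"

text \<open>On each ball \<open>lift\<close> is a chart parametrisation, so the preimage of an open
  set is a finite union of closed boxes cut with open sets. The value (undefined, 0) off the compact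
  set is an arbitrary default, on a set that will be null.\<close>

lemma lift_measurable: "(\<lambda>q. if q \<in> base \<times> cball 0 R then lift q else (undefined, 0)) \<in> measurable borel (tangent_borel A)"
  unfolding tangent_borel_def
proof (rule measurable_measure_of)
  fix W assume "W \<in> {W. openin (tangent_topology A) W}"
  then have W: "openin (tangent_topology A) W" by simp
  let ?O = "\<lambda>c. {q \<in> img c \<times> UNIV. tangent_param A c q \<in> W}"
  have op: "open (?O c)" if "c \<in> A" for c using W that by (simp add: openin_tangent_topology)
  let ?S = "\<lambda>i. (({real i} \<times> cball (ctr i) (rad i)) \<times> cball (0::'e) R) \<inter> (\<lambda>q. (snd (fst q), snd q)) -` ?O (ch i)"
  have "?S i \<in> sets borel" if i: "i < n" for i
  proof -
    have "open ((\<lambda>q :: (real \<times> 'e) \<times> 'e. (snd (fst q), snd q)) -` ?O (ch i))"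
      by (intro open_vimage op cover(1) i continuous_intros)
    moreover have "closed (({real i} \<times> cball (ctr i) (rad i)) \<times> cball (0::'e) R)" by (intro closed_Times) auto
    ultimately show ?thesis by (intro sets.Int borel_open borel_closed)
  qed
  then have 1: "(\<Union>i<n. ?S i) \<in> sets borel" by (intro sets.finite_UN) auto
  have clZ: "closed (base \<times> cball (0::'e) R)" by (intro closed_Times compact_imp_closed[OF compact_base]) auto
  have eq: "(\<lambda>q. if q \<in> base \<times> cball 0 R then lift q else (undefined, 0)) -` W \<inter> space borel =
    (\<Union>i<n. ?S i) \<union> (if (undefined, 0) \<in> W then - (base \<times> cball 0 R) else {})"
  proof (intro equalityI subsetI)
    fix q assume q: "q \<in> (\<lambda>q. if q \<in> base \<times> cball 0 R then lift q else (undefined, 0)) -` W \<inter> space borel"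
    show "q \<in> (\<Union>i<n. ?S i) \<union> (if (undefined, 0) \<in> W then - (base \<times> cball 0 R) else {})"
    proof (cases "q \<in> base \<times> cball 0 R")
      case True
      then have z: "fst q \<in> base" and v: "snd q \<in> cball 0 R" by (simp_all add: mem_Times_iff)
      have "lift q \<in> W" using q True by simp
      then have "tangent_param A (ch (idx (fst q))) (snd (fst q), snd q) \<in> W"
        by (simp add: lift_def tangent_param_eq pt_def btv_def bch_def)
      moreover have "snd (fst q) \<in> img (ch (idx (fst q)))" using baseD(5)[OF z] by (simp only: bch_def)
      ultimately have 2: "(snd (fst q), snd q) \<in> ?O (ch (idx (fst q)))" by (simp only: mem_Collect_eq mem_Times_iff fst_conv snd_conv UNIV_I simp_thms)
      have 3: "q \<in> ?S (idx (fst q))"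
        by (intro IntI vimageI2 2) (simp only: mem_Times_iff singleton_iff baseD(2,3)[OF z] v simp_thms)
      have "idx (fst q) \<in> {..<n}" using baseD(1)[OF z] by simp
      from UN_I[of _ _ _ ?S, OF this 3] show ?thesis by (rule UnI1)
    next
      case False
      then have "(undefined, 0) \<in> W" using q by simp
      then show ?thesis using False by simp
    qed
  next
    fix q assume q: "q \<in> (\<Union>i<n. ?S i) \<union> (if (undefined, 0) \<in> W then - (base \<times> cball 0 R) else {})"
    show "q \<in> (\<lambda>q. if q \<in> base \<times> cball 0 R then lift q else (undefined, 0)) -` W \<inter> space borel"
    proof (cases "q \<in> (\<Union>i<n. ?S i)")
      case True
      then obtain i where i: "i \<in> {..<n}" "q \<in> ?S i" by (elim UN_E)
      have a: "fst q \<in> {real i} \<times> cball (ctr i) (rad i)" "snd q \<in> cball 0 R"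
        "tangent_param A (ch i) (snd (fst q), snd q) \<in> W" using i(2) by (simp_all add: mem_Times_iff)
      have z: "fst q \<in> base" unfolding base_def by (rule UN_I[OF i(1)]) (rule a(1))
      have "idx (fst q) = i" using a(1) by (simp add: idx_def mem_Times_iff)
      then have "lift q \<in> W" using a(3) by (simp add: lift_def tangent_param_eq pt_def btv_def bch_def)
      then show ?thesis using z a(2) by (simp add: mem_Times_iff)
    next
      case False
      have "q \<in> (if (undefined, 0) \<in> W then - (base \<times> cball 0 R) else {})" using q
      proof (rule UnE)
        assume "q \<in> (\<Union>i<n. ?S i)" with False show ?thesis by contradiction
      qed
      then show ?thesis by (simp split: if_splits)
    qed
  qed
  show "(\<lambda>q. if q \<in> base \<times> cball 0 R then lift q else (undefined, 0)) -` W \<inter> space borel \<in> sets borel"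
    unfolding eq using 1 clZ by (intro sets.Un) simp_all
qed auto

lemma tnorm_base_continuous: "continuous_on (base \<times> UNIV) (\<lambda>q. tnorm g (fst (lift q)) (snd (lift q)))"
proof -
  have "continuous_on (base \<times> UNIV) (\<lambda>(z, w). tnorm g (chart_inv (ch (idx z)) (snd z)) (tvec (ch (idx z)) (chart_inv (ch (idx z)) (snd z)) w))"
  proof (rule continuous_on_base)
    fix i assume i: "i < n"
    have "continuous_on (cball (ctr i) (rad i) \<times> UNIV) (\<lambda>q. tnorm g (chart_inv (ch i) (fst q)) (tvec (ch i) (chart_inv (ch i) (fst q)) (snd q)))"
      by (rule continuous_on_subset[OF tnorm_chart_continuous[OF cover(1)[OF i]]]) (use cball_img[OF i] in auto)
    then show "continuous_on (cball (ctr i) (rad i) \<times> UNIV) (\<lambda>(y, w). tnorm g (chart_inv (ch i) y) (tvec (ch i) (chart_inv (ch i) y) w))"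
      by (simp add: split_beta)
  qed simp
  then show ?thesis by (simp add: lift_def pt_def btv_def bch_def split_beta)
qed

lemma differential_lift: assumes "C1_fun A \<phi>" "q \<in> base \<times> cball 0 R"
  shows "blinfun_apply (differential A \<phi> (fst (lift q))) (snd (lift q)) = bgrad \<phi> (fst q) \<bullet> snd q"
  using assms by (auto simp: lift_def differential_pt bcov_btv)

lemma continuous_differential_lift: assumes "C1_fun A \<phi>"
  shows "continuous_on (base \<times> cball 0 R) (\<lambda>q. blinfun_apply (differential A \<phi> (fst (lift q))) (snd (lift q)))"
proof -
  have "continuous_on (base \<times> cball 0 R) (\<lambda>q. bgrad \<phi> (fst q) \<bullet> snd q)"
    by (intro continuous_intros continuous_on_compose2[OF continuous_bgrad[OF assms]]) auto
  then show ?thesis by (rule continuous_on_eq) (simp add: differential_lift[OF assms])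
qed

text \<open>Carries an optimiser of the linear programme from coordinates to TM. Integrals are
  preserved for every Borel F, so the constraint can later be evaluated on the image
  measure.\<close>

lemma mather_from_measure:
  fixes \<nu> :: "((real \<times> 'e) \<times> 'e) measure" and R :: real
  defines "Z \<equiv> base \<times> cball (0::'e) R"
  assumes \<nu>: "prob_space \<nu>" "sets \<nu> = sets borel" "AE q in \<nu>. q \<in> Z"
    and closed: "\<And>\<phi>. C1_fun A \<phi> \<Longrightarrow> (LINT q:Z|\<nu>. blinfun_apply (differential A \<phi> (fst (lift q))) (snd (lift q))) = 0"
    and min: "(LINT q:Z|\<nu>. Lag (lift q) 0 + crit) \<le> 0"
  shows "\<exists>m. mather_measure A g H m \<and> (\<forall>F. F \<in> borel_measurable (tangent_borel A) \<longrightarrow>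
     (\<integral>q. F q \<partial>m) = (LINT q:Z|\<nu>. F (lift q) :: real))"
proof -
  interpret \<nu>: prob_space \<nu> by fact
  have compZ: "compact Z" unfolding Z_def by (intro compact_Times compact_base) auto
  have Zs: "Z \<in> sets \<nu>" using compact_imp_closed[OF compZ] \<nu>(2) by simp
  define \<tau> where "\<tau> q = (if q \<in> Z then lift q else (undefined, 0))" for q
  have \<tau>m: "\<tau> \<in> measurable \<nu> (tangent_borel A)"
    using lift_measurable[of R] unfolding \<tau>_def[abs_def] Z_def by (simp add: measurable_cong_sets[OF \<nu>(2) refl])
  define m where "m = distr \<nu> (tangent_borel A) \<tau>"
  have ps: "prob_space m" unfolding m_def by (rule \<nu>.prob_space_distr[OF \<tau>m])
  have sm: "sets m = sets (tangent_borel A)" by (simp add: m_def)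
  have int: "(\<integral>q. F q \<partial>m) = (LINT q:Z|\<nu>. F (lift q))" if F: "F \<in> borel_measurable (tangent_borel A)" for F :: "'m \<times> 'e \<Rightarrow> real"
  proof -
    have F\<tau>: "(\<lambda>q. F (\<tau> q)) \<in> borel_measurable \<nu>" using measurable_compose[OF \<tau>m F] .
    have "(\<integral>q. F q \<partial>m) = (\<integral>q. F (\<tau> q) \<partial>\<nu>)" unfolding m_def by (rule integral_distr[OF \<tau>m F])
    also have "\<dots> = (\<integral>q. indicator Z q *\<^sub>R F (\<tau> q) \<partial>\<nu>)"
    proof (rule integral_cong_AE[OF F\<tau>])
      show "(\<lambda>q. indicator Z q *\<^sub>R F (\<tau> q)) \<in> borel_measurable \<nu>" using Zs F\<tau> by simp
      show "AE q in \<nu>. F (\<tau> q) = indicator Z q *\<^sub>R F (\<tau> q)" using \<nu>(3) by eventually_elim simp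
    qed
    also have "\<dots> = (LINT q:Z|\<nu>. F (lift q))" unfolding set_lebesgue_integral_def
      by (intro Bochner_Integration.integral_cong) (auto simp: \<tau>_def indicator_def)
    finally show ?thesis .
  qed
  have integ: "integrable m F" if F: "F \<in> borel_measurable (tangent_borel A)" and c: "continuous_on Z (\<lambda>q. F (lift q))" for F :: "'m \<times> 'e \<Rightarrow> real"
  proof -
    have F\<tau>: "(\<lambda>q. F (\<tau> q)) \<in> borel_measurable \<nu>" using measurable_compose[OF \<tau>m F] .
    obtain K where K: "\<And>q. q \<in> Z \<Longrightarrow> \<bar>F (lift q)\<bar> \<le> K"
      using compact_imp_bounded[OF compact_continuous_image[OF c compZ]] unfolding bounded_iff by auto
    have "integrable \<nu> (\<lambda>q. F (\<tau> q))"
    proof (rule \<nu>.integrable_const_bound[of _ K])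
      show "AE q in \<nu>. norm (F (\<tau> q)) \<le> K" using \<nu>(3) by eventually_elim (use K in \<open>simp add: \<tau>_def\<close>)
    qed (rule F\<tau>)
    then show ?thesis unfolding m_def by (subst integrable_distr_eq[OF \<tau>m F])
  qed
  have si: "set_integrable \<nu> Z f" if cf: "continuous_on Z f" for f :: "(real \<times> 'e) \<times> 'e \<Rightarrow> real"
  proof -
    obtain K where K: "\<And>q. q \<in> Z \<Longrightarrow> \<bar>f q\<bar> \<le> K"
      using compact_imp_bounded[OF compact_continuous_image[OF cf compZ]] unfolding bounded_iff by auto
    have "(\<lambda>q. indicator Z q *\<^sub>R f q) \<in> borel_measurable borel"
      by (rule borel_measurable_continuous_on_indicator[OF _ cf]) (use compact_imp_closed[OF compZ] in auto)
    then show ?thesis unfolding set_integrable_def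
      by (intro \<nu>.integrable_const_bound[of _ "\<bar>K\<bar>"] AE_I2) (use K in \<open>fastforce simp: indicator_def\<close>, simp add: measurable_cong_sets[OF \<nu>(2) refl])
  qed
  have one: "(LINT q:Z|\<nu>. c) = c" for c :: real
  proof -
    have "measure \<nu> Z = 1" using \<nu>.prob_eq_1[OF Zs] \<nu>(3) by simp
    then show ?thesis unfolding set_lebesgue_integral_def using Zs by simp
  qed
  have cL: "continuous_on Z (\<lambda>q. Lag (lift q) 0)"
    using bL_continuous[of R] by (simp add: Z_def bL_def lift_def split_beta)
  \<comment> \<open>A closed measure cannot have action below -c: differentials of near-critical C^1
    functions integrate to zero and are at most L + c + e. The assumed inequality is thus an
    equality and the measure is minimising.\<close>
  have "(LINT q:Z|\<nu>. Lag (lift q) 0 + crit) \<ge> 0"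
  proof (rule ccontr)
    assume lt0: "\<not> ?thesis"
    define e where "e = - (LINT q:Z|\<nu>. Lag (lift q) 0 + crit) / 2"
    have e: "e > 0" using lt0 by (simp add: e_def)
    obtain f where f: "C1_fun A f" "\<And>x. H x (differential A f x) 0 \<le> crit + e" using crit_approx[OF e] by blast
    note cd = continuous_differential_lift[OF f(1), of R, folded Z_def]
    have "(LINT q:Z|\<nu>. blinfun_apply (differential A f (fst (lift q))) (snd (lift q)) - e) \<le> (LINT q:Z|\<nu>. Lag (lift q) 0 + crit)"
    proof (rule set_integral_mono)
      show "set_integrable \<nu> Z (\<lambda>q. blinfun_apply (differential A f (fst (lift q))) (snd (lift q)) - e)" by (intro si continuous_intros cd)
      show "set_integrable \<nu> Z (\<lambda>q. Lag (lift q) 0 + crit)" by (intro si continuous_intros cL)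
      fix q assume "q \<in> Z"
      show "blinfun_apply (differential A f (fst (lift q))) (snd (lift q)) - e \<le> Lag (lift q) 0 + crit"
        using fenchel[of "differential A f (fst (lift q))" "snd (lift q)" "fst (lift q)" 0] f(2)[of "fst (lift q)"] by linarith
    qed
    moreover have "(LINT q:Z|\<nu>. blinfun_apply (differential A f (fst (lift q))) (snd (lift q)) - e) = 0 - e"
      by (subst set_integral_diff) (auto intro!: si cd simp: closed[OF f(1)] one)
    ultimately show False using e unfolding e_def by linarith
  qed
  then have z: "(LINT q:Z|\<nu>. Lag (lift q) 0 + crit) = 0" using min by linarith
  have "(LINT q:Z|\<nu>. Lag (lift q) 0 + crit) = (LINT q:Z|\<nu>. Lag (lift q) 0) + crit"
    by (subst set_integral_add) (auto intro!: si cL simp: one)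
  then have val: "(\<integral>q. Lag q 0 \<partial>m) = - crit" using z int[OF measurable_Lag] by simp
  have tn: "(\<lambda>q. tnorm g (fst q) (snd q)) \<in> borel_measurable (tangent_borel A)"
    by (rule measurable_tangent_continuous) (use tnorm_chart_continuous in simp)
  have "closed_measure A g m" unfolding closed_measure_def split_beta
  proof (intro conjI allI impI ps sm)
    show "integrable m (\<lambda>q. tnorm g (fst q) (snd q))"
      by (rule integ[OF tn], rule continuous_on_subset[OF tnorm_base_continuous]) (auto simp: Z_def)
    fix \<phi> assume \<phi>: "C1_fun A \<phi>"
    show "(\<integral>q. blinfun_apply (differential A \<phi> (fst q)) (snd q) \<partial>m) = 0"
      unfolding int[OF measurable_differential[OF \<phi>]] by (rule closed[OF \<phi>])
  qed
  moreover have "has_bochner_integral m (\<lambda>q. Lag q 0) (- crit)"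
    using val integ[OF measurable_Lag cL] by (simp add: has_bochner_integral_iff)
  ultimately have "mather_measure A g H m" unfolding mather_measure_def split_beta by blast
  then show ?thesis using int by blast
qed

section \<open>Dual multipliers and the lower bound for discounted solutions\<close>

lemma constrainedD: assumes "constrained_subsolution A g H V0 w" "continuous_on UNIV V0"
  shows "subsol (\<lambda>x p. H x p 0 + - crit) w"
    and "\<And>m. mather_measure A g H m \<Longrightarrow> (\<integral>q. V0 (fst q) \<partial>m) \<le> (\<integral>q. w (fst q) * dLag q \<partial>m)"
proof -
  show "subsol (\<lambda>x p. H x p 0 + - crit) w" using assms(1) by (simp add: constrained_subsolution_def viscosity_subsolution_iff)
  fix m assume m: "mather_measure A g H m"
  have "fst \<in> measurable m borel" using measurable_fst_tangent by (simp add: measurable_cong_sets[OF matherD(2)[OF m] refl])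
  note eq = integral_distr[OF this borel_measurable_continuous_onI[OF assms(2)]]
  have "integral\<^sup>L (distr m borel fst) V0 \<le> (\<integral>q. w (fst q) * dLag q \<partial>m)"
    using assms(1) m unfolding constrained_subsolution_def split_beta by blast
  then show "(\<integral>q. V0 (fst q) \<partial>m) \<le> (\<integral>q. w (fst q) * dLag q \<partial>m)" unfolding eq .
qed

text \<open>If no multipliers existed, duality would give a closed measure whose action is at most
  -c, hence a Mather measure, on which the integral constraint fails by at least \<delta>. Here t is
  the price of the action condition and \<phi> that of closedness.\<close>

lemma constrained_dual:
  assumes w: "constrained_subsolution A g H V0 w" and V0: "continuous_on UNIV V0" and \<delta>: "\<delta> > 0" and R: "R \<ge> 0"
  shows "\<exists>\<phi> t. C1_fun A \<phi> \<and> t \<ge> 0 \<and> (\<forall>z\<in>base. \<forall>v. norm v \<le> R \<longrightarrow>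
     ba z v * w (pt z) + V0 (pt z) - \<delta> \<le> bgrad \<phi> z \<bullet> v + t * (bL z v 0 + crit))"
proof (rule ccontr)
  assume neg: "\<not> ?thesis"
  note wD = constrainedD[OF w V0]
  have cw: "continuous_on UNIV w" using wD(1) by (simp add: subsol_def)
  define Z where "Z = base \<times> cball (0::'e) R"
  have compZ: "compact Z" unfolding Z_def by (intro compact_Times compact_base) auto
  have neZ: "Z \<noteq> {}" using base_nonempty R by (auto simp: Z_def)
  define D where "D \<phi> q = blinfun_apply (differential A \<phi> (fst (lift q))) (snd (lift q))" for \<phi> q
  define E where "E = {f. \<exists>\<phi>. C1_fun A \<phi> \<and> (\<forall>q\<in>Z. f q = D \<phi> q)}"
  define b where "b q = ba (fst q) (snd q) * w (pt (fst q)) + V0 (pt (fst q)) - \<delta>" for q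
  have cL: "continuous_on Z (\<lambda>q. Lag (lift q) 0)"
    using bL_continuous[of R] by (simp add: Z_def bL_def lift_def split_beta)
  have ca: "continuous_on Z (\<lambda>q. ba (fst q) (snd q))" using ba_continuous[of R] by (simp add: Z_def split_beta)
  have cb: "continuous_on Z b" unfolding b_def
    by (intro continuous_intros ca continuous_on_compose2[OF continuous_pt[OF cw]] continuous_on_compose2[OF continuous_pt[OF V0]])
      (auto simp: Z_def)
  have "\<exists>\<nu>. prob_space \<nu> \<and> sets \<nu> = sets borel \<and> (AE z in \<nu>. z \<in> Z) \<and>
    (\<forall>f\<in>E. (LINT z:Z|\<nu>. f z) = 0) \<and> (LINT z:Z|\<nu>. Lag (lift z) 0 + crit) \<le> 0 \<and> (LINT z:Z|\<nu>. b z) \<ge> 0"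
  proof (rule lp_duality[OF compZ neZ])
    fix f assume "f \<in> E"
    then obtain \<phi> where \<phi>: "C1_fun A \<phi>" "\<And>q. q \<in> Z \<Longrightarrow> f q = D \<phi> q" by (auto simp: E_def)
    show "continuous_on Z f"
      by (rule continuous_on_eq[OF continuous_differential_lift[OF \<phi>(1), of R, folded Z_def]]) (simp add: \<phi>(2) D_def)
  next
    show "(\<lambda>_. 0) \<in> E" by (auto simp: E_def D_def differential_const intro!: exI[of _ "\<lambda>_. 0"] C1_const)
  next
    fix f h assume "f \<in> E" "h \<in> E"
    then obtain \<phi> \<psi> where "C1_fun A \<phi>" "\<forall>q\<in>Z. f q = D \<phi> q" "C1_fun A \<psi>" "\<forall>q\<in>Z. h q = D \<psi> q" by (auto simp: E_def)
    then show "(\<lambda>z. f z + h z) \<in> E"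
      by (auto simp: E_def D_def differential_add blinfun.add_left intro!: exI[of _ "\<lambda>x. \<phi> x + \<psi> x"] C1_add)
  next
    fix c f assume "f \<in> E"
    then obtain \<phi> where "C1_fun A \<phi>" "\<forall>q\<in>Z. f q = D \<phi> q" by (auto simp: E_def)
    then show "(\<lambda>z. c * f z) \<in> E"
      by (auto simp: E_def D_def differential_cmult blinfun.scaleR_left intro!: exI[of _ "\<lambda>x. c * \<phi> x"] C1_cmult)
  next
    show "continuous_on Z (\<lambda>z. Lag (lift z) 0 + crit)" by (intro continuous_intros cL)
    show "continuous_on Z b" by (rule cb)
  next
    fix f and t :: real assume "f \<in> E" and t: "t \<ge> 0"
    then obtain \<phi> where \<phi>: "C1_fun A \<phi>" "\<And>q. q \<in> Z \<Longrightarrow> f q = D \<phi> q" by (auto simp: E_def)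
    from neg \<phi>(1) t obtain z v where zv: "z \<in> base" "norm v \<le> R"
      "\<not> ba z v * w (pt z) + V0 (pt z) - \<delta> \<le> bgrad \<phi> z \<bullet> v + t * (bL z v 0 + crit)" by blast
    have q: "(z, v) \<in> Z" using zv by (simp add: Z_def)
    have "D \<phi> (z, v) = bgrad \<phi> z \<bullet> v" using differential_lift[OF \<phi>(1), of "(z, v)" R] q by (simp add: D_def Z_def)
    then have "b (z, v) > f (z, v) + t * (Lag (lift (z, v)) 0 + crit)"
      using zv(3) \<phi>(2)[OF q] by (simp add: b_def bL_def lift_def)
    then show "\<exists>z\<in>Z. b z > f z + t * (Lag (lift z) 0 + crit)" using q by blast
  qed
  then obtain \<nu> where \<nu>: "prob_space \<nu>" "sets \<nu> = sets borel" "AE z in \<nu>. z \<in> Z" "\<forall>f\<in>E. (LINT z:Z|\<nu>. f z) = 0"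
    "(LINT z:Z|\<nu>. Lag (lift z) 0 + crit) \<le> 0" "(LINT z:Z|\<nu>. b z) \<ge> 0" by (elim exE conjE)
  have cl: "(LINT q:Z|\<nu>. D \<phi> q) = 0" if "C1_fun A \<phi>" for \<phi>
    using bspec[OF \<nu>(4), of "D \<phi>"] that by (auto simp: E_def)
  have "\<exists>m. mather_measure A g H m \<and> (\<forall>F. F \<in> borel_measurable (tangent_borel A) \<longrightarrow> (\<integral>q. F q \<partial>m) = (LINT q:Z|\<nu>. F (lift q) :: real))"
    using cl \<nu>(1,2,3,5) unfolding Z_def D_def by (intro mather_from_measure) auto
  then obtain m where m: "mather_measure A g H m"
    and mint: "\<And>F. F \<in> borel_measurable (tangent_borel A) \<Longrightarrow> (\<integral>q. F q \<partial>m) = (LINT q:Z|\<nu>. F (lift q) :: real)" by blast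
  note mm = matherD[OF m]
  interpret prob_space m by (rule mm(1))
  define F where "F q = - (w (fst q) * dLag q) + V0 (fst q) - \<delta>" for q
  have Fm: "F \<in> borel_measurable (tangent_borel A)" unfolding F_def
    by (intro borel_measurable_diff borel_measurable_add borel_measurable_uminus borel_measurable_times
      measurable_base_fun[OF cw] measurable_base_fun[OF V0] measurable_dLag borel_measurable_const)
  have "(\<integral>q. F q \<partial>m) = (LINT q:Z|\<nu>. F (lift q))" by (rule mint[OF Fm])
  also have "\<dots> = (LINT q:Z|\<nu>. b q)"
  proof -
    have "F (lift q) = b q" for q by (simp add: F_def b_def lift_def ba_def)
    then show ?thesis by simp
  qed
  finally have "(\<integral>q. F q \<partial>m) \<ge> 0" using \<nu>(6) by simp
  moreover have "(\<integral>q. F q \<partial>m) = - (\<integral>q. w (fst q) * dLag q \<partial>m) + (\<integral>q. V0 (fst q) \<partial>m) - \<delta>"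
    unfolding F_def using mather_integrable[OF m cw] mather_integrable(1)[OF m V0] by (simp add: prob_space)
  ultimately show False using wD(2)[OF m] \<delta> by linarith
qed

text \<open>A C^1 strict subsolution f near w is built from a smoothing h of w and the multipliers.
  At the velocity v dual to df, the momentum of h contributes (1 - \<lambda>t)(L + c), the dual
  inequality for \<phi> contributes \<lambda>t(L + c), and together they give L + c once. What
  remains of order \<lambda> is the potential and the discount evaluated at w, and lowering f below
  w makes the balance negative.\<close>

lemma constrained_lower:
  assumes w: "constrained_subsolution A g H V0 w" and V0: "continuous_on UNIV V0"
    and Vl: "\<And>\<delta>. \<delta> > 0 \<Longrightarrow> \<exists>l1>0. \<forall>l. 0 < l \<longrightarrow> l \<le> l1 \<longrightarrow> (\<forall>x. \<bar>V x l - V0 x\<bar> \<le> \<delta>)" and \<kappa>: "\<kappa> > 0"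
  shows "\<exists>l1>0. \<forall>l u. 0 < l \<longrightarrow> l \<le> l1 \<longrightarrow> supersol (\<lambda>x p. H x p (l * u x) + l * V x l - crit) u \<longrightarrow> (\<forall>x. w x - \<kappa> \<le> u x)"
proof -
  note sub = constrainedD(1)[OF w V0]
  have cw: "continuous_on UNIV w" using sub by (simp add: subsol_def)
  obtain W where W: "\<And>x. \<bar>w x\<bar> \<le> W" using bounded_on_M[OF cw] by blast
  have W0: "W \<ge> 0" using W[of undefined] by linarith
  have nice: "coercive_hamiltonian (\<lambda>x p. H x p 0 + - crit)" by (intro coercive_frozen) auto
  obtain P where P: "P > 0" "\<forall>z\<in>base. \<forall>\<xi>. H (pt z) (bcov z \<xi>) 0 + - crit \<le> 1 \<longrightarrow> norm \<xi> \<le> P"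
    using bounded_bN[OF nice, of 1] by blast
  \<comment> \<open>The velocity bound must be fixed before the multipliers are known. The radius P
    + 1 anticipates the term \<lambda> d\<phi>, later made at most 1 by small \<lambda>.\<close>
  obtain R where R: "R > 0" "\<forall>z\<in>base. \<forall>\<xi> u. norm \<xi> \<le> P + 1 \<longrightarrow> \<bar>u\<bar> \<le> 1 \<longrightarrow> (\<exists>v. norm v \<le> R \<and> bL z v u = \<xi> \<bullet> v - bH z \<xi> u)"
    using bL_subgradient[of "P + 1"] by blast
  obtain a where a: "a > 0" "\<And>z v. z \<in> base \<Longrightarrow> norm v \<le> R \<Longrightarrow> a \<le> ba z v" using ba_bounds[of R] R(1) by auto
  \<comment> \<open>Lowering w by at least \<kappa>/4 gains \<lambda>a\<kappa>/4 =
    8\<lambda>\<delta>, against four errors of at most \<lambda>\<delta> each: duality, expansion of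
    L, convergence of V, and smoothing.\<close>
  define \<delta> where "\<delta> = a * \<kappa> / 32"
  have \<delta>: "\<delta> > 0" using a(1) \<kappa> by (simp add: \<delta>_def)
  obtain \<phi> t where \<phi>: "C1_fun A \<phi>" "t \<ge> 0"
    "\<And>z v. z \<in> base \<Longrightarrow> norm v \<le> R \<Longrightarrow> ba z v * w (pt z) + V0 (pt z) - \<delta> \<le> bgrad \<phi> z \<bullet> v + t * (bL z v 0 + crit)"
    using constrained_dual[OF w V0 \<delta>, of R] R(1) by auto
  obtain B where B: "\<And>x. \<bar>\<phi> x\<bar> \<le> B" using bounded_on_M[OF C1_continuous[OF \<phi>(1)]] by blast
  have B0: "B \<ge> 0" using B[of undefined] by linarith
  obtain \<Gamma> where \<Gamma>: "\<And>z. z \<in> base \<Longrightarrow> norm (bgrad \<phi> z) \<le> \<Gamma>"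
    using compact_imp_bounded[OF compact_continuous_image[OF continuous_bgrad[OF \<phi>(1)] compact_base]] unfolding bounded_iff by blast
  define M where "M = W + B + \<kappa> + 1"
  have M0: "M > 0" using W0 B0 \<kappa> by (simp add: M_def)
  obtain s where s: "s > 0" "s \<le> 1" "\<And>z v u. z \<in> base \<Longrightarrow> norm v \<le> R \<Longrightarrow> \<bar>u\<bar> \<le> s \<Longrightarrow> \<bar>bL z v u - bL z v 0 + u * ba z v\<bar> \<le> \<delta> / M * \<bar>u\<bar>"
    using bL_expansion[of "\<delta> / M" R] \<delta> M0 R(1) by auto
  obtain l2 where l2: "l2 > 0" "\<And>l x. 0 < l \<Longrightarrow> l \<le> l2 \<Longrightarrow> \<bar>V x l - V0 x\<bar> \<le> \<delta>" using Vl[OF \<delta>] by blast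
  \<comment> \<open>Bounds |t h + \<phi>|, so that f differs from h - \<kappa>/2 by at most
    \<lambda>K.\<close>
  define K where "K = t * (W + 1) + B"
  have K0: "K \<ge> 0" using \<phi>(2) W0 B0 by (simp add: K_def)
  \<comment> \<open>In order: closeness of V, \<lambda>t \<le> 1 for a convex weight,
    \<lambda>|d\<phi>| \<le> 1 for the radius P + 1, \<lambda>M \<le> s for the expansion of L, and
    \<lambda>K \<le> \<kappa>/8 for closeness to w.\<close>
  define l1 where "l1 = min (min l2 1) (min (min (1 / (t + 1)) (1 / (\<bar>\<Gamma>\<bar> + 1))) (min (s / M) (\<kappa> / (8 * (K + 1)))))"
  have l1: "l1 > 0" using l2(1) \<phi>(2) s(1) M0 \<kappa> K0 by (auto simp: l1_def)
  have "w x - \<kappa> \<le> u x" if l: "0 < l" "l \<le> l1" and sup: "supersol (\<lambda>x p. H x p (l * u x) + l * V x l - crit) u" for l u x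
  proof -
    have "l \<le> l2" "l \<le> 1" and "l \<le> 1 / (t + 1)" "l \<le> 1 / (\<bar>\<Gamma>\<bar> + 1)" "l \<le> s / M" "l \<le> \<kappa> / (8 * (K + 1))"
      using l(2) by (auto simp: l1_def)
    then have "l * (t + 1) \<le> 1" and "l * (\<bar>\<Gamma>\<bar> + 1) \<le> 1" and lM: "l * M \<le> s" and "l * (8 * (K + 1)) \<le> \<kappa>"
      using \<phi>(2) M0 K0 by (auto simp: le_divide_eq)
    then have lt: "l * t \<le> 1" and l\<Gamma>: "l * \<bar>\<Gamma>\<bar> \<le> 1" and lK: "l * K \<le> \<kappa> / 8"
      using l(1) by (auto simp: algebra_simps)
    have lt0: "l * t \<ge> 0" using l(1) \<phi>(2) by simp
    define \<epsilon> where "\<epsilon> = min (min 1 (\<kappa> / 8)) (l * \<delta>)"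
    have \<epsilon>: "\<epsilon> > 0" "\<epsilon> \<le> 1" "\<epsilon> \<le> \<kappa> / 8" "\<epsilon> \<le> l * \<delta>" using \<kappa> l(1) \<delta> by (auto simp: \<epsilon>_def)
    obtain h where h: "C1_fun A h" "\<And>x. \<bar>h x - w x\<bar> \<le> \<epsilon>" "\<And>x. H x (differential A h x) 0 + - crit \<le> \<epsilon>"
      using subsol_smoothing[OF nice sub \<epsilon>(1)] by blast
    have hW: "\<bar>h x\<bar> \<le> W + 1" for x using h(2)[of x] W[of x] \<epsilon>(2) by linarith
    define f where "f x = ((1 - l * t) * h x + (- l) * \<phi> x) + - (\<kappa> / 2)" for x
    have C1a: "C1_fun A (\<lambda>x. (1 - l * t) * h x)" "C1_fun A (\<lambda>x. (- l) * \<phi> x)" by (intro C1_cmult h \<phi>)+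
    have fC1: "C1_fun A f" unfolding f_def by (intro C1_add C1a C1_const)
    have df: "differential A f x = (1 - l * t) *\<^sub>R differential A h x + (- l) *\<^sub>R differential A \<phi> x" for x
      unfolding f_def[abs_def] differential_add[OF C1_add[OF C1a] C1_const] differential_add[OF C1a]
        differential_cmult[OF h(1)] differential_cmult[OF \<phi>(1)] by (simp add: differential_const)
    have shift: "\<bar>f x - w x + \<kappa> / 2\<bar> \<le> \<kappa> / 4" for x
    proof -
      have "\<bar>l * (t * h x + \<phi> x)\<bar> \<le> l * K"
      proof -
        have "\<bar>t * h x + \<phi> x\<bar> \<le> t * \<bar>h x\<bar> + \<bar>\<phi> x\<bar>" using \<phi>(2) abs_triangle_ineq[of "t * h x" "\<phi> x"] by (simp add: abs_mult)
        also have "\<dots> \<le> K" unfolding K_def using hW[of x] B[of x] \<phi>(2) by (intro add_mono mult_left_mono)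
        finally show ?thesis using l(1) by (simp add: abs_mult)
      qed
      moreover have "f x - w x + \<kappa> / 2 = (h x - w x) - l * (t * h x + \<phi> x)" by (simp add: f_def algebra_simps)
      ultimately show ?thesis using h(2)[of x] \<epsilon>(3) lK by linarith
    qed
    have fM: "\<bar>f x\<bar> \<le> M" for x using shift[of x] W[of x] B0 \<kappa> unfolding M_def by linarith
    have strict: "H x (differential A f x) (l * f x) + l * V x l < crit" for x
    proof -
      obtain z where z: "z \<in> base" "pt z = x" using pt_surj by blast
      define \<xi>h where "\<xi>h = bgrad h z"
      define \<xi>p where "\<xi>p = bgrad \<phi> z"
      define \<xi> where "\<xi> = (1 - l * t) *\<^sub>R \<xi>h + (- l) *\<^sub>R \<xi>p"
      have dh: "differential A h x = bcov z \<xi>h" and dp: "differential A \<phi> x = bcov z \<xi>p"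
        using differential_pt[OF h(1) z(1)] differential_pt[OF \<phi>(1) z(1)] z(2) by (simp_all add: \<xi>h_def \<xi>p_def)
      have d: "differential A f x = bcov z \<xi>" unfolding df dh dp \<xi>_def bcov_lin[OF z(1)] ..
      have nh: "norm \<xi>h \<le> P" using P(2) z h(3)[of x] dh \<epsilon>(2) by fastforce
      have "norm \<xi> \<le> norm ((1 - l * t) *\<^sub>R \<xi>h) + norm ((- l) *\<^sub>R \<xi>p)" unfolding \<xi>_def by (rule norm_triangle_ineq)
      also have "\<dots> = (1 - l * t) * norm \<xi>h + l * norm \<xi>p" using lt l(1) by simp
      also have "\<dots> \<le> 1 * P + l * \<bar>\<Gamma>\<bar>"
        using nh lt lt0 l(1) \<Gamma>[OF z(1)] P(1) by (intro add_mono mult_mono mult_left_mono) (auto simp: \<xi>p_def)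
      finally have n\<xi>: "norm \<xi> \<le> P + 1" using l\<Gamma> by linarith
      define y where "y = l * f x"
      have yM: "\<bar>y\<bar> \<le> l * M" using fM[of x] l(1) by (simp add: y_def abs_mult)
      then have ys: "\<bar>y\<bar> \<le> s" using lM by linarith
      \<comment> \<open>At this velocity Fenchel's inequality for df at the level y is an equality,
        so lower bounds on L become upper bounds on H.\<close>
      obtain v where v: "norm v \<le> R" "bL z v y = \<xi> \<bullet> v - bH z \<xi> y" using R(2) z(1) n\<xi> ys s(2) by (meson order_trans)
      define \<Lambda> where "\<Lambda> = bL z v 0 + crit"
      have "H x (differential A h x) 0 \<le> crit + \<epsilon>" using h(3)[of x] by linarith
      then have "\<xi>h \<bullet> v \<le> \<Lambda> + \<epsilon>" using bL_fenchel[OF z(1), of \<xi>h v 0] by (simp add: bH_def z(2) dh \<Lambda>_def)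
      then have 1: "(1 - l * t) * (\<xi>h \<bullet> v) \<le> (1 - l * t) * (\<Lambda> + \<epsilon>)" using lt by (intro mult_left_mono) auto
      have "l * (ba z v * w x + V0 x - \<delta>) \<le> l * (\<xi>p \<bullet> v + t * \<Lambda>)"
        using \<phi>(3)[OF z(1) v(1)] l(1) by (intro mult_left_mono) (auto simp: z(2) \<xi>p_def \<Lambda>_def)
      then have 2: "- (l * (\<xi>p \<bullet> v)) \<le> l * t * \<Lambda> - l * (ba z v * w x) - l * V0 x + l * \<delta>" by (simp add: algebra_simps)
      have "\<xi> \<bullet> v = (1 - l * t) * (\<xi>h \<bullet> v) - l * (\<xi>p \<bullet> v)" by (simp add: \<xi>_def inner_diff_left)
      \<comment> \<open>The two shares of the action add up to \<Lambda> itself; its sign, which is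
        unknown, plays no part.\<close>
      moreover have "(1 - l * t) * (\<Lambda> + \<epsilon>) + l * t * \<Lambda> \<le> \<Lambda> + \<epsilon>"
        using mult_nonneg_nonneg[OF lt0 less_imp_le[OF \<epsilon>(1)]] by (simp add: algebra_simps)
      ultimately have 3: "\<xi> \<bullet> v \<le> \<Lambda> + \<epsilon> - l * (ba z v * w x) - l * V0 x + l * \<delta>" using 1 2 by linarith
      have "\<delta> / M * \<bar>y\<bar> \<le> \<delta> / M * (l * M)" using yM \<delta> M0 by (intro mult_left_mono) auto
      also have "\<dots> = l * \<delta>" using M0 by simp
      finally have 4: "bL z v y \<ge> bL z v 0 - y * ba z v - l * \<delta>" using s(3)[OF z(1) v(1) ys] by (simp add: abs_le_iff)
      have 5: "l * V x l \<le> l * V0 x + l * \<delta>"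
        using mult_left_mono[OF l2(2)[OF l(1) \<open>l \<le> l2\<close>, of x], of l] l(1) mult_left_mono[of "V x l" "V0 x + \<delta>" l]
          l2(2)[OF l(1) \<open>l \<le> l2\<close>, of x] by (simp add: algebra_simps abs_le_iff)
      have "f x - w x \<le> - (\<kappa> / 4)" using shift[of x] by linarith
      then have "ba z v * (f x - w x) \<le> ba z v * (- (\<kappa> / 4))" using ba_pos[OF z(1), of v] by (intro mult_left_mono) auto
      also have "\<dots> \<le> a * (- (\<kappa> / 4))" using a(2)[OF z(1) v(1)] \<kappa> by (intro mult_right_mono_neg) auto
      finally have "l * (ba z v * (f x - w x)) \<le> l * (- (a * \<kappa> / 4))" using l(1) by (intro mult_left_mono) auto
      then have 6: "y * ba z v - l * (ba z v * w x) \<le> - (l * (8 * \<delta>))" by (simp add: y_def \<delta>_def algebra_simps)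
      have "H x (differential A f x) y = \<xi> \<bullet> v - bL z v y" using v(2) by (simp add: bH_def d z(2))
      then have "H x (differential A f x) y + l * V x l \<le> crit + \<epsilon> + 3 * (l * \<delta>) - l * (8 * \<delta>)"
        using 3 4 5 6 unfolding \<Lambda>_def by linarith
      also have "\<dots> < crit"
      proof -
        have "l * (8 * \<delta>) = 8 * (l * \<delta>)" "\<delta> * l = l * \<delta>" by simp_all
        then show ?thesis using \<epsilon>(4) mult_pos_pos[OF l(1) \<delta>] by linarith
      qed
      finally show ?thesis by (simp add: y_def)
    qed
    have "f x \<le> u x" by (rule strict_C1_subsol_le[OF fC1 strict l(1) sup])
    then show ?thesis using shift[of x] \<kappa> by linarith
  qed
  then show ?thesis using l1 by blast
qed

lemma vanishing_discount_limit:
  fixes u :: "real \<Rightarrow> 'm \<Rightarrow> real" and l :: "nat \<Rightarrow> real"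
  assumes l0: "l0 > 0" and Vc: "\<And>l. 0 < l \<Longrightarrow> l \<le> l0 \<Longrightarrow> continuous_on UNIV (\<lambda>x. V x l)"
    and Vb: "\<And>l x. 0 < l \<Longrightarrow> l \<le> l0 \<Longrightarrow> \<bar>V x l\<bar> \<le> Vm" and V0: "continuous_on UNIV V0"
    and Vl: "\<And>\<delta>. \<delta> > 0 \<Longrightarrow> \<exists>l1>0. \<forall>l. 0 < l \<longrightarrow> l \<le> l1 \<longrightarrow> (\<forall>x. \<bar>V x l - V0 x\<bar> \<le> \<delta>)"
    and u: "\<And>l. 0 < l \<Longrightarrow> l \<le> l0 \<Longrightarrow> subsol (\<lambda>x p. H x p (l * u l x) + l * V x l - crit) (u l)"
      "\<And>l. 0 < l \<Longrightarrow> l \<le> l0 \<Longrightarrow> supersol (\<lambda>x p. H x p (l * u l x) + l * V x l - crit) (u l)"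
      "\<And>l. 0 < l \<Longrightarrow> l \<le> l0 \<Longrightarrow> chart_lipschitz P (u l)" "\<And>l x. 0 < l \<Longrightarrow> l \<le> l0 \<Longrightarrow> \<bar>u l x\<bar> \<le> B"
    and l: "\<And>k. 0 < l k" "\<And>k. l k \<le> l0" "l \<longlonglongrightarrow> 0"
  shows "\<exists>r v. strict_mono (r :: nat \<Rightarrow> nat) \<and> uniform_limit UNIV (\<lambda>k. u (l (r k))) v sequentially \<and>
     viscosity_solution A (\<lambda>x p _. H x p 0) crit v \<and> constrained_subsolution A g H V0 v"
proof -
  obtain r v where r: "strict_mono (r :: nat \<Rightarrow> nat)" and cv: "continuous_on UNIV v"
    and ul: "uniform_limit UNIV (\<lambda>k. u (l (r k))) v sequentially"
    using chart_lipschitz_compactness[of P "\<lambda>k. u (l k)" B] u(3,4) l(1,2) by blast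
  have B0: "B \<ge> 0" using u(4)[OF l(1) l(2), of 0 undefined] by linarith
  have lr: "(\<lambda>k. l (r k)) \<longlonglongrightarrow> 0" using LIMSEQ_subseq_LIMSEQ[OF l(3) r] by (simp add: o_def)
  have pick: "\<exists>k. l (r k) \<le> \<delta> \<and> (\<forall>x. \<bar>u (l (r k)) x - v x\<bar> \<le> \<eta>)" if "\<delta> > 0" "\<eta> > 0" for \<delta> \<eta>
  proof -
    have "\<forall>\<^sub>F k in sequentially. l (r k) < \<delta>" using lr that(1) by (rule order_tendstoD(2))
    moreover have "\<forall>\<^sub>F k in sequentially. \<forall>x\<in>UNIV. dist (u (l (r k)) x) (v x) < \<eta>" using ul that(2) unfolding uniform_limit_iff by simp
    ultimately have "\<forall>\<^sub>F k in sequentially. l (r k) \<le> \<delta> \<and> (\<forall>x. \<bar>u (l (r k)) x - v x\<bar> \<le> \<eta>)"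
      by eventually_elim (auto simp: dist_real_def less_imp_le)
    then show ?thesis unfolding eventually_sequentially by blast
  qed
  have approx: "\<exists>k. (\<forall>x. \<bar>u (l (r k)) x - v x\<bar> \<le> \<eta>) \<and> (\<forall>x. \<bar>l (r k) * u (l (r k)) x\<bar> \<le> \<eta>) \<and> (\<forall>x. \<bar>l (r k) * V x (l (r k))\<bar> \<le> \<eta>)"
    if \<eta>: "\<eta> > 0" for \<eta>
  proof -
    define K where "K = B + \<bar>Vm\<bar> + 1"
    have K: "K > 0" using B0 by (simp add: K_def)
    obtain k where k: "l (r k) \<le> \<eta> / K" "\<forall>x. \<bar>u (l (r k)) x - v x\<bar> \<le> \<eta>" using pick[of "\<eta> / K" \<eta>] \<eta> K by auto
    have lK: "l (r k) * K \<le> \<eta>" using k(1) K by (simp add: le_divide_eq)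
    have bd: "\<bar>l (r k) * y\<bar> \<le> \<eta>" if "\<bar>y\<bar> \<le> K" for y
    proof -
      have "\<bar>l (r k) * y\<bar> = l (r k) * \<bar>y\<bar>" using l(1)[of "r k"] by (simp add: abs_mult)
      also have "\<dots> \<le> l (r k) * K" using that l(1)[of "r k"] by (intro mult_left_mono) auto
      finally show ?thesis using lK by linarith
    qed
    have "\<bar>u (l (r k)) x\<bar> \<le> K" "\<bar>V x (l (r k))\<bar> \<le> K" for x
      using u(4)[OF l(1) l(2), of "r k" x] Vb[OF l(1) l(2), of x "r k"] B0 unfolding K_def by linarith+
    then show ?thesis using k(2) bd by blast
  qed
  \<comment> \<open>Stability with l = 0: the terms \<lambda>u and \<lambda>V are the vanishing
    perturbations s' and e'.\<close>
  have vsub: "subsol (\<lambda>x p. H x p (0 * v x) + 0 - crit) v"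
  proof (rule subsol_stable[OF cv continuous_on_const])
    fix x0 and \<eta> :: real assume "\<eta> > 0"
    from approx[OF this] obtain k where k: "\<And>x. \<bar>u (l (r k)) x - v x\<bar> \<le> \<eta>" "\<And>x. \<bar>l (r k) * u (l (r k)) x\<bar> \<le> \<eta>" "\<And>x. \<bar>l (r k) * V x (l (r k))\<bar> \<le> \<eta>" by blast
    have "u (l (r k)) x \<le> v x + \<eta>" "u (l (r k)) x \<ge> v x - \<eta>" for x using k(1)[of x] by (auto simp: abs_le_iff)
    then show "\<exists>w s' e'. (\<forall>x. w x \<le> v x + \<eta>) \<and> w x0 \<ge> v x0 - \<eta> \<and>
      subsol (\<lambda>x p. H x p (s' x) + e' x - crit) w \<and> (\<forall>x. \<bar>s' x - 0 * w x\<bar> \<le> \<eta>) \<and> (\<forall>x. \<bar>e' x - 0\<bar> \<le> \<eta>)"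
      using u(1)[OF l(1) l(2), of "r k"] k(2,3)
      by (intro exI[of _ "u (l (r k))"] exI[of _ "\<lambda>x. l (r k) * u (l (r k)) x"] exI[of _ "\<lambda>x. l (r k) * V x (l (r k))"]) auto
  qed
  have vsup: "supersol (\<lambda>x p. H x p (0 * v x) + 0 - crit) v"
  proof (rule supersol_stable[OF cv continuous_on_const])
    fix x0 and \<eta> :: real assume "\<eta> > 0"
    from approx[OF this] obtain k where k: "\<And>x. \<bar>u (l (r k)) x - v x\<bar> \<le> \<eta>" "\<And>x. \<bar>l (r k) * u (l (r k)) x\<bar> \<le> \<eta>" "\<And>x. \<bar>l (r k) * V x (l (r k))\<bar> \<le> \<eta>" by blast
    have "u (l (r k)) x \<le> v x + \<eta>" "u (l (r k)) x \<ge> v x - \<eta>" for x using k(1)[of x] by (auto simp: abs_le_iff)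
    then show "\<exists>w s' e'. (\<forall>x. w x \<ge> v x - \<eta>) \<and> w x0 \<le> v x0 + \<eta> \<and>
      supersol (\<lambda>x p. H x p (s' x) + e' x - crit) w \<and> (\<forall>x. \<bar>s' x - 0 * w x\<bar> \<le> \<eta>) \<and> (\<forall>x. \<bar>e' x - 0\<bar> \<le> \<eta>)"
      using u(2)[OF l(1) l(2), of "r k"] k(2,3)
      by (intro exI[of _ "u (l (r k))"] exI[of _ "\<lambda>x. l (r k) * u (l (r k)) x"] exI[of _ "\<lambda>x. l (r k) * V x (l (r k))"]) auto
  qed
  have sol: "viscosity_solution A (\<lambda>x p _. H x p 0) crit v"
    unfolding viscosity_solution_def viscosity_subsolution_iff viscosity_supersolution_iff using vsub vsup by simp
  obtain a' where a': "\<And>m. mather_measure A g H m \<Longrightarrow> AE q in m. \<bar>dLag q\<bar> \<le> a'" using mather_dLag_bound by blast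
  have con: "(\<integral>q. V0 (fst q) \<partial>m) \<le> (\<integral>q. v (fst q) * dLag q \<partial>m)" if m: "mather_measure A g H m" for m
  proof (rule field_le_epsilon)
    note mm = matherD[OF m]
    interpret prob_space m by (rule mm(1))
    fix \<epsilon> :: real assume \<epsilon>: "\<epsilon> > 0"
    then have \<epsilon>3: "\<epsilon> / 3 > 0" by simp
    obtain l1 where l1: "l1 > 0" "\<forall>l u e m. 0 < l \<longrightarrow> l \<le> l1 \<longrightarrow> continuous_on UNIV e \<longrightarrow> (\<forall>x. \<bar>u x\<bar> \<le> B) \<longrightarrow>
       subsol (\<lambda>x p. H x p (l * u x) + l * e x - crit) u \<longrightarrow> mather_measure A g H m \<longrightarrow>
       (\<integral>q. e (fst q) \<partial>m) \<le> (\<integral>q. u (fst q) * dLag q \<partial>m) + \<epsilon> / 3" using mather_constraint[OF \<epsilon>3, of B] by blast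
    obtain l2 where l2: "l2 > 0" "\<And>l x. 0 < l \<Longrightarrow> l \<le> l2 \<Longrightarrow> \<bar>V x l - V0 x\<bar> \<le> \<epsilon> / 3" using Vl[OF \<epsilon>3] by blast
    \<comment> \<open>a' bounds the derivative of L on the supports, so a uniform distance \<eta> of
      u from v changes the constraint integral by at most \<epsilon>/3.\<close>
    define \<eta> where "\<eta> = \<epsilon> / (3 * (\<bar>a'\<bar> + 1))"
    have \<eta>: "\<eta> > 0" using \<epsilon> by (simp add: \<eta>_def)
    have \<eta>a: "\<eta> * \<bar>a'\<bar> \<le> \<epsilon> / 3"
    proof -
      have "\<eta> * \<bar>a'\<bar> \<le> \<eta> * (\<bar>a'\<bar> + 1)" using \<eta> by (intro mult_left_mono) auto
      also have "\<dots> = \<epsilon> / 3" by (simp add: \<eta>_def field_simps)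
      finally show ?thesis .
    qed
    obtain k where k: "l (r k) \<le> min l1 l2" "\<And>x. \<bar>u (l (r k)) x - v x\<bar> \<le> \<eta>" using pick[of "min l1 l2" \<eta>] l1(1) l2(1) \<eta> by auto
    define lk where "lk = l (r k)"
    have lk: "0 < lk" "lk \<le> l0" "lk \<le> l1" "lk \<le> l2" using k(1) l(1,2) by (auto simp: lk_def)
    have cV: "continuous_on UNIV (\<lambda>x. V x lk)" by (rule Vc[OF lk(1,2)])
    have cu: "continuous_on UNIV (u lk)" using u(1)[OF lk(1,2)] by (simp add: subsol_def)
    have 1: "(\<integral>q. V (fst q) lk \<partial>m) \<le> (\<integral>q. u lk (fst q) * dLag q \<partial>m) + \<epsilon> / 3"
      using l1(2)[rule_format, OF lk(1,3) cV u(4)[OF lk(1,2)] u(1)[OF lk(1,2)] m] .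
    have "(\<integral>q. V0 (fst q) \<partial>m) \<le> (\<integral>q. V (fst q) lk + \<epsilon> / 3 \<partial>m)"
    proof (rule integral_mono)
      show "integrable m (\<lambda>q. V0 (fst q))" by (rule mather_integrable(1)[OF m V0])
      show "integrable m (\<lambda>q. V (fst q) lk + \<epsilon> / 3)" using mather_integrable(1)[OF m cV] by simp
      fix q show "V0 (fst q) \<le> V (fst q) lk + \<epsilon> / 3" using l2(2)[OF lk(1,4), of "fst q"] by linarith
    qed
    also have "\<dots> = (\<integral>q. V (fst q) lk \<partial>m) + \<epsilon> / 3" using mather_integrable(1)[OF m cV] by (simp add: prob_space)
    finally have 2: "(\<integral>q. V0 (fst q) \<partial>m) \<le> (\<integral>q. V (fst q) lk \<partial>m) + \<epsilon> / 3" .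
    have "(\<integral>q. u lk (fst q) * dLag q \<partial>m) \<le> (\<integral>q. v (fst q) * dLag q + \<epsilon> / 3 \<partial>m)"
    proof (rule integral_mono_AE)
      show "integrable m (\<lambda>q. u lk (fst q) * dLag q)" by (rule mather_integrable(2)[OF m cu])
      show "integrable m (\<lambda>q. v (fst q) * dLag q + \<epsilon> / 3)" using mather_integrable(2)[OF m cv] by simp
      show "AE q in m. u lk (fst q) * dLag q \<le> v (fst q) * dLag q + \<epsilon> / 3" using a'[OF m]
      proof eventually_elim
        fix q assume q: "\<bar>dLag q\<bar> \<le> a'"
        have "\<bar>(u lk (fst q) - v (fst q)) * dLag q\<bar> \<le> \<eta> * \<bar>a'\<bar>"
          unfolding abs_mult using k(2)[of "fst q"] q \<eta> by (intro mult_mono) (auto simp: lk_def)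
        then have "(u lk (fst q) - v (fst q)) * dLag q \<le> \<epsilon> / 3" using \<eta>a by linarith
        then show "u lk (fst q) * dLag q \<le> v (fst q) * dLag q + \<epsilon> / 3" by (simp add: left_diff_distrib)
      qed
    qed
    also have "\<dots> = (\<integral>q. v (fst q) * dLag q \<partial>m) + \<epsilon> / 3" using mather_integrable(2)[OF m cv] by (simp add: prob_space)
    finally show "(\<integral>q. V0 (fst q) \<partial>m) \<le> (\<integral>q. v (fst q) * dLag q \<partial>m) + \<epsilon>" using 1 2 by linarith
  qed
  have "constrained_subsolution A g H V0 v" unfolding constrained_subsolution_def split_beta
  proof (intro conjI allI impI)
    show "viscosity_subsolution A (\<lambda>x p _. H x p 0) crit v" using sol by (simp add: viscosity_solution_def)
    fix m assume m: "mather_measure A g H m"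
    have "fst \<in> measurable m borel" using measurable_fst_tangent by (simp add: measurable_cong_sets[OF matherD(2)[OF m] refl])
    note eq = integral_distr[OF this borel_measurable_continuous_onI[OF V0]]
    show "integral\<^sup>L (distr m borel fst) V0 \<le> (\<integral>q. v (fst q) * dLag q \<partial>m)" unfolding eq by (rule con[OF m])
  qed
  then show ?thesis using r ul sol by blast
qed

end

theorem theorem1:
  fixes A :: "('m::t2_space, 'e::euclidean_space) chart set"
    and g :: "'m \<Rightarrow> 'e \<Rightarrow> 'e \<Rightarrow> real"
    and H :: "'m \<Rightarrow> ('e \<Rightarrow>\<^sub>L real) \<Rightarrow> real \<Rightarrow> real"
    and V :: "'m \<Rightarrow> real \<Rightarrow> real"
  assumes manifold: "closed_connected_riemannian_manifold A g"
    and H_cont: "continuous_map (prod_topology (cotangent_topology A) euclideanreal) euclideanreal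
                   (\<lambda>((x, p), u). H x p u)"
    and H_convex: "\<And>x u. convex_on UNIV (\<lambda>p. H x p u)"
    and H_superlinear: "\<And>x u. filterlim (\<lambda>p. H x p u / conorm g x p) at_top
                                 (filtercomap (conorm g x) at_top)"
    and H_incr: "\<And>x p. strict_mono (H x p)"
    and H_diff: "\<And>x p. H x p field_differentiable (at 0)"
    and H_deriv_pos: "\<And>x p. deriv (H x p) 0 > 0"
    and H_modulus: "\<And>S. compactin (cotangent_topology A) S \<Longrightarrow>
           \<exists>\<eta>. modulus_of_continuity \<eta> \<and>
             (\<forall>(x, p)\<in>S. \<forall>u. \<bar>H x p u - H x p 0 - u * deriv (H x p) 0\<bar> \<le> \<bar>u\<bar> * \<eta> \<bar>u\<bar>)"
    and L_diff: "\<And>x v. lagrangian H x v field_differentiable (at 0)"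
    and V_cont: "\<And>l. l > 0 \<Longrightarrow> continuous_on UNIV (\<lambda>x. V x l)"
    and V_lim: "uniform_limit UNIV (\<lambda>l x. V x l) (\<lambda>x. V x 0) (at_right 0)"
  shows "\<exists>l0>0. \<exists>u :: real \<Rightarrow> 'm \<Rightarrow> real.
           (\<forall>l\<in>{0<..l0}.
              viscosity_solution A (\<lambda>x p z. H x p (l * z) + l * V x l)
                (critical_value A (\<lambda>x p. H x p 0)) (u l) \<and>
              (\<forall>w. viscosity_solution A (\<lambda>x p z. H x p (l * z) + l * V x l)
                     (critical_value A (\<lambda>x p. H x p 0)) w \<longrightarrow> w = u l)) \<and>
           (\<exists>u0 :: 'm \<Rightarrow> real.
              uniform_limit UNIV u u0 (at_right 0) \<and>
              viscosity_solution A (\<lambda>x p _. H x p 0) (critical_value A (\<lambda>x p. H x p 0)) u0 \<and>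
              constrained_subsolution A g H (\<lambda>x. V x 0) u0 \<and>
              (\<forall>w. constrained_subsolution A g H (\<lambda>x. V x 0) w \<longrightarrow> (\<forall>x. w x \<le> u0 x)))"
proof -
  interpret closed_manifold A g by unfold_locales (rule manifold)
  obtain n ch ctr rad where cov: "\<forall>i<(n::nat). ch i \<in> A \<and> rad i > 0 \<and> cball (ctr i) (2 * rad i) \<subseteq> snd (ch i) ` fst (ch i)"
    "\<forall>x. \<exists>i<n. x \<in> chart_inv (ch i) ` ball (ctr i) (rad i)"
    using cover_exists by (elim exE conjE)
  interpret discounted_hamiltonian A g n ch ctr rad H
    by unfold_locales
      (use cov H_cont H_convex H_superlinear H_incr H_diff H_deriv_pos H_modulus L_diff in \<open>simp_all\<close>)
  define V0 where "V0 x = V x 0" for x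
  have Vl: "\<exists>l1>0. \<forall>l. 0 < l \<longrightarrow> l \<le> l1 \<longrightarrow> (\<forall>x. \<bar>V x l - V0 x\<bar> \<le> \<delta>)" if "\<delta> > 0" for \<delta>
  proof -
    have "\<forall>\<^sub>F l in at_right 0. \<forall>x\<in>UNIV. dist (V x l) (V x 0) < \<delta>" using V_lim that unfolding uniform_limit_iff by blast
    then obtain b where b: "b > 0" "\<And>l. 0 < l \<Longrightarrow> l < b \<Longrightarrow> \<forall>x. dist (V x l) (V x 0) < \<delta>"
      unfolding eventually_at_right_field by auto
    have "\<bar>V x l - V0 x\<bar> \<le> \<delta>" if "0 < l" "l \<le> b / 2" for l x
    proof -
      have "l < b" using that b(1) by simp
      then show ?thesis using b(2)[OF that(1)] by (simp add: dist_real_def V0_def less_imp_le)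
    qed
    then show ?thesis using b(1) by (intro exI[of _ "b / 2"]) simp
  qed
  have V0c: "continuous_on UNIV V0" unfolding V0_def
  proof (rule uniform_limit_theorem[OF _ V_lim])
    show "\<forall>\<^sub>F l in at_right 0. continuous_on UNIV (\<lambda>x. V x l)"
      using eventually_at_right_less[of "0::real"] by eventually_elim (rule V_cont)
  qed simp
  \<comment> \<open>V is controlled only near \<lambda> = 0, through its uniform limit; this already
    restricts \<lambda> to at most l1.\<close>
  obtain V1 where V1: "\<And>x. \<bar>V0 x\<bar> \<le> V1" using bounded_on_M[OF V0c] by blast
  obtain l1 where l1: "l1 > 0" "\<And>l x. 0 < l \<Longrightarrow> l \<le> l1 \<Longrightarrow> \<bar>V x l - V0 x\<bar> \<le> 1" using Vl[of 1] by auto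
  define Vm where "Vm = V1 + 1"
  have Vb: "\<bar>V x l\<bar> \<le> Vm" if "0 < l" "l \<le> l1" for l x using l1(2)[OF that, of x] V1[of x] unfolding Vm_def by linarith
  have "\<exists>l0>0. l0 \<le> l1 \<and> (\<exists>P>0. \<exists>B. \<forall>l. 0 < l \<longrightarrow> l \<le> l0 \<longrightarrow>
     (\<exists>u. subsol (\<lambda>x p. H x p (l * u x) + l * V x l - crit) u \<and> supersol (\<lambda>x p. H x p (l * u x) + l * V x l - crit) u \<and>
        chart_lipschitz P u \<and> (\<forall>x. \<bar>u x\<bar> \<le> B)))"
    by (rule existence_small[where V = V and Vm = Vm, OF l1(1)]) (rule V_cont Vb, assumption+)+
  then obtain l0 P B where l0: "l0 > 0" "l0 \<le> l1" and ex: "\<forall>l. 0 < l \<longrightarrow> l \<le> l0 \<longrightarrow>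
     (\<exists>u. subsol (\<lambda>x p. H x p (l * u x) + l * V x l - crit) u \<and> supersol (\<lambda>x p. H x p (l * u x) + l * V x l - crit) u \<and>
        chart_lipschitz P u \<and> (\<forall>x. \<bar>u x\<bar> \<le> B))"
    by (elim exE conjE)
  \<comment> \<open>Outside (0, l0] the choice is arbitrary; the limit from the right at 0 does not
    see those values.\<close>
  define u where "u l = (SOME u. subsol (\<lambda>x p. H x p (l * u x) + l * V x l - crit) u \<and> supersol (\<lambda>x p. H x p (l * u x) + l * V x l - crit) u \<and>
        chart_lipschitz P u \<and> (\<forall>x. \<bar>u x\<bar> \<le> B))" for l
  have u: "subsol (\<lambda>x p. H x p (l * u l x) + l * V x l - crit) (u l)" "supersol (\<lambda>x p. H x p (l * u l x) + l * V x l - crit) (u l)"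
     "chart_lipschitz P (u l)" "\<bar>u l x\<bar> \<le> B" if "0 < l" "l \<le> l0" for l x
    using someI_ex[OF ex[rule_format, OF that], folded u_def] by simp_all
  have unique: "w = u l" if l: "0 < l" "l \<le> l0"
    and w: "subsol (\<lambda>x p. H x p (l * w x) + l * V x l - crit) w" "supersol (\<lambda>x p. H x p (l * w x) + l * V x l - crit) w" for w l
  proof
    fix x
    have e: "continuous_on UNIV (\<lambda>x. l * V x l)" by (intro continuous_intros V_cont l)
    show "w x = u l x"
      using comparison[OF l(1) e w(1) u(2)[OF l], of x] comparison[OF l(1) e u(1)[OF l] w(2), of x] by linarith
  qed
  have Vc0: "continuous_on UNIV (\<lambda>x. V x l)" if "0 < l" "l \<le> l0" for l using V_cont that by blast
  have Vb0: "\<bar>V x l\<bar> \<le> Vm" if "0 < l" "l \<le> l0" for l x using Vb[of l x] that l0(2) by linarith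
  have lim: "\<exists>r v. strict_mono (r :: nat \<Rightarrow> nat) \<and> uniform_limit UNIV (\<lambda>k. u (l (r k))) v sequentially \<and>
     viscosity_solution A (\<lambda>x p _. H x p 0) crit v \<and> constrained_subsolution A g H V0 v"
    if "\<And>k. 0 < l k" "\<And>k. l k \<le> l0" "l \<longlonglongrightarrow> 0" for l :: "nat \<Rightarrow> real"
    by (rule vanishing_discount_limit[where V = V and Vm = Vm and P = P and B = B, OF l0(1)])
      (fact Vc0 Vb0 V0c Vl u that)+
  have lower: "\<exists>b>0. \<forall>l. 0 < l \<longrightarrow> l \<le> b \<longrightarrow> (\<forall>x. w x - \<kappa> \<le> u l x)" if w: "constrained_subsolution A g H V0 w" and \<kappa>: "\<kappa> > 0" for w \<kappa>
  proof -
    have "\<exists>b>0. \<forall>l u. 0 < l \<longrightarrow> l \<le> b \<longrightarrow> supersol (\<lambda>x p. H x p (l * u x) + l * V x l - crit) u \<longrightarrow> (\<forall>x. w x - \<kappa> \<le> u x)"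
      by (rule constrained_lower[where V = V, OF w V0c _ \<kappa>]) (rule Vl)
    then obtain b where b: "b > 0" "\<forall>l u. 0 < l \<longrightarrow> l \<le> b \<longrightarrow> supersol (\<lambda>x p. H x p (l * u x) + l * V x l - crit) u \<longrightarrow> (\<forall>x. w x - \<kappa> \<le> u x)"
      by (elim exE conjE)
    have "w x - \<kappa> \<le> u l x" if "0 < l" "l \<le> min b l0" for l x
      using b(2)[rule_format, of l "u l" x] u(2)[of l] that by simp
    then show ?thesis using b(1) l0(1) by (intro exI[of _ "min b l0"]) simp
  qed
  \<comment> \<open>Stated for arbitrary sequences, so that it compares any constrained subsolution
    with any limit.\<close>
  have dominate: "w x \<le> v x" if w: "constrained_subsolution A g H V0 w" and ul: "uniform_limit UNIV (\<lambda>k. u (l k)) v sequentially"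
    and l: "\<And>k. 0 < l k" "l \<longlonglongrightarrow> 0" for w v x and l :: "nat \<Rightarrow> real"
  proof (rule field_le_epsilon)
    fix \<kappa> :: real assume \<kappa>: "\<kappa> > 0"
    then have \<kappa>2: "\<kappa> / 2 > 0" by simp
    from lower[OF w this] obtain b where b: "b > 0" "\<forall>l. 0 < l \<longrightarrow> l \<le> b \<longrightarrow> (\<forall>x. w x - \<kappa> / 2 \<le> u l x)" by blast
    have "\<forall>\<^sub>F k in sequentially. l k < b" using l(2) b(1) by (rule order_tendstoD(2))
    moreover have "\<forall>\<^sub>F k in sequentially. \<forall>x\<in>UNIV. dist (u (l k) x) (v x) < \<kappa> / 2" using ul \<kappa>2 unfolding uniform_limit_iff by blast
    ultimately have "\<forall>\<^sub>F k in sequentially. w x \<le> v x + \<kappa>"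
    proof eventually_elim
      case (elim k)
      have "w x - \<kappa> / 2 \<le> u (l k) x" using b(2)[rule_format, OF l(1)] elim(1) by simp
      moreover have "u (l k) x - v x < \<kappa> / 2" using elim(2)[rule_format, OF UNIV_I, of x] unfolding dist_real_def by linarith
      ultimately show ?case by linarith
    qed
    then show "w x \<le> v x + \<kappa>" by simp
  qed
  define L where "L k = l0 / real (Suc k)" for k
  have Lp: "0 < L k" "L k \<le> l0" for k using l0(1) by (auto simp: L_def divide_le_eq)
  have L0: "L \<longlonglongrightarrow> 0"
    using tendsto_mult[OF tendsto_const[of l0] LIMSEQ_inverse_real_of_nat] by (simp add: L_def[abs_def] divide_inverse)
  from lim[OF Lp L0] obtain r v where r: "strict_mono r" and ulv: "uniform_limit UNIV (\<lambda>k. u (L (r k))) v sequentially"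
    and vsol: "viscosity_solution A (\<lambda>x p _. H x p 0) crit v" and vcon: "constrained_subsolution A g H V0 v" by (elim exE conjE)
  have Lr: "(\<lambda>k. L (r k)) \<longlonglongrightarrow> 0" using LIMSEQ_subseq_LIMSEQ[OF L0 r] by (simp add: o_def)
  have largest: "w x \<le> v x" if "constrained_subsolution A g H V0 w" for w x
    by (rule dominate[OF that ulv Lp(1) Lr])
  \<comment> \<open>Failure would give \<lambda>'s tending to 0 with u above v + \<kappa> somewhere.
    A further limit v' is again a constrained subsolution, hence v' \<le> v, while uniform closeness
    puts u below v' + \<kappa>.\<close>
  have upper: "\<exists>b>0. \<forall>l. 0 < l \<longrightarrow> l \<le> b \<longrightarrow> (\<forall>x. u l x \<le> v x + \<kappa>)" if \<kappa>: "\<kappa> > 0" for \<kappa>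
  proof (rule ccontr)
    assume neg: "\<not> ?thesis"
    have "\<exists>l x. 0 < l \<and> l \<le> L k \<and> v x + \<kappa> < u l x" for k
    proof (rule ccontr)
      assume "\<not> (\<exists>l x. 0 < l \<and> l \<le> L k \<and> v x + \<kappa> < u l x)"
      then have "\<forall>l. 0 < l \<longrightarrow> l \<le> L k \<longrightarrow> (\<forall>x. u l x \<le> v x + \<kappa>)" by (meson not_le)
      then show False using neg Lp(1)[of k] by blast
    qed
    then have "\<forall>k. \<exists>l. 0 < l \<and> l \<le> L k \<and> (\<exists>x. v x + \<kappa> < u l x)" by blast
    from choice[OF this] obtain l where l: "\<forall>k. 0 < l k \<and> l k \<le> L k \<and> (\<exists>x. v x + \<kappa> < u (l k) x)" by (elim exE)
    have l1: "0 < l k" "l k \<le> l0" for k using l Lp(2)[of k] order_trans by blast+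
    have "l \<longlonglongrightarrow> 0"
      by (rule tendsto_sandwich[OF _ _ tendsto_const L0]) (use l in \<open>auto intro!: always_eventually less_imp_le\<close>)
    from lim[OF l1 this] obtain r' v' where r': "strict_mono r'" and ul': "uniform_limit UNIV (\<lambda>k. u (l (r' k))) v' sequentially"
      and con': "constrained_subsolution A g H V0 v'" by (elim exE conjE)
    have "\<forall>\<^sub>F k in sequentially. \<forall>x\<in>UNIV. dist (u (l (r' k)) x) (v' x) < \<kappa>" using ul' \<kappa> unfolding uniform_limit_iff by blast
    then obtain k where k: "\<And>x. dist (u (l (r' k)) x) (v' x) < \<kappa>"
      unfolding eventually_sequentially by blast
    obtain x where "v x + \<kappa> < u (l (r' k)) x" using l by blast
    then show False using k[of x] largest[OF con', of x] unfolding dist_real_def by linarith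
  qed
  have conv: "uniform_limit UNIV u v (at_right 0)" unfolding uniform_limit_iff
  proof (intro allI impI)
    fix \<kappa> :: real assume "\<kappa> > 0"
    then have \<kappa>: "\<kappa> / 2 > 0" by simp
    obtain b1 where b1: "b1 > 0" "\<forall>l. 0 < l \<longrightarrow> l \<le> b1 \<longrightarrow> (\<forall>x. v x - \<kappa> / 2 \<le> u l x)" using lower[OF vcon \<kappa>] by blast
    obtain b2 where b2: "b2 > 0" "\<forall>l. 0 < l \<longrightarrow> l \<le> b2 \<longrightarrow> (\<forall>x. u l x \<le> v x + \<kappa> / 2)" using upper[OF \<kappa>] by blast
    show "\<forall>\<^sub>F l in at_right 0. \<forall>x\<in>UNIV. dist (u l x) (v x) < \<kappa>"
      unfolding eventually_at_right_field
    proof (intro exI[of _ "min b1 b2"] conjI allI impI ballI)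
      show "0 < min b1 b2" using b1 b2 by simp
      fix l x assume h: "0 < l" "l < min b1 b2"
      have "v x - \<kappa> / 2 \<le> u l x" "u l x \<le> v x + \<kappa> / 2"
        using b1(2)[rule_format, OF h(1), of x] b2(2)[rule_format, OF h(1), of x] h(2) by simp_all
      then show "dist (u l x) (v x) < \<kappa>" using \<kappa> unfolding dist_real_def by linarith
    qed
  qed
  show ?thesis
  proof (intro exI[of _ l0] conjI l0(1) exI[of _ u] ballI allI impI exI[of _ v])
    fix l assume l: "l \<in> {0<..l0}"
    show "viscosity_solution A (\<lambda>x p z. H x p (l * z) + l * V x l) crit (u l)"
      unfolding viscosity_solution_def viscosity_subsolution_iff viscosity_supersolution_iff using u(1,2)[of l] l by simp
    fix w assume "viscosity_solution A (\<lambda>x p z. H x p (l * z) + l * V x l) crit w"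
    then show "w = u l"
      unfolding viscosity_solution_def viscosity_subsolution_iff viscosity_supersolution_iff using l by (intro unique) auto
  next
    show "constrained_subsolution A g H (\<lambda>x. V x 0) v" using vcon by (simp add: V0_def[abs_def])
    fix w x assume "constrained_subsolution A g H (\<lambda>x. V x 0) w"
    then show "w x \<le> v x" using largest by (simp add: V0_def[abs_def])
  qed (rule conv vsol)+
qed

end
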